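(* Suppose $\mathcal C$ is formal and the embedding $\iota:H^\bullet(\mathcal C)\hookrightarrow\mathcal C$ is an algebra homomorphism. Then: (i) The tree part of the effective action on cohomology contains only the trivial term $W_{\mathrm{prod}}$, i.e. $$W(\alpha)=W_{\mathrm{prod}}(\alpha)+\hbar F^{(1)}(\alpha_{(1)}^1,\dots,\alpha_{(1)}^{B_1})+\sum_{l=2}^\infty\hbar^lF^{(l)}(\alpha_{(1)}^1,\dots,\alpha_{(1)}^{B_1}),$$ where $F^{(l)}\in(\mathrm{Fun}(\mathfrak g^{B_1}))^{\mathfrak g}$ for $l=1,2,\dots$. (ii) The one-loop part of the effective action can be written as $$F^{(1)}(\alpha_{(1)})=\tfrac12\,\mathrm{Str}_{\mathfrak g\otimes\mathcal C}\log\left(1+K\circ l(\iota(\alpha_{(1)}),\cdot)\right).$$ (iii) The restriction $F^{(1)}|_{\mathrm{MC}}$ of the one-loop part of the effective action to the Maurer–Cartan set is invariant under deformations of $(\iota,K)$ (preserving the homomorphism condition for $\iota$). Here $\mathrm{MC}\subset H^1(\mathcal C,\mathfrak g)[1]$ is given by $$\sum_{j,k}\mu_{ijk}[\alpha_{(1)}^j,\alpha_{(1)}^k]=0\quad\text{for all }i.$$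
   Context: **Algebraic data.** $\mathcal C=\mathcal C^0\oplus\mathcal C^1\oplus\mathcal C^2\oplus\mathcal C^3$ ($\mathcal C^k$ in degree $k$) is a finite-dimensional real dg Frobenius algebra: a unital differential graded commutative associative algebra with differential $d$ of degree $+1$, product $m$, and a nondegenerate graded-symmetric pairing $\pi$ with $\pi(a,b)\ne0\Rightarrow|a|+|b|=3$, such that $\pi(da,b)+(-1)^{|a|}\pi(a,db)=0$ and $\pi(a,m(b,c))=\pi(m(a,b),c)$. $B_k=\dim H^k(\mathcal C)$; assume $B_0=B_3=1$. "Formal" means that representatives $\iota:H^\bullet(\mathcal C)\hookrightarrow\mathcal C$ of cohomology closed under multiplication exist. $\mathfrak g$ is a finite-dimensional real Lie algebra with nondegenerate ad-invariant symmetric form $\pi_{\mathfrak g}$ and orthonormal basis $\{T_a\}$. On $\mathfrak g\otimes\mathcal C$ put $d(X\otimes a)=X\otimes da$, $l(X\otimes a,Y\otimes b)=[X,Y]\otimes m(a,b)$, $\pi(X\otimes a,Y\otimes b)=\pi_{\mathfrak g}(X,Y)\pi(a,b)$, extended by the Koszul rule. $\mathrm{Fun}$ denotes functions (polynomial, completed to formal power series); $(\cdot)^{\mathfrak g}$ denotes invariants of the diagonal adjoint action. $\mathrm{Str}$ is the supertrace, with sign $(-1)^k$ on $\mathfrak g\otimes\mathcal C^k$, and $\log(1+\cdot)$ is the usual power series. **Fields and action.** $\mathcal F=\mathfrak g\otimes\mathcal C[1]$ with odd symplectic form $\sigma(sA,sB)=(-1)^{|A|}\pi(A,B)$ ($s$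 the suspension). $\omega=\sum T_ae_I\omega^{Ia}$ is the canonical element ($\{e_I\}$ a basis of $\mathcal C$, $\omega^{Ia}$ of ghost number $1-|e_I|$), and $S=\tfrac12\pi(\omega,d\omega)+\tfrac16\pi(\omega,l(\omega,\omega))$. **Induction data** $(\iota,K)$: $\iota:H^\bullet(\mathcal C)\to\mathcal C^\bullet$ is linear and sends each class to a cocycle representing it; $\iota^T$ is its transpose with respect to $\pi$ and the induced pairing $\pi'=\pi(\iota\cdot,\iota\cdot)$; $K:\mathcal C^\bullet\to\mathcal C^{\bullet-1}$ is linear with $$dK+Kd=\mathrm{id}-\iota\iota^T,\quad\pi(Ka,b)=(-1)^{|a|}\pi(a,Kb),\quad K\iota=0,\quad K^2=0.$$ Put $\mathcal L_K=\mathfrak g\otimes\mathrm{im}(K)[1]$, $\mathcal F'=H^\bullet(\mathcal C,\mathfrak g)[1]$. Deformations of $(\iota,K)$ are smooth (or infinitesimal) variations within the set of pairs satisfying these conditions. **Effective action.** $W\in\mathrm{Fun}(\mathcal F')[[\hbar]]$ is defined by the formal (perturbative Gaussian) integral $$e^{W(\alpha)/\hbar}=\frac1N\int_{\mathcal L_K}e^{S(\iota(\alpha)+\omega'')/\hbar}\mu_{\mathcal L_K},\qquad N=\int_{\mathcal L_K}e^{\frac1{2\hbar}\pi(\omega'',d\omega'')}\mu_{\mathcal L_K}.$$ Its tree part and one-loop part are the coefficients of $\hbar^0$ and $\hbar^1$. **Coordinates on $\mathcal F'$.** Let $e_{(0)}=[1]\in H^0$, $e_{(3)}\in H^3$ with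 $\pi'(e_{(0)},e_{(3)})=1$, $\{e_{(1)i}\}$ a basis of $H^1$ and $\{e_{(2)}^i\}$ the dual basis of $H^2$. Then $\alpha=e_{(0)}\alpha_{(0)}+\sum_ie_{(1)i}\alpha_{(1)}^i+\sum_ie_{(2)}^i\alpha_{(2)i}+e_{(3)}\alpha_{(3)}$ with $\mathfrak g$-valued coordinates of ghost numbers $1,0,-1,-2$; $\alpha_{(1)}=\sum_ie_{(1)i}\alpha_{(1)}^i$. Put $W_{\mathrm{prod}}(\alpha)=\tfrac16\pi(\iota(\alpha),l(\iota(\alpha),\iota(\alpha)))$ and $\mu_{ijk}=\pi(\iota(e_{(1)i}),m(\iota(e_{(1)j}),\iota(e_{(1)k})))$. *)

theory Defs
  imports
    "HOL-Computational_Algebra.Formal_Laurent_Series"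
    "HOL-Library.Multiset"
    "HOL-Library.Groups_Big_Fun"
    "HOL-Library.List_Lexorder"
begin

section \<open>Supercommutative formal power series\<close>

text \<open>
  \<open>Resid k i a\<close> is the coordinate \<open>\<alpha>\<^sub>(\<^sub>k\<^sub>)\<close> along the \<open>i\<close>-th basis vector of \<open>H\<^sup>k\<close> and the
  \<open>a\<close>-th basis vector of the Lie algebra; \<open>Fluct k i a\<close> is the coordinate of \<open>\<omega>''\<close> along the
  \<open>i\<close>-th basis vector of \<open>im K \<inter> C\<^sup>k\<close>.  Both have ghost number \<open>1 - k\<close>, hence are odd iff \<open>k\<close> is
  even.
\<close>

datatype var = Resid nat nat nat | Fluct nat nat nat

fun form_degree :: "var \<Rightarrow> nat" where
  "form_degree (Resid k i a) = k"
| "form_degree (Fluct k i a) = k"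

definition odd_var :: "var \<Rightarrow> bool" where
  "odd_var v \<longleftrightarrow> even (form_degree v)"

text \<open>The order on the variables puts the \<open>\<alpha>\<close>'s in front of the \<open>\<omega>''\<close>'s.\<close>

fun var_key :: "var \<Rightarrow> nat list" where
  "var_key (Resid k i a) = [0, k, i, a]"
| "var_key (Fluct k i a) = [1, k, i, a]"

lemma var_key_inject: "var_key v = var_key w \<longleftrightarrow> v = w"
  by (cases v; cases w) auto

instantiation var :: linorder
begin

definition less_eq_var :: "var \<Rightarrow> var \<Rightarrow> bool" where
  "less_eq_var v w \<longleftrightarrow> var_key v \<le> var_key w"

definition less_var :: "var \<Rightarrow> var \<Rightarrow> bool" where
  "less_var v w \<longleftrightarrow> var_key v < var_key w"

instance
  by standard
     (auto simp: less_eq_var_def less_var_def less_le_not_le intro: order.trans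
        dest!: order.antisym simp: var_key_inject)

end

text \<open>
  A multiset \<open>m\<close> of variables stands for the monomial obtained by multiplying its elements in
  increasing order; it vanishes if an odd variable is repeated.  Multiplying the monomials of \<open>m\<close>
  and \<open>n\<close> gives the monomial of \<open>m + n\<close> up to the sign \<open>(-1)^inversions m n\<close>.
\<close>

definition admissible :: "var multiset \<Rightarrow> bool" where
  "admissible m \<longleftrightarrow> (\<forall>v. odd_var v \<longrightarrow> count m v \<le> 1)"

definition inversions :: "var multiset \<Rightarrow> var multiset \<Rightarrow> nat" where
  "inversions m n =
     (\<Sum>v\<in>#filter_mset odd_var m. size {#w \<in># n. odd_var w \<and> w < v#})"

lemma admissible_empty [simp]: "admissible {#}"
  by (simp add: admissible_def)

lemma admissible_single [simp]: "admissible {#v#}"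
  unfolding admissible_def by (metis count_single le_refl zero_le)

lemma admissible_mono: "admissible m \<Longrightarrow> n \<subseteq># m \<Longrightarrow> admissible n"
  unfolding admissible_def by (meson le_trans mset_subset_eq_count)

lemma inversions_empty [simp]: "inversions {#} n = 0" "inversions m {#} = 0"
  by (simp_all add: inversions_def)

lemma inversions_plus_left: "inversions (a + b) c = inversions a c + inversions b c"
  by (simp add: inversions_def)

lemma inversions_plus_right: "inversions a (b + c) = inversions a b + inversions a c"
  by (simp add: inversions_def sum_mset.distrib)

lemma finite_submultisets: "finite {a. a \<subseteq># (m :: 'a multiset)}"
proof (induction m)
  case (add x m)
  have "{a. a \<subseteq># add_mset x m} \<subseteq> {a. a \<subseteq># m} \<union> add_mset x ` {a. a \<subseteq># m}"
  proof
    fix a assume "a \<in> {a. a \<subseteq># add_mset x m}"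
    hence a: "a \<subseteq># add_mset x m" by simp
    show "a \<in> {a. a \<subseteq># m} \<union> add_mset x ` {a. a \<subseteq># m}"
    proof (cases "x \<in># a")
      case True
      then obtain b where "a = add_mset x b" by (metis insert_DiffM)
      with a show ?thesis by auto
    next
      case False
      with a have "a \<subseteq># m"
        by (metis diff_single_trivial subset_eq_diff_conv add_mset_add_single)
      thus ?thesis by simp
    qed
  qed
  with add.IH show ?case
    by (meson finite_UnI finite_imageI finite_subset)
qed simp

typedef (overloaded) 'a superseries =
  "{f :: var multiset \<Rightarrow> 'a::zero. \<forall>m. \<not> admissible m \<longrightarrow> f m = 0}"
  morphisms scoeff Abs_superseries
  by (rule exI[of _ "\<lambda>_. 0"]) simp

setup_lifting type_definition_superseries

lemma superseries_eqI: "(\<And>m. scoeff f m = scoeff g m) \<Longrightarrow> f = g"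
  by (simp add: scoeff_inject[symmetric] fun_eq_iff)

lemma scoeff_not_admissible: "\<not> admissible m \<Longrightarrow> scoeff f m = 0"
  using scoeff[of f] by blast

lift_definition superseries_of :: "(var multiset \<Rightarrow> 'a::zero) \<Rightarrow> 'a superseries" is
  "\<lambda>f m. if admissible m then f m else 0"
  by simp

lift_definition map_scoeff :: "('a::zero \<Rightarrow> 'b::zero) \<Rightarrow> 'a superseries \<Rightarrow> 'b superseries" is
  "\<lambda>h f m. if admissible m then h (f m) else 0"
  by simp

lift_definition sconst :: "'a::zero \<Rightarrow> 'a superseries" is
  "\<lambda>c m. if m = {#} then c else 0"
  by auto

lift_definition svar :: "var \<Rightarrow> 'a::{zero,one} superseries" is
  "\<lambda>v m. if m = {#v#} then 1 else 0"
  by (metis admissible_single)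

instantiation superseries :: (comm_ring_1) ring_1
begin

lift_definition zero_superseries :: "'a superseries" is "\<lambda>_. 0" by simp

lift_definition one_superseries :: "'a superseries" is "\<lambda>m. if m = {#} then 1 else 0" by auto

lift_definition plus_superseries :: "'a superseries \<Rightarrow> 'a superseries \<Rightarrow> 'a superseries"
  is "\<lambda>f g m. f m + g m" by simp

lift_definition minus_superseries :: "'a superseries \<Rightarrow> 'a superseries \<Rightarrow> 'a superseries"
  is "\<lambda>f g m. f m - g m" by simp

lift_definition uminus_superseries :: "'a superseries \<Rightarrow> 'a superseries"
  is "\<lambda>f m. - f m" by simp

lift_definition times_superseries :: "'a superseries \<Rightarrow> 'a superseries \<Rightarrow> 'a superseries"
  is "\<lambda>f g m. if admissible m
              then \<Sum>a | a \<subseteq># m. (-1) ^ inversions a (m - a) * f a * g (m - a) else 0"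
  by simp

instance
proof
  fix f g h :: "'a superseries"
  show "f * g * h = f * (g * h)"
  proof (rule superseries_eqI)
    fix m
    show "scoeff (f * g * h) m = scoeff (f * (g * h)) m"
    proof (cases "admissible m")
      case True
      let ?T = "\<lambda>a b c. (-1) ^ (inversions a b + inversions a c + inversions b c)
                          * scoeff f a * scoeff g b * scoeff h c"
      have adm: "admissible n" if "n \<subseteq># m" for n
        using True that by (rule admissible_mono)
      have "scoeff (f * g * h) m =
          (\<Sum>c | c \<subseteq># m. \<Sum>a | a \<subseteq># c. ?T a (c - a) (m - c))"
      proof -
        have "(-1) ^ inversions c (m - c)
                * (\<Sum>a | a \<subseteq># c. (-1) ^ inversions a (c - a) * scoeff f a * scoeff g (c - a))
                * scoeff h (m - c) = (\<Sum>a | a \<subseteq># c. ?T a (c - a) (m - c))" for c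
          unfolding sum_distrib_left sum_distrib_right
        proof (rule sum.cong[OF refl])
          fix a assume "a \<in> {a. a \<subseteq># c}"
          hence "inversions c (m - c) = inversions a (m - c) + inversions (c - a) (m - c)"
            by (metis inversions_plus_left mem_Collect_eq subset_mset.add_diff_inverse)
          thus "(-1) ^ inversions c (m - c)
                  * ((-1) ^ inversions a (c - a) * scoeff f a * scoeff g (c - a)) * scoeff h (m - c)
                = ?T a (c - a) (m - c)"
            by (simp add: power_add mult_ac)
        qed
        thus ?thesis
          using True by (simp add: times_superseries.rep_eq adm cong: sum.cong_simp)
      qed
      also have "\<dots> = (\<Sum>(c, a) \<in> (SIGMA c:{c. c \<subseteq># m}. {a. a \<subseteq># c}). ?T a (c - a) (m - c))"
        by (rule sum.Sigma) (simp_all add: finite_submultisets)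
      also have "\<dots> = (\<Sum>(a, b) \<in> (SIGMA a:{a. a \<subseteq># m}. {b. b \<subseteq># m - a}). ?T a b (m - a - b))"
        by (rule sum.reindex_bij_witness[where j = "\<lambda>(c, a). (a, c - a)" and i = "\<lambda>(a, b). (a + b, a)"])
           (auto simp: subset_mset.le_diff_conv2 add.commute subset_eq_diff_conv
              intro: subset_mset.order_trans)
      also have "\<dots> = (\<Sum>a | a \<subseteq># m. \<Sum>b | b \<subseteq># m - a. ?T a b (m - a - b))"
        by (rule sum.Sigma[symmetric]) (simp_all add: finite_submultisets)
      also have "\<dots> = scoeff (f * (g * h)) m"
      proof -
        have "(\<Sum>b | b \<subseteq># m - a. ?T a b (m - a - b)) =
              (-1) ^ inversions a (m - a) * scoeff f a
                * (\<Sum>b | b \<subseteq># m - a. (-1) ^ inversions b (m - a - b) * scoeff g b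
                     * scoeff h (m - a - b))" for a
          unfolding sum_distrib_left
        proof (rule sum.cong[OF refl])
          fix b assume "b \<in> {b. b \<subseteq># m - a}"
          hence "inversions a (m - a) = inversions a b + inversions a (m - a - b)"
            by (metis inversions_plus_right mem_Collect_eq subset_mset.add_diff_inverse)
          thus "?T a b (m - a - b) = (-1) ^ inversions a (m - a) * scoeff f a
                  * ((-1) ^ inversions b (m - a - b) * scoeff g b * scoeff h (m - a - b))"
            by (simp add: power_add mult_ac)
        qed
        thus ?thesis
          using True by (simp add: times_superseries.rep_eq adm cong: sum.cong_simp)
      qed
      finally show ?thesis .
    qed (simp add: times_superseries.rep_eq)
  qed
  show "f + g + h = f + (g + h)" by transfer (simp add: add.assoc)
  show "f + g = g + f" by transfer (simp add: add.commute)
  show "0 + f = f" by transfer simp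
  show "- f + f = 0" by transfer simp
  show "f - g = f + - g" by transfer simp
  show "(f + g) * h = f * h + g * h"
    by (rule superseries_eqI)
       (simp add: times_superseries.rep_eq plus_superseries.rep_eq sum.distrib algebra_simps)
  show "f * (g + h) = f * g + f * h"
    by (rule superseries_eqI)
       (simp add: times_superseries.rep_eq plus_superseries.rep_eq sum.distrib algebra_simps)
  show "1 * f = f"
  proof (rule superseries_eqI)
    fix m
    have "(\<Sum>a | a \<subseteq># m. (-1) ^ inversions a (m - a) * scoeff 1 a * scoeff f (m - a)) =
          (\<Sum>a\<in>{{#}}. (-1) ^ inversions a (m - a) * scoeff 1 a * scoeff f (m - a))"
      by (rule sum.mono_neutral_right) (auto simp: finite_submultisets one_superseries.rep_eq)
    thus "scoeff (1 * f) m = scoeff f m"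
      by (simp add: times_superseries.rep_eq one_superseries.rep_eq scoeff_not_admissible)
  qed
  show "f * 1 = f"
  proof (rule superseries_eqI)
    fix m
    have "(\<Sum>a | a \<subseteq># m. (-1) ^ inversions a (m - a) * scoeff f a * scoeff 1 (m - a)) =
          (\<Sum>a\<in>{m}. (-1) ^ inversions a (m - a) * scoeff f a * scoeff 1 (m - a))"
      by (rule sum.mono_neutral_right)
         (auto simp: finite_submultisets one_superseries.rep_eq Diff_eq_empty_iff_mset)
    thus "scoeff (f * 1) m = scoeff f m"
      by (simp add: times_superseries.rep_eq one_superseries.rep_eq scoeff_not_admissible)
  qed
  show "(0::'a superseries) \<noteq> 1"
    by (metis one_superseries.rep_eq zero_neq_one zero_superseries.rep_eq)
qed

end


text \<open>
  Formal power series in the variables with coefficients in the formal Laurent series in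
  \<open>\<hbar> = fls_X\<close>.  A family is summed coefficientwise, for each monomial and each power of \<open>\<hbar>\<close>; this
  is meaningful when only finitely many members contribute to each such coefficient and the powers
  of \<open>\<hbar>\<close> are bounded below for each monomial, which is the case for the sums formed in
  \<open>effective_action\<close> below.
\<close>

definition formal_sum :: "('i \<Rightarrow> real fls superseries) \<Rightarrow> real fls superseries" where
  "formal_sum F =
     superseries_of (\<lambda>m. Abs_fls (\<lambda>k. Sum_any (\<lambda>n. fls_nth (scoeff (F n) m) k)))"

definition formal_exp :: "real fls superseries \<Rightarrow> real fls superseries" where
  "formal_exp f = formal_sum (\<lambda>n. sconst (fls_const (1 / fact n)) * f ^ n)"

definition formal_ln :: "real fls superseries \<Rightarrow> real fls superseries" where
  "formal_ln f = formal_sum (\<lambda>n::nat.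
     if n = 0 then 0 else sconst (fls_const ((-1) ^ (n + 1) / real n)) * (f - 1) ^ n)"

definition hbar_series :: "(nat \<Rightarrow> real superseries) \<Rightarrow> real fls superseries" where
  "hbar_series F = superseries_of (\<lambda>m. fps_to_fls (Abs_fps (\<lambda>l. scoeff (F l) m)))"

definition loop_part :: "nat \<Rightarrow> real fls superseries \<Rightarrow> real superseries" where
  "loop_part l W = map_scoeff (\<lambda>c. fls_nth c (int l)) W"


section \<open>Perturbative Gaussian integrals\<close>

text \<open>
  Let the weight be \<open>exp (1/(2\<hbar>) \<Sum> q v w \<cdot> v \<cdot> w)\<close> and \<open>p = q\<inverse>\<close>.  Vanishing of the integral of the
  total derivative \<open>\<partial>/\<partial>v (f \<cdot> weight)\<close> gives, for left derivatives,
  \<open>\<langle>x \<cdot> f\<rangle> = - \<hbar> \<Sum>\<^sub>v p x v \<langle>\<partial>f/\<partial>v\<rangle>\<close>; together with \<open>\<langle>1\<rangle> = 1\<close> this is the following recursion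
  for the moments, up to the factor \<open>\<hbar>\<close> per contraction.  The sign comes from moving the
  derivative past the preceding factors.
\<close>

function wick :: "(var \<Rightarrow> var \<Rightarrow> real) \<Rightarrow> var list \<Rightarrow> real" where
  "wick p [] = 1"
| "wick p (x # xs) = (\<Sum>j<length xs.
     (if odd_var x then (-1) ^ length (filter odd_var (take j xs)) else 1)
       * (- p x (xs ! j)) * wick p (take j xs @ drop (Suc j) xs))"
  by pat_completeness auto
termination by (relation "measure (length \<circ> snd)") auto

definition moment :: "(var \<Rightarrow> var \<Rightarrow> real) \<Rightarrow> var multiset \<Rightarrow> real fls" where
  "moment p M = fls_const (wick p (sorted_list_of_multiset M)) * fls_X ^ (size M div 2)"

text \<open>The normalised integral over the variables \<open>Fluct\<close>, the variables \<open>Resid\<close> being parameters.\<close>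

definition gaussian_average ::
  "(var \<Rightarrow> var \<Rightarrow> real) \<Rightarrow> real fls superseries \<Rightarrow> real fls superseries" where
  "gaussian_average p f = formal_sum (\<lambda>M. superseries_of (\<lambda>m.
     if (\<forall>v\<in>#m. \<exists>k i a. v = Resid k i a) \<and> (\<forall>v\<in>#M. \<exists>k i a. v = Fluct k i a)
     then scoeff f (m + M) * moment p M else 0))"


section \<open>Algebraic data\<close>

definition bilinear_map ::
  "('a::real_vector \<Rightarrow> 'b::real_vector \<Rightarrow> 'd::real_vector) \<Rightarrow> bool" where
  "bilinear_map f \<longleftrightarrow> (\<forall>x. linear (f x)) \<and> (\<forall>y. linear (\<lambda>x. f x y))"

definition is_basis :: "'a::real_vector list \<Rightarrow> 'a set \<Rightarrow> bool" where
  "is_basis bs V \<longleftrightarrow> distinct bs \<and> independent (set bs) \<and> span (set bs) = V"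

definition some_basis :: "'a::real_vector set \<Rightarrow> 'a list" where
  "some_basis V = (SOME bs. is_basis bs V)"

record 'c dg_data =
  grade :: "nat \<Rightarrow> 'c set"
  diff :: "'c \<Rightarrow> 'c"
  mul :: "'c \<Rightarrow> 'c \<Rightarrow> 'c"
  unit :: 'c
  pairing :: "'c \<Rightarrow> 'c \<Rightarrow> real"

definition dg_frobenius :: "'c::real_vector dg_data \<Rightarrow> bool" where
  "dg_frobenius C \<longleftrightarrow>
     (\<exists>B::'c set. finite B \<and> span B = UNIV) \<and>
     (\<forall>k. subspace (grade C k)) \<and> (\<forall>k>3. grade C k = {0}) \<and>
     (\<forall>c. \<exists>!f. (\<forall>k\<le>3. f k \<in> grade C k) \<and> (\<forall>k>3. f k = 0) \<and> c = (\<Sum>k\<le>3. f k)) \<and>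
     linear (diff C) \<and> (\<forall>k. diff C ` grade C k \<subseteq> grade C (Suc k)) \<and>
     (\<forall>a. diff C (diff C a) = 0) \<and>
     bilinear_map (mul C) \<and>
     (\<forall>i j. \<forall>a\<in>grade C i. \<forall>b\<in>grade C j. mul C a b \<in> grade C (i + j)) \<and>
     (\<forall>a b c. mul C (mul C a b) c = mul C a (mul C b c)) \<and>
     (\<forall>i j. \<forall>a\<in>grade C i. \<forall>b\<in>grade C j. mul C a b = (-1) ^ (i * j) *\<^sub>R mul C b a) \<and>
     unit C \<in> grade C 0 \<and> (\<forall>a. mul C (unit C) a = a) \<and>
     (\<forall>i. \<forall>a\<in>grade C i. \<forall>b.
        diff C (mul C a b) = mul C (diff C a) b + (-1) ^ i *\<^sub>R mul C a (diff C b)) \<and>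
     bilinear_map (pairing C) \<and>
     (\<forall>a. (\<forall>b. pairing C a b = 0) \<longrightarrow> a = 0) \<and>
     (\<forall>i j. \<forall>a\<in>grade C i. \<forall>b\<in>grade C j. pairing C a b = (-1) ^ (i * j) * pairing C b a) \<and>
     (\<forall>i j. \<forall>a\<in>grade C i. \<forall>b\<in>grade C j. pairing C a b \<noteq> 0 \<longrightarrow> i + j = 3) \<and>
     (\<forall>i. \<forall>a\<in>grade C i. \<forall>b. pairing C (diff C a) b + (-1) ^ i * pairing C a (diff C b) = 0) \<and>
     (\<forall>a b c. pairing C a (mul C b c) = pairing C (mul C a b) c)"

text \<open>
  The cohomology is presented as a vector space together with the map \<open>cls\<close> sending a cocycle to
  its class; the values of \<open>cls\<close> outside the cocycles are irrelevant.
\<close>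

definition cohomology :: "'c::real_vector dg_data \<Rightarrow> ('c \<Rightarrow> 'h::real_vector) \<Rightarrow> bool" where
  "cohomology C cls \<longleftrightarrow>
     (\<forall>a b. diff C a = 0 \<longrightarrow> diff C b = 0 \<longrightarrow> cls (a + b) = cls a + cls b) \<and>
     (\<forall>r a. diff C a = 0 \<longrightarrow> cls (r *\<^sub>R a) = r *\<^sub>R cls a) \<and>
     (\<forall>a. diff C a = 0 \<longrightarrow> (cls a = 0 \<longleftrightarrow> a \<in> range (diff C))) \<and>
     cls ` {a. diff C a = 0} = UNIV"

definition coh_grade :: "'c::real_vector dg_data \<Rightarrow> ('c \<Rightarrow> 'h::real_vector) \<Rightarrow> nat \<Rightarrow> 'h set" where
  "coh_grade C cls k = cls ` {a \<in> grade C k. diff C a = 0}"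

definition representatives ::
  "'c::real_vector dg_data \<Rightarrow> ('c \<Rightarrow> 'h::real_vector) \<Rightarrow> ('h \<Rightarrow> 'c) \<Rightarrow> bool" where
  "representatives C cls \<iota> \<longleftrightarrow>
     linear \<iota> \<and> (\<forall>x. diff C (\<iota> x) = 0) \<and> (\<forall>x. cls (\<iota> x) = x) \<and>
     (\<forall>k. \<iota> ` coh_grade C cls k \<subseteq> grade C k)"

definition formal_dg :: "'c::real_vector dg_data \<Rightarrow> ('c \<Rightarrow> 'h::real_vector) \<Rightarrow> bool" where
  "formal_dg C cls \<longleftrightarrow>
     (\<exists>\<iota>. representatives C cls \<iota> \<and> (\<forall>x y. mul C (\<iota> x) (\<iota> y) \<in> range \<iota>))"

text \<open>The product of two classes is the class of the product of representing cocycles.\<close>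

definition algebra_hom ::
  "'c::real_vector dg_data \<Rightarrow> ('c \<Rightarrow> 'h::real_vector) \<Rightarrow> ('h \<Rightarrow> 'c) \<Rightarrow> bool" where
  "algebra_hom C cls \<iota> \<longleftrightarrow>
     \<iota> (cls (unit C)) = unit C \<and>
     (\<forall>a b. diff C a = 0 \<longrightarrow> diff C b = 0 \<longrightarrow>
        \<iota> (cls (mul C a b)) = mul C (\<iota> (cls a)) (\<iota> (cls b)))"

text \<open>
  The transpose of a map \<open>f\<close> from the cohomology to \<open>C\<close>, with respect to the pairing of \<open>C\<close> and
  the pairing \<open>\<lambda>x y. pairing C (\<iota> x) (\<iota> y)\<close> of the cohomology.
\<close>

definition coh_transpose ::
  "'c::real_vector dg_data \<Rightarrow> ('h::real_vector \<Rightarrow> 'c) \<Rightarrow> ('h \<Rightarrow> 'c) \<Rightarrow> 'c \<Rightarrow> 'h" where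
  "coh_transpose C \<iota> f a = (THE h. \<forall>x. pairing C (\<iota> x) (\<iota> h) = pairing C (f x) a)"

definition lowers_degree :: "'c::real_vector dg_data \<Rightarrow> ('c \<Rightarrow> 'c) \<Rightarrow> bool" where
  "lowers_degree C K \<longleftrightarrow>
     K ` grade C 0 \<subseteq> {0} \<and> (\<forall>k. K ` grade C (Suc k) \<subseteq> grade C k)"

definition skew_homotopy :: "'c::real_vector dg_data \<Rightarrow> ('c \<Rightarrow> 'c) \<Rightarrow> bool" where
  "skew_homotopy C K \<longleftrightarrow>
     (\<forall>i. \<forall>a\<in>grade C i. \<forall>b. pairing C (K a) b = (-1) ^ i * pairing C a (K b))"

definition induction_data ::
  "'c::real_vector dg_data \<Rightarrow> ('c \<Rightarrow> 'h::real_vector) \<Rightarrow> ('h \<Rightarrow> 'c) \<Rightarrow> ('c \<Rightarrow> 'c) \<Rightarrow> bool" where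
  "induction_data C cls \<iota> K \<longleftrightarrow>
     representatives C cls \<iota> \<and> linear K \<and> lowers_degree C K \<and> skew_homotopy C K \<and>
     (\<forall>a. diff C (K a) + K (diff C a) = a - \<iota> (coh_transpose C \<iota> \<iota> a)) \<and>
     (\<forall>x. K (\<iota> x) = 0) \<and> (\<forall>a. K (K a) = 0)"

record 'g lie_data =
  bracket :: "'g \<Rightarrow> 'g \<Rightarrow> 'g"
  lie_form :: "'g \<Rightarrow> 'g \<Rightarrow> real"

definition metric_lie_algebra :: "'g::real_vector lie_data \<Rightarrow> bool" where
  "metric_lie_algebra \<gg> \<longleftrightarrow>
     (\<exists>B::'g set. finite B \<and> span B = UNIV) \<and>
     bilinear_map (bracket \<gg>) \<and> (\<forall>X. bracket \<gg> X X = 0) \<and>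
     (\<forall>X Y Z. bracket \<gg> X (bracket \<gg> Y Z) + bracket \<gg> Y (bracket \<gg> Z X)
        + bracket \<gg> Z (bracket \<gg> X Y) = 0) \<and>
     bilinear_map (lie_form \<gg>) \<and> (\<forall>X Y. lie_form \<gg> X Y = lie_form \<gg> Y X) \<and>
     (\<forall>X. (\<forall>Y. lie_form \<gg> X Y = 0) \<longrightarrow> X = 0) \<and>
     (\<forall>X Y Z. lie_form \<gg> (bracket \<gg> X Y) Z + lie_form \<gg> Y (bracket \<gg> X Z) = 0)"

text \<open>
  The form need not be definite, so orthonormality allows the values \<open>\<plusminus>1\<close> on the diagonal.
\<close>

definition orthonormal_basis :: "'g::real_vector lie_data \<Rightarrow> 'g list \<Rightarrow> bool" where
  "orthonormal_basis \<gg> T \<longleftrightarrow> is_basis T UNIV \<and>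
     (\<forall>a<length T. \<forall>b<length T.
        \<bar>lie_form \<gg> (T ! a) (T ! b)\<bar> = (if a = b then 1 else 0))"

text \<open>\<open>E k\<close> lists the chosen basis of the cohomology in degree \<open>k\<close>.\<close>

definition cohomology_basis ::
  "'c::real_vector dg_data \<Rightarrow> ('c \<Rightarrow> 'h::real_vector) \<Rightarrow> ('h \<Rightarrow> 'c) \<Rightarrow> (nat \<Rightarrow> 'h list) \<Rightarrow> bool"
where
  "cohomology_basis C cls \<iota> E \<longleftrightarrow>
     (\<forall>k\<le>3. is_basis (E k) (coh_grade C cls k)) \<and>
     E 0 = [cls (unit C)] \<and> length (E 3) = 1 \<and> pairing C (\<iota> (E 0 ! 0)) (\<iota> (E 3 ! 0)) = 1 \<and>
     length (E 2) = length (E 1) \<and>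
     (\<forall>i<length (E 1). \<forall>j<length (E 1).
        pairing C (\<iota> (E 1 ! i)) (\<iota> (E 2 ! j)) = (if i = j then 1 else 0))"


section \<open>The action\<close>

text \<open>
  An element of \<open>\<gg> \<otimes> C \<otimes> Fun\<close> of total degree 1, given as a list of summands \<open>X \<otimes> a \<cdot> v\<close> with
  \<open>X\<close> in the Lie algebra, \<open>a\<close> homogeneous of degree \<open>form_degree v\<close> and \<open>v\<close> a coordinate, whose
  parity is \<open>1 + form_degree v\<close>.  The Koszul signs in the extensions of the pairing, the
  differential and the bracket come from moving the coordinates to the right.
\<close>

type_synonym ('g, 'c) superfield = "('g \<times> 'c \<times> var) list"

fun kinetic_term ::
  "'c::real_vector dg_data \<Rightarrow> 'g::real_vector lie_data \<Rightarrow>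
   'g \<times> 'c \<times> var \<Rightarrow> 'g \<times> 'c \<times> var \<Rightarrow> real" where
  "kinetic_term C \<gg> (X, a, v) (Y, b, w) =
     (-1) ^ ((1 + form_degree v) * (form_degree w + 1))
       * lie_form \<gg> X Y * pairing C a (diff C b)"

fun cubic_term ::
  "'c::real_vector dg_data \<Rightarrow> 'g::real_vector lie_data \<Rightarrow>
   'g \<times> 'c \<times> var \<Rightarrow> 'g \<times> 'c \<times> var \<Rightarrow> 'g \<times> 'c \<times> var \<Rightarrow> real" where
  "cubic_term C \<gg> (X, a, v) (Y, b, w) (Z, c, z) =
     (-1) ^ ((1 + form_degree v) * (form_degree w + form_degree z)
             + (1 + form_degree w) * form_degree z)
       * lie_form \<gg> X (bracket \<gg> Y Z) * pairing C a (mul C b c)"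

definition coordinate :: "'g \<times> 'c \<times> var \<Rightarrow> var" where
  "coordinate s = snd (snd s)"

definition quadratic_action ::
  "'c::real_vector dg_data \<Rightarrow> 'g::real_vector lie_data \<Rightarrow> ('g, 'c) superfield \<Rightarrow> real superseries"
where
  "quadratic_action C \<gg> \<Phi> = sconst (1 / 2) *
     (\<Sum>s\<leftarrow>\<Phi>. \<Sum>t\<leftarrow>\<Phi>. sconst (kinetic_term C \<gg> s t) * svar (coordinate s) * svar (coordinate t))"

definition cubic_action ::
  "'c::real_vector dg_data \<Rightarrow> 'g::real_vector lie_data \<Rightarrow> ('g, 'c) superfield \<Rightarrow> real superseries"
where
  "cubic_action C \<gg> \<Phi> = sconst (1 / 6) *
     (\<Sum>s\<leftarrow>\<Phi>. \<Sum>t\<leftarrow>\<Phi>. \<Sum>r\<leftarrow>\<Phi>. sconst (cubic_term C \<gg> s t r)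
        * svar (coordinate s) * svar (coordinate t) * svar (coordinate r))"

definition canonical_element ::
  "'g list \<Rightarrow> (nat \<Rightarrow> 'c list) \<Rightarrow> (nat \<Rightarrow> nat \<Rightarrow> nat \<Rightarrow> var) \<Rightarrow> ('g, 'c) superfield" where
  "canonical_element T e x =
     [(T ! a, e k ! i, x k i a). k \<leftarrow> [0..<4], i \<leftarrow> [0..<length (e k)], a \<leftarrow> [0..<length T]]"

text \<open>The matrix inverse of the quadratic form \<open>\<pi>(\<omega>'', d \<omega>'')\<close>.\<close>

definition propagator ::
  "'c::real_vector dg_data \<Rightarrow> 'g::real_vector lie_data \<Rightarrow> ('g, 'c) superfield \<Rightarrow> var \<Rightarrow> var \<Rightarrow> real"
where
  "propagator C \<gg> \<Phi> =
     (let V = coordinate ` set \<Phi>;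
          q = (\<lambda>v w. \<Sum>s\<leftarrow>\<Phi>. \<Sum>t\<leftarrow>\<Phi>. if coordinate s = v \<and> coordinate t = w
                                       then kinetic_term C \<gg> s t else 0)
      in THE p. (\<forall>v w. v \<notin> V \<or> w \<notin> V \<longrightarrow> p v w = 0) \<and>
                (\<forall>v\<in>V. \<forall>w\<in>V. (\<Sum>z\<in>V. p v z * q z w) = (if v = w then 1 else 0)))"

text \<open>
  Dividing \<open>exp (S(\<iota>(\<alpha>) + \<omega>'') / \<hbar>)\<close> by the weight \<open>exp (\<pi>(\<omega>'', d \<omega>'') / (2\<hbar>))\<close> leaves the function
  to be averaged.
\<close>

definition effective_action ::
  "'c::real_vector dg_data \<Rightarrow> 'g::real_vector lie_data \<Rightarrow> 'g list \<Rightarrow> (nat \<Rightarrow> 'h::real_vector list) \<Rightarrow>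
   ('h \<Rightarrow> 'c) \<Rightarrow> ('c \<Rightarrow> 'c) \<Rightarrow> real fls superseries" where
  "effective_action C \<gg> T E \<iota> K =
     (let \<phi> = canonical_element T (\<lambda>k. map \<iota> (E k)) Resid;
          \<omega> = canonical_element T (\<lambda>k. some_basis (K ` grade C (Suc k))) Fluct;
          S = quadratic_action C \<gg> (\<phi> @ \<omega>) + cubic_action C \<gg> (\<phi> @ \<omega>);
          S\<^sub>0 = quadratic_action C \<gg> \<omega>;
          Z = gaussian_average (propagator C \<gg> \<omega>)
                (formal_exp (sconst fls_X_inv * map_scoeff fls_const (S - S\<^sub>0)))
      in sconst fls_X * formal_ln Z)"

definition W_prod ::
  "'c::real_vector dg_data \<Rightarrow> 'g::real_vector lie_data \<Rightarrow> 'g list \<Rightarrow> (nat \<Rightarrow> 'h::real_vector list) \<Rightarrow>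
   ('h \<Rightarrow> 'c) \<Rightarrow> real superseries" where
  "W_prod C \<gg> T E \<iota> = cubic_action C \<gg> (canonical_element T (\<lambda>k. map \<iota> (E k)) Resid)"


section \<open>Functions of the degree one coordinates\<close>

definition deg1_vars :: "'g list \<Rightarrow> (nat \<Rightarrow> 'h list) \<Rightarrow> var set" where
  "deg1_vars T E = {Resid 1 i a | i a. i < length (E 1) \<and> a < length T}"

fun coord_value :: "'g::real_vector list \<Rightarrow> (nat \<Rightarrow> 'g) \<Rightarrow> var \<Rightarrow> real" where
  "coord_value T \<alpha> (Resid k i a) = representation (set T) (\<alpha> i) (T ! a)"
| "coord_value T \<alpha> (Fluct k i a) = 0"

text \<open>
  A formal power series on \<open>\<gg>\<^bsup>B\<^sub>1\<^esup>\<close> is evaluated at \<open>\<alpha> = (\<alpha> 0, \<dots>, \<alpha> (B\<^sub>1 - 1))\<close> along the ray through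
  \<open>\<alpha>\<close>: the result is \<open>F(s\<alpha>)\<close> as a formal power series in \<open>s\<close>, whose \<open>n\<close>-th coefficient is the
  homogeneous component of degree \<open>n\<close> of \<open>F\<close>, a polynomial function of \<open>\<alpha>\<close>.
\<close>

definition eval_ray ::
  "'g::real_vector list \<Rightarrow> (nat \<Rightarrow> 'h list) \<Rightarrow> real superseries \<Rightarrow> (nat \<Rightarrow> 'g) \<Rightarrow> real fps" where
  "eval_ray T E F \<alpha> = Abs_fps (\<lambda>n.
     \<Sum>m | size m = n \<and> set_mset m \<subseteq> deg1_vars T E.
       scoeff F m * (\<Prod>v\<in>#m. coord_value T \<alpha> v))"

definition invariant_function ::
  "'g::real_vector lie_data \<Rightarrow> 'g list \<Rightarrow> (nat \<Rightarrow> 'h list) \<Rightarrow> real superseries \<Rightarrow> bool" where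
  "invariant_function \<gg> T E F \<longleftrightarrow>
     (\<forall>m. scoeff F m \<noteq> 0 \<longrightarrow> set_mset m \<subseteq> deg1_vars T E) \<and>
     (\<forall>X \<alpha> n. ((\<lambda>t. fps_nth (eval_ray T E F (\<lambda>i. \<alpha> i + t *\<^sub>R bracket \<gg> X (\<alpha> i))) n)
                 has_real_derivative 0) (at 0))"

text \<open>Elements of \<open>\<gg> \<otimes> C\<close> are written \<open>\<Sum>\<^sub>a T\<^sub>a \<otimes> f a\<close> with \<open>f :: nat \<Rightarrow> 'c\<close>.\<close>

definition K_l ::
  "'c::real_vector dg_data \<Rightarrow> 'g::real_vector lie_data \<Rightarrow> 'g list \<Rightarrow> (nat \<Rightarrow> 'h::real_vector list) \<Rightarrow>
   ('h \<Rightarrow> 'c) \<Rightarrow> ('c \<Rightarrow> 'c) \<Rightarrow> (nat \<Rightarrow> 'g) \<Rightarrow> (nat \<Rightarrow> 'c) \<Rightarrow> (nat \<Rightarrow> 'c)" where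
  "K_l C \<gg> T E \<iota> K \<alpha> f = (\<lambda>a. if a < length T then
     K (\<Sum>i<length (E 1). \<Sum>b<length T.
          representation (set T) (bracket \<gg> (\<alpha> i) (T ! b)) (T ! a) *\<^sub>R mul C (\<iota> (E 1 ! i)) (f b))
     else 0)"

definition supertrace ::
  "'c::real_vector dg_data \<Rightarrow> 'g list \<Rightarrow> ((nat \<Rightarrow> 'c) \<Rightarrow> (nat \<Rightarrow> 'c)) \<Rightarrow> real" where
  "supertrace C T X =
     (let e = (\<lambda>k. some_basis (grade C k)); B = (\<Union>k\<le>3. set (e k))
      in \<Sum>k\<le>3. (-1) ^ k * (\<Sum>a<length T. \<Sum>c\<in>set (e k).
           representation B (X (\<lambda>b. if b = a then c else 0) a) c))"

text \<open>\<open>Str log (1 + s X)\<close> as a formal power series in \<open>s\<close>.\<close>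

definition str_log ::
  "'c::real_vector dg_data \<Rightarrow> 'g list \<Rightarrow> ((nat \<Rightarrow> 'c) \<Rightarrow> (nat \<Rightarrow> 'c)) \<Rightarrow> real fps" where
  "str_log C T X = Abs_fps (\<lambda>n.
     if n = 0 then 0 else (-1) ^ (n + 1) / real n * supertrace C T (X ^^ n))"

definition half_str_log ::
  "'c::real_vector dg_data \<Rightarrow> 'g::real_vector lie_data \<Rightarrow> 'g list \<Rightarrow> (nat \<Rightarrow> 'h::real_vector list) \<Rightarrow>
   ('h \<Rightarrow> 'c) \<Rightarrow> ('c \<Rightarrow> 'c) \<Rightarrow> (nat \<Rightarrow> 'g) \<Rightarrow> real fps" where
  "half_str_log C \<gg> T E \<iota> K \<alpha> = fps_const (1 / 2) * str_log C T (K_l C \<gg> T E \<iota> K \<alpha>)"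

definition maurer_cartan ::
  "'c::real_vector dg_data \<Rightarrow> 'g::real_vector lie_data \<Rightarrow> (nat \<Rightarrow> 'h::real_vector list) \<Rightarrow>
   ('h \<Rightarrow> 'c) \<Rightarrow> (nat \<Rightarrow> 'g) set" where
  "maurer_cartan C \<gg> E \<iota> = {\<alpha>. \<forall>i<length (E 1).
     (\<Sum>j<length (E 1). \<Sum>k<length (E 1).
        pairing C (\<iota> (E 1 ! i)) (mul C (\<iota> (E 1 ! j)) (\<iota> (E 1 ! k))) *\<^sub>R bracket \<gg> (\<alpha> j) (\<alpha> k)) = 0}"


section \<open>Deformations\<close>

definition smooth01 :: "(real \<Rightarrow> real) \<Rightarrow> bool" where
  "smooth01 f \<longleftrightarrow> (\<exists>D :: nat \<Rightarrow> real \<Rightarrow> real. D 0 = f \<and>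
     (\<forall>n. \<forall>t\<in>{0..1}. (D n has_real_derivative D (Suc n) t) (at t within {0..1})))"

text \<open>
  A path of linear maps into a finite-dimensional space is smooth iff all its matrix coefficients
  are.
\<close>

definition smooth_path :: "(real \<Rightarrow> 'x \<Rightarrow> 'c::real_vector) \<Rightarrow> bool" where
  "smooth_path \<gamma> \<longleftrightarrow> (\<forall>x. \<forall>\<phi> :: 'c \<Rightarrow> real. linear \<phi> \<longrightarrow> smooth01 (\<lambda>t. \<phi> (\<gamma> t x)))"

definition deformation ::
  "'c::real_vector dg_data \<Rightarrow> ('c \<Rightarrow> 'h::real_vector) \<Rightarrow>
   (real \<Rightarrow> 'h \<Rightarrow> 'c) \<Rightarrow> (real \<Rightarrow> 'c \<Rightarrow> 'c) \<Rightarrow> bool" where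
  "deformation C cls \<iota> K \<longleftrightarrow>
     (\<forall>t\<in>{0..1}. induction_data C cls (\<iota> t) (K t) \<and> algebra_hom C cls (\<iota> t)) \<and>
     smooth_path \<iota> \<and> smooth_path K"

text \<open>
  The linearisation, at \<open>(\<iota>, K)\<close>, of the conditions \<open>induction_data\<close> and \<open>algebra_hom\<close>.  The pairing
  induced on the cohomology does not vary.  Since \<open>(\<iota> + t \<delta>\<iota>, K + t \<delta>K)\<close> satisfies the conditions
  to first order in \<open>t\<close> only, the one-loop part is differentiated in this direction through its
  expression \<open>half_str_log\<close>.
\<close>

definition infinitesimal_deformation ::
  "'c::real_vector dg_data \<Rightarrow> ('c \<Rightarrow> 'h::real_vector) \<Rightarrow> ('h \<Rightarrow> 'c) \<Rightarrow> ('c \<Rightarrow> 'c) \<Rightarrow>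
   ('h \<Rightarrow> 'c) \<Rightarrow> ('c \<Rightarrow> 'c) \<Rightarrow> bool" where
  "infinitesimal_deformation C cls \<iota> K \<delta>\<iota> \<delta>K \<longleftrightarrow>
     linear \<delta>\<iota> \<and> (\<forall>x. diff C (\<delta>\<iota> x) = 0) \<and> (\<forall>x. cls (\<delta>\<iota> x) = 0) \<and>
     (\<forall>k. \<delta>\<iota> ` coh_grade C cls k \<subseteq> grade C k) \<and>
     linear \<delta>K \<and> lowers_degree C \<delta>K \<and> skew_homotopy C \<delta>K \<and>
     (\<forall>a. diff C (\<delta>K a) + \<delta>K (diff C a) =
            - \<delta>\<iota> (coh_transpose C \<iota> \<iota> a) - \<iota> (coh_transpose C \<iota> \<delta>\<iota> a)) \<and>
     (\<forall>x. \<delta>K (\<iota> x) + K (\<delta>\<iota> x) = 0) \<and> (\<forall>a. \<delta>K (K a) + K (\<delta>K a) = 0) \<and>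
     \<delta>\<iota> (cls (unit C)) = 0 \<and>
     (\<forall>a b. diff C a = 0 \<longrightarrow> diff C b = 0 \<longrightarrow>
        \<delta>\<iota> (cls (mul C a b)) =
          mul C (\<delta>\<iota> (cls a)) (\<iota> (cls b)) + mul C (\<iota> (cls a)) (\<delta>\<iota> (cls b)))"

end

theory Submission
  imports Defs "Jordan_Normal_Form.Determinant"
begin

text \<open>
  Since \<open>\<iota>\<close> is multiplicative and \<open>im K\<close> is orthogonal to \<open>im \<iota>\<close>, the cubic action has no terms with two
  coordinates \<open>\<alpha>\<close> and one fluctuation, and the unit contributes nothing together with two
  fluctuations.  Hence \<open>S - S\<^sub>0 = W\<^sub>p\<^sub>r\<^sub>o\<^sub>d + V\<close>, where every monomial of \<open>V\<close> contains at most one \<open>\<alpha>\<close>.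
  Counting legs shows that \<open>\<langle>exp (V / \<hbar>)\<rangle>\<close> has no negative powers of \<open>\<hbar>\<close>, and ghost number
  conservation leaves only the coordinates of degree one in it; the invariance of its logarithm
  comes from the invariance of the Gaussian weight and of \<open>V\<close>.

  At order \<open>\<hbar>\<close> only the part of \<open>V\<close> bilinear in the fluctuations matters.  Integration by parts
  gives a differential equation along rays for its Gaussian integral, solved by the exponential
  of \<open>Str log / 2\<close> of the propagator times this bilinear form, which is the matrix of
  \<open>K \<circ> l(\<iota>(\<alpha>), \<cdot>)\<close> on \<open>\<gg> \<otimes> im K\<close>; as this operator takes values there, its powers have the same
  supertraces on \<open>\<gg> \<otimes> C\<close>.

  On the Maurer-Cartan set \<open>L = l(\<iota>(\<alpha>), \<cdot>)\<close> satisfies \<open>L\<^sup>2 = 0\<close> and anticommutes with \<open>d\<close>.  Then the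
  variation of \<open>Str (K L)\<^sup>n\<close> is a combination of supertraces of graded commutators and of supertraces
  of adjoint actions, which vanish because \<open>\<gg>\<close> is unimodular.
\<close>

text \<open>No combinatorics of connected graphs is used. Each of n vertices carries 1/\<hbar> and
  three legs; if e legs are external, contracting the other 3n - e legs in pairs leaves \<hbar>^k
  with n = e + 2k. A vertex of V has at most one external leg, so e \<le> n, hence k \<ge> 0 already
  before the logarithm is taken. The factor exp (W_prod / \<hbar>), which carries the negative
  powers, is split off beforehand. The delicate point of (iii) is that the variation B of A =
  \<iota>(\<alpha>) is exact, but its primitive K B need not commute with A. What is wanted is a
  gauge parameter c with d c + [A, c] = B. On the Maurer-Cartan set it is built degree by degree in
  \<alpha>: c_0 = K B and c_(j+1) = - K [A, c_j], because each [A, c_j] is closed and has no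
  component in im \<iota>. No infinite sum is formed: each integration by parts lowers the power of
  K L by one while raising j by one, so that only finitely many c_j enter a given
  supertrace.\<close>

section \<open>Coefficientwise calculus of superseries\<close>

lemma scoeff_zero [simp]: "scoeff 0 m = 0" by (simp add: zero_superseries.rep_eq)
lemma scoeff_one: "scoeff 1 m = (if m = {#} then 1 else 0)" by (simp add: one_superseries.rep_eq)
lemma scoeff_add [simp]: "scoeff (f + g) m = scoeff f m + scoeff g m"
  by (simp add: plus_superseries.rep_eq)
lemma scoeff_diff [simp]: "scoeff (f - g) m = scoeff f m - scoeff g m"
  by (simp add: minus_superseries.rep_eq)
lemma scoeff_uminus [simp]: "scoeff (- f) m = - scoeff f m"
  by (simp add: uminus_superseries.rep_eq)
lemma scoeff_sum: "scoeff (sum F A) m = (\<Sum>a\<in>A. scoeff (F a) m)"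
  by (induction A rule: infinite_finite_induct) auto
lemma scoeff_sconst: "scoeff (sconst c) m = (if m = {#} then c else 0)"
  by (simp add: sconst.rep_eq)
lemma scoeff_svar: "scoeff (svar v) m = (if m = {#v#} then 1 else 0)"
  by (simp add: svar.rep_eq)
lemma scoeff_superseries_of: "scoeff (superseries_of f) m = (if admissible m then f m else 0)"
  by (simp add: superseries_of.rep_eq)
lemma scoeff_map_scoeff: "h 0 = 0 \<Longrightarrow> scoeff (map_scoeff h f) m = h (scoeff f m)"
  by (simp add: map_scoeff.rep_eq scoeff_not_admissible)

lemma scoeff_mult: "scoeff (f * g) m = (if admissible m
    then \<Sum>a | a \<subseteq># m. (-1) ^ inversions a (m - a) * scoeff f a * scoeff g (m - a) else 0)"
  by (simp add: times_superseries.rep_eq)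

lemma scoeff_sconst_mult [simp]: "scoeff (sconst c * f) m = c * scoeff f m"
proof (cases "admissible m")
  case True
  have "(\<Sum>a | a \<subseteq># m. (-1) ^ inversions a (m - a) * scoeff (sconst c) a * scoeff f (m - a)) =
        (\<Sum>a\<in>{{#}}. (-1) ^ inversions a (m - a) * scoeff (sconst c) a * scoeff f (m - a))"
    by (rule sum.mono_neutral_right) (auto simp: finite_submultisets scoeff_sconst)
  thus ?thesis using True by (simp add: scoeff_mult scoeff_sconst)
qed (simp add: scoeff_mult scoeff_not_admissible)

lemma scoeff_mult_sconst [simp]: "scoeff (f * sconst c) m = c * scoeff f m"
proof (cases "admissible m")
  case True
  have "(\<Sum>a | a \<subseteq># m. (-1) ^ inversions a (m - a) * scoeff f a * scoeff (sconst c) (m - a)) =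
        (\<Sum>a\<in>{m}. (-1) ^ inversions a (m - a) * scoeff f a * scoeff (sconst c) (m - a))"
    by (rule sum.mono_neutral_right)
       (auto simp: finite_submultisets scoeff_sconst Diff_eq_empty_iff_mset)
  thus ?thesis using True by (simp add: scoeff_mult scoeff_sconst mult.commute)
qed (simp add: scoeff_mult scoeff_not_admissible)

lemma sconst_commute: "sconst c * f = f * sconst c"
  by (rule superseries_eqI) simp

lemma sconst_left_commute: "f * (sconst c * g) = sconst c * (f * g)"
  by (metis mult.assoc sconst_commute)

lemma sconst_0 [simp]: "sconst 0 = 0" and sconst_1: "sconst 1 = 1"
  by (auto intro!: superseries_eqI simp: scoeff_sconst scoeff_one)

lemma
  fixes a b :: "'a::comm_ring_1"
  shows sconst_add: "sconst (a + b) = sconst a + sconst b"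
    and sconst_uminus: "sconst (- a) = - sconst a"
    and sconst_diff: "sconst (a - b) = sconst a - sconst b"
    and sconst_mult: "sconst (a * b) = sconst a * sconst b"
  by (auto intro!: superseries_eqI simp: scoeff_sconst)

lemma sconst_sum: "sconst (sum f A) = (\<Sum>a\<in>A. sconst (f a))" for f :: "_ \<Rightarrow> 'a::comm_ring_1"
  by (induction A rule: infinite_finite_induct) (auto simp: sconst_add)

lemma sconst_mult_assoc: "sconst a * (sconst b * f) = sconst (a * b) * f" for f :: "'a::comm_ring_1 superseries"
  by (simp add: sconst_mult mult.assoc)

lemma of_nat_eq_sconst: "(of_nat n :: 'a::comm_ring_1 superseries) = sconst (of_nat n)"
  by (induction n) (simp_all add: sconst_add sconst_1)

subsection \<open>Supports\<close>

text \<open>Arguments about degree, parity and ghost number are phrased through this predicate: a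
  property of multisets that is additive passes to products and powers, whatever the signs
  are.\<close>

definition supp_in :: "(var multiset \<Rightarrow> bool) \<Rightarrow> 'a::zero superseries \<Rightarrow> bool" where
  "supp_in P f \<longleftrightarrow> (\<forall>m. scoeff f m \<noteq> 0 \<longrightarrow> P m)"

lemma supp_inD: "supp_in P f \<Longrightarrow> \<not> P m \<Longrightarrow> scoeff f m = 0"
  by (auto simp: supp_in_def)

lemma supp_in_mono: "supp_in P f \<Longrightarrow> (\<And>m. P m \<Longrightarrow> Q m) \<Longrightarrow> supp_in Q f"
  by (auto simp: supp_in_def)

lemma supp_in_zero [simp]: "supp_in P 0" by (simp add: supp_in_def)

lemma supp_in_add: "supp_in P f \<Longrightarrow> supp_in P g \<Longrightarrow> supp_in P (f + g)"
  for f :: "'a::comm_ring_1 superseries"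
  unfolding supp_in_def by (metis add_0 scoeff_add)

lemma supp_in_sum: "(\<And>a. a \<in> A \<Longrightarrow> supp_in P (F a)) \<Longrightarrow> supp_in P (sum F A)"
  for F :: "_ \<Rightarrow> 'a::comm_ring_1 superseries"
  by (induction A rule: infinite_finite_induct) (auto intro: supp_in_add)

lemma supp_in_sconst_mult: "supp_in P f \<Longrightarrow> supp_in P (sconst c * f)"
  for f :: "'a::comm_ring_1 superseries"
  unfolding supp_in_def by (metis mult_zero_right scoeff_sconst_mult)

lemma supp_in_one: "P {#} \<Longrightarrow> supp_in P 1"
  unfolding supp_in_def by (simp add: scoeff_one)

lemma supp_in_svar: "P {#v#} \<Longrightarrow> supp_in P (svar v)"
  unfolding supp_in_def by (simp add: scoeff_svar)

lemma supp_in_mult: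
  fixes f g :: "'a::comm_ring_1 superseries"
  assumes "supp_in P f" "supp_in Q g" "\<And>a b. P a \<Longrightarrow> Q b \<Longrightarrow> S (a + b)"
  shows "supp_in S (f * g)"
  unfolding supp_in_def
proof (intro allI impI)
  fix m assume m: "scoeff (f * g) m \<noteq> 0"
  hence "admissible m" by (metis scoeff_not_admissible)
  with m have "(\<Sum>a | a \<subseteq># m. (-1) ^ inversions a (m - a) * scoeff f a * scoeff g (m - a)) \<noteq> 0"
    by (simp add: scoeff_mult)
  then obtain a where a: "a \<subseteq># m" "(-1) ^ inversions a (m - a) * scoeff f a * scoeff g (m - a) \<noteq> 0"
    by (metis (mono_tags, lifting) mem_Collect_eq sum.neutral)
  hence "scoeff f a \<noteq> 0" "scoeff g (m - a) \<noteq> 0" by auto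
  hence "P a" "Q (m - a)" using assms(1,2) by (auto simp: supp_in_def)
  from assms(3)[OF this] a(1) show "S m" by simp
qed

lemma supp_in_power:
  fixes f :: "'a::comm_ring_1 superseries"
  assumes "supp_in P f" "Q 0 {#}" "\<And>n a b. P a \<Longrightarrow> Q n b \<Longrightarrow> Q (Suc n) (a + b)"
  shows "supp_in (Q n) (f ^ n)"
proof (induction n)
  case (Suc n)
  show ?case unfolding power_Suc by (rule supp_in_mult[OF assms(1) Suc]) (rule assms(3))
qed (simp add: supp_in_one assms)

lemma supp_in_power':
  fixes f :: "'a::comm_ring_1 superseries"
  assumes "supp_in P f" "P {#}" "\<And>a b. P a \<Longrightarrow> P b \<Longrightarrow> P (a + b)"
  shows "supp_in P (f ^ n)"
  by (rule supp_in_power[where Q = "\<lambda>_. P", OF assms(1,2)]) (rule assms(3))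

section \<open>Koszul signs and supercommutativity\<close>

definition num_odd :: "var multiset \<Rightarrow> nat" where
  "num_odd m = size (filter_mset odd_var m)"

lemma num_odd_empty [simp]: "num_odd {#} = 0"
  and num_odd_plus [simp]: "num_odd (a + b) = num_odd a + num_odd b"
  by (simp_all add: num_odd_def)

lemma num_odd_add_mset [simp]: "num_odd (add_mset v m) = (if odd_var v then 1 else 0) + num_odd m"
  by (simp add: num_odd_def)

text \<open>The exponent of the sign that arises when \<open>v\<close>, multiplied from the left, is
  moved to its place in the ordered monomial \<open>n\<close>.\<close>

definition inv1 :: "var \<Rightarrow> var multiset \<Rightarrow> nat" where
  "inv1 v n = (if odd_var v then size {#w \<in># n. odd_var w \<and> w < v#} else 0)"

lemma inversions_single_left: "inversions {#v#} n = inv1 v n"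
  by (simp add: inversions_def inv1_def)

lemma inv1_simps [simp]:
  "inv1 v {#} = 0"
  "inv1 v (a + b) = inv1 v a + inv1 v b"
  "inv1 v (add_mset w n) = (if odd_var v \<and> odd_var w \<and> w < v then 1 else 0) + inv1 v n"
  by (simp_all add: inv1_def)

lemma inversions_add_mset_left [simp]: "inversions (add_mset v m) n = inv1 v n + inversions m n"
  using inversions_plus_left[of "{#v#}" m n] by (simp add: inversions_single_left)

lemma inversions_add_mset_right:
  "inversions m (add_mset v n) = inversions m {#v#} + inversions m n"
  using inversions_plus_right[of m "{#v#}" n] by simp

text \<open>Admissibility excludes a second copy of an odd \<open>v\<close>, so every odd element of
  \<open>n\<close> lies strictly on one side of \<open>v\<close> and is counted by exactly one
  summand.\<close>

lemma inversions_swap_single: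
  assumes "admissible (add_mset v n)"
  shows "inv1 v n + inversions n {#v#} = (if odd_var v then num_odd n else 0)"
  using assms
proof (induction n)
  case (add w n)
  have "admissible (add_mset v n)"
    by (rule admissible_mono[OF add.prems]) simp
  moreover have "v \<noteq> w" if "odd_var v"
  proof
    assume "v = w"
    hence "2 \<le> count (add_mset v (add_mset w n)) v" by simp
    with add.prems that show False unfolding admissible_def by fastforce
  qed
  ultimately show ?case using add.IH by (auto split: if_splits)
qed auto

lemma inversions_swap:
  assumes "admissible (a + b)"
  shows "inversions a b + inversions b a = num_odd a * num_odd b"
  using assms
proof (induction a)
  case (add v a)
  have "admissible (a + b)" by (rule admissible_mono[OF add.prems]) simp
  moreover have "admissible (add_mset v b)" by (rule admissible_mono[OF add.prems]) simp
  ultimately have "inversions a b + inversions b a = num_odd a * num_odd b"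
      "inv1 v b + inversions b {#v#} = (if odd_var v then num_odd b else 0)"
    using add.IH inversions_swap_single[of v b] by blast+
  moreover have "inversions (add_mset v a) b + inversions b (add_mset v a) =
      (inversions a b + inversions b a) + (inv1 v b + inversions b {#v#})"
    by (simp add: inversions_add_mset_right[of b v a])
  ultimately show ?case by simp
qed auto

text \<open>Passing to the complementary submultiset exchanges the factors; by
  \<open>inversions_swap\<close> the two signs differ by a product of numbers of odd variables, one
  of which is even.\<close>

lemma even_commute:
  fixes f g :: "'a::comm_ring_1 superseries"
  assumes "supp_in (\<lambda>m. even (num_odd m)) f"
  shows "f * g = g * f"
proof (rule superseries_eqI)
  fix m
  show "scoeff (f * g) m = scoeff (g * f) m"
  proof (cases "admissible m")
    case True
    have "(\<Sum>a | a \<subseteq># m. (-1) ^ inversions a (m - a) * scoeff f a * scoeff g (m - a)) =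
          (\<Sum>a | a \<subseteq># m. (-1) ^ inversions (m - a) a * scoeff f (m - a) * scoeff g a)"
      by (rule sum.reindex_bij_witness[where i = "\<lambda>a. m - a" and j = "\<lambda>a. m - a"])
         (auto simp: subset_mset.diff_diff_right)
    also have "\<dots> = (\<Sum>a | a \<subseteq># m. (-1) ^ inversions a (m - a) * scoeff g a * scoeff f (m - a))"
    proof (rule sum.cong[OF refl])
      fix a assume "a \<in> {a. a \<subseteq># m}"
      hence a: "a + (m - a) = m" by simp
      show "(-1) ^ inversions (m - a) a * scoeff f (m - a) * scoeff g a =
            (-1) ^ inversions a (m - a) * scoeff g a * scoeff f (m - a)"
      proof (cases "even (num_odd (m - a))")
        case True
        have "even (inversions a (m - a) + inversions (m - a) a)"
          using inversions_swap[of a "m - a"] a \<open>admissible m\<close> True by simp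
        hence "(-1::'a) ^ inversions (m - a) a = (-1) ^ inversions a (m - a)"
          by (metis even_add neg_one_even_power neg_one_odd_power)
        thus ?thesis by simp
      next
        case False
        thus ?thesis using supp_inD[OF assms, of "m - a"] by simp
      qed
    qed
    finally show ?thesis using True by (simp add: scoeff_mult)
  qed (simp add: scoeff_mult)
qed

subsection \<open>Variables and left derivatives\<close>

lemma scoeff_svar_mult:
  fixes f :: "'a::comm_ring_1 superseries"
  shows "scoeff (svar v * f) m = (if admissible m \<and> v \<in># m
     then (-1) ^ inv1 v (m - {#v#}) * scoeff f (m - {#v#}) else 0)"
proof (cases "admissible m")
  case True
  have "(\<Sum>a | a \<subseteq># m. (-1) ^ inversions a (m - a) * scoeff (svar v :: 'a superseries) a * scoeff f (m - a)) =
        (\<Sum>a\<in>{a \<in> {{#v#}}. v \<in># m}. (-1) ^ inversions a (m - a) * scoeff (svar v :: 'a superseries) a * scoeff f (m - a))"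
    by (rule sum.mono_neutral_right)
       (auto simp: finite_submultisets scoeff_svar split: if_splits)
  thus ?thesis using True by (simp add: scoeff_mult scoeff_svar inversions_single_left)
qed (simp add: scoeff_mult)

definition sg :: "var \<Rightarrow> var \<Rightarrow> real" where
  "sg v w = (if odd_var v \<and> odd_var w then -1 else 1)"

lemma sg_sq [simp]: "sg v w * sg v w = 1" "sg v w * (sg v w * x) = x" by (auto simp: sg_def)
lemma sg_commute: "sg v w = sg w v" by (auto simp: sg_def)

text \<open>The factor \<open>count m v + 1\<close> matters for even \<open>v\<close> only, since odd variables are not repeated.\<close>
lift_definition sderiv :: "var \<Rightarrow> real superseries \<Rightarrow> real superseries" is
  "\<lambda>v f m. (real (count m v) + 1) * (-1) ^ inv1 v m * f (add_mset v m)"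
  by (metis admissible_mono mset_subset_eq_add_right add_mset_add_single mult_zero_right union_commute
      mset_subset_eq_add_left)

lemma scoeff_sderiv:
  "scoeff (sderiv v f) m = (real (count m v) + 1) * (-1) ^ inv1 v m * scoeff f (add_mset v m)"
  by (simp add: sderiv.rep_eq)

lemma sderiv_add [simp]: "sderiv v (f + g) = sderiv v f + sderiv v g"
  and sderiv_diff [simp]: "sderiv v (f - g) = sderiv v f - sderiv v g"
  and sderiv_zero [simp]: "sderiv v 0 = 0"
  and sderiv_sconst_mult [simp]: "sderiv v (sconst c * f) = sconst c * sderiv v f"
  and sderiv_sconst [simp]: "sderiv v (sconst c) = 0"
  and sderiv_one [simp]: "sderiv v 1 = 0"
  by (auto intro!: superseries_eqI simp: scoeff_sderiv algebra_simps scoeff_sconst scoeff_one)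

lemma sderiv_sum [simp]: "sderiv v (sum F A) = (\<Sum>a\<in>A. sderiv v (F a))"
  by (induction A rule: infinite_finite_induct) auto

lemma admissible_add_mset:
  "admissible (add_mset v m) \<longleftrightarrow> admissible m \<and> (odd_var v \<longrightarrow> v \<notin># m)"
proof
  assume a: "admissible (add_mset v m)"
  hence "count (add_mset v m) v \<le> 1" if "odd_var v" using that by (simp only: admissible_def)
  hence "v \<notin># m" if "odd_var v" using that by (simp add: not_in_iff)
  moreover have "admissible m" by (rule admissible_mono[OF a]) simp
  ultimately show "admissible m \<and> (odd_var v \<longrightarrow> v \<notin># m)" by blast
next
  assume "admissible m \<and> (odd_var v \<longrightarrow> v \<notin># m)"
  thus "admissible (add_mset v m)" unfolding admissible_def by (auto simp: not_in_iff)
qed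

text \<open>The graded Leibniz rule for one variable. With the rule on constants it determines all
  left derivatives used below.\<close>

lemma sderiv_svar_mult:
  "sderiv v (svar x * f) = (if x = v then f else 0) + sconst (sg v x) * (svar x * sderiv v f)"
proof (rule superseries_eqI)
  fix m
  show "scoeff (sderiv v (svar x * f)) m =
        scoeff ((if x = v then f else 0) + sconst (sg v x) * (svar x * sderiv v f)) m"
  proof (cases "admissible m")
    case adm: True
    show ?thesis
    proof (cases "x = v")
      case True
      show ?thesis
      proof (cases "v \<in># m")
        case True
        then obtain n where m: "m = add_mset v n" by (metis insert_DiffM)
        from adm m have n: "admissible n" "odd_var v \<longrightarrow> v \<notin># n"
          by (simp_all add: admissible_add_mset)
        show ?thesis
          using \<open>x = v\<close> n m adm
          by (auto simp: scoeff_sderiv scoeff_svar_mult admissible_add_mset sg_def scoeff_not_admissible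
              not_in_iff algebra_simps)
      next
        case False
        have "scoeff (sderiv v (svar v * f)) m = ((-1) ^ inv1 v m * (-1) ^ inv1 v m) * scoeff f m"
          using False adm by (auto simp: scoeff_sderiv scoeff_svar_mult admissible_add_mset not_in_iff)
        also have "(-1::real) ^ inv1 v m * (-1) ^ inv1 v m = 1"
          by (simp flip: power_add)
        finally show ?thesis using False \<open>x = v\<close> by (simp add: scoeff_svar_mult)
      qed
    next
      case xv: False
      show ?thesis
      proof (cases "x \<in># m")
        case True
        then obtain n where m: "m = add_mset x n" by (metis insert_DiffM)
        from adm m have n: "admissible n" "odd_var x \<longrightarrow> x \<notin># n"
          by (simp_all add: admissible_add_mset)
        have "add_mset v (add_mset x n) - {#x#} = add_mset v n" by simp
        \<comment> \<open>Of two distinct odd variables exactly one precedes the other, so the two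
          orders of insertion differ by \<open>sg v x\<close>.\<close>
        moreover have "inv1 v {#x#} + inv1 x {#v#} = (if odd_var v \<and> odd_var x then 1 else 0)"
          using xv by auto
        hence "(-1::real) ^ (inv1 v {#x#}) * (-1) ^ inv1 x {#v#} = sg v x"
          by (auto simp: sg_def simp flip: power_add)
        ultimately show ?thesis
          using xv n m adm
          by (cases "odd_var v \<and> v \<in># n")
             (auto simp: scoeff_sderiv scoeff_svar_mult admissible_add_mset scoeff_not_admissible power_add)
      next
        case False
        thus ?thesis using xv by (simp add: scoeff_sderiv scoeff_svar_mult)
      qed
    qed
  qed (simp add: scoeff_not_admissible)
qed

lemma sderiv_svar: "sderiv v (svar x) = sconst (if x = v then 1 else 0)"
  using sderiv_svar_mult[of v x 1] by (simp add: sconst_1)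

lemma sderiv_commute: "sderiv v (sderiv w f) = sconst (sg v w) * sderiv w (sderiv v f)"
proof (rule superseries_eqI)
  fix m
  show "scoeff (sderiv v (sderiv w f)) m = scoeff (sconst (sg v w) * sderiv w (sderiv v f)) m"
  proof (cases "v = w")
    case True
    show ?thesis
    proof (cases "odd_var v")
      case odd: True
      hence "\<not> admissible (add_mset v (add_mset v m))" by (simp add: admissible_add_mset)
      thus ?thesis using True by (simp add: scoeff_sderiv scoeff_not_admissible)
    next
      case False
      thus ?thesis using True by (simp add: sg_def)
    qed
  next
    case vw: False
    have "inv1 v {#w#} + inv1 w {#v#} = (if odd_var v \<and> odd_var w then 1 else 0)"
      using vw by auto
    hence "(-1::real) ^ (inv1 w {#v#}) = sg v w * (-1) ^ inv1 v {#w#}"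
      by (auto simp: sg_def split: if_splits)
    thus ?thesis using vw
      by (auto simp: scoeff_sderiv power_add add_mset_commute)
  qed
qed

lemma svar_commute: "svar v * svar w = sconst (sg v w) * (svar w * svar v :: real superseries)"
proof (rule superseries_eqI)
  fix m
  show "scoeff (svar v * svar w) m = scoeff (sconst (sg v w) * (svar w * svar v) :: real superseries) m"
  proof (cases "m = {#v, w#}")
    case True
    show ?thesis using True
      by (auto simp: scoeff_svar_mult scoeff_svar admissible_add_mset sg_def)
  next
    case False
    hence *: "v \<in># m \<Longrightarrow> m - {#v#} \<noteq> {#w#}" "w \<in># m \<Longrightarrow> m - {#w#} \<noteq> {#v#}"
      by (metis insert_DiffM, metis add_mset_commute insert_DiffM)
    thus ?thesis by (auto simp: scoeff_svar_mult scoeff_svar)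
  qed
qed

lemma sg_mult_svar_commute: "svar v * (svar w * f) = sconst (sg v w) * (svar w * (svar v * f))"
  by (metis mult.assoc svar_commute)

subsection \<open>The weight filtration and substitution into power series\<close>

text \<open>
  Giving every coordinate weight 1 and \<open>\<hbar>\<close> weight 2 makes the action divided by \<open>\<hbar>\<close> homogeneous of
  weight 1.  The resulting filtration is multiplicative and separated, and all the formal sums
  converge with respect to it.
\<close>

definition wge :: "nat \<Rightarrow> real fls superseries \<Rightarrow> bool" where
  "wge N f \<longleftrightarrow> (\<forall>m k. fls_nth (scoeff f m) k \<noteq> 0 \<longrightarrow> int N \<le> int (size m) + 2 * k)"

lemma wgeD: "wge N f \<Longrightarrow> int (size m) + 2 * k < int N \<Longrightarrow> fls_nth (scoeff f m) k = 0"
  by (force simp: wge_def)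

lemma wge_mono: "wge N f \<Longrightarrow> M \<le> N \<Longrightarrow> wge M f"
  by (force simp: wge_def)

lemma wge_0 [simp]: "wge N 0" by (simp add: wge_def)

lemma wge_add: "wge N f \<Longrightarrow> wge N g \<Longrightarrow> wge N (f + g)"
  unfolding wge_def by (metis add_0 fls_plus_nth scoeff_add)

lemma wge_uminus: "wge N f \<Longrightarrow> wge N (- f)"
  unfolding wge_def by simp

lemma wge_diff: "wge N f \<Longrightarrow> wge N g \<Longrightarrow> wge N (f - g)"
  using wge_add[of N f "- g"] wge_uminus[of N g] by simp

lemma wge_sum: "(\<And>a. a \<in> A \<Longrightarrow> wge N (F a)) \<Longrightarrow> wge N (sum F A)"
  by (induction A rule: infinite_finite_induct) (auto intro: wge_add)

lemma fls_times_nth_nonzeroE: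
  assumes "fls_nth (f * g :: real fls) k \<noteq> 0"
  obtains i where "fls_nth f i \<noteq> 0" "fls_nth g (k - i) \<noteq> 0"
proof -
  have "(\<Sum>i=fls_subdegree f..k - fls_subdegree g. fls_nth f i * fls_nth g (k - i)) \<noteq> 0"
    using assms by (simp add: fls_times_nth(2))
  then obtain i where "fls_nth f i * fls_nth g (k - i) \<noteq> 0"
    by (meson sum.neutral)
  thus ?thesis using that by auto
qed

lemma neg_one_power_fls: "(-1 :: real fls) ^ n = fls_const ((-1) ^ n)"
  by (metis fls_const_1 fls_const_power fls_const_uminus)

lemma fls_nth_neg_one_power_mult [simp]:
  "fls_nth ((-1) ^ n * (h :: real fls)) k = (-1) ^ n * fls_nth h k"
  by (simp add: neg_one_power_fls)

lemma wge_mult: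
  assumes "wge M f" "wge N g"
  shows "wge (M + N) (f * g)"
  unfolding wge_def
proof (intro allI impI)
  fix m k assume nz: "fls_nth (scoeff (f * g) m) k \<noteq> 0"
  hence "admissible m" by (metis scoeff_not_admissible fls_zero_nth)
  with nz have "(\<Sum>a | a \<subseteq># m. fls_nth ((-1) ^ inversions a (m - a) * (scoeff f a * scoeff g (m - a))) k) \<noteq> 0"
    by (simp add: scoeff_mult fls_nth_sum mult.assoc)
  then obtain a where a: "a \<subseteq># m"
    and "fls_nth ((-1) ^ inversions a (m - a) * (scoeff f a * scoeff g (m - a))) k \<noteq> 0"
    by (metis (mono_tags, lifting) mem_Collect_eq sum.neutral)
  hence "fls_nth (scoeff f a * scoeff g (m - a)) k \<noteq> 0" by simp
  then obtain i where "fls_nth (scoeff f a) i \<noteq> 0" "fls_nth (scoeff g (m - a)) (k - i) \<noteq> 0"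
    by (rule fls_times_nth_nonzeroE)
  hence "int M \<le> int (size a) + 2 * i" "int N \<le> int (size (m - a)) + 2 * (k - i)"
    using assms unfolding wge_def by blast+
  moreover have "size m = size a + size (m - a)"
    using a by (metis size_union subset_mset.add_diff_inverse)
  ultimately show "int (M + N) \<le> int (size m) + 2 * k" by simp
qed

lemma wge_one: "wge 0 1"
  by (auto simp: wge_def scoeff_one split: if_splits)

lemma wge_power: "wge 1 f \<Longrightarrow> wge n (f ^ n)"
  by (induction n) (auto simp: wge_one dest: wge_mult)

abbreviation scal :: "real \<Rightarrow> real fls superseries" where
  "scal r \<equiv> sconst (fls_const r)"

lemma wge_scal_mult: "wge N f \<Longrightarrow> wge N (scal r * f)"
  unfolding wge_def by auto

lemma scal_add: "scal (a + b) = scal a + scal b"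
  by (metis fls_plus_const sconst_add)

lemma scal_mult_assoc: "scal a * (scal b * f) = scal (a * b) * f"
  by (simp add: sconst_mult_assoc)

lemma scal_sum: "scal (sum f A) = (\<Sum>a\<in>A. scal (f a))"
  by (induction A rule: infinite_finite_induct) (auto simp: scal_add)

text \<open>A fixed monomial with a fixed power of \<hbar> has finite weight, and a difference of
  larger order vanishes there.\<close>

lemma wge_separated:
  assumes "\<And>N. wge N (f - g)"
  shows "f = g"
proof (rule superseries_eqI, rule fls_eqI)
  fix m k
  show "fls_nth (scoeff f m) k = fls_nth (scoeff g m) k"
    using wgeD[OF assms[of "Suc (nat (int (size m) + 2 * k))"], of m k] by simp
qed

text \<open>Since the \<open>n\<close>-th summand starts in weight \<open>n\<close>, only summands
  up to the weight of the chosen coefficient contribute, and the sum over all \<open>n\<close> is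
  finite.\<close>

lemma fls_nth_formal_sum:
  assumes "\<And>n. wge n (F n)" and N: "int (size m) + 2 * k < int N"
  shows "fls_nth (scoeff (formal_sum F) m) k = (\<Sum>n<N. fls_nth (scoeff (F n) m) k)"
proof (cases "admissible m")
  case True
  have *: "Sum_any (\<lambda>n. fls_nth (scoeff (F n) m) k) = (\<Sum>n<N. fls_nth (scoeff (F n) m) k)"
    if "int (size m) + 2 * k < int N" for N k
  proof (rule Sum_any.expand_superset)
    show "{n. fls_nth (scoeff (F n) m) k \<noteq> 0} \<subseteq> {..<N}"
    proof
      fix n assume "n \<in> {n. fls_nth (scoeff (F n) m) k \<noteq> 0}"
      hence "int n \<le> int (size m) + 2 * k" using assms(1) by (auto simp: wge_def)
      thus "n \<in> {..<N}" using that by simp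
    qed
  qed simp
  have "fls_nth (Abs_fls (\<lambda>k. Sum_any (\<lambda>n. fls_nth (scoeff (F n) m) k))) k
      = Sum_any (\<lambda>n. fls_nth (scoeff (F n) m) k)"
  proof (rule nth_Abs_fls_ex_lower_bound, intro exI allI impI)
    \<comment> \<open>Below this bound the weight is negative, so the truncation at 0 applies and
      the powers of \<hbar> are bounded below.\<close>
    fix k assume "k < - int (size m)"
    thus "Sum_any (\<lambda>n. fls_nth (scoeff (F n) m) k) = 0"
      using *[of k 0] by simp
  qed
  thus ?thesis using True *[OF N] by (simp add: formal_sum_def scoeff_superseries_of)
qed (simp add: scoeff_not_admissible)

text \<open>Congruence modulo weight \<open>N\<close>. Identities between formal sums are shown by
  truncating both sides to finite sums modulo every \<open>N\<close> and then using
  \<open>eqv_eq\<close>.\<close>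

definition eqv :: "nat \<Rightarrow> real fls superseries \<Rightarrow> real fls superseries \<Rightarrow> bool" where
  "eqv N f g \<longleftrightarrow> wge N (f - g)"

lemma eqv_refl [simp]: "eqv N f f" by (simp add: eqv_def)
lemma eqv_sym: "eqv N f g \<Longrightarrow> eqv N g f" unfolding eqv_def using wge_uminus by fastforce
lemma eqv_trans [trans]: "eqv N f g \<Longrightarrow> eqv N g h \<Longrightarrow> eqv N f h"
  unfolding eqv_def using wge_add by fastforce
lemma eqv_add: "eqv N f f' \<Longrightarrow> eqv N g g' \<Longrightarrow> eqv N (f + g) (f' + g')"
  unfolding eqv_def using wge_add[of N "f - f'" "g - g'"] by (simp add: algebra_simps)
lemma eqv_sum: "(\<And>a. a \<in> A \<Longrightarrow> eqv N (F a) (G a)) \<Longrightarrow> eqv N (sum F A) (sum G A)"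
  by (induction A rule: infinite_finite_induct) (auto intro: eqv_add)
lemma eqv_scal_mult: "eqv N f g \<Longrightarrow> eqv N (scal r * f) (scal r * g)"
  unfolding eqv_def using wge_scal_mult[of N "f - g" r] by (simp add: algebra_simps)
lemma eqv_mult:
  assumes "eqv N f f'" "eqv N g g'" "wge 0 f" "wge 0 g'"
  shows "eqv N (f * g) (f' * g')"
proof -
  have "f * g - f' * g' = f * (g - g') + (f - f') * g'" by (simp add: algebra_simps)
  moreover have "wge N (f * (g - g'))" using wge_mult[of 0 f N "g - g'"] assms by (simp add: eqv_def)
  moreover have "wge N ((f - f') * g')" using wge_mult[of N "f - f'" 0 g'] assms by (simp add: eqv_def)
  ultimately show ?thesis unfolding eqv_def by (simp add: wge_add)
qed
lemma eqv_eq: "(\<And>N. eqv N f g) \<Longrightarrow> f = g"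
  by (rule wge_separated) (simp add: eqv_def)

lemma formal_sum_eqv:
  assumes "\<And>n. wge n (F n)"
  shows "eqv N (formal_sum F) (\<Sum>n<N. F n)"
  unfolding eqv_def wge_def
proof (intro allI impI, rule ccontr)
  fix m k assume "fls_nth (scoeff (formal_sum F - (\<Sum>n<N. F n)) m) k \<noteq> 0"
    and "\<not> int N \<le> int (size m) + 2 * k"
  thus False using fls_nth_formal_sum[OF assms, of m k N] by (simp add: scoeff_sum fls_nth_sum)
qed

lemma wge_formal_sum:
  assumes "\<And>n. wge n (F n)" "\<And>n. wge M (F n)"
  shows "wge M (formal_sum F)"
proof -
  have "formal_sum F = (formal_sum F - (\<Sum>n<M. F n)) + (\<Sum>n<M. F n)" by simp
  moreover have "wge M (formal_sum F - (\<Sum>n<M. F n))"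
    using formal_sum_eqv[OF assms(1)] by (simp add: eqv_def)
  ultimately show ?thesis using assms(2) by (metis wge_add wge_sum)
qed

section \<open>Substitution into one-variable series; exponential and logarithm\<close>

text \<open>Powers of a single \<open>G\<close> commute with each other, so identities between power
  series in one variable, such as those of exponential and logarithm, carry over to the
  noncommutative ring.\<close>

definition subst_fps :: "real fps \<Rightarrow> real fls superseries \<Rightarrow> real fls superseries" where
  "subst_fps a G = formal_sum (\<lambda>n. scal (fps_nth a n) * G ^ n)"

lemma subst_fps_terms: "wge 1 G \<Longrightarrow> wge n (scal r * G ^ n)"
  by (intro wge_scal_mult wge_power)

lemma subst_fps_eqv: "wge 1 G \<Longrightarrow> eqv N (subst_fps a G) (\<Sum>n<N. scal (fps_nth a n) * G ^ n)"
  unfolding subst_fps_def by (rule formal_sum_eqv) (rule subst_fps_terms)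

lemma wge_subst_fps: "wge 1 G \<Longrightarrow> wge 0 (subst_fps a G)"
  unfolding subst_fps_def using subst_fps_terms wge_mono by (intro wge_formal_sum) blast+

lemma wge_subst_fps_1:
  assumes "wge 1 G" "fps_nth a 0 = 0"
  shows "wge 1 (subst_fps a G)"
  unfolding subst_fps_def
proof (rule wge_formal_sum)
  show "wge n (scal (fps_nth a n) * G ^ n)" for n by (rule subst_fps_terms[OF assms(1)])
  thus "wge 1 (scal (fps_nth a n) * G ^ n)" for n
    using assms(2) wge_mono[of n _ 1] by (cases "n = 0") auto
qed

lemma subst_fps_one: "wge 1 G \<Longrightarrow> subst_fps 1 G = 1"
proof (rule eqv_eq)
  fix N assume G: "wge 1 G"
  show "eqv N (subst_fps 1 G) 1"
  proof (cases "N = 0")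
    case True
    have "wge 0 (subst_fps 1 G - 1)" by (intro wge_diff wge_subst_fps G wge_one)
    thus ?thesis using True by (simp add: eqv_def)
  next
    case False
    have "(\<Sum>n<N. scal (fps_nth 1 n) * G ^ n) = (\<Sum>n\<in>{0}. scal (fps_nth 1 n) * G ^ n)"
      using False by (intro sum.mono_neutral_right) auto
    thus ?thesis using subst_fps_eqv[OF G, of N 1] by (simp add: sconst_1)
  qed
qed

lemma subst_fps_X: "wge 1 G \<Longrightarrow> subst_fps fps_X G = G"
proof (rule eqv_eq)
  fix N assume G: "wge 1 G"
  show "eqv N (subst_fps fps_X G) G"
  proof (cases "N < 2")
    case True
    have "wge 1 (subst_fps fps_X G - G)" by (intro wge_diff wge_subst_fps_1 G) simp
    thus ?thesis using True wge_mono by (auto simp: eqv_def)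
  next
    case False
    have "(\<Sum>n<N. scal (fps_nth fps_X n) * G ^ n) = (\<Sum>n\<in>{1}. scal (fps_nth fps_X n) * G ^ n)"
      using False by (intro sum.mono_neutral_right) auto
    thus ?thesis using subst_fps_eqv[OF G, of N fps_X] by (simp add: sconst_1)
  qed
qed

lemma subst_fps_diff: "wge 1 G \<Longrightarrow> subst_fps (a - b) G = subst_fps a G - subst_fps b G"
proof (rule eqv_eq)
  fix N assume G: "wge 1 G"
  let ?S = "\<lambda>a. \<Sum>n<N. scal (fps_nth a n) * G ^ n"
  have "?S (a - b) = ?S a - ?S b"
    by (simp add: sum_subtractf left_diff_distrib sconst_diff flip: fls_minus_const)
  hence "subst_fps (a - b) G - (subst_fps a G - subst_fps b G) =
      (subst_fps (a - b) G - ?S (a - b)) - ((subst_fps a G - ?S a) - (subst_fps b G - ?S b))"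
    by simp
  moreover have w: "wge N (subst_fps c G - ?S c)" for c
    using subst_fps_eqv[OF G] by (simp add: eqv_def)
  have "wge N ((subst_fps (a - b) G - ?S (a - b)) - ((subst_fps a G - ?S a) - (subst_fps b G - ?S b)))"
    by (rule wge_diff[OF w wge_diff[OF w w]])
  ultimately show "eqv N (subst_fps (a - b) G) (subst_fps a G - subst_fps b G)"
    by (simp only: eqv_def)
qed

text \<open>A product of two truncated series is a sum over a square. The part with
  \<open>i + j \<ge> N\<close> is negligible modulo weight \<open>N\<close>; the triangle that
  remains is regrouped by total degree.\<close>

lemma fps_truncated_product:
  "(\<Sum>i<N. \<Sum>j<N. if i + j < N then f i j else 0) = (\<Sum>n<N. \<Sum>i\<le>n. f i (n - i))"
  for f :: "nat \<Rightarrow> nat \<Rightarrow> 'a::comm_monoid_add"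
proof -
  have "(\<Sum>i<N. \<Sum>j<N. if i + j < N then f i j else 0)
      = (\<Sum>(i,j)\<in>{..<N} \<times> {..<N}. if i + j < N then f i j else 0)"
    by (simp add: sum.cartesian_product)
  also have "\<dots> = (\<Sum>(i,j)\<in>{(i,j). i + j < N}. f i j)"
    by (rule sum.mono_neutral_cong_right) (auto split: if_splits)
  also have "\<dots> = (\<Sum>n<N. \<Sum>i\<le>n. f i (n - i))"
    by (rule sum.triangle_reindex)
  finally show ?thesis .
qed

lemma subst_fps_mult:
  assumes G: "wge 1 G"
  shows "subst_fps (a * b) G = subst_fps a G * subst_fps b G"
proof (rule eqv_eq)
  fix N
  let ?S = "\<lambda>a. \<Sum>n<N. scal (fps_nth a n) * G ^ n"
  have pr: "(scal x * G ^ i) * (scal y * G ^ j) = scal (x * y) * G ^ (i + j)" for x y i j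
    by (metis (no_types, lifting) mult.assoc power_add scal_mult_assoc sconst_left_commute)
  have "?S a * ?S b = (\<Sum>i<N. \<Sum>j<N. scal (fps_nth a i * fps_nth b j) * G ^ (i + j))"
    by (simp only: sum_product pr)
  also have "eqv N \<dots> (\<Sum>i<N. \<Sum>j<N. if i + j < N then scal (fps_nth a i * fps_nth b j) * G ^ (i + j) else 0)"
  proof (intro eqv_sum)
    fix i j
    show "eqv N (scal (fps_nth a i * fps_nth b j) * G ^ (i + j))
        (if i + j < N then scal (fps_nth a i * fps_nth b j) * G ^ (i + j) else 0)"
      using wge_mono[OF subst_fps_terms[OF G, of "i + j"], of N] by (auto simp: eqv_def)
  qed
  also have "\<dots> = (\<Sum>n<N. \<Sum>i\<le>n. scal (fps_nth a i * fps_nth b (n - i)) * G ^ (i + (n - i)))"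
    by (rule fps_truncated_product)
  also have "\<dots> = ?S (a * b)"
    by (intro sum.cong refl) (simp add: fps_mult_nth scal_sum sum_distrib_right atLeast0AtMost)
  finally have "eqv N (?S a * ?S b) (?S (a * b))" .
  moreover have "eqv N (subst_fps a G * subst_fps b G) (?S a * ?S b)"
    by (intro eqv_mult subst_fps_eqv G wge_subst_fps wge_sum)
       (use subst_fps_terms[OF G] wge_mono in blast)
  ultimately show "eqv N (subst_fps (a * b) G) (subst_fps a G * subst_fps b G)"
    using subst_fps_eqv[OF G, of N "a * b"] eqv_trans eqv_sym by blast
qed

lemma subst_fps_power: "wge 1 G \<Longrightarrow> subst_fps (a ^ n) G = subst_fps a G ^ n"
  by (induction n) (simp_all add: subst_fps_one subst_fps_mult)

lemma subst_fps_compose: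
  assumes G: "wge 1 G" and b: "fps_nth b 0 = 0"
  shows "subst_fps (a oo b) G = subst_fps a (subst_fps b G)"
proof (rule eqv_eq)
  fix N
  \<comment> \<open>A series without constant term has an \<open>i\<close>-th power starting in
    degree \<open>i\<close>; hence for \<open>n < N\<close> the composition may be summed over all
    \<open>i < N\<close>.\<close>
  have bi: "fps_nth (b ^ i) n = 0" if "n < i" for n i
    using b that by (metis fps_eq_iff startsby_zero_power_prefix)
  have "(\<Sum>n<N. scal (fps_nth (a oo b) n) * G ^ n)
      = (\<Sum>n<N. \<Sum>i<N. scal (fps_nth a i) * (scal (fps_nth (b ^ i) n) * G ^ n))"
  proof (rule sum.cong[OF refl])
    fix n assume "n \<in> {..<N}"
    hence "(\<Sum>i=0..n. fps_nth a i * fps_nth (b ^ i) n) = (\<Sum>i<N. fps_nth a i * fps_nth (b ^ i) n)"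
      by (intro sum.mono_neutral_left) (auto simp: bi)
    thus "scal (fps_nth (a oo b) n) * G ^ n
        = (\<Sum>i<N. scal (fps_nth a i) * (scal (fps_nth (b ^ i) n) * G ^ n))"
      by (simp add: fps_compose_nth scal_sum sum_distrib_right scal_mult_assoc)
  qed
  also have "\<dots> = (\<Sum>i<N. scal (fps_nth a i) * (\<Sum>n<N. scal (fps_nth (b ^ i) n) * G ^ n))"
    by (subst sum.swap) (simp add: sum_distrib_left)
  also have "eqv N \<dots> (\<Sum>i<N. scal (fps_nth a i) * subst_fps b G ^ i)"
    by (intro eqv_sum eqv_scal_mult) (metis G eqv_sym subst_fps_eqv subst_fps_power)
  also have "eqv N \<dots> (subst_fps a (subst_fps b G))"
    by (rule eqv_sym, rule subst_fps_eqv, rule wge_subst_fps_1[OF G b])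
  finally show "eqv N (subst_fps (a oo b) G) (subst_fps a (subst_fps b G))"
    using subst_fps_eqv[OF G, of N "a oo b"] eqv_trans by blast
qed

lemma formal_exp_eq_subst: "formal_exp G = subst_fps (fps_exp 1) G"
  by (simp add: formal_exp_def subst_fps_def)

lemma formal_ln_eq_subst: "formal_ln G = subst_fps (fps_ln 1) (G - 1)"
  unfolding formal_ln_def subst_fps_def
proof (rule arg_cong[where f = formal_sum], rule ext)
  fix n :: nat
  show "(if n = 0 then 0 else sconst (fls_const ((-1) ^ (n + 1) / real n)) * (G - 1) ^ n)
      = scal (fps_nth (fps_ln 1) n) * (G - 1) ^ n"
    by (cases n) (simp_all add: fps_ln_def)
qed

text \<open>\<open>fps_ln 1\<close> is the compositional inverse of \<open>fps_exp 1 - 1\<close>;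
  the subtraction of 1 corresponds to expanding the logarithm around 1.\<close>

lemma formal_ln_exp: "wge 1 G \<Longrightarrow> formal_ln (formal_exp G) = G"
proof -
  assume G: "wge 1 G"
  have e: "formal_exp G - 1 = subst_fps (fps_exp 1 - 1) G"
    using G by (simp add: formal_exp_eq_subst subst_fps_diff subst_fps_one)
  have "fps_ln 1 oo (fps_exp 1 - 1) = (fps_X :: real fps)"
    using fps_inv[of "fps_exp 1 - 1 :: real fps"] by (simp add: fps_ln_fps_exp_inv)
  thus ?thesis
    unfolding formal_ln_eq_subst e
    using subst_fps_compose[OF G, of "fps_exp 1 - 1" "fps_ln 1"] subst_fps_X[OF G] by simp
qed

lemma formal_exp_ln: "wge 1 (Z - 1) \<Longrightarrow> formal_exp (formal_ln Z) = Z"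
proof -
  assume Z: "wge 1 (Z - 1)"
  have "(fps_exp 1 - 1) oo fps_ln 1 = (fps_X :: real fps)"
    using fps_inv_right[of "fps_exp 1 - 1 :: real fps"] by (simp add: fps_ln_fps_exp_inv)
  hence e: "(fps_exp 1 oo fps_ln 1) - 1 = (fps_X :: real fps)"
    by (simp add: fps_compose_sub_distrib)
  have "formal_exp (formal_ln Z) = subst_fps (fps_exp 1 oo fps_ln 1) (Z - 1)"
    unfolding formal_exp_eq_subst formal_ln_eq_subst
    by (rule subst_fps_compose[symmetric, OF Z]) (simp add: fps_ln_def)
  also have "\<dots> - 1 = Z - 1"
    using subst_fps_diff[OF Z, of "fps_exp 1 oo fps_ln 1" 1] Z
    unfolding e by (simp add: subst_fps_one subst_fps_X)
  finally show ?thesis by simp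
qed

lemma wge_formal_ln: "wge 1 (Z - 1) \<Longrightarrow> wge 1 (formal_ln Z)"
  unfolding formal_ln_eq_subst by (rule wge_subst_fps_1) (simp_all add: fps_ln_def)

text \<open>Superseries do not commute in general, so the binomial formula is needed from the single
  relation \<open>A * B = B * A\<close>.\<close>

lemma commuting_binomial:
  fixes A B :: "'a::ring_1"
  assumes AB: "A * B = B * A"
  shows "(A + B) ^ n = (\<Sum>i\<le>n. of_nat (n choose i) * (A ^ i * B ^ (n - i)))"
proof (induction n)
  case (Suc n)
  have B: "B * (A ^ i * x) = A ^ i * (B * x)" for i x
    by (metis AB mult.assoc power_commuting_commutes)
  have c: "x * (of_nat k * y) = of_nat k * (x * y)" for x y :: 'a and k
    by (metis mult.assoc mult_of_nat_commute)
  have "(\<Sum>i\<le>n. of_nat (n choose i) * (A ^ i * B ^ (Suc n - i)))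
      = (\<Sum>i\<le>Suc n. of_nat (n choose i) * (A ^ i * B ^ (Suc n - i)))"
    by (simp add: binomial_eq_0)
  also have "\<dots> = B ^ Suc n + (\<Sum>i\<le>n. of_nat (n choose Suc i) * (A ^ Suc i * B ^ (n - i)))"
    by (subst sum.atMost_Suc_shift) simp
  finally have shift: "(\<Sum>i\<le>n. of_nat (n choose i) * (A ^ i * B ^ (Suc n - i))) =
      B ^ Suc n + (\<Sum>i\<le>n. of_nat (n choose Suc i) * (A ^ Suc i * B ^ (n - i)))" .
  have "(A + B) ^ Suc n = A * (A + B) ^ n + B * (A + B) ^ n"
    by (simp add: distrib_right)
  also have "\<dots> = (\<Sum>i\<le>n. of_nat (n choose i) * (A ^ Suc i * B ^ (n - i)))
      + (\<Sum>i\<le>n. of_nat (n choose i) * (A ^ i * B ^ (Suc n - i)))"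
    unfolding Suc sum_distrib_left
    by (intro arg_cong2[where f = "(+)"] sum.cong refl)
       (simp_all add: c B mult.assoc Suc_diff_le)
  also have "\<dots> = B ^ Suc n + (\<Sum>i\<le>n. of_nat (Suc n choose Suc i) * (A ^ Suc i * B ^ (n - i)))"
    unfolding shift by (simp add: distrib_right sum.distrib add_ac del: power_Suc)
  also have "\<dots> = (\<Sum>i\<le>Suc n. of_nat (Suc n choose i) * (A ^ i * B ^ (Suc n - i)))"
    by (subst sum.atMost_Suc_shift) (simp del: power_Suc binomial_Suc_Suc)
  finally show ?case .
qed simp

lemma formal_exp_add:
  assumes A: "wge 1 A" and B: "wge 1 B" and AB: "A * B = B * A"
  shows "formal_exp (A + B) = formal_exp A * formal_exp B"
proof (rule eqv_eq)
  fix N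
  let ?S = "\<lambda>G. \<Sum>n<N. scal (1 / fact n) * G ^ n"
  have eqv: "eqv N (formal_exp G) (?S G)" if "wge 1 G" for G
    using subst_fps_eqv[OF that, of N "fps_exp 1"] by (simp add: formal_exp_eq_subst)
  have pr: "(scal x * A ^ i) * (scal y * B ^ j) = scal (x * y) * (A ^ i * B ^ j)" for x y i j
    by (metis (no_types, lifting) mult.assoc scal_mult_assoc sconst_left_commute)
  have "?S A * ?S B = (\<Sum>i<N. \<Sum>j<N. scal (1 / fact i * (1 / fact j)) * (A ^ i * B ^ j))"
    by (simp only: sum_product pr)
  also have "eqv N \<dots> (\<Sum>i<N. \<Sum>j<N. if i + j < N then scal (1 / fact i * (1 / fact j)) * (A ^ i * B ^ j) else 0)"
  proof (intro eqv_sum)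
    fix i j
    have "wge (i + j) (A ^ i * B ^ j)" using A B by (intro wge_mult wge_power)
    thus "eqv N (scal (1 / fact i * (1 / fact j)) * (A ^ i * B ^ j))
        (if i + j < N then scal (1 / fact i * (1 / fact j)) * (A ^ i * B ^ j) else 0)"
      using wge_mono wge_scal_mult by (auto simp: eqv_def)
  qed
  also have "\<dots> = (\<Sum>n<N. \<Sum>i\<le>n. scal (1 / fact i * (1 / fact (n - i))) * (A ^ i * B ^ (n - i)))"
    by (rule fps_truncated_product)
  also have "\<dots> = ?S (A + B)"
  proof (rule sum.cong[OF refl])
    fix n
    have "scal (1 / fact n) * (of_nat (n choose i) * x) = scal (1 / fact i * (1 / fact (n - i))) * x"
      if "i \<le> n" for i x
      by (simp add: of_nat_eq_sconst fls_of_nat scal_mult_assoc binomial_fact[OF that])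
    thus "(\<Sum>i\<le>n. scal (1 / fact i * (1 / fact (n - i))) * (A ^ i * B ^ (n - i))) =
        scal (1 / fact n) * (A + B) ^ n"
      unfolding commuting_binomial[OF AB] sum_distrib_left by (intro sum.cong) auto
  qed
  finally have "eqv N (?S A * ?S B) (?S (A + B))" .
  moreover have "eqv N (formal_exp A * formal_exp B) (?S A * ?S B)"
  proof (rule eqv_mult[OF eqv[OF A] eqv[OF B]])
    show "wge 0 (formal_exp A)" unfolding formal_exp_eq_subst by (rule wge_subst_fps[OF A])
    show "wge 0 (?S B)"
      using subst_fps_terms[OF B] wge_mono by (intro wge_sum) blast
  qed
  ultimately show "eqv N (formal_exp (A + B)) (formal_exp A * formal_exp B)"
    using eqv[OF wge_add[OF A B]] eqv_trans eqv_sym by blast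
qed

subsection \<open>Gaussian moments\<close>

definition msets :: "'a set \<Rightarrow> nat \<Rightarrow> 'a multiset set" where
  "msets V n = {M. size M = n \<and> set_mset M \<subseteq> V}"

lemma msets_0 [simp]: "msets V 0 = {{#}}" by (auto simp: msets_def)

lemma finite_msets: "finite V \<Longrightarrow> finite (msets V n)"
proof (induction n)
  case (Suc n)
  have "msets V (Suc n) \<subseteq> (\<lambda>(v, M). add_mset v M) ` (V \<times> msets V n)"
  proof
    fix M assume "M \<in> msets V (Suc n)"
    then obtain v N where "M = add_mset v N" "size M = Suc n" "set_mset M \<subseteq> V"
      unfolding msets_def by (metis (mono_tags, lifting) mem_Collect_eq size_eq_Suc_imp_eq_union)
    thus "M \<in> (\<lambda>(v, M). add_mset v M) ` (V \<times> msets V n)"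
      by (intro image_eqI[of _ _ "(v, N)"]) (auto simp: msets_def)
  qed
  thus ?case using Suc by (meson finite_SigmaI finite_imageI finite_subset)
qed simp

definition smono :: "var list \<Rightarrow> real superseries" where
  "smono xs = prod_list (map svar xs)"

lemma smono_Nil [simp]: "smono [] = 1"
  and smono_Cons [simp]: "smono (x # xs) = svar x * smono xs"
  by (simp_all add: smono_def)

lemma inv1_eq_0: "(\<And>w. w \<in># n \<Longrightarrow> v \<le> w) \<Longrightarrow> inv1 v n = 0"
  unfolding inv1_def by (induction n) (fastforce simp: not_less)+

text \<open>In an increasing product each new left factor is minimal and passes nothing, so no sign
  arises: the sorted product is the monomial that a multiset stands for.\<close>

lemma scoeff_smono_sorted:
  "sorted xs \<Longrightarrow> scoeff (smono xs) m = (if m = mset xs \<and> admissible m then 1 else 0)"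
proof (induction xs arbitrary: m)
  case Nil
  thus ?case by (auto simp: scoeff_one)
next
  case (Cons x xs)
  show ?case
  proof (cases "admissible m \<and> x \<in># m")
    case True
    then obtain n where m: "m = add_mset x n" by (metis insert_DiffM)
    have n: "admissible n" using True m by (simp add: admissible_add_mset)
    have "scoeff (smono (x # xs)) m = (-1) ^ inv1 x n * (if n = mset xs then 1 else 0)"
      using True Cons n by (simp add: scoeff_svar_mult m)
    also have "\<dots> = (if n = mset xs then 1 else 0)"
      using Cons.prems inv1_eq_0[of "mset xs" x] by simp
    finally show ?thesis using True m by simp
  next
    case False
    thus ?thesis by (auto simp: scoeff_svar_mult)
  qed
qed

text \<open>The sum over the deleted positions, with the sign of the odd factors passed, is the
  shape of one step of \<open>wick\<close>.\<close>

lemma sderiv_smono: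
  "sderiv u (smono ys) = (\<Sum>j<length ys. sconst (if ys ! j = u then
       if odd_var u then (-1) ^ length (filter odd_var (take j ys)) else 1 else 0)
     * smono (take j ys @ drop (Suc j) ys))"
proof (induction ys)
  case (Cons y ys)
  have "svar y * (sconst c * f) = sconst c * (svar y * f)" for c :: real and f
    by (rule sconst_left_commute)
  hence "sconst (sg u y) * (svar y * sderiv u (smono ys)) = (\<Sum>j<length ys. sconst (if ys ! j = u then
       if odd_var u then (-1) ^ length (filter odd_var (take (Suc j) (y # ys))) else 1 else 0)
     * smono (take (Suc j) (y # ys) @ drop (Suc (Suc j)) (y # ys)))"
    unfolding Cons.IH sum_distrib_left
    by (intro sum.cong refl) (auto simp: sg_def sconst_mult_assoc sconst_uminus)
  thus ?case
    by (simp add: sderiv_svar_mult sum.lessThan_Suc_shift sconst_1 del: sum.lessThan_Suc)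
qed simp

lemma wick_odd_length: "odd (length xs) \<Longrightarrow> wick p xs = 0"
proof (induction p xs rule: wick.induct)
  case (2 p x xs)
  have "wick p (take j xs @ drop (Suc j) xs) = 0" if "j < length xs" for j
  proof (rule "2.IH")
    have "length (take j xs @ drop (Suc j) xs) = length xs - 1" using that by auto
    thus "odd (length (take j xs @ drop (Suc j) xs))" using 2(2) that by (cases "length xs") auto
  qed (use that in auto)
  thus ?case by (auto intro!: sum.neutral)
qed simp

text \<open>The properties of a propagator that make the second order operator below even and
  symmetric in its two derivatives.\<close>

locale wick_form =
  fixes p :: "var \<Rightarrow> var \<Rightarrow> real" and V :: "var set"
  assumes fin_V: "finite V"
    and p_supp: "p v w \<noteq> 0 \<Longrightarrow> v \<in> V \<and> w \<in> V"
    and p_sym: "p w v = sg v w * p v w"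
    and p_par: "p v w \<noteq> 0 \<Longrightarrow> odd_var v = odd_var w"
begin

text \<open>The operator whose exponential performs Gaussian averaging. The factor 1/2 compensates
  that each pair is met in both orders, and the sign is the one of \<open>- p\<close> in
  \<open>wick\<close>.\<close>

definition lap :: "real superseries \<Rightarrow> real superseries" where
  "lap f = sconst (-1/2) * (\<Sum>u\<in>V. \<Sum>w\<in>V. sconst (p w u) * sderiv u (sderiv w f))"

text \<open>The commutator of \<open>lap\<close> with multiplication by the variable
  \<open>x\<close>, as \<open>lap_svar_mult\<close> shows.\<close>

definition contract :: "var \<Rightarrow> real superseries \<Rightarrow> real superseries" where
  "contract x f = - (\<Sum>u\<in>V. sconst (p x u) * sderiv u f)"

text \<open>The Gaussian average of the part of degree \<open>2 k\<close> is the constant term of \<open>exp lap\<close>.\<close>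
definition J :: "nat \<Rightarrow> real superseries \<Rightarrow> real" where
  "J k f = scoeff ((lap ^^ k) f) {#} / fact k"

lemma lap_add: "lap (f + g) = lap f + lap g"
  by (simp add: lap_def distrib_left sum.distrib)
lemma lap_sconst: "lap (sconst c * f) = sconst c * lap f"
  unfolding lap_def by (simp add: sconst_left_commute[of _ c] sum_distrib_left[of "sconst c", symmetric])
lemma lap_0 [simp]: "lap 0 = 0" by (simp add: lap_def)
lemma lap_sum: "lap (sum F A) = (\<Sum>a\<in>A. lap (F a))"
  by (induction A rule: infinite_finite_induct) (auto simp: lap_add)

lemma lap_pow_add: "(lap ^^ k) (f + g) = (lap ^^ k) f + (lap ^^ k) g"
  by (induction k) (auto simp: lap_add)
lemma lap_pow_sconst: "(lap ^^ k) (sconst c * f) = sconst c * (lap ^^ k) f"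
  by (induction k) (auto simp: lap_sconst)

lemma J_add: "J k (f + g) = J k f + J k g" by (simp add: J_def lap_pow_add add_divide_distrib)
lemma J_sconst: "J k (sconst c * f) = c * J k f" by (simp add: J_def lap_pow_sconst)
lemma J_0 [simp]: "J k 0 = 0" using J_sconst[of k 0 0] by simp
lemma J_sum: "J k (sum F A) = (\<Sum>a\<in>A. J k (F a))"
  by (induction A rule: infinite_finite_induct) (auto simp: J_add)
lemma J_uminus: "J k (- f) = - J k f"
  using J_sconst[of k "-1" f] by (simp add: sconst_uminus sconst_1)
lemma J_diff: "J k (f - g) = J k f - J k g"
  using J_add[of k f "- g"] by (simp add: J_uminus)

text \<open>Either derivative may hit \<open>x\<close>. By the supersymmetry of \<open>p\<close> the
  two resulting sums agree and cancel the 1/2; when neither does, both pass \<open>x\<close>, and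
  their signs cancel because \<open>p\<close> preserves parity.\<close>

lemma lap_svar_mult: "lap (svar x * f) = svar x * lap f + contract x f"
proof -
  have d: "sderiv u (sderiv w (svar x * f)) = (if x = w then sderiv u f else 0) +
      sconst (sg w x) * (if x = u then sderiv w f else 0) +
      sconst (sg w x * sg u x) * (svar x * sderiv u (sderiv w f))" for u w
    by (simp add: sderiv_svar_mult distrib_left sconst_mult_assoc add.assoc)
  have p3: "p w u * (sg w x * sg u x) = p w u" for w u
    using p_par[of w u] by (cases "p w u = 0") (auto simp: sg_def)
  have t1: "(\<Sum>u\<in>V. \<Sum>w\<in>V. sconst (p w u) * (if x = w then sderiv u f else 0)) =
      (\<Sum>u\<in>V. sconst (p x u) * sderiv u f)"
  proof (rule sum.cong[OF refl])
    fix u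
    have "(\<Sum>w\<in>V. sconst (p w u) * (if x = w then sderiv u f else 0)) =
        (\<Sum>w\<in>V. if w = x then sconst (p x u) * sderiv u f else 0)"
      by (intro sum.cong) auto
    thus "(\<Sum>w\<in>V. sconst (p w u) * (if x = w then sderiv u f else 0)) = sconst (p x u) * sderiv u f"
      using p_supp[of x u] fin_V by (cases "x \<in> V"; cases "p x u = 0") auto
  qed
  have t2: "(\<Sum>u\<in>V. \<Sum>w\<in>V. sconst (p w u) * (sconst (sg w x) * (if x = u then sderiv w f else 0))) =
      (\<Sum>w\<in>V. sconst (p x w) * sderiv w f)"
  proof (subst sum.swap, rule sum.cong[OF refl])
    fix w
    have "(\<Sum>u\<in>V. sconst (p w u) * (sconst (sg w x) * (if x = u then sderiv w f else 0))) =
        (\<Sum>u\<in>V. if u = x then sconst (p w x * sg w x) * sderiv w f else 0)"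
      by (intro sum.cong) (auto simp: sconst_mult_assoc)
    also have "\<dots> = sconst (p w x * sg w x) * sderiv w f"
      using p_supp[of w x] fin_V by (cases "x \<in> V"; cases "p w x = 0") auto
    also have "p w x * sg w x = p x w" using p_sym[of w x] by (simp add: sg_commute mult.commute)
    finally show "(\<Sum>u\<in>V. sconst (p w u) * (sconst (sg w x) * (if x = u then sderiv w f else 0))) =
      sconst (p x w) * sderiv w f" .
  qed
  have t3: "(\<Sum>u\<in>V. \<Sum>w\<in>V. sconst (p w u) * (sconst (sg w x * sg u x) * (svar x * sderiv u (sderiv w f)))) =
      svar x * (\<Sum>u\<in>V. \<Sum>w\<in>V. sconst (p w u) * sderiv u (sderiv w f))"
    unfolding sum_distrib_left
    by (intro sum.cong refl) (simp only: sconst_mult_assoc p3 sconst_left_commute[of "svar x"])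
  have "lap (svar x * f) = sconst (-1/2) * ((\<Sum>u\<in>V. sconst (p x u) * sderiv u f)
      + (\<Sum>w\<in>V. sconst (p x w) * sderiv w f)
      + svar x * (\<Sum>u\<in>V. \<Sum>w\<in>V. sconst (p w u) * sderiv u (sderiv w f)))"
    unfolding lap_def d distrib_left sum.distrib t1 t2 t3 ..
  also have "\<dots> = sconst (-1) * (\<Sum>u\<in>V. sconst (p x u) * sderiv u f) + svar x * lap f"
  proof -
    have "sconst (-1/2) * (y + y + z) = sconst (-1) * y + sconst (-1/2) * z" for y z :: "real superseries"
      by (rule superseries_eqI) (simp add: add_divide_distrib)
    thus ?thesis unfolding lap_def by (simp only: sconst_left_commute[of "svar x"])
  qed
  finally show ?thesis by (simp add: contract_def sconst_uminus sconst_1)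
qed

lemma sderiv_lap: "sderiv v (lap f) = lap (sderiv v f)"
proof -
  have "sderiv v (sderiv u (sderiv w f)) = sconst (sg v u * sg v w) * sderiv u (sderiv w (sderiv v f))" for u w
    by (simp add: sderiv_commute[of v u] sderiv_commute[of v w] sconst_mult_assoc)
  moreover have "p w u * (sg v u * sg v w) = p w u" for u w
    using p_par[of w u] by (cases "p w u = 0") (auto simp: sg_def)
  ultimately show ?thesis unfolding lap_def by (simp only: sderiv_sconst_mult sderiv_sum sconst_mult_assoc)
qed

lemma contract_lap: "contract x (lap f) = lap (contract x f)"
proof -
  have "lap (- g) = - lap g" for g
    using lap_sconst[of "-1" g] by (simp add: sconst_uminus sconst_1)
  thus ?thesis by (simp add: contract_def sderiv_lap lap_sum lap_sconst)
qed

lemma contract_lap_pow: "contract x ((lap ^^ k) f) = (lap ^^ k) (contract x f)"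
  by (induction k) (auto simp: contract_lap)

text \<open>The commutator of \<open>lap\<close> with \<open>x\<close> commutes with
  \<open>lap\<close>, so each of the \<open>k + 1\<close> factors contributes the same term.\<close>

lemma lap_pow_svar_mult:
  "(lap ^^ Suc k) (svar x * f) = svar x * (lap ^^ Suc k) f + of_nat (Suc k) * (lap ^^ k) (contract x f)"
proof (induction k)
  case (Suc k)
  have n: "lap (of_nat n * g) = of_nat n * lap g" for n g by (simp add: of_nat_eq_sconst lap_sconst)
  have "(lap ^^ Suc (Suc k)) (svar x * f) =
      lap (svar x * (lap ^^ Suc k) f) + lap (of_nat (Suc k) * (lap ^^ k) (contract x f))"
    by (simp only: funpow.simps(2)[of "Suc k"] o_apply Suc lap_add)
  also have "\<dots> = svar x * (lap ^^ Suc (Suc k)) f +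
      ((lap ^^ Suc k) (contract x f) + of_nat (Suc k) * (lap ^^ Suc k) (contract x f))"
    unfolding lap_svar_mult contract_lap_pow n by (simp only: funpow.simps o_apply add.assoc)
  finally show ?case by (simp add: distrib_right algebra_simps del: funpow.simps)
qed (simp add: lap_svar_mult)

text \<open>A multiple of a variable has no constant term, so only the commutator survives, and its
  factor \<open>k + 1\<close> turns one factorial into the other. This is integration by parts, the
  recursion defining \<open>wick\<close>.\<close>

lemma J_Suc_svar_mult: "J (Suc k) (svar x * f) = J k (contract x f)"
  unfolding J_def lap_pow_svar_mult
  by (simp add: scoeff_svar_mult of_nat_eq_sconst del: funpow.simps of_nat_Suc)

lemma J_smono: "length xs = 2 * k \<Longrightarrow> J k (smono xs) = wick p xs"
proof (induction k arbitrary: xs)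
  case 0
  thus ?case by (simp add: J_def scoeff_one)
next
  case (Suc k)
  then obtain x ys where xs: "xs = x # ys" "length ys = Suc (2 * k)"
    by (cases xs) auto
  let ?s = "\<lambda>u j. if odd_var u then (-1::real) ^ length (filter odd_var (take j ys)) else 1"
  let ?r = "\<lambda>j. take j ys @ drop (Suc j) ys"
  have "J (Suc k) (smono xs) = J k (contract x (smono ys))"
    by (simp add: xs J_Suc_svar_mult)
  also have "\<dots> = - (\<Sum>u\<in>V. p x u * (\<Sum>j<length ys. (if ys ! j = u then ?s u j else 0) * J k (smono (?r j))))"
    by (simp add: contract_def J_uminus J_sum J_sconst sderiv_smono)
  also have "\<dots> = - (\<Sum>j<length ys. \<Sum>u\<in>V. if u = ys ! j then p x (ys ! j) * ?s (ys ! j) j * J k (smono (?r j)) else 0)"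
    unfolding sum_distrib_left by (subst sum.swap) (intro arg_cong[where f = uminus] sum.cong refl, auto)
  also have "\<dots> = (\<Sum>j<length ys. ?s x j * (- p x (ys ! j)) * wick p (?r j))"
  proof (subst sum_negf[symmetric], rule sum.cong[OF refl])
    fix j assume "j \<in> {..<length ys}"
    hence "J k (smono (?r j)) = wick p (?r j)" by (intro Suc.IH) (use xs in auto)
    moreover have "(\<Sum>u\<in>V. if u = ys ! j then p x (ys ! j) * ?s (ys ! j) j * J k (smono (?r j)) else 0)
        = p x (ys ! j) * ?s (ys ! j) j * J k (smono (?r j))"
      using p_supp[of x "ys ! j"] fin_V by (cases "ys ! j \<in> V"; cases "p x (ys ! j) = 0") auto
    moreover have "p x (ys ! j) * ?s (ys ! j) j = p x (ys ! j) * ?s x j"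
      using p_par[of x "ys ! j"] by (cases "p x (ys ! j) = 0") auto
    ultimately show "- (\<Sum>u\<in>V. if u = ys ! j then p x (ys ! j) * ?s (ys ! j) j * J k (smono (?r j)) else 0)
        = ?s x j * (- p x (ys ! j)) * wick p (?r j)"
      by simp
  qed
  finally show ?case by (simp add: xs)
qed

text \<open>\<open>2 k\<close> derivatives in the directions of \<open>V\<close> read off only
  coefficients at monomials enlarged by \<open>2 k\<close> elements of \<open>V\<close>; hence
  series may be replaced by finite sums.\<close>

lemma lap_pow_coeff_zero:
  "(\<And>M. M \<in> msets V (2 * k) \<Longrightarrow> scoeff f (M + m) = 0) \<Longrightarrow> scoeff ((lap ^^ k) f) m = 0"
proof (induction k arbitrary: f m)
  case 0
  thus ?case by simp
next
  case (Suc k)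
  have "scoeff ((lap ^^ k) (lap f)) m = 0"
  proof (rule Suc.IH)
    fix M assume M: "M \<in> msets V (2 * k)"
    have "scoeff f (add_mset w (add_mset u (M + m))) = 0" if "u \<in> V" "w \<in> V" for u w
      using Suc.prems[of "add_mset w (add_mset u M)"] M that by (auto simp: msets_def)
    thus "scoeff (lap f) (M + m) = 0"
      by (auto simp: lap_def scoeff_sum scoeff_sderiv intro!: sum.neutral)
  qed
  thus ?case by (simp add: funpow_Suc_right del: funpow.simps)
qed

lemma J_eq_sum_wick:
  "J k f = (\<Sum>M\<in>msets V (2 * k). scoeff f M * wick p (sorted_list_of_multiset M))"
proof -
  \<comment> \<open>The finite sum with the same coefficients in degree \<open>2 k\<close>;
    \<open>J k\<close> cannot distinguish it from \<open>f\<close>, and on ordered monomials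
    \<open>J k\<close> is \<open>wick\<close>.\<close>
  define g where "g = (\<Sum>M\<in>msets V (2 * k). sconst (scoeff f M) * smono (sorted_list_of_multiset M))"
  have g: "scoeff g M = scoeff f M" if "M \<in> msets V (2 * k)" for M
  proof -
    have "scoeff g M = (\<Sum>N\<in>msets V (2 * k). if N = M then scoeff f M else 0)"
      unfolding g_def scoeff_sum
      by (intro sum.cong refl) (auto simp: scoeff_smono_sorted scoeff_not_admissible)
    thus ?thesis using that finite_msets[OF fin_V] by simp
  qed
  have "J k (f - g) = 0"
    unfolding J_def by (simp add: lap_pow_coeff_zero g)
  hence "J k f = J k g" by (simp add: J_diff)
  also have "\<dots> = (\<Sum>M\<in>msets V (2 * k). scoeff f M * wick p (sorted_list_of_multiset M))"
  proof -
    have "length (sorted_list_of_multiset M) = 2 * k" if "M \<in> msets V (2 * k)" for M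
      using that by (metis (mono_tags, lifting) mem_Collect_eq msets_def mset_sorted_list_of_multiset size_mset)
    thus ?thesis by (simp add: g_def J_sum J_sconst J_smono)
  qed
  finally show ?thesis .
qed

text \<open>The linear vector field whose flow is the infinitesimal substitution of each variable
  \<open>v\<close> by \<open>v\<close> plus a multiple of the combination with coefficients
  \<open>X v u\<close>.\<close>

definition vfield :: "(var \<Rightarrow> var \<Rightarrow> real) \<Rightarrow> real superseries \<Rightarrow> real superseries" where
  "vfield X f = (\<Sum>v\<in>V. \<Sum>u\<in>V. sconst (X v u) * (svar u * sderiv v f))"

lemma vfield_add: "vfield X (f + g) = vfield X f + vfield X g"
  by (simp add: vfield_def distrib_left sum.distrib)
lemma vfield_sconst: "vfield X (sconst c * f) = sconst c * vfield X f"
  unfolding vfield_def by (simp add: sconst_left_commute[of _ c] sum_distrib_left[of "sconst c", symmetric])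
lemma vfield_0 [simp]: "vfield X 0 = 0" by (simp add: vfield_def)
lemma vfield_1 [simp]: "vfield X 1 = 0" by (simp add: vfield_def)
lemma vfield_sum: "vfield X (sum F A) = (\<Sum>a\<in>A. vfield X (F a))"
  by (induction A rule: infinite_finite_induct) (auto simp: vfield_add)

lemma vfield_svar_mult:
  assumes X: "\<And>v u. X v u \<noteq> 0 \<Longrightarrow> odd_var v = odd_var u" and x: "x \<in> V"
  shows "vfield X (svar x * f) = (\<Sum>u\<in>V. sconst (X x u) * svar u) * f + svar x * vfield X f"
proof -
  have "sconst (X v u) * (svar u * sderiv v (svar x * f)) =
      (if x = v then sconst (X x u) * svar u * f else 0) +
      svar x * (sconst (X v u) * (svar u * sderiv v f))" for u v
  proof -
    have "sconst (X v u) * (svar u * (sconst (sg v x) * (svar x * g))) =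
        sconst (X v u * (sg v x * sg u x)) * (svar x * (svar u * g))" for g
      by (simp add: sconst_left_commute[of "svar u"] sg_mult_svar_commute[of u x] sconst_mult_assoc mult.assoc)
    moreover have "X v u * (sg v x * sg u x) = X v u"
      using X[of v u] by (cases "X v u = 0") (auto simp: sg_def)
    ultimately show ?thesis
      by (simp add: sderiv_svar_mult distrib_left sconst_left_commute[of "svar x"] mult.assoc)
  qed
  hence "vfield X (svar x * f) = (\<Sum>v\<in>V. \<Sum>u\<in>V. (if x = v then sconst (X x u) * svar u * f else 0)) + svar x * vfield X f"
    by (simp add: vfield_def sum.distrib sum_distrib_left)
  also have "(\<Sum>v\<in>V. \<Sum>u\<in>V. (if x = v then sconst (X x u) * svar u * f else 0)) =
      (\<Sum>u\<in>V. \<Sum>v\<in>V. (if x = v then sconst (X x u) * svar u * f else 0))"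
    by (rule sum.swap)
  also have "\<dots> = (\<Sum>u\<in>V. sconst (X x u) * svar u) * f"
    using x fin_V by (simp add: sum_distrib_right)
  finally show ?thesis .
qed

text \<open>The commutator is a second order operator with coefficients \<open>Y\<close>. Invariance
  of \<open>p\<close> makes \<open>Y\<close> superantisymmetric, whereas second derivatives are
  supersymmetric, so it vanishes.\<close>

lemma lap_vfield:
  assumes X: "\<And>v u. X v u \<noteq> 0 \<Longrightarrow> odd_var v = odd_var u"
    and inv: "\<And>v w. v \<in> V \<Longrightarrow> w \<in> V \<Longrightarrow> (\<Sum>u\<in>V. X v u * p u w + X w u * p v u) = 0"
  shows "lap (vfield X f) = vfield X (lap f)"
proof -
  define Y where "Y v w = (\<Sum>u\<in>V. X v u * p u w)" for v w
  have Yas: "sg v w * Y w v = - Y v w" if "v \<in> V" "w \<in> V" for v w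
  proof -
    have "sg v w * Y w v = (\<Sum>u\<in>V. X w u * p v u)"
      unfolding Y_def sum_distrib_left
    proof (rule sum.cong[OF refl])
      fix u
      have "sg v w * (X w u * p u v) = sg v w * sg v u * X w u * p v u"
        using p_sym[of u v] by simp
      also have "\<dots> = X w u * p v u"
        using X[of w u] by (cases "X w u = 0") (auto simp: sg_def)
      finally show "sg v w * (X w u * p u v) = X w u * p v u" .
    qed
    thus ?thesis using inv[OF that] by (simp add: Y_def sum.distrib)
  qed
  define E where "E = (\<Sum>v\<in>V. \<Sum>w\<in>V. sconst (Y v w) * sderiv w (sderiv v f))"
  have "E = (\<Sum>v\<in>V. \<Sum>w\<in>V. sconst (- Y w v) * sderiv v (sderiv w f))"
    unfolding E_def
  proof (intro sum.cong refl)
    fix v w assume "v \<in> V" "w \<in> V"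
    hence "Y v w * sg w v = - Y w v" using Yas[of w v] by (simp add: mult.commute)
    thus "sconst (Y v w) * sderiv w (sderiv v f) = sconst (- Y w v) * sderiv v (sderiv w f)"
      by (subst sderiv_commute) (simp add: sconst_mult_assoc)
  qed
  also have "\<dots> = - E"
    unfolding E_def by (subst sum.swap) (simp add: sconst_uminus sum_negf)
  finally have E: "E = 0"
    by (metis add.inverse_inverse add_eq_0_iff mult_2 mult_eq_0_iff superseries_eqI scoeff_uminus scoeff_zero equal_neg_zero)
  have "lap (vfield X f) = (\<Sum>v\<in>V. \<Sum>u\<in>V. sconst (X v u) * (svar u * sderiv v (lap f)))
      + (\<Sum>v\<in>V. \<Sum>u\<in>V. sconst (X v u) * contract u (sderiv v f))"
    by (simp add: vfield_def lap_sum lap_sconst lap_svar_mult sderiv_lap distrib_left sum.distrib)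
  also have "(\<Sum>v\<in>V. \<Sum>u\<in>V. sconst (X v u) * contract u (sderiv v f)) = - E"
  proof -
    have "(\<Sum>u\<in>V. sconst (X v u) * contract u (sderiv v f)) =
        - (\<Sum>w\<in>V. sconst (Y v w) * sderiv w (sderiv v f))" for v
      unfolding contract_def Y_def
      by (simp add: sum_negf sum_distrib_left sconst_mult_assoc sconst_sum sum_distrib_right) (rule sum.swap)
    thus ?thesis by (simp add: E_def sum_negf)
  qed
  finally show ?thesis by (simp add: E vfield_def)
qed

text \<open>A linear vector field commuting with \<open>lap\<close> can be moved to the outside,
  where it leaves no constant term: the Gaussian integral is invariant under infinitesimal
  symmetries of \<open>p\<close>.\<close>

lemma J_vfield:
  assumes X: "\<And>v u. X v u \<noteq> 0 \<Longrightarrow> odd_var v = odd_var u"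
    and inv: "\<And>v w. v \<in> V \<Longrightarrow> w \<in> V \<Longrightarrow> (\<Sum>u\<in>V. X v u * p u w + X w u * p v u) = 0"
  shows "J k (vfield X f) = 0"
proof -
  have "(lap ^^ k) (vfield X f) = vfield X ((lap ^^ k) f)"
    by (induction k) (auto simp: lap_vfield[OF X inv])
  moreover have "scoeff (vfield X g) {#} = 0" for g
    by (simp add: vfield_def scoeff_sum scoeff_svar_mult)
  ultimately show ?thesis by (simp add: J_def)
qed

end

subsection \<open>Residual and fluctuation variables\<close>

fun is_resid :: "var \<Rightarrow> bool" where
  "is_resid (Resid k i a) = True"
| "is_resid (Fluct k i a) = False"

lemma is_resid_iff: "is_resid v \<longleftrightarrow> (\<exists>k i a. v = Resid k i a)"
  and is_fluct_iff: "\<not> is_resid v \<longleftrightarrow> (\<exists>k i a. v = Fluct k i a)"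
  by (cases v; simp)+

definition resid :: "var multiset \<Rightarrow> bool" where "resid m \<longleftrightarrow> (\<forall>v\<in>#m. is_resid v)"
definition fluct :: "var multiset \<Rightarrow> bool" where "fluct m \<longleftrightarrow> (\<forall>v\<in>#m. \<not> is_resid v)"

lemma resid_iff: "(\<forall>v\<in>#m. \<exists>k i a. v = Resid k i a) \<longleftrightarrow> resid m"
  and fluct_iff: "(\<forall>v\<in>#m. \<exists>k i a. v = Fluct k i a) \<longleftrightarrow> fluct m"
  by (simp_all only: resid_def fluct_def is_resid_iff[symmetric] is_fluct_iff[symmetric])

lemma resid_empty [simp]: "resid {#}" and fluct_empty [simp]: "fluct {#}"
  by (simp_all add: resid_def fluct_def)

lemma resid_plus [simp]: "resid (a + b) \<longleftrightarrow> resid a \<and> resid b"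
  and fluct_plus [simp]: "fluct (a + b) \<longleftrightarrow> fluct a \<and> fluct b"
  by (auto simp: resid_def fluct_def)

lemma resid_mono: "resid m \<Longrightarrow> a \<subseteq># m \<Longrightarrow> resid a"
  and fluct_mono: "fluct m \<Longrightarrow> a \<subseteq># m \<Longrightarrow> fluct a"
  by (auto simp: resid_def fluct_def dest: mset_subset_eqD)

lemma resid_less_fluct: "is_resid v \<Longrightarrow> \<not> is_resid w \<Longrightarrow> v < w"
  by (cases v; cases w) (auto simp: less_var_def)

lemma inv1_resid_fluct: "is_resid v \<Longrightarrow> fluct M \<Longrightarrow> inv1 v M = 0"
  by (rule inv1_eq_0) (auto simp: fluct_def intro: less_imp_le resid_less_fluct)

lemma inversions_resid_fluct: "resid a \<Longrightarrow> fluct M \<Longrightarrow> inversions a M = 0"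
  by (induction a) (auto simp: resid_def inv1_resid_fluct)

lemma admissible_resid_fluct: "resid m \<Longrightarrow> fluct M \<Longrightarrow> admissible (m + M) \<longleftrightarrow> admissible m \<and> admissible M"
proof
  assume m: "resid m" "fluct M" and adm: "admissible m \<and> admissible M"
  show "admissible (m + M)" unfolding admissible_def
  proof (intro allI impI)
    fix v assume "odd_var v"
    moreover have "count m v = 0 \<or> count M v = 0"
      using m by (metis resid_def fluct_def count_eq_zero_iff)
    ultimately show "count (m + M) v \<le> 1" using adm by (auto simp: admissible_def)
  qed
qed (meson admissible_mono mset_subset_eq_add_left mset_subset_eq_add_right)

lemma sum_submultisets_disjoint:
  assumes "set_mset m \<inter> set_mset M = {}"
  shows "(\<Sum>a | a \<subseteq># m + M. h a) = (\<Sum>x | x \<subseteq># m. \<Sum>b | b \<subseteq># M. h (x + b))"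
    (is "?l = ?r")
proof -
  have "?r = (\<Sum>(x, b)\<in>{x. x \<subseteq># m} \<times> {b. b \<subseteq># M}. h (x + b))"
    by (simp add: sum.cartesian_product)
  also have "\<dots> = ?l"
  \<comment> \<open>As the two multisets share no variable, a submultiset is recovered from its
    intersections with each of them.\<close>
  proof (rule sum.reindex_bij_witness[where j = "\<lambda>(x, b). x + b" and i = "\<lambda>a. (a \<inter># m, a \<inter># M)"])
    fix a assume "a \<in> {a. a \<subseteq># m + M}"
    hence a: "\<And>v. count a v \<le> count m v + count M v"
      by (simp add: subseteq_mset_def)
    have d: "count m v = 0 \<or> count M v = 0" for v using assms by (metis count_eq_zero_iff disjoint_iff)
    have "a \<inter># m + a \<inter># M = a"
    proof (rule multiset_eqI)
      fix v show "count (a \<inter># m + a \<inter># M) v = count a v" using a[of v] d[of v] by auto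
    qed
    thus "(case (a \<inter># m, a \<inter># M) of (x, b) \<Rightarrow> x + b) = a" by simp
    show "(a \<inter># m, a \<inter># M) \<in> {x. x \<subseteq># m} \<times> {b. b \<subseteq># M}" by simp
  next
    fix xb assume xb: "xb \<in> {x. x \<subseteq># m} \<times> {b. b \<subseteq># M}"
    obtain x b where [simp]: "xb = (x, b)" by force
    have x: "\<And>v. count x v \<le> count m v" and b: "\<And>v. count b v \<le> count M v"
      using xb by (simp_all add: subseteq_mset_def)
    have d: "count m v = 0 \<or> count M v = 0" for v using assms by (metis count_eq_zero_iff disjoint_iff)
    have "(x + b) \<inter># m = x"
    proof (rule multiset_eqI)
      fix v show "count ((x + b) \<inter># m) v = count x v" using x[of v] b[of v] d[of v] by auto
    qed
    moreover have "(x + b) \<inter># M = b"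
    proof (rule multiset_eqI)
      fix v show "count ((x + b) \<inter># M) v = count b v" using x[of v] b[of v] d[of v] by auto
    qed
    ultimately show "((case xb of (x, b) \<Rightarrow> x + b) \<inter># m, (case xb of (x, b) \<Rightarrow> x + b) \<inter># M) = xb"
      by simp
    show "(case xb of (x, b) \<Rightarrow> x + b) \<in> {a. a \<subseteq># m + M}" using xb by (simp add: subset_mset.add_mono)
  qed auto
  finally show ?thesis by simp
qed

lemma resid_fluct_disjoint: "resid m \<Longrightarrow> fluct M \<Longrightarrow> set_mset m \<inter> set_mset M = {}"
  by (auto simp: resid_def fluct_def)

lemma mset_add_diff_split: "x \<subseteq># m \<Longrightarrow> b \<subseteq># M \<Longrightarrow> m + M - (x + b) = (m - x) + (M - b)"
  by (rule multiset_eqI) (force simp: subseteq_mset_def)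

lemma sum_msets_split:
  "(\<Sum>m\<in>msets V n. \<Sum>x | x \<subseteq># m. h x (m - x)) =
   (\<Sum>i\<le>n. \<Sum>x\<in>msets V i. \<Sum>y\<in>msets V (n - i). h x y)" if "finite V"
proof -
  have "(\<Sum>m\<in>msets V n. \<Sum>x | x \<subseteq># m. h x (m - x)) =
      (\<Sum>(m, x)\<in>(SIGMA m:msets V n. {x. x \<subseteq># m}). h x (m - x))"
    by (rule sum.Sigma) (simp_all add: finite_msets that finite_submultisets)
  also have "\<dots> = (\<Sum>(i, x, y)\<in>(SIGMA i:{..n}. msets V i \<times> msets V (n - i)). h x y)"
    by (rule sum.reindex_bij_witness[where j = "\<lambda>(m, x). (size x, x, m - x)" and i = "\<lambda>(i, x, y). (x + y, x)"])
       (auto simp: msets_def size_mset_mono size_Diff_submset dest: mset_subset_eqD in_diffD)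
  also have "\<dots> = (\<Sum>i\<le>n. \<Sum>(x, y)\<in>msets V i \<times> msets V (n - i). h x y)"
    by (rule sum.Sigma[symmetric]) (simp_all add: finite_msets that)
  finally show ?thesis by (simp add: sum.cartesian_product)
qed

text \<open>A factor without fluctuations takes its variables from \<open>m\<close> alone, and since
  the \<alpha>'s precede the fluctuations in the order, \<open>M\<close> contributes no
  sign.\<close>

lemma scoeff_resid_mult:
  assumes f: "supp_in resid f" and m: "resid m" and M: "fluct M"
  shows "scoeff (f * g) (m + M) = (if admissible m
     then \<Sum>a | a \<subseteq># m. (-1) ^ inversions a (m - a) * scoeff f a * scoeff g (m - a + M) else 0)"
proof (cases "admissible (m + M)")
  case True
  hence adm: "admissible m" using admissible_resid_fluct m M by blast
  have "(\<Sum>b | b \<subseteq># M. (-1) ^ inversions (x + b) (m + M - (x + b)) * scoeff f (x + b) * scoeff g (m + M - (x + b)))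
      = (-1) ^ inversions x (m - x) * scoeff f x * scoeff g (m - x + M)" if x: "x \<subseteq># m" for x
  proof -
    have "(\<Sum>b | b \<subseteq># M. (-1) ^ inversions (x + b) (m + M - (x + b)) * scoeff f (x + b) * scoeff g (m + M - (x + b)))
      = (\<Sum>b\<in>{{#}}. (-1) ^ inversions (x + b) (m + M - (x + b)) * scoeff f (x + b) * scoeff g (m + M - (x + b)))"
    proof (rule sum.mono_neutral_right)
      have "scoeff f (x + b) = 0" if "b \<subseteq># M" "b \<noteq> {#}" for b
      proof (rule supp_inD[OF f])
        from that M have "fluct b" by (metis fluct_mono)
        thus "\<not> resid (x + b)" using that(2)
          by (auto simp: resid_def fluct_def) (metis UnI2 multiset_nonemptyE)
      qed
      thus "\<forall>i\<in>{b. b \<subseteq># M} - {{#}}. (- 1) ^ inversions (x + i) (m + M - (x + i)) * scoeff f (x + i) *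
         scoeff g (m + M - (x + i)) = 0" by auto
    qed (auto simp: finite_submultisets)
    also have "m + M - x = m - x + M" using mset_add_diff_split[OF x, of "{#}" M] by simp
    moreover have "inversions x (m - x + M) = inversions x (m - x)"
      by (metis M inversions_plus_right inversions_resid_fluct m resid_mono x add.right_neutral)
    ultimately show ?thesis by simp
  qed
  thus ?thesis
    using True adm by (simp add: scoeff_mult sum_submultisets_disjoint[OF resid_fluct_disjoint[OF m M]])
next
  case False
  hence "\<not> (admissible m \<and> admissible M)" using admissible_resid_fluct m M by blast
  moreover have "\<not> admissible M \<Longrightarrow> scoeff g (x + M) = 0" for x
    by (meson admissible_mono mset_subset_eq_add_right scoeff_not_admissible)
  ultimately have s: "(\<Sum>a | a \<subseteq># m. (-1) ^ inversions a (m - a) * scoeff f a * scoeff g (m - a + M)) = 0"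
    if "admissible m" using that by (simp only: simp_thms mult_zero_right sum.neutral_const)
  have z: "scoeff (f * g) (m + M) = 0" by (rule scoeff_not_admissible[OF False])
  show ?thesis
  proof (cases "admissible m")
    case True
    thus ?thesis using s[OF True] z by (simp only: if_True)
  qed (simp only: z if_False)
qed

subsection \<open>Exponentials and Gaussian averages of homogeneous actions\<close>

abbreviation lift_const :: "real superseries \<Rightarrow> real fls superseries" where
  "lift_const \<equiv> map_scoeff fls_const"

lemma scoeff_lift_const [simp]: "scoeff (lift_const f) m = fls_const (scoeff f m)"
  by (simp add: scoeff_map_scoeff)

lemma fls_const_sum: "fls_const (sum f A) = (\<Sum>a\<in>A. fls_const (f a))" for f :: "_ \<Rightarrow> real"
  by (induction A rule: infinite_finite_induct) (auto simp flip: fls_plus_const)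

lemma lift_const_mult: "lift_const (f * g) = lift_const f * lift_const g"
  by (rule superseries_eqI)
     (auto simp: scoeff_mult fls_const_sum neg_one_power_fls intro!: sum.cong simp flip: fls_const_mult_const)

lemma lift_const_1: "lift_const 1 = 1"
  by (rule superseries_eqI) (simp add: scoeff_one)

definition over_hbar :: "real superseries \<Rightarrow> real fls superseries" where
  "over_hbar f = sconst fls_X_inv * lift_const f"

lemma over_hbar_power: "over_hbar f ^ n = sconst (fls_X_inv ^ n) * lift_const (f ^ n)"
proof (induction n)
  case (Suc n)
  have "over_hbar f ^ Suc n = sconst fls_X_inv * (lift_const f * (sconst (fls_X_inv ^ n) * lift_const (f ^ n)))"
    unfolding power_Suc Suc by (simp only: over_hbar_def mult.assoc)
  thus ?case
    by (simp only: sconst_left_commute[of "lift_const f"] lift_const_mult power_Suc sconst_mult mult.assoc)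
qed (simp add: lift_const_1 sconst_1)

lemma fls_nth_X_inv_power_mult_const:
  "fls_nth (fls_X_inv ^ n * fls_const x) k = (if k = - int n then x else 0)" for x :: real
  by simp

abbreviation cubic :: "real superseries \<Rightarrow> bool" where
  "cubic f \<equiv> supp_in (\<lambda>m. size m = 3) f"

lemma cubic_power: "cubic f \<Longrightarrow> supp_in (\<lambda>m. size m = 3 * n) (f ^ n)"
  by (rule supp_in_power[where Q = "\<lambda>n m. size m = 3 * n"]) auto

text \<open>Three coordinates weigh 3 and the division by \<hbar> subtracts 2.\<close>

lemma wge_over_hbar: "cubic f \<Longrightarrow> wge 1 (over_hbar f)"
  unfolding wge_def over_hbar_def
proof (intro allI impI)
  fix m k assume f: "cubic f" and nz: "fls_nth (scoeff (sconst fls_X_inv * lift_const f) m) k \<noteq> 0"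
  have "k = -1 \<and> scoeff f m \<noteq> 0"
    using nz fls_nth_X_inv_power_mult_const[of 1 "scoeff f m" k] by (auto split: if_splits)
  thus "int 1 \<le> int (size m) + 2 * k" using f by (auto simp: supp_in_def)
qed

text \<open>The \<open>n\<close>-th term of the exponential carries exactly the power
  \<open>- n\<close> of \<hbar>, so a power of \<hbar> selects a single \<open>n\<close>.\<close>

lemma fls_nth_exp_over_hbar:
  assumes f: "cubic f"
  shows "fls_nth (scoeff (formal_exp (over_hbar f)) m) k =
    (if k \<le> 0 then scoeff (f ^ nat (- k)) m / fact (nat (- k)) else 0)"
proof -
  define N where "N = Suc (nat (int (size m) + 2 * k))"
  have t: "fls_nth (scoeff (scal (1 / fact n) * over_hbar f ^ n) m) k =
      (if n = nat (- k) \<and> k \<le> 0 then scoeff (f ^ n) m / fact n else 0)" for n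
    by (auto simp: over_hbar_power fls_nth_X_inv_power_mult_const mult.assoc simp flip: fls_const_mult_const)
  have "fls_nth (scoeff (formal_exp (over_hbar f)) m) k =
      (\<Sum>n<N. fls_nth (scoeff (scal (1 / fact n) * over_hbar f ^ n) m) k)"
    unfolding formal_exp_def
  proof (rule fls_nth_formal_sum)
    show "wge n (scal (1 / fact n) * over_hbar f ^ n)" for n
      by (rule subst_fps_terms[OF wge_over_hbar[OF f]])
  qed (simp add: N_def)
  also have "\<dots> = (\<Sum>n<N. if n = nat (- k) then (if k \<le> 0 then scoeff (f ^ n) m / fact n else 0) else 0)"
    unfolding t by (intro sum.cong) auto
  also have "\<dots> = (if k \<le> 0 then scoeff (f ^ nat (- k)) m / fact (nat (- k)) else 0)"
  proof (cases "nat (- k) < N \<or> k > 0")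
    case False
    \<comment> \<open>A nonzero coefficient would force \<open>size m\<close> to be three times
      \<open>- k\<close>; then \<open>N\<close> would be one more than \<open>- k\<close>, contrary
      to the case.\<close>
    hence "scoeff (f ^ nat (- k)) m = 0"
      using supp_inD[OF cubic_power[OF f], of m "nat (- k)"] by (auto simp: N_def)
    thus ?thesis using False by simp
  qed auto
  finally show ?thesis .
qed

definition fluct_average ::
  "(var \<Rightarrow> var \<Rightarrow> real) \<Rightarrow> var set \<Rightarrow> nat \<Rightarrow> real superseries \<Rightarrow> var multiset \<Rightarrow> real" where
  "fluct_average p F h f m = (\<Sum>M\<in>msets F h. scoeff f (m + M) * wick p (sorted_list_of_multiset M))"

text \<open>With \<open>n\<close> cubic vertices there are \<open>3 n - size m\<close> legs to
  contract, each pair giving one \<hbar>, so \<open>2 k = n - size m\<close>. Thus the monomial and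
  the power of \<hbar> determine the number of vertices, and the formal sum collapses to one power
  of \<open>f\<close>.\<close>

lemma fls_nth_gaussian_average:
  assumes f: "cubic f" and vars: "supp_in (\<lambda>m. set_mset m \<subseteq> R \<union> F) f"
    and R: "\<And>v. v \<in> R \<Longrightarrow> is_resid v" and F: "\<And>v. v \<in> F \<Longrightarrow> \<not> is_resid v" "finite F"
  shows "fls_nth (scoeff (gaussian_average p (formal_exp (over_hbar f))) m) k =
    (if resid m \<and> admissible m \<and> 0 \<le> int (size m) + 2 * k
     then let n = nat (int (size m) + 2 * k)
          in fluct_average p F (3 * n - size m) (f ^ n) m / fact n else 0)"
proof (cases "resid m \<and> admissible m")
  case True
  let ?E = "formal_exp (over_hbar f)"
  define n where "n k = nat (int (size m) + 2 * k)" for k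
  define G where "G M = superseries_of (\<lambda>m.
     if (\<forall>v\<in>#m. \<exists>k i a. v = Resid k i a) \<and> (\<forall>v\<in>#M. \<exists>k i a. v = Fluct k i a)
     then scoeff ?E (m + M) * moment p M else 0)" for M
  have varsn: "supp_in (\<lambda>m. set_mset m \<subseteq> R \<union> F) (f ^ n)" for n
    by (rule supp_in_power'[OF vars]) auto
  have val: "fls_nth (scoeff (G M) m) k =
      (if 0 \<le> int (size m) + 2 * k \<and> M \<in> msets F (3 * n k - size m)
       then scoeff (f ^ n k) (m + M) * wick p (sorted_list_of_multiset M) / fact (n k) else 0)" for M k
  proof -
    define h where "h = size M div 2"
    define w where "w = wick p (sorted_list_of_multiset M)"
    have "scoeff ?E (m + M) * moment p M = fls_const w * (scoeff ?E (m + M) * fls_X ^ h)"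
      by (simp only: moment_def w_def h_def mult_ac)
    hence "fls_nth (scoeff ?E (m + M) * moment p M) k = w * fls_nth (scoeff ?E (m + M)) (k - int h)"
      by (simp add: fls_X_power_times_conv_shift)
    hence l: "fls_nth (scoeff (G M) m) k = (if fluct M \<and> k \<le> int h then
        w * (scoeff (f ^ nat (int h - k)) (m + M) / fact (nat (int h - k))) else 0)"
      using True by (simp add: G_def scoeff_superseries_of fls_nth_exp_over_hbar[OF f] resid_iff fluct_iff)
    show ?thesis
    proof (cases "fluct M \<and> k \<le> int h \<and> w \<noteq> 0 \<and> scoeff (f ^ nat (int h - k)) (m + M) \<noteq> 0")
      case nz: True
      \<comment> \<open>An odd number of legs has vanishing \<open>wick\<close>, so the integer
        division by 2 in \<open>moment\<close> loses nothing.\<close>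
      have "even (size M)"
        using nz wick_odd_length[of "sorted_list_of_multiset M" p] unfolding w_def
        by (metis mset_sorted_list_of_multiset size_mset)
      hence hM: "size M = 2 * h" by (simp add: h_def)
      have "size (m + M) = 3 * nat (int h - k)"
        using nz cubic_power[OF f, of "nat (int h - k)"] by (auto simp: supp_in_def)
      moreover obtain q where "nat (int h - k) = q" "int q = int h - k" using nz by simp
      ultimately have "int (size m) + 2 * int h = 3 * (int h - k)" using hM by simp
      hence h: "int h - k = int (size m) + 2 * k" by simp
      hence nk: "nat (int h - k) = n k" and "0 \<le> int (size m) + 2 * k"
        using nz by (simp_all add: n_def)
      moreover have "size M = 3 * n k - size m"
        using h hM nz unfolding n_def by linarith
      moreover have "set_mset (m + M) \<subseteq> R \<union> F"
        using nz varsn[of "nat (int h - k)"] unfolding supp_in_def by blast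
      hence "set_mset M \<subseteq> F" using nz R by (auto simp: fluct_def)
      ultimately show ?thesis using nz unfolding l nk by (simp add: msets_def w_def)
    next
      case z: False
      hence "fls_nth (scoeff (G M) m) k = 0" unfolding l by auto
      moreover have "scoeff (f ^ n k) (m + M) * w = 0" if "0 \<le> int (size m) + 2 * k" "M \<in> msets F (3 * n k - size m)"
      proof (rule ccontr)
        assume nz: "scoeff (f ^ n k) (m + M) * w \<noteq> 0"
        hence "size (m + M) = 3 * n k" using cubic_power[OF f, of "n k"] by (auto simp: supp_in_def)
        hence sM: "int (size M) = 2 * int (size m) + 6 * k" using that by (simp add: n_def)
        hence "int h = int (size m) + 3 * k" unfolding h_def by linarith
        hence "int h - k = int (size m) + 2 * k" by simp
        hence "nat (int h - k) = n k" "k \<le> int h" using that by (simp_all add: n_def)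
        moreover have "fluct M" using that(2) F(1) by (auto simp: msets_def fluct_def)
        ultimately show False using z nz by auto
      qed
      ultimately show ?thesis by (auto simp: w_def)
    qed
  qed
  have S: "Sum_any (\<lambda>M. fls_nth (scoeff (G M) m) k) =
      (if 0 \<le> int (size m) + 2 * k then fluct_average p F (3 * n k - size m) (f ^ n k) m / fact (n k) else 0)" for k
  proof -
    have "Sum_any (\<lambda>M. fls_nth (scoeff (G M) m) k) =
        (\<Sum>M\<in>msets F (3 * n k - size m). fls_nth (scoeff (G M) m) k)"
      by (rule Sum_any.expand_superset) (auto simp: finite_msets F val)
    thus ?thesis by (simp add: val fluct_average_def sum_divide_distrib)
  qed
  have "fls_nth (Abs_fls (\<lambda>k. Sum_any (\<lambda>M. fls_nth (scoeff (G M) m) k))) k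
      = Sum_any (\<lambda>M. fls_nth (scoeff (G M) m) k)"
    by (rule nth_Abs_fls_ex_lower_bound, rule exI[of _ "- int (size m)"]) (auto simp: S)
  moreover have "gaussian_average p ?E = formal_sum G"
    unfolding gaussian_average_def G_def ..
  ultimately show ?thesis using True
    by (simp add: formal_sum_def scoeff_superseries_of S n_def Let_def)
next
  case False
  have "scoeff (gaussian_average p (formal_exp (over_hbar f))) m = 0"
  proof (cases "admissible m")
    case True
    hence "(\<forall>v\<in>#m. \<exists>k i a. v = Resid k i a) = False" using False by (simp only: resid_iff) simp
    thus ?thesis using True
      by (simp only: gaussian_average_def formal_sum_def scoeff_superseries_of if_True if_False simp_thms
          fls_zero_nth Sum_any.neutral) (simp add: zero_fls_def)
  qed (simp add: scoeff_not_admissible)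
  thus ?thesis using False by auto
qed

text \<open>A factor that involves only parameters comes out of the integral. In coefficients this
  is the binomial expansion of \<open>(W + V) ^ n\<close>, with the power of \<open>W\<close> read
  off from the size of the part of the monomial that it supplies.\<close>

lemma gaussian_average_factor:
  assumes W: "cubic W" "supp_in (\<lambda>m. set_mset m \<subseteq> R) W"
    and V: "cubic V" "supp_in (\<lambda>m. set_mset m \<subseteq> R \<union> F) V"
    and WV: "W * V = V * W"
    and R: "\<And>v. v \<in> R \<Longrightarrow> is_resid v" and F: "\<And>v. v \<in> F \<Longrightarrow> \<not> is_resid v" "finite F"
  shows "gaussian_average p (formal_exp (over_hbar (W + V))) =
     formal_exp (over_hbar W) * gaussian_average p (formal_exp (over_hbar V))"
proof (rule superseries_eqI, rule fls_eqI)
  fix m k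
  have "supp_in (\<lambda>m. set_mset m \<subseteq> R \<union> F) W" using W(2) by (auto simp: supp_in_def)
  hence S: "cubic (W + V)" "supp_in (\<lambda>m. set_mset m \<subseteq> R \<union> F) (W + V)"
    using W(1) V by (simp_all add: supp_in_add)
  let ?ZV = "gaussian_average p (formal_exp (over_hbar V))"
  have GA: "fls_nth (scoeff (gaussian_average p (formal_exp (over_hbar f))) m) k =
    (if resid m \<and> admissible m \<and> 0 \<le> int (size m) + 2 * k
     then let n = nat (int (size m) + 2 * k)
          in fluct_average p F (3 * n - size m) (f ^ n) m / fact n else 0)"
    if "cubic f" "supp_in (\<lambda>m. set_mset m \<subseteq> R \<union> F) f" for f m k
    by (rule fls_nth_gaussian_average[where R = R]) (fact that R F)+
  have Wn: "supp_in resid (W ^ j)" for j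
    by (rule supp_in_power') (use W(2) R in \<open>auto simp: supp_in_def resid_def\<close>)
  have E: "fls_nth (scoeff (formal_exp (over_hbar W)) a * x) k =
      (if 3 dvd size a then scoeff (W ^ (size a div 3)) a / fact (size a div 3) * fls_nth x (k + int (size a div 3)) else 0)"
    for a x
  proof -
    have "scoeff (formal_exp (over_hbar W)) a = (if 3 dvd size a then
        fls_const (scoeff (W ^ (size a div 3)) a / fact (size a div 3)) * fls_X_inv ^ (size a div 3) else 0)"
    proof (rule fls_eqI)
      fix i
      have "scoeff (W ^ nat (- i)) a = 0" if "i \<noteq> - int (size a div 3) \<or> \<not> 3 dvd size a" "i \<le> 0"
        using that by (intro supp_inD[OF cubic_power[OF W(1)]]) auto
      thus "fls_nth (scoeff (formal_exp (over_hbar W)) a) i = fls_nth (if 3 dvd size a then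
        fls_const (scoeff (W ^ (size a div 3)) a / fact (size a div 3)) * fls_X_inv ^ (size a div 3) else 0) i"
        by (auto simp: fls_nth_exp_over_hbar[OF W(1)])
    qed
    hence "scoeff (formal_exp (over_hbar W)) a * x = (if 3 dvd size a then
        fls_const (scoeff (W ^ (size a div 3)) a / fact (size a div 3)) * (fls_X_inv ^ (size a div 3) * x) else 0)"
      by (simp only: mult.assoc if_distrib[of "\<lambda>y. y * x"] mult_zero_left)
    thus ?thesis
      by (simp add: fls_X_inv_power_times_conv_shift)
  qed
  show "fls_nth (scoeff (gaussian_average p (formal_exp (over_hbar (W + V)))) m) k =
      fls_nth (scoeff (formal_exp (over_hbar W) * ?ZV) m) k"
  proof (cases "resid m \<and> admissible m")
    case True
    define n where "n = nat (int (size m) + 2 * k)"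
    define h where "h = 3 * n - size m"
    have rhs: "fls_nth (scoeff (formal_exp (over_hbar W) * ?ZV) m) k =
        (\<Sum>a | a \<subseteq># m. (-1) ^ inversions a (m - a) * (if 3 dvd size a then scoeff (W ^ (size a div 3)) a / fact (size a div 3)
            * fls_nth (scoeff ?ZV (m - a)) (k + int (size a div 3)) else 0))"
      using True by (simp only: scoeff_mult fls_nth_sum mult.assoc fls_nth_neg_one_power_mult E if_True)
    \<comment> \<open>Removing \<open>j\<close> vertices of \<open>W\<close> takes away
      \<open>3 j\<close> external legs and shifts the power of \<hbar> by \<open>j\<close>; the
      number \<open>h\<close> of contracted legs stays the same.\<close>
    have ma: "fls_nth (scoeff ?ZV (m - a)) (k + int j) =
        (if int j \<le> int (size m) + 2 * k then fluct_average p F h (V ^ (n - j)) (m - a) / fact (n - j) else 0)"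
      if a: "a \<subseteq># m" "size a = 3 * j" for a j
    proof -
      have "size m = size a + size (m - a)"
        using a(1) by (metis size_union subset_mset.add_diff_inverse)
      hence sz: "int (size (m - a)) = int (size m) - 3 * int j" using a(2) by simp
      have "resid (m - a)" "admissible (m - a)"
        using True by (auto intro: resid_mono admissible_mono diff_subset_eq_self)
      moreover have e: "int (size (m - a)) + 2 * (k + int j) = int (size m) + 2 * k - int j" using sz by simp
      moreover have nj: "nat (int (size m) + 2 * k - int j) = n - j" by (simp add: n_def)
      moreover have "3 * (n - j) - size (m - a) = h" if "int j \<le> int (size m) + 2 * k"
        using sz that unfolding h_def n_def by linarith
      ultimately show ?thesis unfolding GA[OF V] Let_def e nj by simp
    qed
    show ?thesis
    proof (cases "0 \<le> int (size m) + 2 * k")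
      case pos: True
      have av: "fluct_average p F h (W ^ j * V ^ (n - j)) m =
          (\<Sum>a | a \<subseteq># m. (-1) ^ inversions a (m - a) * scoeff (W ^ j) a * fluct_average p F h (V ^ (n - j)) (m - a))" for j
      proof -
        have "scoeff (W ^ j * V ^ (n - j)) (m + M) =
            (\<Sum>a | a \<subseteq># m. (-1) ^ inversions a (m - a) * scoeff (W ^ j) a * scoeff (V ^ (n - j)) (m - a + M))"
          if "M \<in> msets F h" for M
          using scoeff_resid_mult[OF Wn, of m M] True that F(1) by (auto simp: msets_def fluct_def)
        hence "fluct_average p F h (W ^ j * V ^ (n - j)) m = (\<Sum>M\<in>msets F h.
            \<Sum>a | a \<subseteq># m. (-1) ^ inversions a (m - a) * scoeff (W ^ j) a * scoeff (V ^ (n - j)) (m - a + M)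
              * wick p (sorted_list_of_multiset M))"
          by (simp add: fluct_average_def sum_distrib_right)
        thus ?thesis
          by (subst (asm) sum.swap) (simp add: fluct_average_def sum_distrib_left mult.assoc)
      qed
      have "fluct_average p F h ((W + V) ^ n) m =
          (\<Sum>j\<le>n. real (n choose j) * fluct_average p F h (W ^ j * V ^ (n - j)) m)"
        unfolding commuting_binomial[OF WV] fluct_average_def sum_distrib_left
        by (subst sum.swap) (simp add: scoeff_sum of_nat_eq_sconst sum_distrib_right mult.assoc)
      hence "fluct_average p F h ((W + V) ^ n) m / fact n =
          (\<Sum>j\<le>n. \<Sum>a | a \<subseteq># m. (-1) ^ inversions a (m - a) * (scoeff (W ^ j) a / fact j *
             (fluct_average p F h (V ^ (n - j)) (m - a) / fact (n - j))))"
        unfolding av by (simp add: sum_divide_distrib sum_distrib_left binomial_fact field_simps)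
      also have "\<dots> = (\<Sum>a | a \<subseteq># m. \<Sum>j\<le>n. (-1) ^ inversions a (m - a) * (scoeff (W ^ j) a / fact j *
             (fluct_average p F h (V ^ (n - j)) (m - a) / fact (n - j))))"
        by (rule sum.swap)
      also have "\<dots> = (\<Sum>a | a \<subseteq># m. (-1) ^ inversions a (m - a) * (if 3 dvd size a then scoeff (W ^ (size a div 3)) a / fact (size a div 3)
            * fls_nth (scoeff ?ZV (m - a)) (k + int (size a div 3)) else 0))"
      proof (rule sum.cong[OF refl])
        fix a assume a: "a \<in> {a. a \<subseteq># m}"
        have z: "scoeff (W ^ j) a = 0" if "size a \<noteq> 3 * j" for j
          by (rule supp_inD[OF cubic_power[OF W(1)] that])
        show "(\<Sum>j\<le>n. (-1) ^ inversions a (m - a) * (scoeff (W ^ j) a / fact j *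
             (fluct_average p F h (V ^ (n - j)) (m - a) / fact (n - j)))) =
            (-1) ^ inversions a (m - a) * (if 3 dvd size a then scoeff (W ^ (size a div 3)) a / fact (size a div 3)
            * fls_nth (scoeff ?ZV (m - a)) (k + int (size a div 3)) else 0)"
        proof (cases "3 dvd size a")
          case True
          then obtain j where j: "size a = 3 * j" by blast
          have "(\<Sum>i\<le>n. (-1) ^ inversions a (m - a) * (scoeff (W ^ i) a / fact i *
             (fluct_average p F h (V ^ (n - i)) (m - a) / fact (n - i)))) =
             (\<Sum>i\<le>n. if i = j then (-1) ^ inversions a (m - a) * (scoeff (W ^ j) a / fact j *
             (fluct_average p F h (V ^ (n - j)) (m - a) / fact (n - j))) else 0)"
            by (intro sum.cong refl) (auto simp: z j)
          also have "\<dots> = (-1) ^ inversions a (m - a) * (scoeff (W ^ j) a / fact j * fls_nth (scoeff ?ZV (m - a)) (k + int j))"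
            using ma[of a j] a j pos by (auto simp: n_def)
          finally show ?thesis using True j by simp
        next
          case False
          hence "scoeff (W ^ j) a = 0" for j using z[of j] by fastforce
          thus ?thesis using False by simp
        qed
      qed
      finally show ?thesis using True pos by (simp add: GA[OF S] rhs Let_def flip: n_def h_def)
    next
      case False
      have "fls_nth (scoeff (formal_exp (over_hbar W) * ?ZV) m) k = 0"
        unfolding rhs
      proof (intro sum.neutral ballI)
        fix a assume "a \<in> {a. a \<subseteq># m}"
        thus "(-1) ^ inversions a (m - a) * (if 3 dvd size a then scoeff (W ^ (size a div 3)) a / fact (size a div 3)
            * fls_nth (scoeff ?ZV (m - a)) (k + int (size a div 3)) else 0) = 0"
          using ma[of a "size a div 3"] False by auto
      qed
      thus ?thesis using False by (simp add: GA[OF S])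
    qed
  next
    case False
    have "fls_nth (scoeff (formal_exp (over_hbar W) * ?ZV) m) k = 0"
    proof (cases "admissible m")
      case adm: True
      have "fls_nth (scoeff (formal_exp (over_hbar W)) a * scoeff ?ZV (m - a)) k = 0" if "a \<subseteq># m" for a
      proof (cases "resid a")
        case True
        hence "\<not> resid (m - a)" using False adm that by (metis resid_plus subset_mset.add_diff_inverse)
        thus ?thesis by (simp add: E GA[OF V])
      next
        case False
        thus ?thesis using supp_inD[OF Wn False] by (simp add: E)
      qed
      thus ?thesis using adm by (simp add: scoeff_mult fls_nth_sum mult.assoc)
    qed (simp add: scoeff_mult)
    thus ?thesis using False by (auto simp: GA[OF S])
  qed
qed

subsection \<open>Evaluation of series in even variables\<close>

definition good :: "var set \<Rightarrow> real fls superseries \<Rightarrow> bool" where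
  "good D f \<longleftrightarrow> (\<forall>m k. fls_nth (scoeff f m) k \<noteq> 0 \<longrightarrow> set_mset m \<subseteq> D \<and> 0 \<le> k)"

lemma good_0 [simp]: "good D 0" by (simp add: good_def)

lemma good_1 [simp]: "good D 1"
  by (auto simp: good_def scoeff_one split: if_splits)

lemma good_add: "good D f \<Longrightarrow> good D g \<Longrightarrow> good D (f + g)"
  unfolding good_def by (metis add_0 fls_plus_nth scoeff_add)

lemma good_uminus: "good D f \<Longrightarrow> good D (- f)"
  unfolding good_def by simp

lemma good_diff: "good D f \<Longrightarrow> good D g \<Longrightarrow> good D (f - g)"
  using good_add[of D f "- g"] good_uminus[of D g] by simp

lemma good_mult:
  assumes "good D f" "good D g"
  shows "good D (f * g)"
  unfolding good_def
proof (intro allI impI)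
  fix m k assume nz: "fls_nth (scoeff (f * g) m) k \<noteq> 0"
  hence "admissible m" by (metis scoeff_not_admissible fls_zero_nth)
  with nz have "(\<Sum>a | a \<subseteq># m. fls_nth ((-1) ^ inversions a (m - a) * (scoeff f a * scoeff g (m - a))) k) \<noteq> 0"
    by (simp add: scoeff_mult fls_nth_sum mult.assoc)
  then obtain a where a: "a \<subseteq># m"
    and "fls_nth ((-1) ^ inversions a (m - a) * (scoeff f a * scoeff g (m - a))) k \<noteq> 0"
    by (metis (mono_tags, lifting) mem_Collect_eq sum.neutral)
  hence "fls_nth (scoeff f a * scoeff g (m - a)) k \<noteq> 0" by simp
  then obtain i where "fls_nth (scoeff f a) i \<noteq> 0" "fls_nth (scoeff g (m - a)) (k - i) \<noteq> 0"
    by (rule fls_times_nth_nonzeroE)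
  hence "set_mset a \<subseteq> D" "0 \<le> i" "set_mset (m - a) \<subseteq> D" "0 \<le> k - i"
    using assms unfolding good_def by blast+
  moreover have "set_mset m = set_mset a \<union> set_mset (m - a)"
    using a by (metis set_mset_union subset_mset.add_diff_inverse)
  ultimately show "set_mset m \<subseteq> D \<and> 0 \<le> k" by auto
qed

lemma good_power: "good D f \<Longrightarrow> good D (f ^ n)"
  by (induction n) (auto intro: good_mult)

lemma fls_nth_subst_fps:
  assumes "wge 1 G" "int (size m) + 2 * k < int N"
  shows "fls_nth (scoeff (subst_fps a G) m) k = (\<Sum>n<N. fps_nth a n * fls_nth (scoeff (G ^ n) m) k)"
  using fls_nth_formal_sum[of "\<lambda>n. scal (fps_nth a n) * G ^ n", OF subst_fps_terms[OF assms(1)] assms(2)]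
  by (simp add: subst_fps_def)

lemma good_subst_fps:
  assumes "wge 1 G" "good D G"
  shows "good D (subst_fps a G)"
  unfolding good_def
proof (intro allI impI)
  fix m k assume nz: "fls_nth (scoeff (subst_fps a G) m) k \<noteq> 0"
  define N where "N = Suc (nat (int (size m) + 2 * k))"
  have N: "int (size m) + 2 * k < int N" by (simp add: N_def)
  have "(\<Sum>n<N. fps_nth a n * fls_nth (scoeff (G ^ n) m) k) \<noteq> 0"
    using nz fls_nth_subst_fps[OF assms(1) N] by simp
  then obtain n where "fps_nth a n * fls_nth (scoeff (G ^ n) m) k \<noteq> 0"
    by (rule sum.not_neutral_contains_not_neutral)
  hence "fls_nth (scoeff (G ^ n) m) k \<noteq> 0" by simp
  thus "set_mset m \<subseteq> D \<and> 0 \<le> k" using good_power[OF assms(2)] by (auto simp: good_def)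
qed

text \<open>The outer index is the degree in the variables (evaluation along a ray), the inner one
  the power of \<hbar>; negative powers are ignored, so it is meaningful on \<open>good\<close>
  series.\<close>

definition Ev :: "var set \<Rightarrow> (var \<Rightarrow> real) \<Rightarrow> real fls superseries \<Rightarrow> real fps fps" where
  "Ev D val f = Abs_fps (\<lambda>n. Abs_fps (\<lambda>k.
     \<Sum>m\<in>msets D n. fls_nth (scoeff f m) (int k) * (\<Prod>v\<in>#m. val v)))"

lemma Ev_nth: "fps_nth (fps_nth (Ev D val f) n) k =
    (\<Sum>m\<in>msets D n. fls_nth (scoeff f m) (int k) * (\<Prod>v\<in>#m. val v))"
  by (simp add: Ev_def)

lemma Ev_diff: "Ev D val (f - g) = Ev D val f - Ev D val g"
  by (intro fps_ext) (simp add: Ev_nth left_diff_distrib sum_subtractf)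

lemma Ev_1: "Ev D val 1 = 1"
proof (intro fps_ext)
  fix n k
  show "fps_nth (fps_nth (Ev D val 1) n) k = fps_nth (fps_nth 1 n) k"
  proof (cases "n = 0")
    case False
    hence "scoeff (1 :: real fls superseries) m = 0" if "m \<in> msets D n" for m
      using that by (auto simp: msets_def scoeff_one)
    thus ?thesis using False by (simp add: Ev_nth)
  qed (simp add: Ev_nth scoeff_one)
qed

lemma fls_times_nth_nonneg:
  fixes f g :: "real fls"
  assumes "\<And>i. i < 0 \<Longrightarrow> fls_nth f i = 0" "\<And>i. i < 0 \<Longrightarrow> fls_nth g i = 0"
  shows "fls_nth (f * g) (int k) = (\<Sum>i\<le>k. fls_nth f (int i) * fls_nth g (int (k - i)))"
proof -
  define F where "F = Abs_fps (\<lambda>n. fls_nth f (int n))"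
  define G where "G = Abs_fps (\<lambda>n. fls_nth g (int n))"
  have "f = fps_to_fls F" "g = fps_to_fls G"
    using assms by (auto intro!: fls_eqI simp: F_def G_def)
  hence "f * g = fps_to_fls (F * G)" by (metis fls_times_fps_to_fls)
  thus ?thesis by (simp add: fps_mult_nth atLeast0AtMost F_def G_def)
qed

lemma even_vars_admissible: "(\<And>v. v \<in># m \<Longrightarrow> \<not> odd_var v) \<Longrightarrow> admissible m"
  unfolding admissible_def by (metis count_eq_zero_iff zero_le)

lemma even_vars_inversions: "(\<And>v. v \<in># a \<Longrightarrow> \<not> odd_var v) \<Longrightarrow> inversions a b = 0"
  by (induction a) (auto simp: inv1_def)

text \<open>Even variables multiply without signs and are never excluded by admissibility, and
  without negative powers of \<hbar> the Laurent product is the product of ordinary power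
  series.\<close>

lemma Ev_mult:
  assumes D: "finite D" "\<And>v. v \<in> D \<Longrightarrow> \<not> odd_var v" and f: "good D f" and g: "good D g"
  shows "Ev D val (f * g) = Ev D val f * Ev D val g"
proof (intro fps_ext)
  fix n k
  let ?h = "\<lambda>a b. \<Sum>i\<le>k. (fls_nth (scoeff f a) (int i) * (\<Prod>v\<in>#a. val v)) *
      (fls_nth (scoeff g b) (int (k - i)) * (\<Prod>v\<in>#b. val v))"
  have neg: "fls_nth (scoeff h a) i = 0" if "good D h" "i < 0" for h a i
    using that by (force simp: good_def)
  have "fps_nth (fps_nth (Ev D val (f * g)) n) k = (\<Sum>m\<in>msets D n. \<Sum>a | a \<subseteq># m. ?h a (m - a))"
    unfolding Ev_nth
  proof (rule sum.cong[OF refl])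
    fix m assume m: "m \<in> msets D n"
    have ev: "\<not> odd_var v" if "v \<in># a" "a \<subseteq># m" for a v
      using that m D by (auto simp: msets_def dest: mset_subset_eqD)
    have "scoeff (f * g) m = (\<Sum>a | a \<subseteq># m. scoeff f a * scoeff g (m - a))"
      unfolding scoeff_mult using ev[of _ m]
      by (auto simp: even_vars_admissible even_vars_inversions ev intro!: sum.cong)
    hence "fls_nth (scoeff (f * g) m) (int k) * (\<Prod>v\<in>#m. val v) =
        (\<Sum>a | a \<subseteq># m. fls_nth (scoeff f a * scoeff g (m - a)) (int k) * (\<Prod>v\<in>#m. val v))"
      by (simp add: fls_nth_sum sum_distrib_right)
    also have "\<dots> = (\<Sum>a | a \<subseteq># m. ?h a (m - a))"
    proof (rule sum.cong[OF refl])
      fix a assume "a \<in> {a. a \<subseteq># m}"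
      hence "m = a + (m - a)" by simp
      hence p: "(\<Prod>v\<in>#m. val v) = (\<Prod>v\<in>#a. val v) * (\<Prod>v\<in>#m - a. val v)"
        by (metis image_mset_union prod_mset.union)
      have ft: "fls_nth (scoeff f a * scoeff g (m - a)) (int k) =
          (\<Sum>i\<le>k. fls_nth (scoeff f a) (int i) * fls_nth (scoeff g (m - a)) (int (k - i)))"
        by (rule fls_times_nth_nonneg) (fact neg[OF f] neg[OF g])+
      show "fls_nth (scoeff f a * scoeff g (m - a)) (int k) * (\<Prod>v\<in>#m. val v) = ?h a (m - a)"
        unfolding p ft
        by (simp add: sum_distrib_right sum_distrib_left mult_ac)
    qed
    finally show "fls_nth (scoeff (f * g) m) (int k) * (\<Prod>v\<in>#m. val v) = (\<Sum>a | a \<subseteq># m. ?h a (m - a))" .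
  qed
  also have "\<dots> = (\<Sum>i\<le>n. \<Sum>x\<in>msets D i. \<Sum>y\<in>msets D (n - i). ?h x y)"
    by (rule sum_msets_split[OF D(1)])
  also have "\<dots> = (\<Sum>i\<le>n. \<Sum>j\<le>k. fps_nth (fps_nth (Ev D val f) i) j * fps_nth (fps_nth (Ev D val g) (n - i)) (k - j))"
  proof (rule sum.cong[OF refl])
    fix i
    have "(\<Sum>x\<in>msets D i. \<Sum>y\<in>msets D (n - i). ?h x y) =
      (\<Sum>x\<in>msets D i. \<Sum>j\<le>k. \<Sum>y\<in>msets D (n - i). (fls_nth (scoeff f x) (int j) * (\<Prod>v\<in>#x. val v)) *
      (fls_nth (scoeff g y) (int (k - j)) * (\<Prod>v\<in>#y. val v)))"
      by (intro sum.cong refl sum.swap)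
    also have "\<dots> = (\<Sum>j\<le>k. \<Sum>x\<in>msets D i. \<Sum>y\<in>msets D (n - i). (fls_nth (scoeff f x) (int j) * (\<Prod>v\<in>#x. val v)) *
      (fls_nth (scoeff g y) (int (k - j)) * (\<Prod>v\<in>#y. val v)))"
      by (rule sum.swap)
    finally show "(\<Sum>x\<in>msets D i. \<Sum>y\<in>msets D (n - i). ?h x y) =
        (\<Sum>j\<le>k. fps_nth (fps_nth (Ev D val f) i) j * fps_nth (fps_nth (Ev D val g) (n - i)) (k - j))"
      by (simp add: Ev_nth sum_product)
  qed
  also have "\<dots> = fps_nth (fps_nth (Ev D val f * Ev D val g) n) k"
    by (simp add: fps_mult_nth fps_sum_nth atLeast0AtMost)
  finally show "fps_nth (fps_nth (Ev D val (f * g)) n) k = fps_nth (fps_nth (Ev D val f * Ev D val g) n) k" .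
qed

lemma Ev_power:
  assumes D: "finite D" "\<And>v. v \<in> D \<Longrightarrow> \<not> odd_var v" and f: "good D f"
  shows "Ev D val (f ^ n) = Ev D val f ^ n"
  by (induction n) (simp_all add: Ev_1 Ev_mult[OF D f good_power[OF f]])

lemma Ev_subst_fps:
  assumes D: "finite D" "\<And>v. v \<in> D \<Longrightarrow> \<not> odd_var v" and G: "good D G" "wge 1 G" and N: "n + 2 * k < N"
  shows "fps_nth (fps_nth (Ev D val (subst_fps a G)) n) k =
    (\<Sum>i<N. fps_nth a i * fps_nth (fps_nth (Ev D val G ^ i) n) k)"
proof -
  have "fps_nth (fps_nth (Ev D val (subst_fps a G)) n) k =
    (\<Sum>m\<in>msets D n. \<Sum>i<N. fps_nth a i * (fls_nth (scoeff (G ^ i) m) (int k) * (\<Prod>v\<in>#m. val v)))"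
    unfolding Ev_nth
  proof (rule sum.cong[OF refl])
    fix m assume "m \<in> msets D n"
    hence "int (size m) + 2 * int k < int N" using N by (simp add: msets_def)
    thus "fls_nth (scoeff (subst_fps a G) m) (int k) * (\<Prod>v\<in>#m. val v) =
       (\<Sum>i<N. fps_nth a i * (fls_nth (scoeff (G ^ i) m) (int k) * (\<Prod>v\<in>#m. val v)))"
      by (simp add: fls_nth_subst_fps[OF G(2)] sum_distrib_right mult.assoc)
  qed
  also have "\<dots> = (\<Sum>i<N. fps_nth a i * fps_nth (fps_nth (Ev D val (G ^ i)) n) k)"
    by (subst sum.swap) (simp add: Ev_nth sum_distrib_left)
  finally show ?thesis by (simp add: Ev_power[OF D G(1)])
qed

text \<open>Sets \<hbar> to 0, which is a ring homomorphism; this is how the one-loop part is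
  isolated.\<close>

definition fps_at0 :: "real fps fps \<Rightarrow> real fps" where
  "fps_at0 F = Abs_fps (\<lambda>n. fps_nth (fps_nth F n) 0)"

lemma fps_at0_nth [simp]: "fps_nth (fps_at0 F) n = fps_nth (fps_nth F n) 0"
  by (simp add: fps_at0_def)

lemma fps_at0_1: "fps_at0 1 = 1"
  by (rule fps_ext) simp

lemma fps_at0_mult: "fps_at0 (F * G) = fps_at0 F * fps_at0 G"
  by (rule fps_ext) (simp add: fps_mult_nth fps_sum_nth)

lemma fps_at0_power: "fps_at0 (F ^ n) = fps_at0 F ^ n"
  by (induction n) (simp_all add: fps_at0_1 fps_at0_mult)

text \<open>The logarithm is characterised through \<open>Z = exp (ln Z)\<close> instead of being
  expanded, which is what the later comparison by a differential equation needs.\<close>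

lemma Ev_formal_ln_at0:
  fixes val :: "var \<Rightarrow> real"
  assumes D: "finite D" "\<And>v. v \<in> D \<Longrightarrow> \<not> odd_var v" and Z: "good D Z" "wge 1 (Z - 1)"
  defines "\<Lambda> \<equiv> fps_at0 (Ev D val (formal_ln Z))"
  shows "fps_nth \<Lambda> 0 = 0" "fps_at0 (Ev D val Z) = fps_exp 1 oo \<Lambda>"
proof -
  have L: "wge 1 (formal_ln Z)" by (rule wge_formal_ln[OF Z(2)])
  have gL: "good D (formal_ln Z)" unfolding formal_ln_eq_subst
    by (rule good_subst_fps) (use Z good_diff in auto)
  show 0: "fps_nth \<Lambda> 0 = 0"
    \<comment> \<open>The empty monomial at order 0 in \<hbar> has weight 0, while the logarithm
      starts in weight 1.\<close>
    using wgeD[OF L, of "{#}" 0] by (simp add: \<Lambda>_def Ev_nth)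
  have Ze: "Z = subst_fps (fps_exp 1) (formal_ln Z)"
    using formal_exp_ln[OF Z(2)] by (simp add: formal_exp_eq_subst)
  show "fps_at0 (Ev D val Z) = fps_exp 1 oo \<Lambda>"
  proof (rule fps_ext)
    fix n
    have "fps_nth (fps_at0 (Ev D val Z)) n =
        (\<Sum>i<Suc n. fps_nth (fps_exp 1) i * fps_nth (fps_nth (Ev D val (formal_ln Z) ^ i) n) 0)"
      by (subst Ze, simp only: fps_at0_nth, rule Ev_subst_fps[OF D gL L]) auto
    also have "\<dots> = (\<Sum>i<Suc n. fps_nth (fps_exp 1) i * fps_nth (\<Lambda> ^ i) n)"
      by (simp only: \<Lambda>_def fps_at0_power[symmetric] fps_at0_nth)
    also have "\<dots> = fps_nth (fps_exp 1 oo \<Lambda>) n"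
      by (simp add: fps_compose_nth atLeast0AtMost lessThan_Suc_atMost)
    finally show "fps_nth (fps_at0 (Ev D val Z)) n = fps_nth (fps_exp 1 oo \<Lambda>) n" .
  qed
qed

text \<open>Infinitesimal invariance of every coefficient; it is stable under ring operations and
  therefore passes from \<open>Z\<close> to its logarithm.\<close>

definition flat :: "(real \<Rightarrow> real fps fps) \<Rightarrow> bool" where
  "flat \<phi> \<longleftrightarrow> (\<forall>n k. ((\<lambda>t. fps_nth (fps_nth (\<phi> t) n) k) has_real_derivative 0) (at 0))"

lemma flat_const: "flat (\<lambda>t. F)" by (simp add: flat_def)

lemma flat_diff: "flat \<phi> \<Longrightarrow> flat \<psi> \<Longrightarrow> flat (\<lambda>t. \<phi> t - \<psi> t)"
  unfolding flat_def by (auto intro!: derivative_eq_intros)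

lemma flat_mult:
  assumes "flat \<phi>" "flat \<psi>"
  shows "flat (\<lambda>t. \<phi> t * \<psi> t)"
  unfolding flat_def
proof (intro allI)
  fix n k
  have "((\<lambda>t. \<Sum>i\<in>{0..n}. \<Sum>j\<in>{0..k}. fps_nth (fps_nth (\<phi> t) i) j * fps_nth (fps_nth (\<psi> t) (n - i)) (k - j))
      has_real_derivative (\<Sum>i\<in>{0..n}. \<Sum>j\<in>{0..k}. 0 * fps_nth (fps_nth (\<psi> 0) (n - i)) (k - j) + 0 * fps_nth (fps_nth (\<phi> 0) i) j)) (at 0)"
    using assms unfolding flat_def by (intro DERIV_sum DERIV_mult) auto
  thus "((\<lambda>t. fps_nth (fps_nth (\<phi> t * \<psi> t) n) k) has_real_derivative 0) (at 0)"
    by (simp add: fps_mult_nth fps_sum_nth)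
qed

lemma flat_power: "flat \<phi> \<Longrightarrow> flat (\<lambda>t. \<phi> t ^ n)"
  by (induction n) (auto intro: flat_mult flat_const)

lemma flat_Ev_formal_ln:
  assumes D: "finite D" "\<And>v. v \<in> D \<Longrightarrow> \<not> odd_var v" and Z: "good D Z" "wge 1 (Z - 1)"
    and fl: "flat (\<lambda>t. Ev D (val t) Z)"
  shows "flat (\<lambda>t. Ev D (val t) (formal_ln Z))"
  unfolding flat_def
proof (intro allI)
  fix n k
  have "flat (\<lambda>t. (Ev D (val t) (Z - 1)) ^ i)" for i
    unfolding Ev_diff Ev_1 by (intro flat_power flat_diff fl flat_const)
  hence "((\<lambda>t. fps_nth (fps_nth (Ev D (val t) (Z - 1) ^ i) n) k) has_real_derivative 0) (at 0)" for i
    by (simp add: flat_def)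
  hence "((\<lambda>t. \<Sum>i<Suc (n + 2 * k). fps_nth (fps_ln 1) i * fps_nth (fps_nth (Ev D (val t) (Z - 1) ^ i) n) k)
      has_real_derivative (\<Sum>i<Suc (n + 2 * k). fps_nth (fps_ln 1) i * 0)) (at 0)"
    by (intro DERIV_sum DERIV_cmult)
  moreover have "fps_nth (fps_nth (Ev D (val t) (formal_ln Z)) n) k =
      (\<Sum>i<Suc (n + 2 * k). fps_nth (fps_ln 1) i * fps_nth (fps_nth (Ev D (val t) (Z - 1) ^ i) n) k)" for t
    unfolding formal_ln_eq_subst
    by (rule Ev_subst_fps[OF D good_diff[OF Z(1) good_1] Z(2) lessI])
  ultimately show "((\<lambda>t. fps_nth (fps_nth (Ev D (val t) (formal_ln Z)) n) k) has_real_derivative 0) (at 0)"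
    by (simp only: mult_zero_right sum.neutral_const)
qed

subsection \<open>Perturbation theory for a cubic action\<close>

text \<open>The ghost number of a variable \<open>v\<close> is \<open>1 - form_degree v\<close>; hence \<open>gh0\<close> is total ghost number zero.\<close>
definition gh0 :: "var multiset \<Rightarrow> bool" where
  "gh0 m \<longleftrightarrow> (\<Sum>v\<in>#m. form_degree v) = size m"

lemma gh0_empty [simp]: "gh0 {#}" and gh0_plus: "gh0 a \<Longrightarrow> gh0 b \<Longrightarrow> gh0 (a + b)"
  by (simp_all add: gh0_def)

text \<open>A variable is odd exactly when its form degree plus 1 is odd; summing over the monomial
  gives the parity.\<close>

lemma gh0_even: "gh0 m \<Longrightarrow> even (num_odd m)"
proof -
  have "even (num_odd m) \<longleftrightarrow> even ((\<Sum>v\<in>#m. form_degree v) + size m)"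
    by (induction m) (auto simp: odd_var_def)
  thus "gh0 m \<Longrightarrow> even (num_odd m)" by (simp add: gh0_def)
qed

text \<open>A nonzero moment has a complete pairing, each pair having total form degree 2, so the
  average degree is 1.\<close>

lemma wick_degree:
  "wick p xs \<noteq> 0 \<Longrightarrow> (\<And>v w. p v w \<noteq> 0 \<Longrightarrow> form_degree v + form_degree w = 2) \<Longrightarrow>
   sum_list (map form_degree xs) = length xs"
proof (induction p xs rule: wick.induct)
  case (2 q x xs)
  from 2(2) obtain j where j: "j < length xs" "q x (xs ! j) \<noteq> 0"
      "wick q (take j xs @ drop (Suc j) xs) \<noteq> 0"
    by (auto elim!: sum.not_neutral_contains_not_neutral)
  have IH: "sum_list (map form_degree (take j xs @ drop (Suc j) xs)) = length (take j xs @ drop (Suc j) xs)"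
    by (rule "2.IH") (use j 2 in auto)
  have "sum_list (map form_degree xs) = sum_list (map form_degree (take j xs @ xs ! j # drop (Suc j) xs))"
    by (simp only: id_take_nth_drop[OF j(1), symmetric])
  also have "\<dots> = form_degree (xs ! j) + sum_list (map form_degree (take j xs @ drop (Suc j) xs))" by simp
  finally have "sum_list (map form_degree xs) = form_degree (xs ! j) + (length xs - 1)"
    using IH j(1) by simp
  thus ?case using 2(3)[OF j(2)] j(1) by simp
qed simp

definition mpow :: "var set \<Rightarrow> (var \<Rightarrow> var \<Rightarrow> real) \<Rightarrow> nat \<Rightarrow> var \<Rightarrow> var \<Rightarrow> real" where
  "mpow F X n = ((\<lambda>Y v w. \<Sum>u\<in>F. Y v u * X u w) ^^ n) (\<lambda>v w. if v = w then 1 else 0)"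

lemma mpow_0: "mpow F X 0 v w = (if v = w then 1 else 0)"
  and mpow_Suc: "mpow F X (Suc n) v w = (\<Sum>u\<in>F. mpow F X n v u * X u w)"
  by (simp_all add: mpow_def)

lemma mpow_Suc_left:
  "finite F \<Longrightarrow> v \<in> F \<Longrightarrow> w \<in> F \<Longrightarrow> mpow F X (Suc n) v w = (\<Sum>u\<in>F. X v u * mpow F X n u w)"
proof (induction n arbitrary: v w)
  case 0
  thus ?case by (simp add: mpow_Suc mpow_0 if_distrib[of "\<lambda>x. x * _"] if_distrib[of "\<lambda>x. _ * x"] cong: if_cong)
next
  case (Suc n)
  have "mpow F X (Suc (Suc n)) v w = (\<Sum>u\<in>F. (\<Sum>x\<in>F. X v x * mpow F X n x u) * X u w)"
    using Suc by (subst mpow_Suc) (intro sum.cong refl, simp)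
  also have "\<dots> = (\<Sum>x\<in>F. X v x * (\<Sum>u\<in>F. mpow F X n x u * X u w))"
    unfolding sum_distrib_right sum_distrib_left by (subst sum.swap) (simp add: mult.assoc)
  finally show ?case by (simp add: mpow_Suc)
qed

text \<open>The perturbative problem freed from its algebraic origin: \<open>R\<close> external and
  \<open>F\<close> internal variables, \<open>c\<close> the vertex, \<open>p\<close> the propagator.
  \<open>c_RRF\<close> reflects multiplicativity of \<iota>, \<open>c_0FF\<close> the unit, and the
  two degree conditions ghost number conservation.\<close>

locale cubic_theory = wick_form p F for p F +
  fixes R :: "var set" and c :: "var \<Rightarrow> var \<Rightarrow> var \<Rightarrow> real"
  assumes fin_R: "finite R"
    and R_resid: "v \<in> R \<Longrightarrow> is_resid v"
    and F_fluct: "v \<in> F \<Longrightarrow> \<not> is_resid v"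
    and c_sym1: "c v u w = sg u v * c u v w"
    and c_sym2: "c u w v = sg v w * c u v w"
    and c_deg: "c u v w \<noteq> 0 \<Longrightarrow> form_degree u + form_degree v + form_degree w = 3"
    and c_RRF: "u \<in> R \<Longrightarrow> v \<in> R \<Longrightarrow> w \<in> F \<Longrightarrow> c u v w = 0"
    and c_0FF: "u \<in> R \<Longrightarrow> form_degree u = 0 \<Longrightarrow> v \<in> F \<Longrightarrow> w \<in> F \<Longrightarrow> c u v w = 0"
    and p_deg: "p v w \<noteq> 0 \<Longrightarrow> form_degree v + form_degree w = 2"
begin

lemma RF_disjoint: "R \<inter> F = {}" using R_resid F_fluct by blast

lemma c_RFR: "u \<in> R \<Longrightarrow> v \<in> F \<Longrightarrow> w \<in> R \<Longrightarrow> c u v w = 0"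
  using c_sym2[of u v w] c_RRF[of u w v] by simp
lemma c_FRR: "u \<in> F \<Longrightarrow> v \<in> R \<Longrightarrow> w \<in> R \<Longrightarrow> c u v w = 0"
  using c_sym1[of u v w] c_RFR[of v u w] by simp
lemma c_F0F: "u \<in> F \<Longrightarrow> v \<in> R \<Longrightarrow> form_degree v = 0 \<Longrightarrow> w \<in> F \<Longrightarrow> c u v w = 0"
  using c_sym1[of u v w] c_0FF[of v u w] by simp
lemma c_FF0: "u \<in> F \<Longrightarrow> v \<in> F \<Longrightarrow> w \<in> R \<Longrightarrow> form_degree w = 0 \<Longrightarrow> c u v w = 0"
  using c_sym2[of u v w] c_F0F[of u w v] by simp

definition D :: "var set" where "D = {v \<in> R. form_degree v = 1}"

lemma fin_D: "finite D" using fin_R by (simp add: D_def)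
lemma D_even: "v \<in> D \<Longrightarrow> \<not> odd_var v" by (simp add: D_def odd_var_def)
lemma D_resid: "v \<in> D \<Longrightarrow> is_resid v" using R_resid by (simp add: D_def)
lemma DF_disjoint: "v \<in> D \<Longrightarrow> v \<notin> F" using D_resid F_fluct by blast

definition trip :: "var \<Rightarrow> var \<Rightarrow> var \<Rightarrow> real superseries" where
  "trip u v w = sconst (c u v w) * (svar u * (svar v * svar w))"

definition S :: "real superseries" where
  "S = sconst (1/6) * (\<Sum>u\<in>R \<union> F. \<Sum>v\<in>R \<union> F. \<Sum>w\<in>R \<union> F. trip u v w)"

definition W :: "real superseries" where
  "W = sconst (1/6) * (\<Sum>u\<in>R. \<Sum>v\<in>R. \<Sum>w\<in>R. trip u v w)"

definition V :: "real superseries" where "V = S - W"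

lemma sum3_cartesian:
  "(\<Sum>u\<in>A. \<Sum>v\<in>A. \<Sum>w\<in>A. h u v w) = (\<Sum>(u, v, w)\<in>A \<times> A \<times> A. h u v w)"
  by (simp add: sum.cartesian_product)

lemma V_eq: "V = sconst (1/6) * (\<Sum>(u, v, w)\<in>(R \<union> F) \<times> (R \<union> F) \<times> (R \<union> F) - R \<times> R \<times> R. trip u v w)"
proof -
  have "(\<Sum>(u, v, w)\<in>(R \<union> F) \<times> (R \<union> F) \<times> (R \<union> F) - R \<times> R \<times> R. trip u v w) =
      (\<Sum>(u, v, w)\<in>(R \<union> F) \<times> (R \<union> F) \<times> (R \<union> F). trip u v w) - (\<Sum>(u, v, w)\<in>R \<times> R \<times> R. trip u v w)"
    by (rule sum_diff) (use fin_R fin_V in auto)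
  thus ?thesis by (simp only: V_def S_def W_def sum3_cartesian right_diff_distrib)
qed

lemma supp_trip: "(c u v w \<noteq> 0 \<Longrightarrow> P {#u, v, w#}) \<Longrightarrow> supp_in P (trip u v w)"
proof (cases "c u v w = 0")
  case False
  assume "c u v w \<noteq> 0 \<Longrightarrow> P {#u, v, w#}"
  with False have "P {#u, v, w#}" by simp
  moreover have "{#u, v, w#} = {#u#} + ({#v#} + {#w#})" by (simp add: add_mset_commute)
  ultimately have "P ({#u#} + ({#v#} + {#w#}))" by (simp only:)
  moreover have sv: "supp_in (\<lambda>m. m = {#x#}) (svar x :: real superseries)" for x
    by (rule supp_in_svar) simp
  have "supp_in (\<lambda>m. m = {#v#} + {#w#}) (svar v * svar w :: real superseries)"
    by (rule supp_in_mult[OF sv sv]) simp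
  hence "supp_in (\<lambda>m. m = {#u#} + ({#v#} + {#w#})) (svar u * (svar v * svar w) :: real superseries)"
    by (rule supp_in_mult[OF sv]) (simp only:)
  ultimately show ?thesis
    unfolding trip_def by (intro supp_in_sconst_mult) (auto elim: supp_in_mono)
qed (simp add: trip_def)

definition nres :: "var multiset \<Rightarrow> nat" where "nres m = size (filter_mset is_resid m)"

lemma nres_simps [simp]: "nres {#} = 0" "nres (a + b) = nres a + nres b"
  "nres (add_mset v m) = (if is_resid v then 1 else 0) + nres m"
  by (simp_all add: nres_def)

lemma nres_resid: "resid m \<Longrightarrow> nres m = size m"
  by (induction m) (auto simp: resid_def)

text \<open>What monomials of \<open>V ^ n\<close> satisfy; the bound by \<open>n\<close> on the
  residual variables is the statement that a vertex has at most one external leg.\<close>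

definition vsupp :: "nat \<Rightarrow> var multiset \<Rightarrow> bool" where
  "vsupp n m \<longleftrightarrow> size m = 3 * n \<and> set_mset m \<subseteq> R \<union> F \<and> gh0 m \<and> nres m \<le> n \<and>
     (\<forall>v\<in>#m. is_resid v \<longrightarrow> form_degree v \<noteq> 0)"

lemma supp_V: "supp_in (vsupp 1) V"
  unfolding V_eq
proof (intro supp_in_sconst_mult supp_in_sum)
  fix t assume t: "t \<in> (R \<union> F) \<times> (R \<union> F) \<times> (R \<union> F) - R \<times> R \<times> R"
  obtain u v w where [simp]: "t = (u, v, w)" by (cases t)
  have "supp_in (vsupp 1) (trip u v w)"
  proof (rule supp_trip)
    assume nz: "c u v w \<noteq> 0"
    have mem: "u \<in> R \<union> F" "v \<in> R \<union> F" "w \<in> R \<union> F" and nR: "\<not> (u \<in> R \<and> v \<in> R \<and> w \<in> R)"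
      using t by auto
    have res: "is_resid x \<longleftrightarrow> x \<in> R" if "x \<in> R \<union> F" for x
      using that R_resid F_fluct by blast
    \<comment> \<open>Three residual legs were subtracted with \<open>W\<close>, and two are
      excluded by \<open>c_RRF\<close> in each of its three positions.\<close>
    have "nres {#u, v, w#} \<le> 1"
      using mem nR nz c_RRF[of u v w] c_RFR[of u v w] c_FRR[of u v w] by (auto simp: res)
    moreover have "\<forall>x\<in>#{#u, v, w#}. is_resid x \<longrightarrow> form_degree x \<noteq> 0"
      using mem nR nz c_RRF[of u v w] c_RFR[of u v w] c_FRR[of u v w]
        c_0FF[of u v w] c_F0F[of u v w] c_FF0[of u v w] by (auto simp: res)
    ultimately show "vsupp 1 {#u, v, w#}"
      using mem c_deg[OF nz] by (auto simp: vsupp_def gh0_def)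
  qed
  thus "supp_in (vsupp 1) (case t of (u, v, w) \<Rightarrow> trip u v w)" by simp
qed

lemma supp_V_power: "supp_in (vsupp n) (V ^ n)"
  by (rule supp_in_power[OF supp_V]) (auto simp: vsupp_def gh0_plus)

lemma cubic_V: "cubic V" "supp_in (\<lambda>m. set_mset m \<subseteq> R \<union> F) V"
  using supp_V by (auto simp: supp_in_def vsupp_def)

lemma supp_W: "supp_in (\<lambda>m. size m = 3 \<and> set_mset m \<subseteq> R \<and> gh0 m) W"
  unfolding W_def by (intro supp_in_sconst_mult supp_in_sum supp_trip) (auto simp: gh0_def dest: c_deg)

lemma cubic_W: "cubic W" "supp_in (\<lambda>m. set_mset m \<subseteq> R) W"
  using supp_W by (auto simp: supp_in_def)

lemma W_commute: "W * f = f * W"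
  by (rule even_commute) (use supp_W gh0_even in \<open>auto simp: supp_in_def\<close>)

definition Z :: "real fls superseries" where
  "Z = gaussian_average p (formal_exp (over_hbar V))"

lemma Z_nth: "fls_nth (scoeff Z m) k =
    (if resid m \<and> admissible m \<and> 0 \<le> int (size m) + 2 * k
     then let n = nat (int (size m) + 2 * k)
          in fluct_average p F (3 * n - size m) (V ^ n) m / fact n else 0)"
  unfolding Z_def by (rule fls_nth_gaussian_average[OF cubic_V]) (use R_resid F_fluct fin_V in auto)

text \<open>Contractions conserve ghost number, so the form degrees of the external legs sum to
  their number; as degree 0 is absent, all are 1. And at most one external leg per vertex means
  \<open>size m \<le> n = size m + 2 k\<close>, so \<open>k \<ge> 0\<close>.\<close>

lemma good_Z: "good D Z"
  unfolding good_def
proof (intro allI impI)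
  fix m k assume nz: "fls_nth (scoeff Z m) k \<noteq> 0"
  define n where "n = nat (int (size m) + 2 * k)"
  have m: "resid m" "0 \<le> int (size m) + 2 * k"
    and "fluct_average p F (3 * n - size m) (V ^ n) m \<noteq> 0"
    using nz by (auto simp: Z_nth n_def Let_def split: if_splits)
  then obtain M where M: "M \<in> msets F (3 * n - size m)"
      and "scoeff (V ^ n) (m + M) * wick p (sorted_list_of_multiset M) \<noteq> 0"
    unfolding fluct_average_def by (metis (no_types, lifting) sum.not_neutral_contains_not_neutral)
  hence Vn: "vsupp n (m + M)" and wick: "wick p (sorted_list_of_multiset M) \<noteq> 0"
    using supp_V_power[of n] by (auto simp: supp_in_def)
  have "sum_list (map form_degree (sorted_list_of_multiset M)) = length (sorted_list_of_multiset M)"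
    by (rule wick_degree[OF wick p_deg])
  hence "gh0 M"
    unfolding gh0_def by (metis mset_map mset_sorted_list_of_multiset size_mset sum_mset_sum_list)
  hence gm: "(\<Sum>v\<in>#m. form_degree v) = size m" using Vn by (auto simp: vsupp_def gh0_def)
  have ge: "1 \<le> form_degree v" if "v \<in># m" for v
    using that Vn m(1) by (auto simp: vsupp_def resid_def Suc_le_eq)
  have one: "form_degree v = 1" if v: "v \<in># m" for v
  proof (rule ccontr)
    assume "form_degree v \<noteq> 1"
    hence "2 \<le> form_degree v" using ge[OF v] by simp
    moreover obtain m' where m': "m = add_mset v m'" using v by (metis insert_DiffM)
    moreover have "size m' \<le> (\<Sum>v\<in>#m'. form_degree v)"
    proof -
      have "\<forall>v\<in>#m'. 1 \<le> form_degree v" using ge m' by auto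
      thus ?thesis by (induction m') auto
    qed
    ultimately show False using gm by simp
  qed
  have "set_mset m \<subseteq> R" using Vn m(1) F_fluct by (auto simp: vsupp_def resid_def)
  hence "set_mset m \<subseteq> D" using one by (auto simp: D_def)
  moreover have "size m \<le> n" using Vn nres_resid[OF m(1)] by (simp add: vsupp_def)
  hence "0 \<le> k" using m(2) by (simp add: n_def)
  ultimately show "set_mset m \<subseteq> D \<and> 0 \<le> k" by simp
qed

text \<open>Without negative powers of \<hbar> the only coefficient of weight 0 is the constant one,
  which is the normalised integral of 1.\<close>

lemma wge_Z: "wge 1 (Z - 1)"
  unfolding wge_def
proof (intro allI impI, rule ccontr)
  fix m k assume nz: "fls_nth (scoeff (Z - 1) m) k \<noteq> 0" and lt: "\<not> int 1 \<le> int (size m) + 2 * k"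
  have "0 \<le> k" using nz good_Z good_diff[OF good_Z good_1] unfolding good_def by blast
  hence "size m = 0" "k = 0" using lt by linarith+
  hence mk: "m = {#}" "k = 0" by simp_all
  have "fls_nth (scoeff Z {#}) 0 = 1"
    by (simp add: Z_nth fluct_average_def scoeff_one)
  thus False using nz mk by (simp add: scoeff_one)
qed

lemma gaussian_average_S:
  "gaussian_average p (formal_exp (over_hbar S)) = formal_exp (over_hbar W) * Z"
proof -
  have "S = W + V" by (simp add: V_def)
  thus ?thesis unfolding Z_def
    by (simp only:) (rule gaussian_average_factor[OF cubic_W cubic_V W_commute R_resid F_fluct fin_V])
qed

lemma good_ln_Z: "good D (formal_ln Z)"
  unfolding formal_ln_eq_subst
  by (rule good_subst_fps[OF wge_Z good_diff[OF good_Z good_1]])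

text \<open>\<open>W\<close> is even, hence central, so the exponentials of both summands multiply
  to the average; applying the logarithm to this exponential gives the sum back.\<close>

lemma ln_gaussian_average_S:
  "formal_ln (gaussian_average p (formal_exp (over_hbar S))) = over_hbar W + formal_ln Z"
proof -
  have lW: "wge 1 (over_hbar W)" by (rule wge_over_hbar[OF cubic_W(1)])
  have lZ: "wge 1 (formal_ln Z)" by (rule wge_formal_ln[OF wge_Z])
  have "over_hbar W * formal_ln Z = formal_ln Z * over_hbar W"
  proof (rule even_commute)
    have "supp_in (\<lambda>m. even (num_odd m)) (lift_const W)"
      using supp_W gh0_even by (auto simp: supp_in_def)
    thus "supp_in (\<lambda>m. even (num_odd m)) (over_hbar W)"
      unfolding over_hbar_def by (rule supp_in_sconst_mult)
  qed
  hence "formal_exp (over_hbar W + formal_ln Z) = formal_exp (over_hbar W) * Z"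
    using formal_exp_add[OF lW lZ] formal_exp_ln[OF wge_Z] by simp
  thus ?thesis
    unfolding gaussian_average_S by (metis formal_ln_exp lW lZ wge_add)
qed

text \<open>The shift by 1 is the prefactor \<hbar> in front of the logarithm.\<close>

definition loop :: "nat \<Rightarrow> real superseries" where
  "loop l = map_scoeff (\<lambda>x. fls_nth x (int l - 1)) (formal_ln Z)"

lemma scoeff_loop: "scoeff (loop l) m = fls_nth (scoeff (formal_ln Z) m) (int l - 1)"
  by (simp add: loop_def scoeff_map_scoeff)

text \<open>Since \<open>formal_ln Z\<close> has no negative powers of \<hbar>, \<hbar> times it
  starts at order 1, and order 0 consists of \<open>W\<close> alone.\<close>

lemma hbar_expansion:
  "sconst fls_X * formal_ln (gaussian_average p (formal_exp (over_hbar S))) =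
     hbar_series (\<lambda>l. if l = 0 then W else loop l)"
proof (rule superseries_eqI)
  fix m
  show "scoeff (sconst fls_X * formal_ln (gaussian_average p (formal_exp (over_hbar S)))) m =
      scoeff (hbar_series (\<lambda>l. if l = 0 then W else loop l)) m"
  proof (cases "admissible m")
    case True
    have X: "fls_nth (fls_X * x) k = fls_nth x (k - 1)" for x :: "real fls" and k
      using fls_X_power_times_conv_shift(1)[of 1 x] by simp
    have Xi: "fls_X * (fls_X_inv * x) = x" for x :: "real fls"
      by (simp add: fls_X_times_conv_shift fls_X_inv_times_conv_shift)
    have oW: "scoeff (over_hbar W) m = fls_X_inv * fls_const (scoeff W m)"
      by (simp add: over_hbar_def)
    have neg: "fls_nth (scoeff (formal_ln Z) m) k = 0" if "k < 0" for k
      using good_ln_Z that by (force simp: good_def)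
    have "scoeff (sconst fls_X * formal_ln (gaussian_average p (formal_exp (over_hbar S)))) m =
        fls_const (scoeff W m) + fls_X * scoeff (formal_ln Z) m"
      unfolding ln_gaussian_average_S by (simp add: distrib_left Xi oW)
    also have "\<dots> = fps_to_fls (Abs_fps (\<lambda>l. scoeff (if l = 0 then W else loop l) m))"
      by (rule fls_eqI) (auto simp: X neg scoeff_loop)
    finally show ?thesis using True by (simp add: hbar_series_def scoeff_superseries_of)
  qed (simp add: scoeff_not_admissible)
qed

lemma supp_loop: "scoeff (loop l) m \<noteq> 0 \<Longrightarrow> set_mset m \<subseteq> D"
  using good_ln_Z by (auto simp: good_def scoeff_loop)

end

lemma even_vars_inversions_right: "(\<And>v. v \<in># b \<Longrightarrow> \<not> odd_var v) \<Longrightarrow> inversions a b = 0"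
proof -
  assume "\<And>v. v \<in># b \<Longrightarrow> \<not> odd_var v"
  hence "filter_mset (\<lambda>w. odd_var w \<and> w < v) b = {#}" for v
    by (auto simp: filter_mset_eq_conv intro: multiset_eqI)
  thus ?thesis by (simp add: inversions_def)
qed

context cubic_theory
begin

subsection \<open>Evaluation of the residual variables\<close>

definition mval :: "(var \<Rightarrow> real) \<Rightarrow> var multiset \<Rightarrow> real" where
  "mval val m = (\<Prod>v\<in>#m. val v)"

lemma mval_simps [simp]: "mval val {#} = 1" "mval val (a + b) = mval val a * mval val b"
  "mval val (add_mset v a) = val v * mval val a"
  by (simp_all add: mval_def)

definition part :: "(var \<Rightarrow> real) \<Rightarrow> nat \<Rightarrow> real superseries \<Rightarrow> var multiset \<Rightarrow> real" where
  "part val i f M = (\<Sum>m\<in>msets D i. scoeff f (m + M) * mval val m)"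

text \<open>
  The evaluation, at \<open>val\<close>, of the residual variables in a series which is homogeneous of degree
  \<open>d\<close>; all residual variables of form degree other than 1 are set to zero.
\<close>
definition evF :: "(var \<Rightarrow> real) \<Rightarrow> nat \<Rightarrow> real superseries \<Rightarrow> real superseries" where
  "evF val d f = superseries_of (\<lambda>M. if set_mset M \<subseteq> F \<and> size M \<le> d then part val (d - size M) f M else 0)"

lemma part_zero: "supp_in (\<lambda>m. size m = d) f \<Longrightarrow> i + size M \<noteq> d \<Longrightarrow> part val i f M = 0"
  unfolding part_def by (auto intro!: sum.neutral simp: msets_def supp_in_def)

lemma evF_add: "evF val d (f + g) = evF val d f + evF val d g"
  by (rule superseries_eqI)
     (simp add: evF_def scoeff_superseries_of part_def distrib_right sum.distrib)

lemma evF_sconst_mult: "evF val d (sconst r * f) = sconst r * evF val d f"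
  by (rule superseries_eqI)
     (simp add: evF_def scoeff_superseries_of part_def sum_distrib_left mult.assoc)

lemma evF_0 [simp]: "evF val d 0 = 0"
  using evF_sconst_mult[of val d 0 0] by simp

lemma evF_sum: "evF val d (sum G A) = (\<Sum>a\<in>A. evF val d (G a))"
  by (induction A rule: infinite_finite_induct) (auto simp: evF_add)

lemma evF_1: "evF val 0 1 = 1"
  by (rule superseries_eqI) (auto simp: evF_def scoeff_superseries_of part_def scoeff_one)

text \<open>The evaluated variables are even, so the signs that remain are those of the
  fluctuations; homogeneity tells how many residual variables each factor has lost.\<close>

lemma evF_mult:
  assumes f: "supp_in (\<lambda>m. size m = d) f" and g: "supp_in (\<lambda>m. size m = e) g"
  shows "evF val (d + e) (f * g) = evF val d f * evF val e g"
proof (rule superseries_eqI)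
  fix M
  show "scoeff (evF val (d + e) (f * g)) M = scoeff (evF val d f * evF val e g) M"
  proof (cases "admissible M \<and> set_mset M \<subseteq> F")
    case True
    define N where "N = d + e - size M"
    let ?s = "\<lambda>b. (-1::real) ^ inversions b (M - b)"
    let ?h = "\<lambda>x y. \<Sum>b | b \<subseteq># M. ?s b * ((scoeff f (x + b) * mval val x) * (scoeff g (y + (M - b)) * mval val y))"
    have FM: "fluct M" using True F_fluct by (auto simp: fluct_def)
    have pr: "scoeff (f * g) (m + M) * mval val m = (\<Sum>x | x \<subseteq># m. ?h x (m - x))" if m: "m \<in> msets D N" for m
    proof -
      have ev: "\<not> odd_var v" if "v \<in># x" "x \<subseteq># m" for v x
        using that m D_even by (auto simp: msets_def dest: mset_subset_eqD)
      have rm: "resid m" using m D_resid by (auto simp: resid_def msets_def)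
      have adm: "admissible (m + M)"
        using admissible_resid_fluct[OF rm FM] True even_vars_admissible[of m] ev[of _ m] by auto
      have "scoeff (f * g) (m + M) = (\<Sum>x | x \<subseteq># m. \<Sum>b | b \<subseteq># M.
          ?s b * (scoeff f (x + b) * scoeff g (m - x + (M - b))))"
      proof -
        have "(-1) ^ inversions (x + b) (m + M - (x + b)) * scoeff f (x + b) * scoeff g (m + M - (x + b)) =
            ?s b * (scoeff f (x + b) * scoeff g (m - x + (M - b)))" if x: "x \<subseteq># m" and b: "b \<subseteq># M" for x b
        proof -
          have "inversions (x + b) (m - x + (M - b)) = inversions x (m - x + (M - b)) + (inversions b (m - x) + inversions b (M - b))"
            by (simp only: inversions_plus_left inversions_plus_right)
          also have "inversions x (m - x + (M - b)) = 0" by (rule even_vars_inversions) (rule ev[OF _ x])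
          also have "inversions b (m - x) = 0" by (rule even_vars_inversions_right) (rule ev[OF _ diff_subset_eq_self])
          finally show ?thesis by (simp only: mset_add_diff_split[OF x b] mult.assoc add_0)
        qed
        thus ?thesis
          unfolding scoeff_mult using adm
          by (simp only: if_True sum_submultisets_disjoint[OF resid_fluct_disjoint[OF rm FM]])
             (intro sum.cong refl, simp only: mem_Collect_eq)
      qed
      moreover have mm: "mval val m = mval val x * mval val (m - x)" if "x \<subseteq># m" for x
        using that by (metis mval_simps(2) subset_mset.add_diff_inverse)
      ultimately have "scoeff (f * g) (m + M) * mval val m = (\<Sum>x | x \<subseteq># m. \<Sum>b | b \<subseteq># M.
          ?s b * (scoeff f (x + b) * scoeff g (m - x + (M - b))) * mval val m)"
        by (simp only: sum_distrib_right)
      also have "\<dots> = (\<Sum>x | x \<subseteq># m. ?h x (m - x))"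
      proof (intro sum.cong refl)
        fix x b assume "x \<in> {x. x \<subseteq># m}"
        hence "mval val m = mval val x * mval val (m - x)" using mm by simp
        thus "?s b * (scoeff f (x + b) * scoeff g (m - x + (M - b))) * mval val m =
            ?s b * ((scoeff f (x + b) * mval val x) * (scoeff g (m - x + (M - b)) * mval val (m - x)))"
          by (simp only: mult_ac)
      qed
      finally show ?thesis .
    qed
    have hs: "(\<Sum>x\<in>msets D i. \<Sum>y\<in>msets D j. ?h x y) =
        (\<Sum>b | b \<subseteq># M. ?s b * (part val i f b * part val j g (M - b)))" for i j
    proof -
      have "(\<Sum>x\<in>msets D i. \<Sum>y\<in>msets D j. ?h x y) = (\<Sum>x\<in>msets D i. \<Sum>b | b \<subseteq># M. \<Sum>y\<in>msets D j.
          ?s b * ((scoeff f (x + b) * mval val x) * (scoeff g (y + (M - b)) * mval val y)))"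
        by (intro sum.cong refl sum.swap)
      also have "\<dots> = (\<Sum>b | b \<subseteq># M. \<Sum>x\<in>msets D i. \<Sum>y\<in>msets D j.
          ?s b * ((scoeff f (x + b) * mval val x) * (scoeff g (y + (M - b)) * mval val y)))"
        by (rule sum.swap)
      moreover have "part val i f b * part val j g (M - b) = (\<Sum>x\<in>msets D i. \<Sum>y\<in>msets D j.
          (scoeff f (x + b) * mval val x) * (scoeff g (y + (M - b)) * mval val y))" for b
        by (simp only: part_def sum_product)
      ultimately show ?thesis by (simp only: sum_distrib_left)
    qed
    \<comment> \<open>Because \<open>f\<close> is homogeneous of degree \<open>d\<close>, only the
      summand with \<open>i = d - size b\<close> survives.\<close>
    have split: "(\<Sum>i\<le>N. part val i f b * part val (N - i) g (M - b)) =
        (if size b \<le> d \<and> size (M - b) \<le> e then part val (d - size b) f b * part val (e - size (M - b)) g (M - b) else 0)"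
      if b: "b \<subseteq># M" and le: "size M \<le> d + e" for b
    proof -
      have sz: "size M = size b + size (M - b)"
        using b by (metis size_union subset_mset.add_diff_inverse)
      have "(\<Sum>i\<le>N. part val i f b * part val (N - i) g (M - b)) =
          (\<Sum>i\<le>N. if i = d - size b then (if size b \<le> d then part val (d - size b) f b * part val (N - (d - size b)) g (M - b) else 0) else 0)"
        by (intro sum.cong refl) (auto simp: part_zero[OF f])
      also have "\<dots> = (if d - size b \<le> N \<and> size b \<le> d then part val (d - size b) f b * part val (N - (d - size b)) g (M - b) else 0)"
        by auto
      finally have *: "(\<Sum>i\<le>N. part val i f b * part val (N - i) g (M - b)) =
          (if d - size b \<le> N \<and> size b \<le> d then part val (d - size b) f b * part val (N - (d - size b)) g (M - b) else 0)" .
      have "d - size b \<le> N \<and> size b \<le> d \<longleftrightarrow> size b \<le> d \<and> size (M - b) \<le> e"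
        using sz le by (auto simp: N_def)
      moreover have "N - (d - size b) = e - size (M - b)" if "size b \<le> d" "size (M - b) \<le> e"
        using sz that by (auto simp: N_def)
      ultimately show ?thesis unfolding * by (cases "size b \<le> d \<and> size (M - b) \<le> e") simp_all
    qed
    have rhs: "scoeff (evF val d f * evF val e g) M = (\<Sum>b | b \<subseteq># M. ?s b *
        (if size b \<le> d \<and> size (M - b) \<le> e then part val (d - size b) f b * part val (e - size (M - b)) g (M - b) else 0))"
    proof -
      have "scoeff (evF val d f) b = (if size b \<le> d then part val (d - size b) f b else 0)"
        "scoeff (evF val e g) (M - b) = (if size (M - b) \<le> e then part val (e - size (M - b)) g (M - b) else 0)"
        if "b \<subseteq># M" for b
        using True that admissible_mono[of M b] admissible_mono[of M "M - b"]
        by (auto simp: evF_def scoeff_superseries_of dest: mset_subset_eqD in_diffD)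
      thus ?thesis using True unfolding scoeff_mult
        by (simp only: if_True) (intro sum.cong refl, auto)
    qed
    show ?thesis
    proof (cases "size M \<le> d + e")
      case le: True
      have "scoeff (evF val (d + e) (f * g)) M = (\<Sum>m\<in>msets D N. \<Sum>x | x \<subseteq># m. ?h x (m - x))"
        using True le by (simp add: evF_def scoeff_superseries_of part_def pr flip: N_def)
      also have "\<dots> = (\<Sum>i\<le>N. \<Sum>b | b \<subseteq># M. ?s b * (part val i f b * part val (N - i) g (M - b)))"
        using sum_msets_split[OF fin_D, where h = ?h and n = N] by (simp only: hs)
      also have "\<dots> = (\<Sum>b | b \<subseteq># M. ?s b * (\<Sum>i\<le>N. part val i f b * part val (N - i) g (M - b)))"
        by (subst sum.swap) (simp add: sum_distrib_left)
      finally show ?thesis unfolding rhs using le by (simp add: split)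
    next
      case False
      have "\<not> (size b \<le> d \<and> size (M - b) \<le> e)" if "b \<subseteq># M" for b
        using that False by (metis add_mono size_union subset_mset.add_diff_inverse)
      hence "scoeff (evF val d f * evF val e g) M = 0"
        unfolding rhs by (intro sum.neutral) auto
      thus ?thesis using False by (simp add: evF_def scoeff_superseries_of)
    qed
  next
    case False
    have "scoeff (evF val d f) b * scoeff (evF val e g) (M - b) = 0" if "b \<subseteq># M" "admissible M" for b
    proof -
      have "\<not> (set_mset b \<subseteq> F \<and> set_mset (M - b) \<subseteq> F)"
        using False that by (metis Un_subset_iff set_mset_union subset_mset.add_diff_inverse)
      thus ?thesis by (auto simp: evF_def scoeff_superseries_of)
    qed
    hence "scoeff (evF val d f * evF val e g) M = 0"
      unfolding scoeff_mult mult.assoc by (cases "admissible M") (auto intro!: sum.neutral)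
    moreover have "scoeff (evF val (d + e) (f * g)) M = 0"
      using False by (auto simp: evF_def scoeff_superseries_of)
    ultimately show ?thesis by simp
  qed
qed

definition ev1 :: "(var \<Rightarrow> real) \<Rightarrow> var \<Rightarrow> real superseries" where
  "ev1 val x = (if x \<in> F then svar x else if x \<in> D then sconst (val x) else 0)"

lemma evF_svar: "evF val 1 (svar x) = ev1 val x"
proof (rule superseries_eqI)
  fix M :: "var multiset"
  consider "M = {#}" | y where "M = {#y#}" | "size M > 1"
    by (metis One_nat_def less_one linorder_neqE_nat size_1_singleton_mset size_eq_0_iff_empty)
  thus "scoeff (evF val 1 (svar x)) M = scoeff (ev1 val x) M"
  proof cases
    case 1
    have "part val 1 (svar x) {#} = (if x \<in> D then val x else 0)"
    proof -
      have "part val 1 (svar x) {#} = (\<Sum>m\<in>msets D 1. if m = {#x#} then val x else 0)"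
        unfolding part_def by (intro sum.cong) (auto simp: scoeff_svar)
      also have "\<dots> = (if {#x#} \<in> msets D 1 then val x else 0)"
        by (rule sum.delta) (rule finite_msets[OF fin_D])
      finally show ?thesis by (simp add: msets_def)
    qed
    thus ?thesis using 1 DF_disjoint[of x]
      by (auto simp: evF_def scoeff_superseries_of ev1_def scoeff_svar scoeff_sconst)
  next
    case (2 y)
    thus ?thesis by (auto simp: evF_def scoeff_superseries_of ev1_def part_def scoeff_svar scoeff_sconst)
  next
    case 3
    thus ?thesis by (auto simp: evF_def scoeff_superseries_of ev1_def scoeff_svar scoeff_sconst)
  qed
qed

lemma evF_trip: "evF val 3 (trip u v w) = sconst (c u v w) * (ev1 val u * (ev1 val v * ev1 val w))"
proof -
  have sv: "supp_in (\<lambda>m. size m = 1) (svar x :: real superseries)" for x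
    by (rule supp_in_svar) simp
  have sv2: "supp_in (\<lambda>m. size m = 2) (svar v * svar w :: real superseries)"
    by (rule supp_in_mult[OF sv sv]) simp
  have "evF val 2 (svar v * svar w) = ev1 val v * ev1 val w"
    using evF_mult[OF sv sv, of val v w] by (simp only: evF_svar one_add_one)
  moreover have "(1::nat) + 2 = 3" by simp
  ultimately have "evF val 3 (svar u * (svar v * svar w)) = ev1 val u * (ev1 val v * ev1 val w)"
    using evF_mult[OF sv sv2, of val u] by (metis evF_svar)
  thus ?thesis by (simp add: trip_def evF_sconst_mult)
qed

lemma evF_power: "supp_in (\<lambda>m. size m = 3) f \<Longrightarrow> evF val (3 * n) (f ^ n) = evF val 3 f ^ n"
proof (induction n)
  case (Suc n)
  have "evF val (3 + 3 * n) (f * f ^ n) = evF val 3 f * evF val (3 * n) (f ^ n)"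
    by (rule evF_mult[OF Suc.prems cubic_power[OF Suc.prems]])
  thus ?case using Suc by simp
qed (simp add: evF_1)

definition A :: "(var \<Rightarrow> real) \<Rightarrow> var \<Rightarrow> var \<Rightarrow> real" where
  "A val v w = (\<Sum>x\<in>D. val x * c v x w)"

definition Q :: "(var \<Rightarrow> real) \<Rightarrow> real superseries" where
  "Q val = sconst (1/2) * (\<Sum>v\<in>F. \<Sum>w\<in>F. sconst (A val v w) * (svar v * svar w))"

definition C3 :: "real superseries" where
  "C3 = sconst (1/6) * (\<Sum>u\<in>F. \<Sum>v\<in>F. \<Sum>w\<in>F. trip u v w)"

lemma c_D1: "x \<in> D \<Longrightarrow> c x v w = c v x w" and c_D2: "x \<in> D \<Longrightarrow> c v w x = c v x w"
  using c_sym1[of v x w] c_sym2[of v w x] D_even[of x] by (auto simp: sg_def)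

text \<open>The evaluated leg can stand in three places, each giving the same sum because degree one
  variables are even; three times 1/6 is the 1/2 in \<open>Q\<close>.\<close>

lemma evF_V: "evF val 3 V = Q val + C3"
proof -
  define h where "h u v w = evF val 3 (trip u v w)" for u v w
  have h: "h u v w = sconst (c u v w) * (ev1 val u * (ev1 val v * ev1 val w))" for u v w
    by (simp add: h_def evF_trip)
  have evd: "evF val 3 (f - g) = evF val 3 f - evF val 3 g" for f g
    using evF_add[of val 3 "f - g" g] by simp
  have un: "(\<Sum>u\<in>R \<union> F. t u) = (\<Sum>u\<in>R. t u) + (\<Sum>u\<in>F. t u)" for t :: "var \<Rightarrow> real superseries"
    by (rule sum.union_disjoint[OF fin_R fin_V RF_disjoint])
  have z: "(\<Sum>u\<in>R. \<Sum>v\<in>R. \<Sum>w\<in>F. h u v w) = 0" "(\<Sum>u\<in>R. \<Sum>v\<in>F. \<Sum>w\<in>R. h u v w) = 0"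
    "(\<Sum>u\<in>F. \<Sum>v\<in>R. \<Sum>w\<in>R. h u v w) = 0"
    by (auto simp: h c_RRF c_RFR c_FRR)
  have RD: "(\<Sum>x\<in>R. t x) = (\<Sum>x\<in>D. t x)" if "\<And>x. x \<in> R - D \<Longrightarrow> t x = 0" for t :: "var \<Rightarrow> real superseries"
    using that by (intro sum.mono_neutral_right[OF fin_R]) (auto simp: D_def)
  have e0: "ev1 val x = 0" if "x \<in> R - D" for x
    using that RF_disjoint by (auto simp: ev1_def)
  have eD: "ev1 val x = sconst (val x)" if "x \<in> D" for x using that DF_disjoint by (simp add: ev1_def)
  have eF: "ev1 val x = svar x" if "x \<in> F" for x using that by (simp add: ev1_def)
  have AA: "(\<Sum>x\<in>D. sconst (val x * c v x w) * f) = sconst (A val v w) * f" for v w f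
    by (simp add: A_def sconst_sum sum_distrib_right)
  have cm: "svar w * sconst r = sconst r * (svar w :: real superseries)" for w r
    by (simp only: sconst_commute)
  define B where "B = (\<Sum>v\<in>F. \<Sum>w\<in>F. sconst (A val v w) * (svar v * svar w))"
  have b1: "(\<Sum>u\<in>R. \<Sum>v\<in>F. \<Sum>w\<in>F. h u v w) = B"
  proof -
    have "(\<Sum>u\<in>R. \<Sum>v\<in>F. \<Sum>w\<in>F. h u v w) = (\<Sum>u\<in>D. \<Sum>v\<in>F. \<Sum>w\<in>F. h u v w)"
      by (rule RD) (auto simp: h e0)
    also have "\<dots> = (\<Sum>x\<in>D. \<Sum>v\<in>F. \<Sum>w\<in>F. sconst (val x * c v x w) * (svar v * svar w))"
      by (intro sum.cong refl) (simp add: h eD eF c_D1 c_D1[symmetric] sconst_mult_assoc mult.commute)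
    also have "\<dots> = (\<Sum>v\<in>F. \<Sum>x\<in>D. \<Sum>w\<in>F. sconst (val x * c v x w) * (svar v * svar w))"
      by (rule sum.swap)
    also have "\<dots> = (\<Sum>v\<in>F. \<Sum>w\<in>F. \<Sum>x\<in>D. sconst (val x * c v x w) * (svar v * svar w))"
      by (intro sum.cong refl sum.swap)
    finally show ?thesis by (simp only: AA B_def)
  qed
  have b2: "(\<Sum>v\<in>F. \<Sum>u\<in>R. \<Sum>w\<in>F. h v u w) = B"
  proof -
    have "(\<Sum>u\<in>R. \<Sum>w\<in>F. h v u w) = (\<Sum>w\<in>F. sconst (A val v w) * (svar v * svar w))" if v: "v \<in> F" for v
    proof -
      have "(\<Sum>u\<in>R. \<Sum>w\<in>F. h v u w) = (\<Sum>u\<in>D. \<Sum>w\<in>F. h v u w)"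
        by (rule RD) (auto simp: h e0)
      also have "\<dots> = (\<Sum>x\<in>D. \<Sum>w\<in>F. sconst (val x * c v x w) * (svar v * svar w))"
        by (intro sum.cong refl)
           (simp add: h v eD eF sconst_left_commute[of "svar v"] sconst_mult_assoc mult.commute)
      also have "\<dots> = (\<Sum>w\<in>F. \<Sum>x\<in>D. sconst (val x * c v x w) * (svar v * svar w))"
        by (rule sum.swap)
      finally show ?thesis by (simp only: AA)
    qed
    thus ?thesis by (simp add: B_def)
  qed
  have b3: "(\<Sum>v\<in>F. \<Sum>w\<in>F. \<Sum>u\<in>R. h v w u) = B"
  proof -
    have "(\<Sum>u\<in>R. h v w u) = sconst (A val v w) * (svar v * svar w)" if v: "v \<in> F" "w \<in> F" for v w
    proof -
      have "(\<Sum>u\<in>R. h v w u) = (\<Sum>u\<in>D. h v w u)"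
        by (rule RD) (auto simp: h e0)
      also have "\<dots> = (\<Sum>x\<in>D. sconst (val x * c v x w) * (svar v * svar w))"
        by (intro sum.cong refl)
           (simp add: h v eD eF c_D2 cm sconst_left_commute[of "svar v"] sconst_mult_assoc mult.commute)
      finally show ?thesis by (simp only: AA)
    qed
    thus ?thesis by (simp add: B_def)
  qed
  have FFF: "(\<Sum>u\<in>F. \<Sum>v\<in>F. \<Sum>w\<in>F. h u v w) = (\<Sum>u\<in>F. \<Sum>v\<in>F. \<Sum>w\<in>F. trip u v w)"
    by (intro sum.cong refl) (simp add: h eF trip_def)
  have "evF val 3 V = sconst (1/6) * ((\<Sum>u\<in>R \<union> F. \<Sum>v\<in>R \<union> F. \<Sum>w\<in>R \<union> F. h u v w) - (\<Sum>u\<in>R. \<Sum>v\<in>R. \<Sum>w\<in>R. h u v w))"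
    by (simp add: V_def S_def W_def evd evF_sconst_mult evF_sum h_def right_diff_distrib)
  also have "(\<Sum>u\<in>R \<union> F. \<Sum>v\<in>R \<union> F. \<Sum>w\<in>R \<union> F. h u v w) - (\<Sum>u\<in>R. \<Sum>v\<in>R. \<Sum>w\<in>R. h u v w)
      = B + B + B + (\<Sum>u\<in>F. \<Sum>v\<in>F. \<Sum>w\<in>F. trip u v w)"
    unfolding un sum.distrib z b1 b2 b3 FFF by (simp add: algebra_simps)
  also have "sconst (1/6) * (B + B + B + y) = sconst (1/2) * B + sconst (1/6) * y" for y
    by (rule superseries_eqI) (simp add: field_simps)
  finally show ?thesis by (simp add: Q_def C3_def B_def)
qed

text \<open>With \<open>n\<close> external legs at order \<open>k\<close> in \<hbar> there are
  \<open>n + 2 k\<close> vertices, leaving \<open>3 (n + 2 k) - n = 2 (n + 3 k)\<close> legs to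
  contract.\<close>

lemma Ev_Z: "fps_nth (fps_nth (Ev D val Z) n) k =
    J (n + 3 * k) ((Q val + C3) ^ (n + 2 * k)) / fact (n + 2 * k)"
proof -
  define N where "N = n + 2 * k"
  have h: "3 * N - n = 2 * (n + 3 * k)" by (simp add: N_def)
  have "fps_nth (fps_nth (Ev D val Z) n) k = (\<Sum>m\<in>msets D n. fluct_average p F (3 * N - n) (V ^ N) m / fact N * mval val m)"
    unfolding Ev_nth mval_def[symmetric]
  proof (rule sum.cong[OF refl])
    fix m assume m: "m \<in> msets D n"
    hence "resid m" "admissible m"
      using D_resid D_even by (auto simp: msets_def resid_def intro!: even_vars_admissible)
    moreover have "size m = n" using m by (simp add: msets_def)
    moreover have "nat (int n + 2 * int k) = N" by (simp add: N_def)
    ultimately show "fls_nth (scoeff Z m) (int k) * mval val m = fluct_average p F (3 * N - n) (V ^ N) m / fact N * mval val m"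
      by (simp add: Z_nth Let_def)
  qed
  also have "\<dots> = (\<Sum>m\<in>msets D n. \<Sum>M\<in>msets F (3 * N - n). scoeff (V ^ N) (m + M) * mval val m * wick p (sorted_list_of_multiset M)) / fact N"
    by (simp add: fluct_average_def sum_divide_distrib sum_distrib_right sum_distrib_left mult_ac)
  also have "\<dots> = (\<Sum>M\<in>msets F (3 * N - n). part val n (V ^ N) M * wick p (sorted_list_of_multiset M)) / fact N"
    by (subst sum.swap) (simp add: part_def sum_distrib_right)
  also have "\<dots> = (\<Sum>M\<in>msets F (3 * N - n). scoeff (evF val (3 * N) (V ^ N)) M * wick p (sorted_list_of_multiset M)) / fact N"
  proof (intro arg_cong[where f = "\<lambda>x. x / fact N"] sum.cong refl)
    fix M assume M: "M \<in> msets F (3 * N - n)"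
    hence "3 * N - size M = n" "size M \<le> 3 * N" by (auto simp: msets_def N_def)
    moreover have "part val n (V ^ N) M = 0" if "\<not> admissible M"
    proof -
      have "scoeff (V ^ N) (m + M) = 0" for m
        using that by (meson admissible_mono mset_subset_eq_add_right scoeff_not_admissible)
      thus ?thesis by (simp add: part_def)
    qed
    ultimately show "part val n (V ^ N) M * wick p (sorted_list_of_multiset M) =
        scoeff (evF val (3 * N) (V ^ N)) M * wick p (sorted_list_of_multiset M)"
      using M by (auto simp: evF_def scoeff_superseries_of msets_def)
  qed
  finally show ?thesis
    unfolding evF_power[OF cubic_V(1)] evF_V h J_eq_sum_wick[symmetric] by (simp only: N_def)
qed

end

context cubic_theory
begin

subsection \<open>The one-loop part\<close>

lemma A_sym: "A val w v = sg v w * A val v w"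
proof -
  have "c w x v = sg v w * c v x w" if "x \<in> D" for x
    using c_D1[OF that, of w v] c_sym2[of x w v] c_D1[OF that, of v w] by simp
  thus ?thesis by (simp add: A_def sum_distrib_left mult_ac)
qed

lemma A_par: "A val v w \<noteq> 0 \<Longrightarrow> form_degree v + form_degree w = 2"
  unfolding A_def by (auto simp: D_def elim!: sum.not_neutral_contains_not_neutral dest!: c_deg)

lemma par_of_sum2: "form_degree v + form_degree w = 2 \<Longrightarrow> odd_var v = odd_var w"
  unfolding odd_var_def by (metis even_add even_numeral)

text \<open>Differentiating either factor of the quadratic form gives the same term by
  \<open>A_sym\<close>, which cancels the 1/2.\<close>

lemma sderiv_Q_mult: "sderiv u (Q val * f) =
    (\<Sum>w\<in>F. sconst (A val u w) * svar w) * f + Q val * sderiv u f" if u: "u \<in> F"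
proof -
  have par: "odd_var v = odd_var w" if "A val v w \<noteq> 0" for v w
    by (rule par_of_sum2[OF A_par[OF that]])
  have d: "sconst (A val v w) * sderiv u (svar v * (svar w * f)) =
      (if v = u then sconst (A val u w) * (svar w * f) else 0) +
      (if w = u then sconst (A val u v) * (svar v * f) else 0) +
      sconst (A val v w) * (svar v * (svar w * sderiv u f))" for v w
  proof -
    have s1: "sconst (A val v w) * (sconst (sg u v) * (svar v * (if w = u then f else 0))) =
        (if w = u then sconst (A val u v) * (svar v * f) else 0)"
      using A_sym[of val u v] by (simp add: sconst_mult_assoc mult.commute sg_commute)
    have s2: "sconst (A val v w) * (sconst (sg u v) * (svar v * (sconst (sg u w) * g))) =
        sconst (A val v w) * (svar v * g)" for g
    proof (cases "A val v w = 0")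
      case False
      hence "sg u v * sg u w = 1" using par[OF False] by (simp add: sg_def)
      hence "A val v w * (sg u v * sg u w) = A val v w" by simp
      thus ?thesis by (simp only: sconst_left_commute[of "svar v"] sconst_mult_assoc mult.assoc)
    qed simp
    have "sconst (A val v w) * sderiv u (svar v * (svar w * f)) =
      sconst (A val v w) * (if v = u then svar w * f else 0) +
      sconst (A val v w) * (sconst (sg u v) * (svar v * (if w = u then f else 0))) +
      sconst (A val v w) * (sconst (sg u v) * (svar v * (sconst (sg u w) * (svar w * sderiv u f))))"
      by (simp only: sderiv_svar_mult distrib_left add.assoc)
    thus ?thesis unfolding s1 s2 by (simp add: if_distrib cong: if_cong)
  qed
  have "sderiv u (Q val * f) = sconst (1/2) * (\<Sum>v\<in>F. \<Sum>w\<in>F. sconst (A val v w) * sderiv u (svar v * (svar w * f)))"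
    by (simp add: Q_def sum_distrib_right mult.assoc)
  also have "\<dots> = sconst (1/2) * ((\<Sum>w\<in>F. sconst (A val u w) * (svar w * f)) + (\<Sum>v\<in>F. sconst (A val u v) * (svar v * f)))
      + Q val * sderiv u f"
  proof -
    have "(\<Sum>v\<in>F. \<Sum>w\<in>F. if v = u then sconst (A val u w) * (svar w * f) else 0) = (\<Sum>w\<in>F. sconst (A val u w) * (svar w * f))"
      by (subst sum.swap) (simp add: u fin_V)
    moreover have "(\<Sum>v\<in>F. \<Sum>w\<in>F. if w = u then sconst (A val u v) * (svar v * f) else 0) = (\<Sum>v\<in>F. sconst (A val u v) * (svar v * f))"
      by (simp add: u fin_V)
    ultimately show ?thesis
      unfolding d sum.distrib by (simp add: Q_def sum_distrib_right distrib_left mult.assoc)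
  qed
  also have "sconst (1/2) * (y + y) = y" for y :: "real superseries"
    by (rule superseries_eqI) simp
  finally show ?thesis by (simp add: sum_distrib_right mult.assoc)
qed

lemma Q_even: "supp_in (\<lambda>m. even (num_odd m)) (Q val)"
  unfolding Q_def
proof (rule supp_in_sconst_mult, rule supp_in_sum, rule supp_in_sum)
  fix v w
  show "supp_in (\<lambda>m. even (num_odd m)) (sconst (A val v w) * (svar v * svar w))"
  proof (cases "A val v w = 0")
    case False
    have "odd_var v = odd_var w" by (rule par_of_sum2[OF A_par[OF False]])
    hence "supp_in (\<lambda>m. even (num_odd m)) (svar v * svar w :: real superseries)"
      by (intro supp_in_mult[of "\<lambda>m. m = {#v#}" _ "\<lambda>m. m = {#w#}"] supp_in_svar) auto
    thus ?thesis by (rule supp_in_sconst_mult)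
  qed simp
qed

lemma Q_commute: "Q val * f = f * Q val"
  by (rule even_commute[OF Q_even])

lemma sderiv_Q_power: "u \<in> F \<Longrightarrow> sderiv u (Q val ^ Suc n) =
    sconst (real (Suc n)) * ((\<Sum>w\<in>F. sconst (A val u w) * svar w) * Q val ^ n)"
proof (induction n)
  case 0
  thus ?case using sderiv_Q_mult[of u val 1] by (simp add: sconst_1)
next
  case (Suc n)
  let ?d = "\<Sum>w\<in>F. sconst (A val u w) * svar w"
  have "sderiv u (Q val ^ Suc (Suc n)) = ?d * Q val ^ Suc n + Q val * (sconst (real (Suc n)) * (?d * Q val ^ n))"
    unfolding power_Suc[of _ "Suc n"] sderiv_Q_mult[OF Suc.prems] Suc.IH[OF Suc.prems] ..
  also have "Q val * (sconst (real (Suc n)) * (?d * Q val ^ n)) = sconst (real (Suc n)) * (?d * Q val ^ Suc n)"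
  proof -
    have "Q val * (?d * Q val ^ n) = ?d * Q val ^ Suc n"
      by (simp only: mult.assoc[symmetric] Q_commute[of val ?d] power_Suc)
    thus ?thesis by (simp only: sconst_left_commute[of "Q val"])
  qed
  also have "?d * Q val ^ Suc n + sconst (real (Suc n)) * (?d * Q val ^ Suc n) =
      sconst (real (Suc (Suc n))) * (?d * Q val ^ Suc n)"
    by (rule superseries_eqI) (simp add: algebra_simps)
  finally show ?case .
qed

text \<open>The coefficient of degree \<open>n\<close> of the Gaussian integral of
  \<open>exp Q\<close>, that is, of \<open>Z\<close> at \<hbar> = 0.\<close>

definition zc :: "(var \<Rightarrow> real) \<Rightarrow> nat \<Rightarrow> real" where
  "zc val n = J n (Q val ^ n) / fact n"

text \<open>Propagator times vertex form; it turns out to be the matrix of K l(\<iota>(\<alpha>), .)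
  on the span of the fluctuations.\<close>

definition X :: "(var \<Rightarrow> real) \<Rightarrow> var \<Rightarrow> var \<Rightarrow> real" where
  "X val v w = (\<Sum>u\<in>F. p v u * A val u w)"

text \<open>The coefficient of degree \<open>n\<close> of the unnormalised two-point function in the
  presence of \<open>exp Q\<close>.\<close>

definition gc :: "(var \<Rightarrow> real) \<Rightarrow> nat \<Rightarrow> var \<Rightarrow> var \<Rightarrow> real" where
  "gc val n x y = J (Suc n) (svar x * (svar y * Q val ^ n)) / fact n"

lemma J_contract: "J (Suc k) (svar x * f) = - (\<Sum>u\<in>F. p x u * J k (sderiv u f))"
  by (simp add: J_Suc_svar_mult contract_def J_uminus J_sum J_sconst)

lemma zc_0: "zc val 0 = 1"
  by (simp add: zc_def J_def scoeff_one)

lemma gc_0: "gc val 0 x y = - p x y * zc val 0"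
proof -
  have "p x u * J 0 (sderiv u (svar y)) = (if u = y then p x y else 0)" for u
    by (simp add: sderiv_svar J_def scoeff_sconst)
  hence "gc val 0 x y = - (\<Sum>u\<in>F. if u = y then p x y else 0)"
    by (simp add: gc_def J_contract)
  thus ?thesis using p_supp[of x y] fin_V by (cases "y \<in> F"; cases "p x y = 0") (auto simp: zc_0)
qed

text \<open>The Schwinger-Dyson equation: \<open>x\<close> is contracted either with
  \<open>y\<close> or with a leg of one of the quadratic vertices, whose other leg then replaces
  \<open>x\<close>.\<close>

lemma gc_Suc: "gc val (Suc n) x y = - p x y * zc val (Suc n) - (\<Sum>w\<in>F. X val x w * gc val n w y)"
proof -
  let ?Qn = "Q val ^ n"
  have d: "p x u * J (Suc n) (sderiv u (svar y * Q val ^ Suc n)) =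
      (if u = y then p x y * J (Suc n) (Q val ^ Suc n) else 0) +
      (\<Sum>w\<in>F. p x u * A val u w * (real (Suc n) * J (Suc n) (svar w * (svar y * ?Qn))))" if u: "u \<in> F" for u
  proof -
    have "svar y * sderiv u (Q val ^ Suc n) =
        sconst (real (Suc n)) * (\<Sum>w\<in>F. sconst (A val u w * sg y w) * (svar w * (svar y * ?Qn)))"
      unfolding sderiv_Q_power[OF u] sum_distrib_right
      by (simp only: sconst_left_commute[of "svar y"] sum_distrib_left[of "svar y"] mult.assoc
          sg_mult_svar_commute[of y] sconst_mult_assoc)
    hence J: "J (Suc n) (svar y * sderiv u (Q val ^ Suc n)) =
        (\<Sum>w\<in>F. A val u w * sg y w * (real (Suc n) * J (Suc n) (svar w * (svar y * ?Qn))))"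
      by (simp only: J_sconst J_sum sum_distrib_left) (simp only: mult_ac)
    have sg: "p x u * (sg u y * (A val u w * sg y w)) = p x u * A val u w" for w
    proof (cases "A val u w = 0")
      case False
      thus ?thesis using par_of_sum2[OF A_par[OF False]] by (auto simp: sg_def)
    qed simp
    have "p x u * J (Suc n) (sderiv u (svar y * Q val ^ Suc n)) =
      p x u * J (Suc n) (if y = u then Q val ^ Suc n else 0) +
      p x u * (sg u y * J (Suc n) (svar y * sderiv u (Q val ^ Suc n)))"
      by (simp only: sderiv_svar_mult J_add J_sconst distrib_left)
    also have "p x u * (sg u y * J (Suc n) (svar y * sderiv u (Q val ^ Suc n))) =
       (\<Sum>w\<in>F. p x u * (sg u y * (A val u w * sg y w)) * (real (Suc n) * J (Suc n) (svar w * (svar y * ?Qn))))"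
      unfolding J sum_distrib_left by (simp only: mult.assoc)
    finally show ?thesis unfolding sg by auto
  qed
  have s: "(\<Sum>u\<in>F. if u = y then p x y * J (Suc n) (Q val ^ Suc n) else 0) = p x y * J (Suc n) (Q val ^ Suc n)"
    using fin_V p_supp[of x y] by (cases "y \<in> F"; cases "p x y = 0") auto
  have "J (Suc (Suc n)) (svar x * (svar y * Q val ^ Suc n)) =
      - (p x y * J (Suc n) (Q val ^ Suc n) + (\<Sum>u\<in>F. \<Sum>w\<in>F. p x u * A val u w * (real (Suc n) * J (Suc n) (svar w * (svar y * ?Qn)))))"
    unfolding J_contract[of "Suc n"] by (simp add: d sum.distrib s del: power_Suc of_nat_Suc)
  also have "(\<Sum>u\<in>F. \<Sum>w\<in>F. p x u * A val u w * (real (Suc n) * J (Suc n) (svar w * (svar y * ?Qn)))) =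
      (\<Sum>w\<in>F. X val x w * (real (Suc n) * J (Suc n) (svar w * (svar y * ?Qn))))"
    unfolding X_def sum_distrib_right by (rule sum.swap)
  also have "\<dots> = fact (Suc n) * (\<Sum>w\<in>F. X val x w * gc val n w y)"
    unfolding sum_distrib_left gc_def by (intro sum.cong refl) (simp add: field_simps)
  finally show ?thesis
    by (simp add: gc_def[of _ "Suc n"] zc_def[of _ "Suc n"] add_divide_distrib diff_divide_distrib del: power_Suc fact_Suc)
qed

text \<open>Iterating \<open>gc_Suc\<close> yields the geometric series of the full propagator
  \<open>- (1 + X)^-1 p\<close>, multiplied by the partition function.\<close>

lemma gc_eq: "x \<in> F \<Longrightarrow> gc val n x y =
    - (\<Sum>j\<le>n. (-1) ^ j * zc val (n - j) * (\<Sum>u\<in>F. mpow F (X val) j x u * p u y))"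
proof (induction n arbitrary: x)
  case 0
  have "(\<Sum>u\<in>F. mpow F (X val) 0 x u * p u y) = p x y"
    using 0 fin_V by (simp add: mpow_0 if_distrib[of "\<lambda>z. z * _"] cong: if_cong)
  thus ?case by (simp add: gc_0)
next
  case (Suc n)
  have X: "(\<Sum>w\<in>F. X val x w * (\<Sum>u\<in>F. mpow F (X val) j w u * p u y)) = (\<Sum>u\<in>F. mpow F (X val) (Suc j) x u * p u y)" for j
  proof -
    have "(\<Sum>w\<in>F. X val x w * (\<Sum>u\<in>F. mpow F (X val) j w u * p u y)) =
        (\<Sum>u\<in>F. (\<Sum>w\<in>F. X val x w * mpow F (X val) j w u) * p u y)"
      unfolding sum_distrib_left sum_distrib_right by (subst sum.swap) (simp add: mult.assoc)
    thus ?thesis using mpow_Suc_left[OF fin_V Suc.prems] by simp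
  qed
  have "(\<Sum>w\<in>F. X val x w * gc val n w y) =
      - (\<Sum>w\<in>F. \<Sum>j\<le>n. (-1) ^ j * zc val (n - j) * (X val x w * (\<Sum>u\<in>F. mpow F (X val) j w u * p u y)))"
    by (simp add: Suc.IH sum_distrib_left sum_negf mult_ac)
  also have "\<dots> = - (\<Sum>j\<le>n. (-1) ^ j * zc val (n - j) * (\<Sum>u\<in>F. mpow F (X val) (Suc j) x u * p u y))"
    by (subst sum.swap) (simp only: sum_distrib_left[symmetric] X)
  finally have "gc val (Suc n) x y = - p x y * zc val (Suc n)
      + (\<Sum>j\<le>n. (-1) ^ j * zc val (n - j) * (\<Sum>u\<in>F. mpow F (X val) (Suc j) x u * p u y))"
    by (simp add: gc_Suc)
  moreover have "(\<Sum>u\<in>F. mpow F (X val) 0 x u * p u y) = p x y"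
    using Suc.prems fin_V by (simp add: mpow_0 if_distrib[of "\<lambda>z. z * _"] cong: if_cong)
  ultimately show ?case
    by (subst sum.atMost_Suc_shift) (simp add: sum_negf)
qed

definition strF :: "(var \<Rightarrow> real) \<Rightarrow> nat \<Rightarrow> real" where
  "strF val n = (\<Sum>v\<in>F. (-1) ^ form_degree v * mpow F (X val) n v v)"

text \<open>Singling out one vertex closes the two-point function into a loop. In generating form
  this is z' = z H' with H the half supertrace of log (1 + s X).\<close>

lemma zc_Suc: "real (Suc n) * zc val (Suc n) =
    1 / 2 * (\<Sum>j\<le>n. zc val (n - j) * ((-1) ^ j * strF val (Suc j)))"
proof -
  \<comment> \<open>Exchanging the legs of the form costs a sign depending on parity; this is what
    turns the ordinary trace of the closed loop into a supertrace.\<close>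
  have sgn: "A val v w = - ((-1) ^ form_degree v) * A val w v" for v w
  proof (cases "A val w v = 0")
    case True
    thus ?thesis using A_sym[of val v w] by simp
  next
    case False
    hence "odd_var w = odd_var v" using par_of_sum2[OF A_par] by blast
    thus ?thesis using A_sym[of val v w] by (auto simp: sg_def odd_var_def)
  qed
  have tr: "(\<Sum>v\<in>F. \<Sum>w\<in>F. A val v w * (\<Sum>u\<in>F. mpow F (X val) j v u * p u w)) = - strF val (Suc j)" for j
  proof -
    have "(\<Sum>w\<in>F. A val v w * (\<Sum>u\<in>F. mpow F (X val) j v u * p u w)) = - ((-1) ^ form_degree v * mpow F (X val) (Suc j) v v)" for v
    proof -
      have "(\<Sum>w\<in>F. A val v w * (\<Sum>u\<in>F. mpow F (X val) j v u * p u w)) =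
          (\<Sum>w\<in>F. \<Sum>u\<in>F. - ((-1) ^ form_degree v) * (mpow F (X val) j v u * (p u w * A val w v)))"
        unfolding sum_distrib_left by (subst sgn) (simp add: mult_ac)
      also have "\<dots> = (\<Sum>u\<in>F. \<Sum>w\<in>F. - ((-1) ^ form_degree v) * (mpow F (X val) j v u * (p u w * A val w v)))"
        by (rule sum.swap)
      also have "\<dots> = - ((-1) ^ form_degree v) * (\<Sum>u\<in>F. mpow F (X val) j v u * X val u v)"
        by (simp only: X_def sum_distrib_left)
      finally show ?thesis by (simp add: mpow_Suc)
    qed
    thus ?thesis by (simp add: strF_def sum_negf)
  qed
  have "J (Suc n) (Q val ^ Suc n) = 1 / 2 * (\<Sum>v\<in>F. \<Sum>w\<in>F. A val v w * J (Suc n) (svar v * (svar w * Q val ^ n)))"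
    by (simp add: Q_def[of val] sum_distrib_right mult.assoc J_sconst J_sum)
  hence "real (Suc n) * zc val (Suc n) = 1 / 2 * (\<Sum>v\<in>F. \<Sum>w\<in>F. A val v w * gc val n v w)"
    by (simp add: zc_def gc_def sum_divide_distrib[symmetric] field_simps del: power_Suc of_nat_Suc)
  also have "(\<Sum>v\<in>F. \<Sum>w\<in>F. A val v w * gc val n v w) =
      - (\<Sum>v\<in>F. \<Sum>w\<in>F. \<Sum>j\<le>n. (-1) ^ j * zc val (n - j) * (A val v w * (\<Sum>u\<in>F. mpow F (X val) j v u * p u w)))"
    unfolding sum_negf[symmetric] by (intro sum.cong refl) (simp add: gc_eq sum_distrib_left sum_negf mult_ac)
  also have "(\<Sum>v\<in>F. \<Sum>w\<in>F. \<Sum>j\<le>n. (-1) ^ j * zc val (n - j) * (A val v w * (\<Sum>u\<in>F. mpow F (X val) j v u * p u w))) =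
      (\<Sum>v\<in>F. \<Sum>j\<le>n. \<Sum>w\<in>F. (-1) ^ j * zc val (n - j) * (A val v w * (\<Sum>u\<in>F. mpow F (X val) j v u * p u w)))"
    by (intro sum.cong refl sum.swap)
  also have "\<dots> = (\<Sum>j\<le>n. \<Sum>v\<in>F. \<Sum>w\<in>F. (-1) ^ j * zc val (n - j) * (A val v w * (\<Sum>u\<in>F. mpow F (X val) j v u * p u w)))"
    by (rule sum.swap)
  also have "\<dots> = (\<Sum>j\<le>n. (-1) ^ j * zc val (n - j) * (- strF val (Suc j)))"
    by (simp only: sum_distrib_left[symmetric] tr)
  finally show ?thesis by (simp add: sum_negf mult_ac)
qed

lemma J_large: "supp_in (\<lambda>m. 2 * k < size m) f \<Longrightarrow> J k f = 0"
  unfolding J_eq_sum_wick by (intro sum.neutral) (auto simp: msets_def supp_in_def)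

text \<open>Replacing a factor \<open>Q\<close> by \<open>C3\<close> adds a leg, so any product
  containing \<open>C3\<close> has more than \<open>2 n\<close> legs, which \<open>J n\<close> does
  not see. Cubic vertices thus enter only at higher order in \<hbar>.\<close>

lemma J_Q_C3: "J n ((Q val + C3) ^ n) = J n (Q val ^ n)"
proof -
  have sv: "supp_in (\<lambda>m. size m = 1) (svar x :: real superseries)" for x
    by (rule supp_in_svar) simp
  have Q: "supp_in (\<lambda>m. size m = 2) (Q val)"
    unfolding Q_def by (intro supp_in_sconst_mult supp_in_sum supp_in_mult[OF sv sv]) simp
  have C: "supp_in (\<lambda>m. size m = 3) C3"
    unfolding C3_def by (intro supp_in_sconst_mult supp_in_sum supp_trip) simp
  have Qn: "supp_in (\<lambda>m. size m = 2 * n) (Q val ^ n)" for n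
    by (rule supp_in_power[where Q = "\<lambda>n m. size m = 2 * n", OF Q]) auto
  have "supp_in (\<lambda>m. 2 * n < size m) ((Q val + C3) ^ n - Q val ^ n)"
  proof (induction n)
    case (Suc n)
    have "(Q val + C3) ^ Suc n - Q val ^ Suc n = (Q val + C3) * ((Q val + C3) ^ n - Q val ^ n) + C3 * Q val ^ n"
      by (simp add: algebra_simps)
    moreover have "supp_in (\<lambda>m. 2 \<le> size m) (Q val + C3)"
      by (rule supp_in_add) (rule supp_in_mono[OF Q], simp, rule supp_in_mono[OF C], simp)
    hence "supp_in (\<lambda>m. 2 * Suc n < size m) ((Q val + C3) * ((Q val + C3) ^ n - Q val ^ n))"
      by (rule supp_in_mult[OF _ Suc]) simp
    moreover have "supp_in (\<lambda>m. 2 * Suc n < size m) (C3 * Q val ^ n)"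
      by (rule supp_in_mult[OF C Qn]) simp
    ultimately show ?case by (simp only: supp_in_add)
  qed simp
  hence "J n ((Q val + C3) ^ n - Q val ^ n) = 0" by (rule J_large)
  thus ?thesis by (simp add: J_diff)
qed

lemma one_loop: "fps_at0 (Ev D val (formal_ln Z)) =
    fps_const (1/2) * Abs_fps (\<lambda>n. if n = 0 then 0 else (-1) ^ (n + 1) / real n * strF val n)"
proof -
  define \<Lambda> where "\<Lambda> = fps_at0 (Ev D val (formal_ln Z))"
  define H where "H = fps_const (1/2) * Abs_fps (\<lambda>n. if n = 0 then 0 else (-1) ^ (n + 1) / real n * strF val n)"
  define z where "z = fps_at0 (Ev D val Z)"
  have L0: "fps_nth \<Lambda> 0 = 0" and z: "z = fps_exp 1 oo \<Lambda>"
    using Ev_formal_ln_at0[OF fin_D D_even good_Z wge_Z] by (simp_all add: \<Lambda>_def z_def)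
  have zn: "fps_nth z n = zc val n" for n
    by (simp add: z_def Ev_Z J_Q_C3 zc_def)
  have "fps_deriv z = z * fps_deriv \<Lambda>"
    unfolding z by (simp add: fps_compose_deriv[OF L0])
  moreover have "fps_deriv z = z * fps_deriv H"
  proof (rule fps_ext)
    fix n
    have hd: "fps_nth (fps_deriv H) j = 1 / 2 * ((-1) ^ j * strF val (Suc j))" for j
      by (simp add: H_def)
    have "fps_nth (z * fps_deriv H) n = (\<Sum>i\<le>n. zc val i * (1 / 2 * ((-1) ^ (n - i) * strF val (Suc (n - i)))))"
      by (simp only: fps_mult_nth zn atLeast0AtMost hd)
    also have "\<dots> = (\<Sum>j\<le>n. zc val (n - j) * (1 / 2 * ((-1) ^ j * strF val (Suc j))))"
      by (rule sum.reindex_bij_witness[where i = "\<lambda>j. n - j" and j = "\<lambda>i. n - i"]) auto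
    also have "\<dots> = real (Suc n) * zc val (Suc n)"
      unfolding zc_Suc by (simp add: sum_distrib_left mult_ac)
    finally show "fps_nth (fps_deriv z) n = fps_nth (z * fps_deriv H) n"
      by (simp add: zn)
  qed
  \<comment> \<open>With z cancelled, the logarithm and its candidate have equal derivatives and
    equal vanishing constant terms.\<close>
  moreover have "z \<noteq> 0"
  proof
    assume "z = 0"
    hence "zc val 0 = 0" using zn[of 0] by simp
    thus False by (simp add: zc_0)
  qed
  ultimately have "fps_deriv \<Lambda> = fps_deriv H" by simp
  moreover have "fps_nth H 0 = 0" by (simp add: H_def)
  ultimately have "\<Lambda> = H" using L0 by (simp add: fps_deriv_eq_iff)
  thus ?thesis by (simp add: \<Lambda>_def H_def)
qed

end

subsection \<open>Infinitesimal symmetries\<close>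

text \<open>Differentiability at 0 of a path of series, coefficient by coefficient.\<close>

definition sder :: "(real \<Rightarrow> real superseries) \<Rightarrow> real superseries \<Rightarrow> bool" where
  "sder \<Phi> \<Phi>' \<longleftrightarrow> (\<forall>m. ((\<lambda>t. scoeff (\<Phi> t) m) has_real_derivative scoeff \<Phi>' m) (at 0))"

lemma sder_mult:
  assumes "sder \<Phi> \<Phi>'" "sder \<Psi> \<Psi>'"
  shows "sder (\<lambda>t. \<Phi> t * \<Psi> t) (\<Phi>' * \<Psi> 0 + \<Phi> 0 * \<Psi>')"
  unfolding sder_def
proof
  fix m
  show "((\<lambda>t. scoeff (\<Phi> t * \<Psi> t) m) has_real_derivative scoeff (\<Phi>' * \<Psi> 0 + \<Phi> 0 * \<Psi>') m) (at 0)"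
  proof (cases "admissible m")
    case True
    have "((\<lambda>t. \<Sum>a | a \<subseteq># m. (-1) ^ inversions a (m - a) * (scoeff (\<Phi> t) a * scoeff (\<Psi> t) (m - a)))
       has_real_derivative (\<Sum>a | a \<subseteq># m. (-1) ^ inversions a (m - a) *
          (scoeff \<Phi>' a * scoeff (\<Psi> 0) (m - a) + scoeff \<Psi>' (m - a) * scoeff (\<Phi> 0) a))) (at 0)"
      using assms unfolding sder_def by (intro DERIV_sum DERIV_cmult DERIV_mult) auto
    thus ?thesis using True
      by (simp add: scoeff_mult distrib_left sum.distrib mult_ac)
  qed (simp add: scoeff_not_admissible)
qed

lemma sder_power:
  assumes d: "sder \<Phi> \<Phi>'" and comm: "\<Phi> 0 * \<Phi>' = \<Phi>' * \<Phi> 0"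
  shows "sder (\<lambda>t. \<Phi> t ^ Suc n) (sconst (real (Suc n)) * (\<Phi>' * \<Phi> 0 ^ n))"
proof (induction n)
  case 0
  thus ?case using d by (simp add: sconst_1)
next
  case (Suc n)
  have "\<Phi> 0 * (sconst (real (Suc n)) * (\<Phi>' * \<Phi> 0 ^ n)) = sconst (real (Suc n)) * (\<Phi>' * \<Phi> 0 ^ Suc n)"
  proof -
    have "\<Phi> 0 * (\<Phi>' * \<Phi> 0 ^ n) = \<Phi>' * \<Phi> 0 ^ Suc n"
      by (simp only: mult.assoc[symmetric] comm power_Suc)
    thus ?thesis by (simp only: sconst_left_commute[of "\<Phi> 0"])
  qed
  moreover have "y + sconst (real (Suc n)) * y = sconst (real (Suc (Suc n))) * y" for y :: "real superseries"
    by (rule superseries_eqI) (simp add: algebra_simps)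
  ultimately have "\<Phi>' * \<Phi> 0 ^ Suc n + \<Phi> 0 * (sconst (real (Suc n)) * (\<Phi>' * \<Phi> 0 ^ n)) =
      sconst (real (Suc (Suc n))) * (\<Phi>' * \<Phi> 0 ^ Suc n)"
    by (simp only:)
  thus ?case using sder_mult[OF d Suc] by (simp only: power_Suc)
qed

context wick_form
begin

lemma J_sder:
  assumes "sder \<Phi> \<Phi>'"
  shows "((\<lambda>t. J k (\<Phi> t)) has_real_derivative J k \<Phi>') (at 0)"
  unfolding J_eq_sum_wick
  using assms unfolding sder_def by (intro DERIV_sum DERIV_cmult_right) auto

end

text \<open>An infinitesimal linear symmetry of vertex and propagator that preserves degree and does
  not mix external with internal variables.\<close>

locale symmetry = cubic_theory +
  fixes Y :: "var \<Rightarrow> var \<Rightarrow> real"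
  assumes Y_deg: "Y v u \<noteq> 0 \<Longrightarrow> form_degree v = form_degree u"
    and Y_resid: "Y v u \<noteq> 0 \<Longrightarrow> is_resid v = is_resid u"
    and c_inv: "u \<in> R \<union> F \<Longrightarrow> v \<in> R \<union> F \<Longrightarrow> w \<in> R \<union> F \<Longrightarrow>
       (\<Sum>x\<in>R \<union> F. Y x u * c x v w) + (\<Sum>x\<in>R \<union> F. Y x v * c u x w) + (\<Sum>x\<in>R \<union> F. Y x w * c u v x) = 0"
    and p_inv: "v \<in> F \<Longrightarrow> w \<in> F \<Longrightarrow> (\<Sum>u\<in>F. Y v u * p u w) + (\<Sum>u\<in>F. Y w u * p v u) = 0"
begin

lemma Y_par: "Y v u \<noteq> 0 \<Longrightarrow> odd_var v = odd_var u"
  using Y_deg by (simp add: odd_var_def)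

lemma sum_F: "u \<in> F \<Longrightarrow> (\<Sum>x\<in>R \<union> F. Y x u * f x) = (\<Sum>x\<in>F. Y x u * f x)"
proof (rule sum.mono_neutral_right)
  assume u: "u \<in> F"
  show "\<forall>i\<in>R \<union> F - F. Y i u * f i = 0"
    using u R_resid F_fluct Y_resid[of _ u] by (metis Diff_iff Un_iff mult_zero_left)
qed (use fin_R fin_V in auto)

lemma sum_D: "u \<in> D \<Longrightarrow> (\<Sum>x\<in>R \<union> F. Y x u * f x) = (\<Sum>x\<in>D. Y x u * f x)"
proof (rule sum.mono_neutral_right)
  assume u: "u \<in> D"
  show "\<forall>i\<in>R \<union> F - D. Y i u * f i = 0"
  proof
    fix i assume i: "i \<in> R \<union> F - D"
    show "Y i u * f i = 0"
    proof (rule ccontr)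
      assume "Y i u * f i \<noteq> 0"
      hence "form_degree i = 1" "is_resid i" using Y_deg[of i u] Y_resid[of i u] u R_resid by (auto simp: D_def)
      thus False using i F_fluct by (auto simp: D_def)
    qed
  qed
qed (use fin_R fin_V in \<open>auto simp: D_def\<close>)

definition dvar :: "var \<Rightarrow> real superseries" where
  "dvar x = (\<Sum>u\<in>F. sconst (Y x u) * svar u)"

lemma vfield_svar: "x \<in> F \<Longrightarrow> vfield Y (svar x * f) = dvar x * f + svar x * vfield Y f"
  unfolding dvar_def by (rule vfield_svar_mult[OF Y_par])

lemma vfield_svar1: "x \<in> F \<Longrightarrow> vfield Y (svar x) = dvar x"
  using vfield_svar[of x 1] by simp

text \<open>Moves the symmetry from the variables to the coefficients in front of them, in any
  linear context \<open>G\<close>.\<close>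

lemma sum_dvar:
  assumes "\<And>x. x \<in> F \<Longrightarrow> G (dvar x) = (\<Sum>u\<in>F. sconst (Y x u) * G (svar u))"
  shows "(\<Sum>x\<in>F. sconst (f x) * G (dvar x)) = (\<Sum>u\<in>F. sconst (\<Sum>x\<in>F. Y x u * f x) * G (svar u))"
proof -
  have "(\<Sum>x\<in>F. sconst (f x) * G (dvar x)) = (\<Sum>x\<in>F. \<Sum>u\<in>F. sconst (Y x u * f x) * G (svar u))"
    by (intro sum.cong refl) (simp add: assms sum_distrib_left sconst_mult_assoc mult.commute)
  thus ?thesis by (subst (asm) sum.swap) (simp add: sconst_sum sum_distrib_right)
qed

lemma dvar_mult:
  "dvar x * g = (\<Sum>u\<in>F. sconst (Y x u) * (svar u * g))"
  "h * (dvar x * g) = (\<Sum>u\<in>F. sconst (Y x u) * (h * (svar u * g)))"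
  "h * dvar x = (\<Sum>u\<in>F. sconst (Y x u) * (h * svar u))"
  "h * (k * dvar x) = (\<Sum>u\<in>F. sconst (Y x u) * (h * (k * svar u)))"
proof -
  have l: "h * (sconst r * g) = sconst r * (h * g)" for h g and r :: real by (rule sconst_left_commute)
  show "dvar x * g = (\<Sum>u\<in>F. sconst (Y x u) * (svar u * g))" for g
    by (simp add: dvar_def sum_distrib_right mult.assoc)
  thus "h * (dvar x * g) = (\<Sum>u\<in>F. sconst (Y x u) * (h * (svar u * g)))"
    by (simp add: sum_distrib_left l)
  show "h * dvar x = (\<Sum>u\<in>F. sconst (Y x u) * (h * svar u))" for h
    by (simp add: dvar_def sum_distrib_left l)
  thus "h * (k * dvar x) = (\<Sum>u\<in>F. sconst (Y x u) * (h * (k * svar u)))"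
    by (simp add: sum_distrib_left l)
qed

definition \<delta> :: "(var \<Rightarrow> real) \<Rightarrow> var \<Rightarrow> real" where
  "\<delta> val v = (\<Sum>u\<in>D. Y v u * val u)"

text \<open>Invariance of \<open>c\<close> on all three legs trades its action on the two
  fluctuations for minus its action on the external leg.\<close>

lemma A_inv:
  assumes u: "u \<in> F" and w: "w \<in> F"
  shows "(\<Sum>v\<in>F. Y v u * A val v w) + (\<Sum>v\<in>F. Y v w * A val u v) = - A (\<delta> val) u w"
proof -
  have 1: "(\<Sum>v\<in>F. Y v u * A val v w) = (\<Sum>x\<in>D. val x * (\<Sum>v\<in>F. Y v u * c v x w))"
    unfolding A_def sum_distrib_left by (subst sum.swap) (simp add: mult_ac)
  have 2: "(\<Sum>v\<in>F. Y v w * A val u v) = (\<Sum>x\<in>D. val x * (\<Sum>v\<in>F. Y v w * c u x v))"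
    unfolding A_def sum_distrib_left by (subst sum.swap) (simp add: mult_ac)
  have 3: "A (\<delta> val) u w = (\<Sum>x\<in>D. val x * (\<Sum>y\<in>D. Y y x * c u y w))"
    unfolding A_def \<delta>_def sum_distrib_left sum_distrib_right by (subst sum.swap) (simp add: mult_ac)
  have "(\<Sum>x\<in>D. val x * ((\<Sum>v\<in>F. Y v u * c v x w) + (\<Sum>y\<in>D. Y y x * c u y w) + (\<Sum>v\<in>F. Y v w * c u x v))) = 0"
  proof (intro sum.neutral ballI)
    fix x assume x: "x \<in> D"
    hence "x \<in> R" by (simp add: D_def)
    thus "val x * ((\<Sum>v\<in>F. Y v u * c v x w) + (\<Sum>y\<in>D. Y y x * c u y w) + (\<Sum>v\<in>F. Y v w * c u x v)) = 0"
      using c_inv[of u x w] u w x by (simp add: sum_F sum_D)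
  qed
  thus ?thesis unfolding 1 2 3 by (simp add: distrib_left sum.distrib)
qed

lemma vfield_Q: "vfield Y (Q val) = - Q (\<delta> val)"
proof -
  have 1: "(\<Sum>v\<in>F. \<Sum>w\<in>F. sconst (A val v w) * (dvar v * svar w)) =
      (\<Sum>u\<in>F. \<Sum>w\<in>F. sconst (\<Sum>v\<in>F. Y v u * A val v w) * (svar u * svar w))"
  proof -
    have "(\<Sum>v\<in>F. sconst (A val v w) * (dvar v * svar w)) =
        (\<Sum>u\<in>F. sconst (\<Sum>v\<in>F. Y v u * A val v w) * (svar u * svar w))" for w
      by (rule sum_dvar[where G = "\<lambda>y. y * svar w"]) (rule dvar_mult(1))
    thus ?thesis by (subst (1 2) sum.swap) simp
  qed
  have 2: "(\<Sum>v\<in>F. \<Sum>w\<in>F. sconst (A val v w) * (svar v * dvar w)) =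
      (\<Sum>v\<in>F. \<Sum>u\<in>F. sconst (\<Sum>w\<in>F. Y w u * A val v w) * (svar v * svar u))"
    by (intro sum.cong refl sum_dvar[where G = "\<lambda>y. _ * y"] dvar_mult(3))
  have "vfield Y (Q val) = sconst (1/2) * (\<Sum>v\<in>F. \<Sum>w\<in>F. sconst (A val v w) * vfield Y (svar v * svar w))"
    by (simp add: Q_def vfield_sconst vfield_sum)
  also have "(\<Sum>v\<in>F. \<Sum>w\<in>F. sconst (A val v w) * vfield Y (svar v * svar w)) =
      (\<Sum>v\<in>F. \<Sum>w\<in>F. sconst (A val v w) * (dvar v * svar w)) + (\<Sum>v\<in>F. \<Sum>w\<in>F. sconst (A val v w) * (svar v * dvar w))"
    unfolding sum.distrib[symmetric]
    by (intro sum.cong refl) (simp only: vfield_svar vfield_svar1 distrib_left)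
  also have "\<dots> = (\<Sum>u\<in>F. \<Sum>w\<in>F. sconst ((\<Sum>v\<in>F. Y v u * A val v w) + (\<Sum>v\<in>F. Y v w * A val u v)) * (svar u * svar w))"
    unfolding 1 2 by (simp only: sconst_add distrib_right sum.distrib)
  also have "\<dots> = - (\<Sum>u\<in>F. \<Sum>w\<in>F. sconst (A (\<delta> val) u w) * (svar u * svar w))"
    unfolding sum_negf[symmetric] by (intro sum.cong refl) (simp add: A_inv sconst_uminus)
  finally show ?thesis by (simp add: Q_def)
qed

lemma vfield_C3: "vfield Y C3 = 0"
proof -
  have 1: "(\<Sum>u\<in>F. \<Sum>v\<in>F. \<Sum>w\<in>F. sconst (c u v w) * (dvar u * (svar v * svar w))) =
      (\<Sum>u\<in>F. \<Sum>v\<in>F. \<Sum>w\<in>F. sconst (\<Sum>x\<in>F. Y x u * c x v w) * (svar u * (svar v * svar w)))"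
  proof -
    have *: "(\<Sum>u\<in>F. sconst (c u v w) * (dvar u * (svar v * svar w))) =
        (\<Sum>u\<in>F. sconst (\<Sum>x\<in>F. Y x u * c x v w) * (svar u * (svar v * svar w)))" for v w
      by (rule sum_dvar[where G = "\<lambda>y. y * (svar v * svar w)"]) (rule dvar_mult(1))
    have sw: "(\<Sum>u\<in>F. \<Sum>v\<in>F. \<Sum>w\<in>F. t u v w) = (\<Sum>v\<in>F. \<Sum>w\<in>F. \<Sum>u\<in>F. t u v w)" for t :: "_ \<Rightarrow> _ \<Rightarrow> _ \<Rightarrow> real superseries"
      by (subst sum.swap) (intro sum.cong refl sum.swap)
    have "(\<Sum>u\<in>F. \<Sum>v\<in>F. \<Sum>w\<in>F. sconst (c u v w) * (dvar u * (svar v * svar w))) =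
        (\<Sum>v\<in>F. \<Sum>w\<in>F. \<Sum>u\<in>F. sconst (c u v w) * (dvar u * (svar v * svar w)))"
      by (rule sw)
    also have "\<dots> = (\<Sum>v\<in>F. \<Sum>w\<in>F. \<Sum>u\<in>F. sconst (\<Sum>x\<in>F. Y x u * c x v w) * (svar u * (svar v * svar w)))"
      by (simp only: *)
    also note sw[symmetric]
    finally show ?thesis .
  qed
  have 2: "(\<Sum>u\<in>F. \<Sum>v\<in>F. \<Sum>w\<in>F. sconst (c u v w) * (svar u * (dvar v * svar w))) =
      (\<Sum>u\<in>F. \<Sum>v\<in>F. \<Sum>w\<in>F. sconst (\<Sum>x\<in>F. Y x v * c u x w) * (svar u * (svar v * svar w)))"
  proof (rule sum.cong[OF refl])
    fix u
    have "(\<Sum>v\<in>F. sconst (c u v w) * (svar u * (dvar v * svar w))) =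
        (\<Sum>v\<in>F. sconst (\<Sum>x\<in>F. Y x v * c u x w) * (svar u * (svar v * svar w)))" for w
      by (rule sum_dvar[where G = "\<lambda>y. svar u * (y * svar w)"]) (rule dvar_mult(2))
    thus "(\<Sum>v\<in>F. \<Sum>w\<in>F. sconst (c u v w) * (svar u * (dvar v * svar w))) =
      (\<Sum>v\<in>F. \<Sum>w\<in>F. sconst (\<Sum>x\<in>F. Y x v * c u x w) * (svar u * (svar v * svar w)))"
      by (subst (1 2) sum.swap) simp
  qed
  have 3: "(\<Sum>u\<in>F. \<Sum>v\<in>F. \<Sum>w\<in>F. sconst (c u v w) * (svar u * (svar v * dvar w))) =
      (\<Sum>u\<in>F. \<Sum>v\<in>F. \<Sum>w\<in>F. sconst (\<Sum>x\<in>F. Y x w * c u v x) * (svar u * (svar v * svar w)))"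
    by (intro sum.cong refl sum_dvar[where G = "\<lambda>y. _ * (_ * y)"] dvar_mult(4))
  have "vfield Y C3 = sconst (1/6) * (\<Sum>u\<in>F. \<Sum>v\<in>F. \<Sum>w\<in>F. sconst (c u v w) * vfield Y (svar u * (svar v * svar w)))"
    by (simp add: C3_def trip_def vfield_sconst vfield_sum)
  also have "(\<Sum>u\<in>F. \<Sum>v\<in>F. \<Sum>w\<in>F. sconst (c u v w) * vfield Y (svar u * (svar v * svar w))) =
      (\<Sum>u\<in>F. \<Sum>v\<in>F. \<Sum>w\<in>F. sconst (c u v w) * (dvar u * (svar v * svar w)))
      + (\<Sum>u\<in>F. \<Sum>v\<in>F. \<Sum>w\<in>F. sconst (c u v w) * (svar u * (dvar v * svar w)))
      + (\<Sum>u\<in>F. \<Sum>v\<in>F. \<Sum>w\<in>F. sconst (c u v w) * (svar u * (svar v * dvar w)))"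
    unfolding sum.distrib[symmetric]
    by (intro sum.cong refl)
       (simp only: vfield_svar vfield_svar1 distrib_left add.assoc)
  also have "\<dots> = (\<Sum>u\<in>F. \<Sum>v\<in>F. \<Sum>w\<in>F. sconst ((\<Sum>x\<in>F. Y x u * c x v w) + (\<Sum>x\<in>F. Y x v * c u x w)
      + (\<Sum>x\<in>F. Y x w * c u v x)) * (svar u * (svar v * svar w)))"
    unfolding 1 2 3 by (simp only: sconst_add distrib_right sum.distrib)
  also have "\<dots> = 0"
  proof (intro sum.neutral ballI)
    fix u v w assume "u \<in> F" "v \<in> F" "w \<in> F"
    hence "(\<Sum>x\<in>F. Y x u * c x v w) + (\<Sum>x\<in>F. Y x v * c u x w) + (\<Sum>x\<in>F. Y x w * c u v x) = 0"
      using c_inv[of u v w] by (simp add: sum_F)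
    thus "sconst ((\<Sum>x\<in>F. Y x u * c x v w) + (\<Sum>x\<in>F. Y x v * c u x w) + (\<Sum>x\<in>F. Y x w * c u v x)) *
        (svar u * (svar v * svar w)) = 0" by simp
  qed
  finally show ?thesis by simp
qed

lemma vfield_mult_left:
  assumes B: "B = Q val + C3"
  shows "vfield Y (B * g) = vfield Y B * g + B * vfield Y g"
proof -
  have w2: "vfield Y (svar v * (svar w * g)) = vfield Y (svar v * svar w) * g + svar v * (svar w * vfield Y g)"
    if "v \<in> F" "w \<in> F" for v w g
    using that vfield_svar[of w 1] by (simp add: vfield_svar distrib_left distrib_right mult.assoc)
  have w3: "vfield Y (svar u * (svar v * (svar w * g))) = vfield Y (svar u * (svar v * svar w)) * g + svar u * (svar v * (svar w * vfield Y g))"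
    if "u \<in> F" "v \<in> F" "w \<in> F" for u v w g
    by (simp only: vfield_svar[OF that(1)] w2[OF that(2,3)] distrib_left distrib_right mult.assoc add.assoc)
  have Qe: "Q val * h = sconst (1/2) * (\<Sum>v\<in>F. \<Sum>w\<in>F. sconst (A val v w) * (svar v * (svar w * h)))" for h
    by (simp only: Q_def sum_distrib_right mult.assoc)
  have Ce: "C3 * h = sconst (1/6) * (\<Sum>u\<in>F. \<Sum>v\<in>F. \<Sum>w\<in>F. sconst (c u v w) * (svar u * (svar v * (svar w * h))))" for h
    by (simp only: C3_def trip_def sum_distrib_right mult.assoc)
  have "vfield Y (Q val * g) = sconst (1/2) * (\<Sum>v\<in>F. \<Sum>w\<in>F. sconst (A val v w) *
      (vfield Y (svar v * svar w) * g) + sconst (A val v w) * (svar v * (svar w * vfield Y g)))"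
    unfolding Qe vfield_sconst vfield_sum
    by (intro arg_cong[where f = "\<lambda>x. _ * x"] sum.cong refl) (simp only: w2 distrib_left)
  also have "\<dots> = vfield Y (Q val) * g + Q val * vfield Y g"
    unfolding Qe by (simp only: Q_def[of val] vfield_sconst vfield_sum sum_distrib_right mult.assoc sum.distrib distrib_left)
  finally have "vfield Y (Q val * g) = vfield Y (Q val) * g + Q val * vfield Y g" .
  moreover have "vfield Y (C3 * g) = vfield Y C3 * g + C3 * vfield Y g"
  proof -
    have "vfield Y (C3 * g) = sconst (1/6) * (\<Sum>u\<in>F. \<Sum>v\<in>F. \<Sum>w\<in>F. sconst (c u v w) *
        (vfield Y (svar u * (svar v * svar w)) * g) + sconst (c u v w) * (svar u * (svar v * (svar w * vfield Y g))))"
      unfolding Ce vfield_sconst vfield_sum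
      by (intro arg_cong[where f = "\<lambda>x. _ * x"] sum.cong refl) (simp only: w3 distrib_left)
    also have "\<dots> = vfield Y C3 * g + C3 * vfield Y g"
      unfolding Ce by (simp only: C3_def trip_def vfield_sconst vfield_sum sum_distrib_right mult.assoc sum.distrib distrib_left)
    finally show ?thesis .
  qed
  ultimately show ?thesis by (simp add: B vfield_add distrib_right)
qed

lemma B_even: "supp_in (\<lambda>m. even (num_odd m)) (Q val + C3)"
proof (rule supp_in_add[OF Q_even])
  show "supp_in (\<lambda>m. even (num_odd m)) C3"
    unfolding C3_def
  proof (rule supp_in_sconst_mult, intro supp_in_sum supp_trip)
    fix u v w assume "c u v w \<noteq> 0"
    hence "gh0 {#u, v, w#}" using c_deg[of u v w] by (simp add: gh0_def)
    thus "even (num_odd {#u, v, w#})" by (rule gh0_even)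
  qed
qed

lemma vfield_power:
  "vfield Y ((Q val + C3) ^ Suc n) = sconst (real (Suc n)) * (vfield Y (Q val + C3) * (Q val + C3) ^ n)"
proof (induction n)
  case 0
  thus ?case by (simp add: sconst_1)
next
  case (Suc n)
  let ?B = "Q val + C3"
  have "?B * (vfield Y ?B * ?B ^ n) = vfield Y ?B * ?B ^ Suc n"
    by (simp only: mult.assoc[symmetric] even_commute[OF B_even, of val "vfield Y ?B"] power_Suc)
  hence "vfield Y (?B ^ Suc (Suc n)) = vfield Y ?B * ?B ^ Suc n + sconst (real (Suc n)) * (vfield Y ?B * ?B ^ Suc n)"
    unfolding power_Suc[of _ "Suc n"] vfield_mult_left[OF refl] Suc by (simp only: sconst_left_commute[of ?B])
  also have "y + sconst (real (Suc n)) * y = sconst (real (Suc (Suc n))) * y" for y :: "real superseries"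
    by (rule superseries_eqI) (simp add: algebra_simps)
  finally show ?case .
qed

text \<open>Moving \<alpha> changes the integrand by the negative of what moving the fluctuations
  does, and the Gaussian integral of a variation along a symmetry vanishes by
  \<open>J_vfield\<close>.\<close>

lemma flat_Ev_Z: "flat (\<lambda>t. Ev D (\<lambda>v. val v + t * \<delta> val v) Z)"
  unfolding flat_def
proof (intro allI)
  fix n k
  define \<Phi> where "\<Phi> t = Q (\<lambda>v. val v + t * \<delta> val v) + C3" for t
  have \<Phi>: "\<Phi> t = (Q val + C3) + sconst t * Q (\<delta> val)" for t
  proof -
    have "A (\<lambda>v. val v + t * \<delta> val v) v w = A val v w + t * A (\<delta> val) v w" for v w
      by (simp add: A_def distrib_right sum.distrib sum_distrib_left mult.assoc)
    hence "Q (\<lambda>v. val v + t * \<delta> val v) = Q val + sconst t * Q (\<delta> val)"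
    proof -
      assume A: "\<And>v w. A (\<lambda>v. val v + t * \<delta> val v) v w = A val v w + t * A (\<delta> val) v w"
      have "sconst (1/2) * (a + sconst t * b) = sconst (1/2) * a + sconst t * (sconst (1/2) * b)"
        for a b :: "real superseries" by (rule superseries_eqI) (simp add: distrib_left)
      moreover have "(\<Sum>v\<in>F. \<Sum>w\<in>F. sconst (A val v w + t * A (\<delta> val) v w) * (svar v * svar w)) =
          (\<Sum>v\<in>F. \<Sum>w\<in>F. sconst (A val v w) * (svar v * svar w)) +
          sconst t * (\<Sum>v\<in>F. \<Sum>w\<in>F. sconst (A (\<delta> val) v w) * (svar v * svar w))"
        by (simp only: sconst_add sconst_mult distrib_right sum.distrib sum_distrib_left mult.assoc)
      ultimately show ?thesis by (simp only: Q_def A)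
    qed
    thus ?thesis by (simp add: \<Phi>_def)
  qed
  have sd: "sder \<Phi> (Q (\<delta> val))"
    unfolding sder_def \<Phi> by (auto intro!: derivative_eq_intros)
  have comm: "\<Phi> 0 * Q (\<delta> val) = Q (\<delta> val) * \<Phi> 0" by (rule Q_commute[symmetric])
  have "((\<lambda>t. J k' (\<Phi> t ^ N)) has_real_derivative 0) (at 0)" for k' N
  proof (cases N)
    case (Suc N')
    have "vfield Y (\<Phi> 0) = - Q (\<delta> val)" by (simp add: \<Phi> vfield_add vfield_Q vfield_C3)
    hence "vfield Y (\<Phi> 0 ^ Suc N') = - (sconst (real (Suc N')) * (Q (\<delta> val) * \<Phi> 0 ^ N'))"
      using vfield_power[of val N'] by (simp add: \<Phi>)
    moreover have "J k' (vfield Y (\<Phi> 0 ^ Suc N')) = 0"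
      by (rule J_vfield[OF Y_par]) (simp_all add: sum.distrib p_inv)
    ultimately have "J k' (sconst (real (Suc N')) * (Q (\<delta> val) * \<Phi> 0 ^ N')) = 0"
      by (simp add: J_uminus)
    thus ?thesis using J_sder[OF sder_power[OF sd comm, of N'], of k'] Suc by simp
  qed simp
  hence "((\<lambda>t. J (n + 3 * k) (\<Phi> t ^ (n + 2 * k)) / fact (n + 2 * k)) has_real_derivative 0 / fact (n + 2 * k)) (at 0)"
    by (intro DERIV_cdivide)
  thus "((\<lambda>t. fps_nth (fps_nth (Ev D (\<lambda>v. val v + t * \<delta> val v) Z) n) k) has_real_derivative 0) (at 0)"
    by (simp add: Ev_Z \<Phi>_def)
qed

lemma flat_Ev_ln_Z: "flat (\<lambda>t. Ev D (\<lambda>v. val v + t * \<delta> val v) (formal_ln Z))"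
  by (rule flat_Ev_formal_ln[OF fin_D D_even good_Z wge_Z flat_Ev_Z])

end

subsection \<open>Bases\<close>

lemma some_basis:
  fixes V :: "'a::real_vector set"
  assumes "subspace V" and "\<exists>B::'a set. finite B \<and> span B = UNIV"
  shows "is_basis (some_basis V) V"
proof -
  obtain B where B: "B \<subseteq> V" "independent B" "V \<subseteq> span B"
    using maximal_independent_subset[of V] by blast
  obtain G :: "'a set" where "finite G" "span G = UNIV" using assms(2) by blast
  hence "finite B" using independent_span_bound[of G B] B(2) by auto
  then obtain bs where bs: "set bs = B" "distinct bs" using finite_distinct_list by blast
  have "span B = V" using B assms(1) by (metis span_subspace)
  hence "is_basis bs V" using bs B by (simp add: is_basis_def)
  thus ?thesis unfolding some_basis_def by (rule someI)
qed

lemma basis_expand: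
  assumes "independent B" "finite B" "x \<in> span B"
  shows "(\<Sum>b\<in>B. representation B x b *\<^sub>R b) = x"
  by (rule sum_representation_eq) (use assms in auto)

lemma rep_linear_sum:
  assumes "independent B" "\<And>i. i \<in> I \<Longrightarrow> f i \<in> span B"
  shows "representation B (\<Sum>i\<in>I. r i *\<^sub>R f i) b = (\<Sum>i\<in>I. r i * representation B (f i) b)"
proof -
  have "representation B (\<Sum>i\<in>I. r i *\<^sub>R f i) = (\<lambda>b. \<Sum>i\<in>I. representation B (r i *\<^sub>R f i) b)"
    by (rule representation_sum) (use assms in \<open>auto intro: span_scale\<close>)
  thus ?thesis using assms
    by (simp add: representation_scale)
qed

lemma linear_eq_on_basis_sum:
  assumes "linear f"
  shows "f (\<Sum>i\<in>I. r i *\<^sub>R g i) = (\<Sum>i\<in>I. r i *\<^sub>R f (g i))"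
  using assms by (simp add: linear_sum linear_scale)

lemma linear_sum_real:
  assumes "linear (f :: 'a::real_vector \<Rightarrow> real)"
  shows "f (\<Sum>i\<in>I. r i *\<^sub>R g i) = (\<Sum>i\<in>I. r i * f (g i))"
  using assms by (simp add: linear_sum linear_scale)

text \<open>A square matrix with trivial kernel has nonzero determinant. The index set is enumerated
  through \<open>h\<close> with inverse \<open>g\<close> so that this applies to an arbitrary finite
  set.\<close>

lemma matrix_inverse_ex:
  fixes q :: "'i \<Rightarrow> 'i \<Rightarrow> real"
  assumes V: "finite V"
    and ker: "\<And>x. (\<And>v. v \<in> V \<Longrightarrow> (\<Sum>w\<in>V. q v w * x w) = 0) \<Longrightarrow> (\<And>v. v \<in> V \<Longrightarrow> x v = 0)"
  obtains p where "\<And>v w. v \<in> V \<Longrightarrow> w \<in> V \<Longrightarrow> (\<Sum>z\<in>V. p v z * q z w) = (if v = w then 1 else 0)"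
    and "\<And>v w. v \<in> V \<Longrightarrow> w \<in> V \<Longrightarrow> (\<Sum>z\<in>V. q v z * p z w) = (if v = w then 1 else 0)"
    and "\<And>v w. v \<notin> V \<or> w \<notin> V \<Longrightarrow> p v w = 0"
proof -
  obtain h where h: "bij_betw h {0..<card V} V" using V ex_bij_betw_nat_finite by blast
  define N where "N = card V"
  define g where "g = inv_into {0..<N} h"
  have hV: "h i \<in> V" if "i < N" for i using h that by (auto simp: N_def bij_betw_def)
  have gh: "g (h i) = i" if "i < N" for i
    using h that by (auto simp: g_def N_def bij_betw_def intro!: inv_into_f_f)
  have gV: "g v < N" "h (g v) = v" if "v \<in> V" for v
    using h that unfolding g_def N_def bij_betw_def
    by (metis atLeastLessThan_iff inv_into_into, metis f_inv_into_f)
  have hinj: "h i = h j \<longleftrightarrow> i = j" if "i < N" "j < N" for i j using gh that by metis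
  have reidx: "(\<Sum>v\<in>V. f v) = (\<Sum>i<N. f (h i))" for f :: "'i \<Rightarrow> real"
    using sum.reindex_bij_betw[OF h, of f] by (simp add: N_def atLeast0LessThan)
  define M where "M = mat N N (\<lambda>(i, j). q (h i) (h j))"
  have M: "M \<in> carrier_mat N N" by (simp add: M_def)
  have "det M \<noteq> 0"
  proof
    assume "det M = 0"
    then obtain x where x: "x \<in> carrier_vec N" "x \<noteq> 0\<^sub>v N" "M *\<^sub>v x = 0\<^sub>v N"
      using det_0_iff_vec_prod_zero_field[OF M] by blast
    have "(\<Sum>w\<in>V. q v w * vec_index x (g w)) = 0" if v: "v \<in> V" for v
    proof -
      have "vec_index (M *\<^sub>v x) (g v) = 0" using x(3) gV(1)[OF v] by simp
      hence "(\<Sum>j<N. q v (h j) * vec_index x j) = 0"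
        using x(1) gV[OF v] by (simp add: M_def scalar_prod_def atLeast0LessThan)
      thus ?thesis by (simp add: reidx gh)
    qed
    hence z: "vec_index x (g v) = 0" if "v \<in> V" for v using ker[of "\<lambda>w. vec_index x (g w)"] that by blast
    have "x = 0\<^sub>v N"
    proof (rule eq_vecI)
      fix i assume "i < dim_vec (0\<^sub>v N :: real vec)"
      thus "vec_index x i = vec_index (0\<^sub>v N) i" using z[OF hV[of i]] gh[of i] by simp
    qed (use x(1) in simp)
    thus False using x(2) by simp
  qed
  hence "M \<in> Units (ring_mat TYPE(real) N ())" by (rule det_non_zero_imp_unit[OF M])
  then obtain P where P: "P \<in> carrier_mat N N" "P * M = 1\<^sub>m N" "M * P = 1\<^sub>m N"
    unfolding Units_def by (auto simp: ring_mat_simps)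
  define p where "p v w = (if v \<in> V \<and> w \<in> V then index_mat P (g v, g w) else 0)" for v w
  have pM: "(\<Sum>j<N. index_mat P (i, j) * q (h j) (h k)) = (if i = k then 1 else 0)" if "i < N" "k < N" for i k
  proof -
    have "index_mat (P * M) (i, k) = (if i = k then 1 else 0)" using that by (simp add: P)
    thus ?thesis using that P(1) by (simp add: M_def scalar_prod_def atLeast0LessThan)
  qed
  have Mp: "(\<Sum>j<N. q (h i) (h j) * index_mat P (j, k)) = (if i = k then 1 else 0)" if "i < N" "k < N" for i k
  proof -
    have "index_mat (M * P) (i, k) = (if i = k then 1 else 0)" using that by (simp add: P)
    thus ?thesis using that P(1) by (simp add: M_def scalar_prod_def atLeast0LessThan)
  qed
  have gi: "g v = g w \<longleftrightarrow> v = w" if "v \<in> V" "w \<in> V" for v w using gV(2) that by metis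
  show ?thesis
  proof
    fix v w assume vw: "v \<in> V" "w \<in> V"
    show "(\<Sum>z\<in>V. p v z * q z w) = (if v = w then 1 else 0)"
      using pM[OF gV(1)[OF vw(1)] gV(1)[OF vw(2)]] vw by (simp add: reidx p_def gh hV gV gi)
    show "(\<Sum>z\<in>V. q v z * p z w) = (if v = w then 1 else 0)"
      using Mp[OF gV(1)[OF vw(1)] gV(1)[OF vw(2)]] vw by (simp add: reidx p_def gh hV gV gi)
  qed (auto simp: p_def)
qed

lemma matrix_left_inverse_unique:
  fixes q :: "'i \<Rightarrow> 'i \<Rightarrow> real"
  assumes V: "finite V"
    and l: "\<And>v w. v \<in> V \<Longrightarrow> w \<in> V \<Longrightarrow> (\<Sum>z\<in>V. p' v z * q z w) = (if v = w then 1 else 0)"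
    and r: "\<And>v w. v \<in> V \<Longrightarrow> w \<in> V \<Longrightarrow> (\<Sum>z\<in>V. q v z * p z w) = (if v = w then 1 else 0)"
    and vw: "v \<in> V" "w \<in> V"
  shows "p' v w = p v w"
proof -
  have "p' v w = (\<Sum>z\<in>V. p' v z * (if z = w then 1 else 0))" using V vw by (simp add: if_distrib cong: if_cong)
  also have "\<dots> = (\<Sum>z\<in>V. p' v z * (\<Sum>y\<in>V. q z y * p y w))" using vw by (simp add: r)
  also have "\<dots> = (\<Sum>y\<in>V. (\<Sum>z\<in>V. p' v z * q z y) * p y w)"
    unfolding sum_distrib_left sum_distrib_right by (subst sum.swap) (simp add: mult.assoc)
  also have "\<dots> = p v w" using V vw by (simp add: l if_distrib[of "\<lambda>x. x * _"] cong: if_cong)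
  finally show ?thesis .
qed

subsection \<open>Metric Lie algebras\<close>

locale metric_lie =
  fixes \<gg> :: "'g::real_vector lie_data" and T :: "'g list"
  assumes lie: "metric_lie_algebra \<gg>" and orth: "orthonormal_basis \<gg> T"
begin

abbreviation br where "br \<equiv> bracket \<gg>"
abbreviation lf where "lf \<equiv> lie_form \<gg>"
abbreviation nT where "nT \<equiv> length T"

lemma br_linear: "linear (br X)" "linear (\<lambda>X. br X Y)"
  and lf_linear: "linear (lf X)" "linear (\<lambda>X. lf X Y)"
  and br_self: "br X X = 0"
  and lf_sym: "lf X Y = lf Y X"
  and lf_inv: "lf (br X Y) Z + lf Y (br X Z) = 0"
  and jacobi: "br X (br Y Z) + br Y (br Z X) + br Z (br X Y) = 0"
  using lie unfolding metric_lie_algebra_def bilinear_map_def by blast+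

lemma br_anti: "br Y X = - br X Y"
proof -
  have "br (X + Y) (X + Y) = br X X + br X Y + (br Y X + br Y Y)"
    by (simp add: linear_add[OF br_linear(1)] linear_add[OF br_linear(2)])
  hence "br X Y + br Y X = 0" by (simp add: br_self)
  thus ?thesis by (simp add: eq_neg_iff_add_eq_0 add.commute)
qed

lemma lf_br_swap12: "lf X (br Y Z) = - lf Y (br X Z)"
proof -
  have "lf (br X Y) Z = - lf Y (br X Z)" using lf_inv[of X Y Z] by simp
  moreover have "lf (br Y X) Z = - lf X (br Y Z)" using lf_inv[of Y X Z] by simp
  moreover have "lf (br Y X) Z = - lf (br X Y) Z"
    by (subst br_anti) (simp add: linear_neg[OF lf_linear(2)])
  ultimately show ?thesis by simp
qed

lemma lf_br_swap23: "lf X (br Y Z) = - lf X (br Z Y)"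
  by (subst br_anti) (simp add: linear_neg[OF lf_linear(1)])

lemma T_basis: "distinct T" "independent (set T)" "span (set T) = UNIV"
  using orth by (auto simp: orthonormal_basis_def is_basis_def)

lemma T_orth: "a < nT \<Longrightarrow> b < nT \<Longrightarrow> \<bar>lf (T ! a) (T ! b)\<bar> = (if a = b then 1 else 0)"
  using orth by (auto simp: orthonormal_basis_def)

definition rT :: "'g \<Rightarrow> nat \<Rightarrow> real" where "rT X a = representation (set T) X (T ! a)"

lemma rT_sum_scale: "rT (\<Sum>i\<in>I. r i *\<^sub>R f i) a = (\<Sum>i\<in>I. r i * rT (f i) a)"
  unfolding rT_def by (rule rep_linear_sum) (simp_all add: T_basis)

lemma rT_linear: "linear (\<lambda>X. rT X a)"
  unfolding rT_def by (rule linearI) (simp_all add: representation_add representation_scale T_basis)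

lemma rT_expand: "X = (\<Sum>a<nT. rT X a *\<^sub>R T ! a)"
proof -
  have "X = (\<Sum>b\<in>set T. representation (set T) X b *\<^sub>R b)"
    using basis_expand[of "set T" X] by (simp add: T_basis)
  also have "\<dots> = (\<Sum>a<nT. rT X a *\<^sub>R T ! a)"
    unfolding rT_def using sum.reindex_bij_betw[OF bij_betw_nth[OF T_basis(1) refl refl], of "\<lambda>b. representation (set T) X b *\<^sub>R b"]
    by simp
  finally show ?thesis .
qed

lemma rT_T: "a < nT \<Longrightarrow> b < nT \<Longrightarrow> rT (T ! b) a = (if a = b then 1 else 0)"
  unfolding rT_def using representation_basis[OF T_basis(2), of "T ! b"] T_basis(1)
  by (auto simp: nth_eq_iff_index_eq)

text \<open>The signs \<plusminus>1 that an indefinite form takes on an orthonormal basis; only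
  their being nonzero is used.\<close>

definition \<eta> :: "nat \<Rightarrow> real" where "\<eta> a = lf (T ! a) (T ! a)"

lemma lf_T: "a < nT \<Longrightarrow> b < nT \<Longrightarrow> lf (T ! a) (T ! b) = (if a = b then \<eta> a else 0)"
  using T_orth[of a b] by (auto simp: \<eta>_def split: if_splits)

lemma \<eta>_nz: "a < nT \<Longrightarrow> \<eta> a \<noteq> 0"
  using T_orth[of a a] by (auto simp: \<eta>_def)

lemma lf_rT: "a < nT \<Longrightarrow> lf (T ! a) X = \<eta> a * rT X a"
  by (subst rT_expand[of X], subst linear_sum_real[OF lf_linear(1)])
     (simp add: lf_T if_distrib[of "\<lambda>x. _ * x"] cong: if_cong)

definition sc :: "nat \<Rightarrow> nat \<Rightarrow> nat \<Rightarrow> real" where "sc a b c = rT (br (T ! b) (T ! c)) a"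

lemma sc_anti: "sc a c b = - sc a b c"
  unfolding sc_def by (subst br_anti) (simp add: linear_neg[OF rT_linear])

lemma rT_br: "rT (br X Y) a = (\<Sum>b<nT. \<Sum>c<nT. rT X b * rT Y c * sc a b c)"
proof -
  have "br X Y = br (\<Sum>b<nT. rT X b *\<^sub>R T ! b) Y" by (simp only: rT_expand[symmetric])
  also have "\<dots> = (\<Sum>b<nT. rT X b *\<^sub>R br (T ! b) Y)" by (rule linear_eq_on_basis_sum[OF br_linear(2)])
  finally have "rT (br X Y) a = (\<Sum>b<nT. rT X b * rT (br (T ! b) Y) a)" by (simp only: rT_sum_scale)
  moreover have "rT (br (T ! b) Y) a = (\<Sum>c<nT. rT Y c * sc a b c)" for b
  proof -
    have "br (T ! b) Y = br (T ! b) (\<Sum>c<nT. rT Y c *\<^sub>R T ! c)" by (simp only: rT_expand[symmetric])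
    also have "\<dots> = (\<Sum>c<nT. rT Y c *\<^sub>R br (T ! b) (T ! c))" by (rule linear_eq_on_basis_sum[OF br_linear(1)])
    finally show ?thesis by (simp only: rT_sum_scale sc_def)
  qed
  ultimately show ?thesis by (simp add: sum_distrib_left mult.assoc)
qed

lemma rT_br_T: "c < nT \<Longrightarrow> rT (br X (T ! c)) a = (\<Sum>b<nT. rT X b * sc a b c)"
  by (simp add: rT_br rT_T if_distrib[of "\<lambda>x. _ * x"] if_distrib[of "\<lambda>x. x * _"] cong: if_cong)

text \<open>The Jacobi identity in components: the adjoint action is a representation.\<close>

lemma sc_jacobi:
  assumes "b < nT" "c < nT" "d < nT"
  shows "(\<Sum>e<nT. sc a b e * sc e c d) - (\<Sum>e<nT. sc a c e * sc e b d) = (\<Sum>e<nT. sc a e d * sc e b c)"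
proof -
  have k: "rT (br (T ! x) (br (T ! y) (T ! z))) a = (\<Sum>e<nT. sc a x e * sc e y z)" if "x < nT" for x y z
    using that by (simp add: rT_br[of "T ! x"] rT_T sc_def[of _ y z] mult.commute
        if_distrib[of "\<lambda>x. _ * x"] if_distrib[of "\<lambda>x. x * _"] sum_distrib_left cong: if_cong)
       (subst sum.swap, simp add: if_distrib[of "\<lambda>x. _ * x"] cong: if_cong)?
  have "rT (br (T ! b) (br (T ! c) (T ! d)) + br (T ! c) (br (T ! d) (T ! b)) + br (T ! d) (br (T ! b) (T ! c))) a = 0"
    by (simp add: jacobi linear_0[OF rT_linear])
  hence "(\<Sum>e<nT. sc a b e * sc e c d) + (\<Sum>e<nT. sc a c e * sc e d b) + (\<Sum>e<nT. sc a d e * sc e b c) = 0"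
    using assms by (simp add: linear_add[OF rT_linear] k)
  moreover have "sc a c e * sc e d b = - (sc a c e * sc e b d)" "sc a d e * sc e b c = - (sc a e d * sc e b c)" for e
    using sc_anti[of e b d] sc_anti[of a e d] by simp_all
  ultimately show ?thesis by (simp add: sum_negf)
qed

text \<open>Each diagonal term vanishes separately: by invariance it is, up to a sign, the pairing
  of \<open>T ! b\<close> with the bracket of \<open>T ! a\<close> with itself.\<close>

lemma sc_trace: "b < nT \<Longrightarrow> (\<Sum>a<nT. sc a b a) = 0"
proof (intro sum.neutral ballI)
  fix a assume a: "a \<in> {..<nT}"
  have "lf (T ! a) (br (T ! b) (T ! a)) = - lf (T ! b) (br (T ! a) (T ! a))" by (rule lf_br_swap12)
  hence "\<eta> a * sc a b a = 0" using a by (simp add: lf_rT sc_def br_self linear_0[OF lf_linear(1)])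
  thus "sc a b a = 0" using \<eta>_nz a by simp
qed

end

subsection \<open>Differential graded Frobenius algebras\<close>

locale dgf =
  fixes C :: "'c::real_vector dg_data"
  assumes frob: "dg_frobenius C"
begin

abbreviation "gr \<equiv> grade C"
abbreviation "d \<equiv> diff C"
abbreviation "mu \<equiv> mul C"
abbreviation "pp \<equiv> pairing C"

lemma fin_dim: "\<exists>B::'c set. finite B \<and> span B = UNIV"
  using frob[unfolded dg_frobenius_def bilinear_map_def, THEN conjunct1] by blast
lemma gr_subspace: "subspace (gr k)"
  using frob[unfolded dg_frobenius_def bilinear_map_def, THEN conjunct2, THEN conjunct1] by blast
lemma gr_large: "k > 3 \<Longrightarrow> gr k = {0}"
  using frob[unfolded dg_frobenius_def bilinear_map_def, THEN conjunct2, THEN conjunct2, THEN conjunct1] by blast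
lemma gr_ex1: "\<exists>!f. (\<forall>k\<le>3. f k \<in> gr k) \<and> (\<forall>k>3. f k = 0) \<and> c = (\<Sum>k\<le>3. f k)"
  using frob[unfolded dg_frobenius_def bilinear_map_def, THEN conjunct2, THEN conjunct2, THEN conjunct2, THEN conjunct1] by blast
lemma d_linear: "linear d"
  using frob[unfolded dg_frobenius_def bilinear_map_def, THEN conjunct2, THEN conjunct2, THEN conjunct2, THEN conjunct2, THEN conjunct1] by blast
lemma d_gr: "a \<in> gr k \<Longrightarrow> d a \<in> gr (Suc k)"
  using frob[unfolded dg_frobenius_def bilinear_map_def, THEN conjunct2, THEN conjunct2, THEN conjunct2, THEN conjunct2, THEN conjunct2, THEN conjunct1] by (meson image_subset_iff)
lemma d_d [simp]: "d (d a) = 0"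
  using frob[unfolded dg_frobenius_def bilinear_map_def, THEN conjunct2, THEN conjunct2, THEN conjunct2, THEN conjunct2, THEN conjunct2, THEN conjunct2, THEN conjunct1] by blast
lemma mu_linear: "linear (mu a)" "linear (\<lambda>a. mu a b)"
  using frob[unfolded dg_frobenius_def bilinear_map_def, THEN conjunct2, THEN conjunct2, THEN conjunct2, THEN conjunct2, THEN conjunct2, THEN conjunct2, THEN conjunct2, THEN conjunct1] by simp_all
lemma mu_gr: "a \<in> gr i \<Longrightarrow> b \<in> gr j \<Longrightarrow> mu a b \<in> gr (i + j)"
  using frob[unfolded dg_frobenius_def bilinear_map_def, THEN conjunct2, THEN conjunct2, THEN conjunct2, THEN conjunct2, THEN conjunct2, THEN conjunct2, THEN conjunct2, THEN conjunct2, THEN conjunct1] by blast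
lemma mu_assoc: "mu (mu a b) c = mu a (mu b c)"
  using frob[unfolded dg_frobenius_def bilinear_map_def, THEN conjunct2, THEN conjunct2, THEN conjunct2, THEN conjunct2, THEN conjunct2, THEN conjunct2, THEN conjunct2, THEN conjunct2, THEN conjunct2, THEN conjunct1] by blast
lemma mu_comm: "a \<in> gr i \<Longrightarrow> b \<in> gr j \<Longrightarrow> mu a b = (-1) ^ (i * j) *\<^sub>R mu b a"
  using frob[unfolded dg_frobenius_def bilinear_map_def, THEN conjunct2, THEN conjunct2, THEN conjunct2, THEN conjunct2, THEN conjunct2, THEN conjunct2, THEN conjunct2, THEN conjunct2, THEN conjunct2, THEN conjunct2, THEN conjunct1] by blast
lemma unit_mu: "mu (unit C) a = a"
  using frob[unfolded dg_frobenius_def bilinear_map_def, THEN conjunct2, THEN conjunct2, THEN conjunct2, THEN conjunct2, THEN conjunct2, THEN conjunct2, THEN conjunct2, THEN conjunct2, THEN conjunct2, THEN conjunct2, THEN conjunct2, THEN conjunct2, THEN conjunct1] by blast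
lemma leibniz: "a \<in> gr i \<Longrightarrow> d (mu a b) = mu (d a) b + (-1) ^ i *\<^sub>R mu a (d b)"
  using frob[unfolded dg_frobenius_def bilinear_map_def, THEN conjunct2, THEN conjunct2, THEN conjunct2, THEN conjunct2, THEN conjunct2, THEN conjunct2, THEN conjunct2, THEN conjunct2, THEN conjunct2, THEN conjunct2, THEN conjunct2, THEN conjunct2, THEN conjunct2, THEN conjunct1] by blast
lemma pi_linear: "linear (pp a)" "linear (\<lambda>a. pp a b)"
  using frob[unfolded dg_frobenius_def bilinear_map_def, THEN conjunct2, THEN conjunct2, THEN conjunct2, THEN conjunct2, THEN conjunct2, THEN conjunct2, THEN conjunct2, THEN conjunct2, THEN conjunct2, THEN conjunct2, THEN conjunct2, THEN conjunct2, THEN conjunct2, THEN conjunct2, THEN conjunct1] by simp_all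
lemma pi_nondeg: "(\<And>b. pp a b = 0) \<Longrightarrow> a = 0"
  using frob[unfolded dg_frobenius_def bilinear_map_def, THEN conjunct2, THEN conjunct2, THEN conjunct2, THEN conjunct2, THEN conjunct2, THEN conjunct2, THEN conjunct2, THEN conjunct2, THEN conjunct2, THEN conjunct2, THEN conjunct2, THEN conjunct2, THEN conjunct2, THEN conjunct2, THEN conjunct2, THEN conjunct1] by blast
lemma pi_sym: "a \<in> gr i \<Longrightarrow> b \<in> gr j \<Longrightarrow> pp a b = (-1) ^ (i * j) * pp b a"
  using frob[unfolded dg_frobenius_def bilinear_map_def, THEN conjunct2, THEN conjunct2, THEN conjunct2, THEN conjunct2, THEN conjunct2, THEN conjunct2, THEN conjunct2, THEN conjunct2, THEN conjunct2, THEN conjunct2, THEN conjunct2, THEN conjunct2, THEN conjunct2, THEN conjunct2, THEN conjunct2, THEN conjunct2, THEN conjunct1] by blast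
lemma pi_gr: "a \<in> gr i \<Longrightarrow> b \<in> gr j \<Longrightarrow> pp a b \<noteq> 0 \<Longrightarrow> i + j = 3"
  using frob[unfolded dg_frobenius_def bilinear_map_def, THEN conjunct2, THEN conjunct2, THEN conjunct2, THEN conjunct2, THEN conjunct2, THEN conjunct2, THEN conjunct2, THEN conjunct2, THEN conjunct2, THEN conjunct2, THEN conjunct2, THEN conjunct2, THEN conjunct2, THEN conjunct2, THEN conjunct2, THEN conjunct2, THEN conjunct2, THEN conjunct1] by blast
lemma pi_d: "a \<in> gr i \<Longrightarrow> pp (d a) b + (-1) ^ i * pp a (d b) = 0"
  using frob[unfolded dg_frobenius_def bilinear_map_def, THEN conjunct2, THEN conjunct2, THEN conjunct2, THEN conjunct2, THEN conjunct2, THEN conjunct2, THEN conjunct2, THEN conjunct2, THEN conjunct2, THEN conjunct2, THEN conjunct2, THEN conjunct2, THEN conjunct2, THEN conjunct2, THEN conjunct2, THEN conjunct2, THEN conjunct2, THEN conjunct2, THEN conjunct1] by blast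
lemma pi_mu: "pp a (mu b c) = pp (mu a b) c"
  using frob[unfolded dg_frobenius_def bilinear_map_def, THEN conjunct2, THEN conjunct2, THEN conjunct2, THEN conjunct2, THEN conjunct2, THEN conjunct2, THEN conjunct2, THEN conjunct2, THEN conjunct2, THEN conjunct2, THEN conjunct2, THEN conjunct2, THEN conjunct2, THEN conjunct2, THEN conjunct2, THEN conjunct2, THEN conjunct2, THEN conjunct2, THEN conjunct2] by blast

lemma gr_expand: obtains f where "\<And>k. f k \<in> gr k" "c = (\<Sum>k\<le>3. f k)"
proof -
  obtain f where f: "\<And>k. k \<le> 3 \<Longrightarrow> f k \<in> gr k" "\<And>k. k > 3 \<Longrightarrow> f k = 0" "c = (\<Sum>k\<le>3. f k)"
    using gr_ex1[of c] by blast
  have "f k \<in> gr k" for k using f(1,2)[of k] subspace_0[OF gr_subspace] by (cases "k \<le> 3") auto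
  thus ?thesis using that f(3) by blast
qed

lemma gr_unique:
  assumes "\<forall>k\<le>3. f k \<in> gr k" "\<forall>k>3. f k = 0" "\<forall>k\<le>3. g k \<in> gr k" "\<forall>k>3. g k = 0"
    and "(\<Sum>k\<le>3. f k) = (\<Sum>k\<le>3. g k)"
  shows "f = g"
proof -
  have "(THE h. (\<forall>k\<le>3. h k \<in> gr k) \<and> (\<forall>k>3. h k = 0) \<and> (\<Sum>k\<le>3. f k) = (\<Sum>k\<le>3. h k)) = f"
    by (rule the1_equality[OF gr_ex1]) (use assms in simp)
  moreover have "(THE h. (\<forall>k\<le>3. h k \<in> gr k) \<and> (\<forall>k>3. h k = 0) \<and> (\<Sum>k\<le>3. f k) = (\<Sum>k\<le>3. h k)) = g"
    by (rule the1_equality[OF gr_ex1]) (use assms in simp)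
  ultimately show ?thesis by simp
qed

lemma pi_zero: "linear f \<Longrightarrow> (\<And>k a. a \<in> gr k \<Longrightarrow> f a = 0) \<Longrightarrow> f a = 0" for f :: "'c \<Rightarrow> 'd::real_vector"
proof -
  assume f: "linear f" "\<And>k a. a \<in> gr k \<Longrightarrow> f a = 0"
  obtain g where g: "\<And>k. g k \<in> gr k" "a = (\<Sum>k\<le>3. g k)" by (rule gr_expand[of a]) blast
  have "f (g k) = 0" for k by (rule f(2)[OF g(1)])
  thus ?thesis unfolding g(2) using f(1) by (simp add: linear_sum)
qed

lemma linear_ext_gr:
  assumes "linear f" "linear g" "\<And>k a. a \<in> gr k \<Longrightarrow> f a = g a"
  shows "f a = g a"
  using pi_zero[of "\<lambda>a. f a - g a" a] assms by (simp add: linear_compose_sub)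

lemma pi_closed_exact: "d a = 0 \<Longrightarrow> a \<in> gr i \<Longrightarrow> pp a (d b) = 0"
  using pi_d[of a i b] by (simp add: linear_0[OF pi_linear(2)])

text \<open>Nondegeneracy is given in the first argument. It transfers through graded symmetry,
  which holds for homogeneous elements; hence the splitting into components, which the pairing tells
  apart by degree.\<close>

lemma pi_nondeg_right: "(\<And>b. pp b a = 0) \<Longrightarrow> a = 0"
proof -
  assume a: "\<And>b. pp b a = 0"
  obtain g where g: "\<And>k. g k \<in> gr k" "a = (\<Sum>k\<le>3. g k)" by (rule gr_expand[of a]) blast
  have "g j = 0" if j: "j \<le> 3" for j
  proof (rule pi_nondeg)
    have gj: "pp b (g j) = 0" for b
    proof (rule linear_ext_gr[of "\<lambda>b. pp b (g j)" "\<lambda>_. 0"])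
      fix k b assume b: "b \<in> gr k"
      show "pp b (g j) = 0"
      proof (rule ccontr)
        assume nz: "pp b (g j) \<noteq> 0"
        hence kj: "k + j = 3" using pi_gr[OF b g(1)] by blast
        have "pp b (g i) = 0" if "i \<noteq> j" for i
          using pi_gr[OF b g(1), of i] kj that by auto
        hence "pp b a = (\<Sum>i\<le>3. if i = j then pp b (g j) else 0)"
          unfolding g(2) linear_sum[OF pi_linear(1)] by (intro sum.cong) auto
        thus False using a[of b] nz j by simp
      qed
    qed (simp_all add: pi_linear linear_zero)
    fix b
    show "pp (g j) b = 0"
    proof (rule linear_ext_gr[of "pp (g j)" "\<lambda>_. 0"])
      fix k b assume b: "b \<in> gr k"
      show "pp (g j) b = 0" using pi_sym[OF g(1) b] gj by simp
    qed (simp_all add: pi_linear linear_zero)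
  qed
  thus ?thesis using g(2) by simp
qed

end

subsection \<open>Induction data\<close>

locale induction = dgf C for C :: "'c::real_vector dg_data" +
  fixes cls :: "'c \<Rightarrow> 'h::real_vector" and \<iota> :: "'h \<Rightarrow> 'c" and K :: "'c \<Rightarrow> 'c"
  assumes coh: "cohomology C cls" and ind: "induction_data C cls \<iota> K" and hom: "algebra_hom C cls \<iota>"
begin

lemma rep: "representatives C cls \<iota>" and lowers: "lowers_degree C K" and skew: "skew_homotopy C K"
  using ind by (simp_all add: induction_data_def)

lemma K_linear: "linear K" and K_\<iota> [simp]: "K (\<iota> x) = 0" and K_K [simp]: "K (K a) = 0"
  using ind by (simp_all add: induction_data_def)

lemma \<iota>_linear: "linear \<iota>" and d_\<iota> [simp]: "d (\<iota> x) = 0" and cls_\<iota>: "cls (\<iota> x) = x"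
  using rep by (simp_all add: representatives_def)

lemma \<iota>_gr: "x \<in> coh_grade C cls k \<Longrightarrow> \<iota> x \<in> gr k"
  using rep by (meson representatives_def image_subset_iff)

lemma K_gr0: "a \<in> gr 0 \<Longrightarrow> K a = 0" and K_gr: "a \<in> gr (Suc k) \<Longrightarrow> K a \<in> gr k"
  using lowers unfolding lowers_degree_def by (meson image_subset_iff singletonD)+

lemma pi_K: "a \<in> gr i \<Longrightarrow> pp (K a) b = (-1) ^ i * pp a (K b)"
  using skew unfolding skew_homotopy_def by blast

lemma homotopy: "\<exists>x. d (K a) + K (d a) = a - \<iota> x"
  using ind unfolding induction_data_def by blast

lemma \<iota>_unit: "\<iota> (cls (unit C)) = unit C"
  and \<iota>_mult: "d a = 0 \<Longrightarrow> d b = 0 \<Longrightarrow> \<iota> (cls (mu a b)) = mu (\<iota> (cls a)) (\<iota> (cls b))"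
  using hom unfolding algebra_hom_def by blast+

lemma \<iota>_mu: obtains z where "mu (\<iota> x) (\<iota> y) = \<iota> z"
  using \<iota>_mult[of "\<iota> x" "\<iota> y"] by (metis cls_\<iota> d_\<iota>)

text \<open>The projector onto representatives, \<iota> after its transpose, expressed through the
  homotopy so that the transpose never has to be computed.\<close>

definition P :: "'c \<Rightarrow> 'c" where "P a = a - d (K a) - K (d a)"

lemma P_linear: "linear P"
  unfolding P_def[abs_def]
  by (intro linear_compose_sub linear_ident linear_compose[OF K_linear d_linear, unfolded o_def]
      linear_compose[OF d_linear K_linear, unfolded o_def])

lemma P_range: "\<exists>x. P a = \<iota> x"
proof -
  obtain x where "d (K a) + K (d a) = a - \<iota> x" using homotopy by blast
  hence "P a = a - (a - \<iota> x)" by (simp only: P_def diff_diff_eq)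
  thus ?thesis by auto
qed

lemma P_\<iota> [simp]: "P (\<iota> x) = \<iota> x"
  by (simp add: P_def linear_0[OF d_linear] linear_0[OF K_linear])

lemma K_P [simp]: "K (P a) = 0" and d_P [simp]: "d (P a) = 0" and P_P [simp]: "P (P a) = P a"
  using P_range[of a] by auto

text \<open>Comes from \<open>K (P a) = 0\<close> upon inserting the definition of \<open>P\<close>,
  the square of \<open>K\<close> being zero.\<close>

lemma K_d_K: "K (d (K a)) = K a"
  using K_P[of a] by (simp add: P_def linear_diff[OF K_linear])

lemma d_K_d: "d (K (d a)) = d a"
  using d_P[of a] by (simp add: P_def linear_diff[OF d_linear])

lemma P_K [simp]: "P (K a) = 0"
  by (simp add: P_def linear_0[OF d_linear] K_d_K)

lemma P_d [simp]: "P (d a) = 0"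
  by (simp add: P_def d_K_d linear_0[OF K_linear])

lemma decomp: "a = P a + d (K a) + K (d a)"
  by (simp add: P_def)

text \<open>Integration by parts with \<open>d\<close> and the skewness of \<open>K\<close> exchange
  the roles of \<open>d K\<close> and \<open>K d\<close> under the pairing.\<close>

lemma pi_P: "pp (P a) b = pp a (P b)"
proof (rule linear_ext_gr[of "\<lambda>a. pp (P a) b" "\<lambda>a. pp a (P b)"])
  show "linear (\<lambda>a. pp (P a) b)"
    using linear_compose[OF P_linear pi_linear(2)[of b]] by (simp add: o_def)
  show "linear (\<lambda>a. pp a (P b))" by (rule pi_linear)
  fix i a assume a: "a \<in> gr i"
  have "pp (d (K a)) b = pp a (K (d b))"
  proof (cases i)
    case 0
    thus ?thesis using a K_gr0[of a] pi_K[OF a, of "d b"] by (simp add: linear_0[OF d_linear] linear_0[OF pi_linear(2)])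
  next
    case (Suc j)
    have "pp (d (K a)) b + (-1) ^ j * pp (K a) (d b) = 0" by (rule pi_d[OF K_gr]) (use a Suc in simp)
    moreover have "pp (K a) (d b) = (-1) ^ Suc j * pp a (K (d b))" using pi_K[OF a, of "d b"] Suc by simp
    ultimately show ?thesis by (cases "even j") simp_all
  qed
  moreover have "pp (K (d a)) b = pp a (d (K b))"
  proof -
    have "pp (d a) (K b) = - ((-1) ^ i * pp a (d (K b)))" using pi_d[OF a, of "K b"] by simp
    thus ?thesis using pi_K[OF d_gr[OF a], of b] by simp
  qed
  ultimately show "pp (P a) b = pp a (P b)"
    by (simp add: P_def linear_diff[OF pi_linear(1)] linear_diff[OF pi_linear(2)])
qed

text \<open>\<open>P\<close> is self-adjoint, kills im K and fixes im \<iota>.\<close>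

lemma pi_K_\<iota>: "pp (K a) (\<iota> x) = 0" and pi_\<iota>_K: "pp (\<iota> x) (K a) = 0"
proof -
  have "pp (K a) (P (\<iota> x)) = 0" "pp (P (\<iota> x)) (K a) = 0"
    by (simp_all only: pi_P[symmetric] P_K linear_0[OF pi_linear(2)]) (simp only: pi_P P_K linear_0[OF pi_linear(1)])
  thus "pp (K a) (\<iota> x) = 0" "pp (\<iota> x) (K a) = 0" by simp_all
qed

text \<open>Skewness moves \<open>K\<close> to the other argument; in particular im K is
  isotropic.\<close>

lemma pi_K_eq_0: "pp (K a) b = 0" if "K b = 0"
proof (rule linear_ext_gr[of "\<lambda>a. pp (K a) b" "\<lambda>_. 0"])
  show "linear (\<lambda>a. pp (K a) b)"
    using linear_compose[OF K_linear pi_linear(2)[of b]] by (simp add: o_def)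
qed (use that in \<open>simp_all add: pi_K linear_zero linear_0[OF pi_linear(1)]\<close>)

text \<open>Pairing with a representative and using associativity leaves a product of
  representatives, again in im \<iota>, paired with im K. This is where multiplicativity of \<iota>
  enters.\<close>

lemma P_\<iota>_K: "P (mu (\<iota> h) (K c)) = 0"
proof (rule pi_nondeg_right)
  fix b
  obtain x where x: "P b = \<iota> x" using P_range by blast
  have "pp b (P (mu (\<iota> h) (K c))) = pp (mu (\<iota> x) (\<iota> h)) (K c)"
    by (simp only: pi_P[symmetric] x pi_mu)
  moreover obtain z where "mu (\<iota> x) (\<iota> h) = \<iota> z" by (rule \<iota>_mu)
  ultimately show "pp b (P (mu (\<iota> h) (K c))) = 0" by (simp only: pi_\<iota>_K)
qed

lemma K_\<iota>_P: "K (mu (\<iota> h) (P c)) = 0"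
proof -
  obtain x where x: "P c = \<iota> x" using P_range by blast
  moreover obtain z where "mu (\<iota> h) (\<iota> x) = \<iota> z" by (rule \<iota>_mu)
  ultimately show ?thesis by (simp only: K_\<iota>)
qed

end

subsection \<open>The cubic theory of a formal Frobenius algebra\<close>

definition mm :: "'i set \<Rightarrow> ('i \<Rightarrow> 'i \<Rightarrow> real) \<Rightarrow> ('i \<Rightarrow> 'i \<Rightarrow> real) \<Rightarrow> 'i \<Rightarrow> 'i \<Rightarrow> real" where
  "mm V A B v w = (\<Sum>u\<in>V. A v u * B u w)"

lemma mm_assoc: "mm V (mm V A B) D v w = mm V A (mm V B D) v w"
  unfolding mm_def sum_distrib_left sum_distrib_right by (subst sum.swap) (simp add: mult.assoc)

lemma mm_id_right: "finite V \<Longrightarrow> w \<in> V \<Longrightarrow> (\<And>u. u \<in> V \<Longrightarrow> B u w = (if u = w then 1 else 0)) \<Longrightarrow> mm V A B v w = A v w"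
proof -
  assume *: "finite V" "w \<in> V" "\<And>u. u \<in> V \<Longrightarrow> B u w = (if u = w then 1 else 0)"
  have "mm V A B v w = (\<Sum>u\<in>V. if u = w then A v w else 0)"
    unfolding mm_def by (intro sum.cong refl) (simp add: *(3))
  thus ?thesis using * by simp
qed

lemma mm_id_left: "finite V \<Longrightarrow> v \<in> V \<Longrightarrow> (\<And>u. u \<in> V \<Longrightarrow> B v u = (if v = u then 1 else 0)) \<Longrightarrow> mm V B A v w = A v w"
proof -
  assume *: "finite V" "v \<in> V" "\<And>u. u \<in> V \<Longrightarrow> B v u = (if v = u then 1 else 0)"
  have "mm V B A v w = (\<Sum>u\<in>V. if v = u then A v w else 0)"
    unfolding mm_def by (intro sum.cong refl) (simp add: *(3))
  thus ?thesis using * by simp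
qed

lemma mm_cong: "(\<And>u. u \<in> V \<Longrightarrow> A v u = A' v u) \<Longrightarrow> (\<And>u. u \<in> V \<Longrightarrow> B u w = B' u w) \<Longrightarrow> mm V A B v w = mm V A' B' v w"
  by (simp add: mm_def)

definition idx :: "(nat \<Rightarrow> 'x list) \<Rightarrow> nat \<Rightarrow> (nat \<times> nat \<times> nat) set" where
  "idx e n = (SIGMA k:{..<4}. SIGMA i:{..<length (e k)}. {..<n})"

lemma finite_idx: "finite (idx e n)" by (simp add: idx_def)

lemma mem_idx: "(k, i, a) \<in> idx e n \<longleftrightarrow> k < 4 \<and> i < length (e k) \<and> a < n"
  by (auto simp: idx_def)

lemma sum_idx: "(\<Sum>(k, i, a)\<in>idx e n. f k i a) = (\<Sum>k<4. \<Sum>i<length (e k). \<Sum>a<n. f k i a)"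
proof -
  have "(\<Sum>k<4. \<Sum>i<length (e k). \<Sum>a<n. f k i a) = (\<Sum>k<4. \<Sum>(i, a)\<in>(SIGMA i:{..<length (e k)}. {..<n}). f k i a)"
    by (intro sum.cong refl sum.Sigma) auto
  also have "\<dots> = (\<Sum>(k, i, a)\<in>idx e n. f k i a)"
    unfolding idx_def by (rule sum.Sigma) auto
  finally show ?thesis by simp
qed

lemma sum_list_concat_map: "(\<Sum>s\<leftarrow>concat (map g xs). f s) = (\<Sum>x\<leftarrow>xs. \<Sum>s\<leftarrow>g x. f s)"
  by (induction xs) auto

lemma sum_list_upt: "(\<Sum>i\<leftarrow>[0..<n]. f i) = (\<Sum>i<n. f i)"
  by (simp add: interv_sum_list_conv_sum_set_nat atLeast0LessThan)

lemma sum_canonical_element: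
  fixes f :: "_ \<Rightarrow> 'y::comm_monoid_add"
  shows "(\<Sum>s\<leftarrow>canonical_element T e x. f s) = (\<Sum>(k, i, a)\<in>idx e (length T). f (T ! a, e k ! i, x k i a))"
proof -
  have "(\<Sum>a\<leftarrow>[0..<n]. \<Sum>s\<leftarrow>[g a]. f s) = (\<Sum>a<n. f (g a))" for n g
    by (simp add: sum_list_upt)
  thus ?thesis
    unfolding canonical_element_def sum_idx
    by (simp add: sum_list_concat_map sum_list_upt o_def)
qed

lemma set_canonical_element:
  "set (canonical_element T e x) = (\<lambda>(k, i, a). (T ! a, e k ! i, x k i a)) ` idx e (length T)"
  by (force simp: canonical_element_def idx_def image_iff)

lemma minus_one_cases: "(-1 :: real) ^ n = (if even n then 1 else -1)"
  by (simp add: minus_one_power_iff)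

locale formal_theory = induction C cls \<iota> K + metric_lie \<gg> T
  for C :: "'c::real_vector dg_data" and cls :: "'c \<Rightarrow> 'h::real_vector" and \<iota> and K
    and \<gg> :: "'g::real_vector lie_data" and T +
  fixes E :: "nat \<Rightarrow> 'h list"
  assumes cbas: "cohomology_basis C cls \<iota> E"
begin

definition eF :: "nat \<Rightarrow> 'c list" where "eF k = some_basis (K ` gr (Suc k))"

lemma eF_basis: "is_basis (eF k) (K ` gr (Suc k))"
  unfolding eF_def by (rule some_basis[OF linear_subspace_image[OF K_linear gr_subspace] fin_dim])

lemma eF_in: "i < length (eF k) \<Longrightarrow> eF k ! i \<in> K ` gr (Suc k)"
  using eF_basis[of k] unfolding is_basis_def by (metis nth_mem span_base)

lemma E_basis: "k < 4 \<Longrightarrow> is_basis (E k) (coh_grade C cls k)"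
  using cbas by (simp add: cohomology_basis_def)

lemma E_gr: "k < 4 \<Longrightarrow> i < length (E k) \<Longrightarrow> \<iota> (E k ! i) \<in> gr k"
  by (rule \<iota>_gr) (use E_basis[of k] in \<open>metis is_basis_def nth_mem span_base\<close>)

lemma E0: "E 0 = [cls (unit C)]"
  using cbas by (simp add: cohomology_basis_def)

definition Rv :: "var set" where "Rv = (\<lambda>(k, i, a). Resid k i a) ` idx E nT"
definition Fv :: "var set" where "Fv = (\<lambda>(k, i, a). Fluct k i a) ` idx eF nT"

lemma fin_Rv: "finite Rv" and fin_Fv: "finite Fv"
  by (simp_all add: Rv_def Fv_def finite_idx)

lemma Rv_iff: "Resid k i a \<in> Rv \<longleftrightarrow> k < 4 \<and> i < length (E k) \<and> a < nT"
  unfolding mem_idx[symmetric] by (force simp: Rv_def)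

lemma Fv_iff: "Fluct k i a \<in> Fv \<longleftrightarrow> k < 4 \<and> i < length (eF k) \<and> a < nT"
  unfolding mem_idx[symmetric] by (force simp: Fv_def)

lemma RvF [simp]: "Fluct k i a \<notin> Rv" and FvR [simp]: "Resid k i a \<notin> Fv"
  by (auto simp: Rv_def Fv_def image_iff mem_idx)

lemma Rv_cases: "v \<in> Rv \<Longrightarrow> \<exists>k i a. v = Resid k i a \<and> k < 4 \<and> i < length (E k) \<and> a < nT"
  and Fv_cases: "v \<in> Fv \<Longrightarrow> \<exists>k i a. v = Fluct k i a \<and> k < 4 \<and> i < length (eF k) \<and> a < nT"
  by (auto simp: Rv_def Fv_def mem_idx)

lemma sum_Rv: "(\<Sum>v\<in>Rv. f v) = (\<Sum>(k, i, a)\<in>idx E nT. f (Resid k i a))"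
  unfolding Rv_def by (subst sum.reindex) (auto intro!: inj_onI sum.cong)
lemma sum_Fv: "(\<Sum>v\<in>Fv. f v) = (\<Sum>(k, i, a)\<in>idx eF nT. f (Fluct k i a))"
  unfolding Fv_def by (subst sum.reindex) (auto intro!: inj_onI sum.cong)

fun fg :: "var \<Rightarrow> 'g" where
  "fg (Resid k i a) = T ! a"
| "fg (Fluct k i a) = T ! a"

fun fc0 :: "var \<Rightarrow> 'c" where
  "fc0 (Resid k i a) = \<iota> (E k ! i)"
| "fc0 (Fluct k i a) = eF k ! i"

text \<open>The value 0 outside the coordinates in use makes the degree and symmetry statements
  below hold for all variables.\<close>

definition fc :: "var \<Rightarrow> 'c" where "fc v = (if v \<in> Rv \<union> Fv then fc0 v else 0)"

definition fld :: "var \<Rightarrow> 'g \<times> 'c \<times> var" where "fld v = (fg v, fc v, v)"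

lemma fc_gr: "fc v \<in> gr (form_degree v)"
proof (cases v)
  case (Resid k i a)
  thus ?thesis using E_gr[of k i] subspace_0[OF gr_subspace] by (simp add: fc_def Rv_iff)
next
  case (Fluct k i a)
  thus ?thesis using eF_in[of i k] K_gr[of _ k] subspace_0[OF gr_subspace] by (auto simp: fc_def Fv_iff)
qed

lemma fc_Rv: "v \<in> Rv \<Longrightarrow> \<exists>x. fc v = \<iota> x"
  by (cases v) (auto simp: fc_def Rv_iff)

lemma fc_Fv: "v \<in> Fv \<Longrightarrow> \<exists>a. fc v = K a"
  by (cases v) (use eF_in in \<open>auto simp: fc_def Fv_iff\<close>)

definition cc :: "var \<Rightarrow> var \<Rightarrow> var \<Rightarrow> real" where
  "cc u v w = cubic_term C \<gg> (fld u) (fld v) (fld w)"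

lemma cc: "cc u v w = (-1) ^ ((1 + form_degree u) * (form_degree v + form_degree w)
     + (1 + form_degree v) * form_degree w) * lf (fg u) (br (fg v) (fg w)) * pp (fc u) (mu (fc v) (fc w))"
  by (simp add: cc_def fld_def)

definition qq :: "var \<Rightarrow> var \<Rightarrow> real" where
  "qq v w = kinetic_term C \<gg> (fld v) (fld w)"

lemma qq: "qq v w = (-1) ^ ((1 + form_degree v) * (form_degree w + 1)) * lf (fg v) (fg w) * pp (fc v) (d (fc w))"
  by (simp add: qq_def fld_def)

text \<open>The antisymmetry of the bracket shifts the parity by one, so a graded commutative
  product becomes supersymmetric in the shifted coordinates.\<close>

lemma cc_sym1: "cc v u w = sg u v * cc u v w"
proof -
  have 1: "pp (fc v) (mu (fc u) (fc w)) = (-1) ^ (form_degree v * form_degree u) * pp (fc u) (mu (fc v) (fc w))"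
    by (simp add: pi_mu mu_comm[OF fc_gr[of v] fc_gr[of u]] linear_scale[OF pi_linear(2)])
  have 2: "lf (fg v) (br (fg u) (fg w)) = - lf (fg u) (br (fg v) (fg w))"
    by (rule lf_br_swap12)
  show ?thesis unfolding cc 1 2
    by (cases "even (form_degree u)"; cases "even (form_degree v)"; cases "even (form_degree w)")
       (simp_all add: minus_one_cases sg_def odd_var_def)
qed

lemma cc_sym2: "cc u w v = sg v w * cc u v w"
proof -
  have 1: "pp (fc u) (mu (fc w) (fc v)) = (-1) ^ (form_degree w * form_degree v) * pp (fc u) (mu (fc v) (fc w))"
    by (simp add: mu_comm[OF fc_gr[of w] fc_gr[of v]] linear_scale[OF pi_linear(1)])
  have 2: "lf (fg u) (br (fg w) (fg v)) = - lf (fg u) (br (fg v) (fg w))"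
    by (rule lf_br_swap23)
  show ?thesis unfolding cc 1 2
    by (cases "even (form_degree u)"; cases "even (form_degree v)"; cases "even (form_degree w)")
       (simp_all add: minus_one_cases sg_def odd_var_def)
qed

lemma cc_deg: "cc u v w \<noteq> 0 \<Longrightarrow> form_degree u + form_degree v + form_degree w = 3"
proof -
  assume "cc u v w \<noteq> 0"
  hence "pp (fc u) (mu (fc v) (fc w)) \<noteq> 0" by (auto simp: cc)
  from pi_gr[OF fc_gr mu_gr[OF fc_gr fc_gr] this] show ?thesis by simp
qed

lemma cc_RRF: "u \<in> Rv \<Longrightarrow> v \<in> Rv \<Longrightarrow> w \<in> Fv \<Longrightarrow> cc u v w = 0"
proof -
  assume "u \<in> Rv" "v \<in> Rv" "w \<in> Fv"
  then obtain x y a where xy: "fc u = \<iota> x" "fc v = \<iota> y" "fc w = K a" using fc_Rv fc_Fv by meson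
  obtain z where "mu (\<iota> x) (\<iota> y) = \<iota> z" by (rule \<iota>_mu)
  thus ?thesis by (simp add: cc xy pi_mu pi_\<iota>_K)
qed

text \<open>The degree zero representative is the unit, so the vertex reduces to the pairing of two
  elements of im K, and im K is isotropic.\<close>

lemma cc_0FF: "u \<in> Rv \<Longrightarrow> form_degree u = 0 \<Longrightarrow> v \<in> Fv \<Longrightarrow> w \<in> Fv \<Longrightarrow> cc u v w = 0"
proof -
  assume u: "u \<in> Rv" "form_degree u = 0" and "v \<in> Fv" "w \<in> Fv"
  then obtain a b where ab: "fc v = K a" "fc w = K b" using fc_Fv by meson
  have "fc u = unit C" using u by (cases u) (auto simp: fc_def Rv_iff E0 \<iota>_unit)
  thus ?thesis by (simp add: cc ab pi_mu unit_mu pi_K_eq_0)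
qed

lemma qq_deg: "qq v w \<noteq> 0 \<Longrightarrow> form_degree v + form_degree w = 2"
proof -
  assume "qq v w \<noteq> 0"
  hence "pp (fc v) (d (fc w)) \<noteq> 0" by (auto simp: qq)
  from pi_gr[OF fc_gr d_gr[OF fc_gr] this] show ?thesis by simp
qed

lemma deg2_par: "form_degree v + form_degree w = 2 \<Longrightarrow> even (form_degree v) = even (form_degree w)"
  by (metis even_add even_numeral)

lemma qq_sym: "qq w v = sg v w * qq v w"
proof -
  have s: "pp (d (fc w)) (fc v) = (-1) ^ (Suc (form_degree w) * form_degree v) * pp (fc v) (d (fc w))"
    by (rule pi_sym[OF d_gr[OF fc_gr] fc_gr])
  have e: "pp (fc w) (d (fc v)) = - ((-1) ^ form_degree w * pp (d (fc w)) (fc v))"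
    using pi_d[OF fc_gr[of w], of "fc v"]
    by (cases "even (form_degree w)") (simp_all add: minus_one_cases)
  show ?thesis
  proof (cases "pp (fc v) (d (fc w)) = 0")
    case True
    thus ?thesis by (simp add: qq e s)
  next
    case False
    hence "form_degree v + form_degree w = 2" using pi_gr[OF fc_gr d_gr[OF fc_gr]] by fastforce
    thus ?thesis unfolding qq e s lf_sym[of "fg w"] using deg2_par[of v w]
      by (cases "even (form_degree v)") (auto simp: minus_one_cases sg_def odd_var_def)
  qed
qed

lemma eF_expand: "y \<in> K ` gr (Suc k) \<Longrightarrow> y = (\<Sum>i<length (eF k). representation (set (eF k)) y (eF k ! i) *\<^sub>R eF k ! i)"
proof -
  assume "y \<in> K ` gr (Suc k)"
  hence "y \<in> span (set (eF k))" using eF_basis[of k] by (simp add: is_basis_def)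
  hence "y = (\<Sum>b\<in>set (eF k). representation (set (eF k)) y b *\<^sub>R b)"
    using eF_basis[of k] by (subst basis_expand) (auto simp: is_basis_def)
  also have "\<dots> = (\<Sum>i<length (eF k). representation (set (eF k)) y (eF k ! i) *\<^sub>R eF k ! i)"
    using eF_basis[of k] sum.reindex_bij_betw[OF bij_betw_nth[of "eF k"], of "{..<length (eF k)}" "set (eF k)" "\<lambda>b. representation (set (eF k)) y b *\<^sub>R b"]
    by (simp add: is_basis_def)
  finally show ?thesis .
qed

lemma rep_eF: "i < length (eF k) \<Longrightarrow> j < length (eF k) \<Longrightarrow>
    representation (set (eF k)) (eF k ! i) (eF k ! j) = (if i = j then 1 else 0)"
  using representation_basis[of "set (eF k)" "eF k ! i"] eF_basis[of k]
  by (auto simp: is_basis_def nth_eq_iff_index_eq)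

lemma fc_Fluct: "Fluct k i a \<in> Fv \<Longrightarrow> fc (Fluct k i a) = eF k ! i"
  and fc_Resid: "Resid k i a \<in> Rv \<Longrightarrow> fc (Resid k i a) = \<iota> (E k ! i)"
  by (simp_all add: fc_def)

end

context formal_theory
begin

text \<open>If \<open>d y\<close> is orthogonal to im K, then skewness and nondegeneracy give
  \<open>K (d y) = 0\<close>; for \<open>y\<close> in im K this means \<open>y = 0\<close>, since
  \<open>K d K = K\<close>. So the kinetic form is nondegenerate on the fluctuations.\<close>

lemma qq_kernel:
  assumes x: "\<And>v. v \<in> Fv \<Longrightarrow> (\<Sum>w\<in>Fv. qq v w * x w) = 0" and v: "v \<in> Fv"
  shows "x v = 0"
proof -
  obtain k j a where vk: "v = Fluct k j a" "k < 4" "j < length (eF k)" "a < nT" using Fv_cases[OF v] by blast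
  \<comment> \<open>By orthonormality the Lie algebra index decouples: the components with index
    \<open>a\<close> fixed form one vector of im K in each degree.\<close>
  define y where "y l = (\<Sum>i<length (eF l). x (Fluct l i a) *\<^sub>R eF l ! i)" for l
  have y_K: "y l \<in> K ` gr (Suc l)" for l
  proof -
    have "y l \<in> span (set (eF l))" unfolding y_def by (intro span_sum span_scale span_base) auto
    thus ?thesis using eF_basis[of l] by (simp add: is_basis_def)
  qed
  have basis: "pp (eF k' ! i') (d (y k)) = 0" if k': "k' < 4" "i' < length (eF k')" for k' i'
  proof (cases "k' + k = 2")
    case False
    obtain z where "z \<in> gr (Suc k')" "eF k' ! i' = K z" using eF_in[OF k'(2)] by blast
    hence "eF k' ! i' \<in> gr k'" using K_gr by simp
    obtain z' where "z' \<in> gr (Suc k)" "y k = K z'" using y_K[of k] by (rule imageE) simp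
    hence "d (y k) \<in> gr (Suc k)" using K_gr d_gr by simp
    from pi_gr[OF \<open>eF k' ! i' \<in> gr k'\<close> this] show ?thesis using False by fastforce
  next
    case True
    let ?v = "Fluct k' i' a"
    have v': "?v \<in> Fv" using k' vk by (simp add: Fv_iff)
    let ?s = "\<lambda>l. (-1::real) ^ ((1 + k') * (l + 1))"
    have "0 = (\<Sum>w\<in>Fv. qq ?v w * x w)" using x[OF v'] by simp
    also have "\<dots> = (\<Sum>l<4. \<Sum>i<length (eF l). \<Sum>b<nT. qq ?v (Fluct l i b) * x (Fluct l i b))"
      unfolding sum_Fv by (rule sum_idx)
    also have "\<dots> = (\<Sum>l<4. ?s l * \<eta> a * pp (eF k' ! i') (d (y l)))"
    proof (rule sum.cong[OF refl])
      fix l assume l: "l \<in> {..<4::nat}"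
      have "(\<Sum>b<nT. qq ?v (Fluct l i b) * x (Fluct l i b)) =
          ?s l * \<eta> a * (x (Fluct l i a) * pp (eF k' ! i') (d (eF l ! i)))" if i: "i < length (eF l)" for i
      proof -
        have "(\<Sum>b<nT. qq ?v (Fluct l i b) * x (Fluct l i b)) = (\<Sum>b<nT. if b = a then
            ?s l * \<eta> a * (x (Fluct l i a) * pp (eF k' ! i') (d (eF l ! i))) else 0)"
        proof (rule sum.cong[OF refl])
          fix b assume b: "b \<in> {..<nT}"
          hence w: "Fluct l i b \<in> Fv" using i l by (simp add: Fv_iff)
          show "qq ?v (Fluct l i b) * x (Fluct l i b) = (if b = a then
            ?s l * \<eta> a * (x (Fluct l i a) * pp (eF k' ! i') (d (eF l ! i))) else 0)"
            unfolding qq fc_Fluct[OF w] fc_Fluct[OF v'] using b vk(4) by (simp add: lf_T)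
        qed
        thus ?thesis using vk by simp
      qed
      hence "(\<Sum>i<length (eF l). \<Sum>b<nT. qq ?v (Fluct l i b) * x (Fluct l i b)) =
          ?s l * \<eta> a * (\<Sum>i<length (eF l). x (Fluct l i a) * pp (eF k' ! i') (d (eF l ! i)))"
        by (simp add: sum_distrib_left)
      also have "(\<Sum>i<length (eF l). x (Fluct l i a) * pp (eF k' ! i') (d (eF l ! i))) = pp (eF k' ! i') (d (y l))"
        unfolding y_def linear_eq_on_basis_sum[OF d_linear] linear_sum_real[OF pi_linear(1)] ..
      finally show "(\<Sum>i<length (eF l). \<Sum>b<nT. qq ?v (Fluct l i b) * x (Fluct l i b)) =
          ?s l * \<eta> a * pp (eF k' ! i') (d (y l))" .
    qed
    also have "\<dots> = (\<Sum>l<4. if l = k then ?s k * \<eta> a * pp (eF k' ! i') (d (y k)) else 0)"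
    proof (rule sum.cong[OF refl])
      fix l :: nat assume "l \<in> {..<4}"
      show "?s l * \<eta> a * pp (eF k' ! i') (d (y l)) = (if l = k then ?s k * \<eta> a * pp (eF k' ! i') (d (y k)) else 0)"
      proof (cases "l = k")
        case False
        obtain z where "z \<in> gr (Suc k')" "eF k' ! i' = K z" using eF_in[OF k'(2)] by blast
        hence "eF k' ! i' \<in> gr k'" using K_gr by simp
        moreover obtain z' where "z' \<in> gr (Suc l)" "y l = K z'" using y_K[of l] by (rule imageE) simp
        hence "d (y l) \<in> gr (Suc l)" using K_gr d_gr by simp
        ultimately have "pp (eF k' ! i') (d (y l)) \<noteq> 0 \<Longrightarrow> k' + Suc l = 3" by (rule pi_gr)
        hence "pp (eF k' ! i') (d (y l)) = 0" using False True by linarith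
        thus ?thesis using False by simp
      qed simp
    qed
    also have "\<dots> = ?s k * \<eta> a * pp (eF k' ! i') (d (y k))" using vk by simp
    finally show ?thesis using \<eta>_nz[OF vk(4)] by simp
  qed
  have "pp c (K (d (y k))) = 0" for c
  proof (rule linear_ext_gr[of "\<lambda>c. pp c (K (d (y k)))" "\<lambda>_. 0"])
    fix j c assume c: "c \<in> gr j"
    have "pp (K c) (d (y k)) = 0"
    proof (cases j)
      case 0
      thus ?thesis using c K_gr0 by (simp add: linear_0[OF pi_linear(2)])
    next
      case (Suc k')
      show ?thesis
      proof (cases "k' < 4")
        case True
        let ?r = "\<lambda>i. representation (set (eF k')) (K c) (eF k' ! i)"
        have "K c = (\<Sum>i<length (eF k'). ?r i *\<^sub>R eF k' ! i)"
          by (rule eF_expand) (use c Suc in auto)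
        from arg_cong[OF this, of "\<lambda>z. pp z (d (y k))"]
        have "pp (K c) (d (y k)) = (\<Sum>i<length (eF k'). ?r i * pp (eF k' ! i) (d (y k)))"
          by (rule trans) (rule linear_sum_real[OF pi_linear(2)])
        thus ?thesis using basis[OF True] by simp
      next
        case False
        hence "c = 0" using c Suc gr_large[of j] by auto
        thus ?thesis by (simp add: linear_0[OF K_linear] linear_0[OF pi_linear(2)])
      qed
    qed
    thus "pp c (K (d (y k))) = 0" using pi_K[OF c, of "d (y k)"] by simp
  qed (simp_all add: pi_linear linear_zero)
  hence "K (d (y k)) = 0" by (rule pi_nondeg_right)
  moreover obtain u where "y k = K u" using y_K by blast
  ultimately have "y k = 0" using K_d_K by simp
  hence "representation (set (eF k)) (y k) (eF k ! j) = 0" by (simp add: representation_zero)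
  moreover have "representation (set (eF k)) (y k) (eF k ! j) = x (Fluct k j a)"
    unfolding y_def using eF_basis[of k] vk(3)
    by (subst rep_linear_sum) (auto simp: is_basis_def rep_eF span_base if_distrib cong: if_cong)
  ultimately show ?thesis by (simp add: vk)
qed

definition prg :: "var \<Rightarrow> var \<Rightarrow> real" where
  "prg = propagator C \<gg> (canonical_element T eF Fluct)"

lemma sum_omega: "(\<Sum>s\<leftarrow>canonical_element T eF Fluct. f s) = (\<Sum>v\<in>Fv. f (fld v))"
  for f :: "_ \<Rightarrow> 'y::comm_monoid_add"
  unfolding sum_canonical_element sum_Fv
  by (rule sum.cong[OF refl]) (auto simp: fld_def fc_def Fv_iff mem_idx)

lemma sum_phi: "(\<Sum>s\<leftarrow>canonical_element T (\<lambda>k. map \<iota> (E k)) Resid. f s) = (\<Sum>v\<in>Rv. f (fld v))"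
  for f :: "_ \<Rightarrow> 'y::comm_monoid_add"
proof -
  have "idx (\<lambda>k. map \<iota> (E k)) nT = idx E nT" by (simp add: idx_def)
  thus ?thesis unfolding sum_canonical_element sum_Rv
    by (simp only:) (rule sum.cong[OF refl], auto simp: fld_def fc_def Rv_iff mem_idx)
qed

lemma coordinate_omega: "coordinate ` set (canonical_element T eF Fluct) = Fv"
  by (auto simp: set_canonical_element Fv_def coordinate_def image_image split: prod.splits intro!: image_cong)

text \<open>The description by \<open>THE\<close> in \<open>propagator\<close> is met by exactly one
  matrix because the kinetic matrix has a two-sided inverse.\<close>

lemma prop_inverse:
  shows prop_left: "v \<in> Fv \<Longrightarrow> w \<in> Fv \<Longrightarrow> (\<Sum>z\<in>Fv. prg v z * qq z w) = (if v = w then 1 else 0)"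
    and prop_right: "v \<in> Fv \<Longrightarrow> w \<in> Fv \<Longrightarrow> (\<Sum>z\<in>Fv. qq v z * prg z w) = (if v = w then 1 else 0)"
    and prop_out: "v \<notin> Fv \<or> w \<notin> Fv \<Longrightarrow> prg v w = 0"
proof -
  obtain p where l: "\<And>v w. v \<in> Fv \<Longrightarrow> w \<in> Fv \<Longrightarrow> (\<Sum>z\<in>Fv. p v z * qq z w) = (if v = w then 1 else 0)"
    and r: "\<And>v w. v \<in> Fv \<Longrightarrow> w \<in> Fv \<Longrightarrow> (\<Sum>z\<in>Fv. qq v z * p z w) = (if v = w then 1 else 0)"
    and out: "\<And>v w. v \<notin> Fv \<or> w \<notin> Fv \<Longrightarrow> p v w = 0"
  proof (rule matrix_inverse_ex[OF fin_Fv, of qq])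
    show "\<And>x v. (\<And>v. v \<in> Fv \<Longrightarrow> (\<Sum>w\<in>Fv. qq v w * x w) = 0) \<Longrightarrow> v \<in> Fv \<Longrightarrow> x v = 0" by (rule qq_kernel)
  qed (rule that)
  let ?Q = "\<lambda>v w. \<Sum>s\<leftarrow>canonical_element T eF Fluct. \<Sum>t\<leftarrow>canonical_element T eF Fluct.
      if coordinate s = v \<and> coordinate t = w then kinetic_term C \<gg> s t else 0"
  have q: "(\<Sum>s\<leftarrow>canonical_element T eF Fluct. \<Sum>t\<leftarrow>canonical_element T eF Fluct.
      if coordinate s = v \<and> coordinate t = w then kinetic_term C \<gg> s t else 0) = qq v w"
    if "v \<in> Fv" "w \<in> Fv" for v w
  proof -
    have "(\<Sum>s\<leftarrow>canonical_element T eF Fluct. \<Sum>t\<leftarrow>canonical_element T eF Fluct.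
      if coordinate s = v \<and> coordinate t = w then kinetic_term C \<gg> s t else 0) =
      (\<Sum>s\<in>Fv. \<Sum>t\<in>Fv. if t = w then (if s = v then qq s t else 0) else 0)"
      unfolding sum_omega by (intro sum.cong refl) (simp add: coordinate_def fld_def qq_def)
    thus ?thesis using that fin_Fv by simp
  qed
  have Q: "(\<Sum>z\<in>Fv. p' v z * ?Q z w) = (\<Sum>z\<in>Fv. p' v z * qq z w)" if "w \<in> Fv" for p' :: "var \<Rightarrow> var \<Rightarrow> real" and v w
    by (rule sum.cong[OF refl]) (simp only: q that)
  have "prg = p"
    unfolding prg_def propagator_def Let_def coordinate_omega
  proof (rule the_equality)
    show "(\<forall>v w. v \<notin> Fv \<or> w \<notin> Fv \<longrightarrow> p v w = 0) \<and>
      (\<forall>v\<in>Fv. \<forall>w\<in>Fv. (\<Sum>z\<in>Fv. p v z * (\<Sum>s\<leftarrow>canonical_element T eF Fluct. \<Sum>t\<leftarrow>canonical_element T eF Fluct.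
      if coordinate s = z \<and> coordinate t = w then kinetic_term C \<gg> s t else 0)) = (if v = w then 1 else 0))"
      by (intro conjI ballI allI impI) (simp_all only: Q out l)
  next
    fix p' assume p': "(\<forall>v w. v \<notin> Fv \<or> w \<notin> Fv \<longrightarrow> p' v w = 0) \<and>
      (\<forall>v\<in>Fv. \<forall>w\<in>Fv. (\<Sum>z\<in>Fv. p' v z * (\<Sum>s\<leftarrow>canonical_element T eF Fluct. \<Sum>t\<leftarrow>canonical_element T eF Fluct.
      if coordinate s = z \<and> coordinate t = w then kinetic_term C \<gg> s t else 0)) = (if v = w then 1 else 0))"
    have l': "(\<Sum>z\<in>Fv. p' v z * qq z w) = (if v = w then 1 else 0)" if "v \<in> Fv" "w \<in> Fv" for v w
      using p'[THEN conjunct2, rule_format, OF that] unfolding Q[OF that(2)] .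
    show "p' = p"
    proof (intro ext)
      fix v w
      show "p' v w = p v w"
        using matrix_left_inverse_unique[OF fin_Fv l' r] p' out by (cases "v \<in> Fv \<and> w \<in> Fv") auto
    qed
  qed
  thus "v \<in> Fv \<Longrightarrow> w \<in> Fv \<Longrightarrow> (\<Sum>z\<in>Fv. prg v z * qq z w) = (if v = w then 1 else 0)"
    "v \<in> Fv \<Longrightarrow> w \<in> Fv \<Longrightarrow> (\<Sum>z\<in>Fv. qq v z * prg z w) = (if v = w then 1 else 0)"
    "v \<notin> Fv \<or> w \<notin> Fv \<Longrightarrow> prg v w = 0"
    using l r out by simp_all
qed

lemma prop_unique:
  assumes "\<And>v w. v \<in> Fv \<Longrightarrow> w \<in> Fv \<Longrightarrow> (\<Sum>z\<in>Fv. p' v z * qq z w) = (if v = w then 1 else 0)"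
    and "v \<in> Fv" "w \<in> Fv"
  shows "p' v w = prg v w"
  by (rule matrix_left_inverse_unique[OF fin_Fv assms(1) prop_right assms(2,3)])

lemma prop_supp: "prg v w \<noteq> 0 \<Longrightarrow> v \<in> Fv \<and> w \<in> Fv"
  using prop_out by blast

text \<open>The supertranspose of the propagator is again a left inverse of the supersymmetric
  kinetic matrix, hence equal to it by uniqueness.\<close>

lemma prop_sym: "prg w v = sg v w * prg v w"
proof (cases "v \<in> Fv \<and> w \<in> Fv")
  case True
  have "(\<Sum>z\<in>Fv. (sg v z * prg z v) * qq z w) = (if v = w then 1 else 0)" if vw: "v \<in> Fv" "w \<in> Fv" for v w
  proof -
    have "(sg v z * prg z v) * qq z w = (sg v w * sg w w) * (qq w z * prg z v)" for z
    proof (cases "qq w z = 0")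
      case True
      thus ?thesis using qq_sym[of z w] by simp
    next
      case False
      hence "even (form_degree z) = even (form_degree w)" using deg2_par[OF qq_deg[OF False]] by simp
      thus ?thesis using qq_sym[of z w] by (auto simp: sg_def odd_var_def)
    qed
    hence "(\<Sum>z\<in>Fv. (sg v z * prg z v) * qq z w) = (\<Sum>z\<in>Fv. (sg v w * sg w w) * (qq w z * prg z v))"
      by (rule sum.cong[OF refl])
    also have "\<dots> = (sg v w * sg w w) * (if w = v then 1 else 0)"
      by (simp only: sum_distrib_left[symmetric] prop_right[OF vw(2,1)])
    finally have "(\<Sum>z\<in>Fv. (sg v z * prg z v) * qq z w) = (sg v w * sg w w) * (if w = v then 1 else 0)" .
    thus ?thesis by (auto simp: sg_def)
  qed
  from prop_unique[of "\<lambda>v z. sg v z * prg z v", OF this] True have "sg v w * prg w v = prg v w" by blast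
  thus ?thesis by (auto simp: sg_def split: if_splits)
next
  case False
  thus ?thesis using prop_out by auto
qed

text \<open>Discarding the entries of wrong total degree still leaves a left inverse, as the kinetic
  matrix obeys the same selection rule; uniqueness shows that nothing was discarded.\<close>

lemma prop_deg: "prg v w \<noteq> 0 \<Longrightarrow> form_degree v + form_degree w = 2"
proof (rule ccontr)
  assume nz: "prg v w \<noteq> 0" and ne: "form_degree v + form_degree w \<noteq> 2"
  let ?p = "\<lambda>v z. if form_degree v + form_degree z = 2 then prg v z else 0"
  have "(\<Sum>z\<in>Fv. ?p v z * qq z w) = (if v = w then 1 else 0)" if vw: "v \<in> Fv" "w \<in> Fv" for v w
  proof (cases "form_degree v = form_degree w")
    case True
    have "?p v z * qq z w = prg v z * qq z w" for z
      using True qq_deg[of z w] by (cases "qq z w = 0") auto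
    thus ?thesis by (simp only: prop_left[OF vw])
  next
    case False
    have "?p v z * qq z w = 0" for z
      using False qq_deg[of z w] by (cases "qq z w = 0") auto
    hence "(\<Sum>z\<in>Fv. ?p v z * qq z w) = 0" by (intro sum.neutral ballI)
    thus ?thesis using False by auto
  qed
  from prop_unique[of ?p, OF this] prop_supp[OF nz] have "?p v w = prg v w" by blast
  thus False using nz ne by simp
qed

sublocale th: cubic_theory prg Fv Rv cc
proof
  show "prg v w \<noteq> 0 \<Longrightarrow> odd_var v = odd_var w" for v w
    using deg2_par[OF prop_deg] by (simp add: odd_var_def)
  show "prg w v = sg v w * prg v w" for v w by (rule prop_sym)
  show "cc v u w = sg u v * cc u v w" for u v w by (rule cc_sym1)
  show "cc u w v = sg v w * cc u v w" for u v w by (rule cc_sym2)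
  show "v \<in> Rv \<Longrightarrow> is_resid v" for v by (cases v) auto
  show "v \<in> Fv \<Longrightarrow> \<not> is_resid v" for v by (cases v) auto
qed (fact fin_Fv prop_supp fin_Rv cc_deg cc_RRF cc_0FF prop_deg)+

section \<open>The effective action as an instance of the abstract cubic theory\<close>

text \<open>Representatives are closed, so kinetic terms with a residual variable on the right
  vanish, and those on the left follow by supersymmetry.\<close>

lemma quadratic_action_phi_omega:
  "quadratic_action C \<gg> (canonical_element T (\<lambda>k. map \<iota> (E k)) Resid @ canonical_element T eF Fluct) =
   quadratic_action C \<gg> (canonical_element T eF Fluct)"
proof -
  have r: "qq v w = 0" if "w \<in> Rv" for v w
    using fc_Rv[OF that] by (auto simp: qq linear_0[OF pi_linear(1)])
  have l: "qq v w = 0" if v: "v \<in> Rv" for v w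
    using r[OF v, of w] qq_sym[of v w] by (auto simp: sg_def split: if_splits)
  have k: "kinetic_term C \<gg> (fld v) (fld w) = qq v w" for v w by (simp add: qq_def)
  show ?thesis
    by (simp add: quadratic_action_def sum_phi sum_omega k l r sum.distrib)
qed

lemma trip_eq: "sconst (cubic_term C \<gg> (fld u) (fld v) (fld w)) * svar (coordinate (fld u)) *
    svar (coordinate (fld v)) * svar (coordinate (fld w)) = th.trip u v w"
  by (simp add: th.trip_def cc_def coordinate_def fld_def mult.assoc)

lemma cubic_action_phi: "W_prod C \<gg> T E \<iota> = th.W"
  unfolding W_prod_def cubic_action_def sum_phi trip_eq th.W_def ..

lemma cubic_action_phi_omega:
  "cubic_action C \<gg> (canonical_element T (\<lambda>k. map \<iota> (E k)) Resid @ canonical_element T eF Fluct) = th.S"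
proof -
  have "(\<Sum>s\<leftarrow>canonical_element T (\<lambda>k. map \<iota> (E k)) Resid @ canonical_element T eF Fluct. f s) =
      (\<Sum>v\<in>Rv \<union> Fv. f (fld v))" for f :: "_ \<Rightarrow> real superseries"
    using th.RF_disjoint by (simp add: sum_phi sum_omega sum.union_disjoint fin_Rv fin_Fv)
  thus ?thesis by (simp only: cubic_action_def trip_eq th.S_def)
qed

theorem effective_action_expansion:
  "effective_action C \<gg> T E \<iota> K = hbar_series (\<lambda>l. if l = 0 then W_prod C \<gg> T E \<iota> else th.loop l)"
proof -
  have "effective_action C \<gg> T E \<iota> K =
      sconst fls_X * formal_ln (gaussian_average prg (formal_exp (over_hbar th.S)))"
    unfolding effective_action_def Let_def eF_def[symmetric] quadratic_action_phi_omega
      cubic_action_phi_omega prg_def over_hbar_def by simp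
  thus ?thesis by (simp only: th.hbar_expansion cubic_action_phi)
qed

lemma deg1_vars_eq: "deg1_vars T E = th.D"
  unfolding deg1_vars_def th.D_def
proof ((rule equalityI; rule subsetI), goal_cases)
  case (1 v)
  thus ?case by (auto simp: Rv_iff)
next
  case (2 v)
  then obtain k i a where "v = Resid k i a" "k < 4 \<and> i < length (E k) \<and> a < nT" using Rv_cases by blast
  thus ?case using 2 by auto
qed

lemma eval_ray_loop:
  "fps_nth (eval_ray T E (th.loop (Suc l)) \<alpha>) n = fps_nth (fps_nth (Ev th.D (coord_value T \<alpha>) (formal_ln th.Z)) n) l"
  by (simp add: eval_ray_def Ev_nth deg1_vars_eq th.scoeff_loop msets_def)

lemma loop_part_1: "loop_part 1 (effective_action C \<gg> T E \<iota> K) = th.loop 1"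
proof (rule superseries_eqI)
  fix m
  show "scoeff (loop_part 1 (effective_action C \<gg> T E \<iota> K)) m = scoeff (th.loop 1) m"
    by (cases "admissible m")
       (simp_all add: effective_action_expansion loop_part_def scoeff_map_scoeff hbar_series_def
         scoeff_superseries_of scoeff_not_admissible)
qed

lemma eval_ray_one_loop: "eval_ray T E (loop_part 1 (effective_action C \<gg> T E \<iota> K)) \<alpha> =
   fps_const (1/2) * Abs_fps (\<lambda>n. if n = 0 then 0 else (-1) ^ (n + 1) / real n * th.strF (coord_value T \<alpha>) n)"
  unfolding loop_part_1 th.one_loop[symmetric]
  by (rule fps_ext) (use eval_ray_loop[of 0] in simp)

subsection \<open>Invariance under the Lie algebra\<close>

text \<open>The adjoint action of \<open>X\<close> in coordinates: it acts on the Lie algebra index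
  only and keeps the kind of variable, the degree and the basis vector.\<close>

fun YY :: "'g \<Rightarrow> var \<Rightarrow> var \<Rightarrow> real" where
  "YY X (Resid k i a) (Resid l j b) = (if k = l \<and> i = j then rT (br X (T ! b)) a else 0)"
| "YY X (Fluct k i a) (Fluct l j b) = (if k = l \<and> i = j then rT (br X (T ! b)) a else 0)"
| "YY X _ _ = 0"

fun upd :: "var \<Rightarrow> nat \<Rightarrow> var" where
  "upd (Resid k i a) b = Resid k i b"
| "upd (Fluct k i a) b = Fluct k i b"

fun vidx :: "var \<Rightarrow> nat" where
  "vidx (Resid k i a) = a"
| "vidx (Fluct k i a) = a"

lemma form_degree_upd [simp]: "form_degree (upd v b) = form_degree v" by (cases v) auto
lemma fg_upd [simp]: "fg (upd v b) = T ! b" by (cases v) auto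
lemma fc_upd: "v \<in> Rv \<union> Fv \<Longrightarrow> b < nT \<Longrightarrow> fc (upd v b) = fc v"
  by (cases v) (auto simp: fc_def Rv_iff Fv_iff)
lemma fg_vidx: "fg v = T ! vidx v" by (cases v) auto

lemma sum_YY: "u \<in> Rv \<union> Fv \<Longrightarrow> (\<Sum>x\<in>Rv \<union> Fv. YY X x u * f x) = (\<Sum>b<nT. rT (br X (fg u)) b * f (upd u b))"
proof -
  assume u: "u \<in> Rv \<union> Fv"
  have inj: "inj_on (upd u) {..<nT}" by (rule inj_onI) (cases u; simp)
  have sub: "upd u ` {..<nT} \<subseteq> Rv \<union> Fv" using u by (cases u) (auto simp: Rv_iff Fv_iff)
  have zero: "YY X x u * f x = 0" if "x \<in> Rv \<union> Fv - upd u ` {..<nT}" for x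
    using that u by (cases u; cases x) (auto simp: Rv_iff Fv_iff image_iff)
  have "(\<Sum>x\<in>Rv \<union> Fv. YY X x u * f x) = (\<Sum>x\<in>upd u ` {..<nT}. YY X x u * f x)"
    by (rule sum.mono_neutral_right) (use fin_Rv fin_Fv sub zero in auto)
  also have "\<dots> = (\<Sum>b<nT. YY X (upd u b) u * f (upd u b))"
    using sum.reindex[OF inj, of "\<lambda>x. YY X x u * f x"] by simp
  also have "\<dots> = (\<Sum>b<nT. rT (br X (fg u)) b * f (upd u b))"
    by (intro sum.cong refl) (cases u, auto)
  finally show ?thesis .
qed

lemma sum_YY_F: "u \<in> Fv \<Longrightarrow> (\<Sum>x\<in>Fv. YY X x u * f x) = (\<Sum>b<nT. rT (br X (fg u)) b * f (upd u b))"
proof -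
  assume u: "u \<in> Fv"
  have "YY X x u * f x = 0" if "x \<in> Rv" for x using that u by (cases u; cases x) auto
  hence "(\<Sum>x\<in>Rv \<union> Fv. YY X x u * f x) = (\<Sum>x\<in>Fv. YY X x u * f x)"
    using fin_Rv fin_Fv by (intro sum.mono_neutral_right) auto
  thus ?thesis using sum_YY[of u X f] u by simp
qed

lemma sum_rT_lf: "(\<Sum>b<nT. rT Z b * (s * lf (T ! b) Y * r)) = s * lf Z Y * r"
  and sum_rT_lf2: "(\<Sum>b<nT. rT Z b * (s * lf Y (T ! b) * r)) = s * lf Y Z * r"
  and sum_rT_br: "(\<Sum>b<nT. rT Z b * (s * lf Y (br (T ! b) U) * r)) = s * lf Y (br Z U) * r"
  and sum_rT_br2: "(\<Sum>b<nT. rT Z b * (s * lf Y (br U (T ! b)) * r)) = s * lf Y (br U Z) * r"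
proof -
  have *: "(\<Sum>b<nT. rT Z b * (s * L (T ! b) * r)) = s * L Z * r" if "linear L" for L :: "'g \<Rightarrow> real"
    by (subst (2) rT_expand[of Z], subst linear_sum_real[OF that]) (simp add: sum_distrib_left sum_distrib_right mult_ac)
  have l: "linear (\<lambda>x. lf Y (br x U))" "linear (\<lambda>x. lf Y (br U x))"
    using linear_compose[OF br_linear(2)[of U] lf_linear(1)[of Y]] linear_compose[OF br_linear(1)[of U] lf_linear(1)[of Y]]
    by (simp_all add: o_def)
  show "(\<Sum>b<nT. rT Z b * (s * lf (T ! b) Y * r)) = s * lf Z Y * r" by (rule *[OF lf_linear(2)])
  show "(\<Sum>b<nT. rT Z b * (s * lf Y (T ! b) * r)) = s * lf Y Z * r" by (rule *[OF lf_linear(1)])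
  show "(\<Sum>b<nT. rT Z b * (s * lf Y (br (T ! b) U) * r)) = s * lf Y (br Z U) * r" by (rule *[OF l(1)])
  show "(\<Sum>b<nT. rT Z b * (s * lf Y (br U (T ! b)) * r)) = s * lf Y (br U Z) * r" by (rule *[OF l(2)])
qed

lemma br_derivation: "br X (br Y Z) = br (br X Y) Z + br Y (br X Z)"
proof -
  have "br (br X Y) Z = - br Z (br X Y)" by (rule br_anti)
  moreover have "br Y (br X Z) = - br Y (br Z X)" by (subst br_anti) (simp add: linear_neg[OF br_linear(1)])
  moreover have "br X (br Y Z) = - (br Y (br Z X) + br Z (br X Y))"
    using jacobi[of X Y Z] by (simp only: eq_neg_iff_add_eq_0 add.assoc)
  ultimately show ?thesis by simp
qed

text \<open>Vertex and kinetic form are invariant because the Lie algebra form and bracket are; for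
  the propagator the invariance is passed on to the inverse matrix.\<close>

lemma symmetry_YY: "symmetry prg Fv Rv cc (YY X)"
proof (unfold_locales)
  show "YY X v u \<noteq> 0 \<Longrightarrow> form_degree v = form_degree u" for v u
    by (cases v; cases u) (auto split: if_splits)
  show "YY X v u \<noteq> 0 \<Longrightarrow> is_resid v = is_resid u" for v u
    by (cases v; cases u) auto
next
  fix u v w assume m: "u \<in> Rv \<union> Fv" "v \<in> Rv \<union> Fv" "w \<in> Rv \<union> Fv"
  have "lf (br X (fg u)) (br (fg v) (fg w)) + lf (fg u) (br (br X (fg v)) (fg w)) + lf (fg u) (br (fg v) (br X (fg w))) = 0"
    using lf_inv[of X "fg u" "br (fg v) (fg w)"] br_derivation[of X "fg v" "fg w"]
    by (simp add: linear_add[OF lf_linear(1)])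
  hence "s * lf (br X (fg u)) (br (fg v) (fg w)) * r + s * lf (fg u) (br (br X (fg v)) (fg w)) * r
      + s * lf (fg u) (br (fg v) (br X (fg w))) * r = 0" for s r
    by (metis distrib_left distrib_right mult_zero_left mult_zero_right)
  thus "(\<Sum>x\<in>Rv \<union> Fv. YY X x u * cc x v w) + (\<Sum>x\<in>Rv \<union> Fv. YY X x v * cc u x w) + (\<Sum>x\<in>Rv \<union> Fv. YY X x w * cc u v x) = 0"
    using m by (simp add: sum_YY cc fc_upd sum_rT_lf sum_rT_br sum_rT_br2)
next
  fix v w assume vw: "v \<in> Fv" "w \<in> Fv"
  let ?Y = "YY X" and ?t = "\<lambda>u x. YY X x u"
  have inv: "mm Fv ?t qq u w + mm Fv qq ?Y u w = 0" if "u \<in> Fv" "w \<in> Fv" for u w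
  proof -
    have "mm Fv ?t qq u w = (\<Sum>b<nT. rT (br X (fg u)) b * qq (upd u b) w)"
      unfolding mm_def by (rule sum_YY_F[OF that(1)])
    also have "\<dots> = (-1) ^ ((1 + form_degree u) * (form_degree w + 1)) * lf (br X (fg u)) (fg w) * pp (fc u) (d (fc w))"
      by (rule trans[OF sum.cong[OF refl] sum_rT_lf]) (use that fc_upd in \<open>simp add: qq\<close>)
    finally have 1: "mm Fv ?t qq u w = (-1) ^ ((1 + form_degree u) * (form_degree w + 1)) * lf (br X (fg u)) (fg w) * pp (fc u) (d (fc w))" .
    have "mm Fv qq ?Y u w = (\<Sum>x\<in>Fv. YY X x w * qq u x)" by (simp only: mm_def mult.commute)
    also have "\<dots> = (\<Sum>b<nT. rT (br X (fg w)) b * qq u (upd w b))"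
      by (rule sum_YY_F[OF that(2)])
    also have "\<dots> = (-1) ^ ((1 + form_degree u) * (form_degree w + 1)) * lf (fg u) (br X (fg w)) * pp (fc u) (d (fc w))"
      by (rule trans[OF sum.cong[OF refl] sum_rT_lf2]) (use that fc_upd in \<open>simp add: qq\<close>)
    finally show ?thesis unfolding 1
      by (simp only: distrib_left[symmetric] distrib_right[symmetric] lf_inv mult_zero_left mult_zero_right)
  qed
  have pq: "mm Fv prg qq x y = (if x = y then 1 else 0)" "mm Fv qq prg x y = (if x = y then 1 else 0)"
    if "x \<in> Fv" "y \<in> Fv" for x y
    using prop_left[OF that] prop_right[OF that] by (simp_all add: mm_def)
  \<comment> \<open>Multiplying the invariance of the kinetic matrix by its inverse on both sides
    turns it into the invariance of the propagator.\<close>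
  have "mm Fv prg (mm Fv (\<lambda>u w. mm Fv ?t qq u w + mm Fv qq ?Y u w) prg) v w = 0"
    by (simp add: mm_def inv[unfolded mm_def] cong: sum.cong)
  moreover have "mm Fv prg (mm Fv (\<lambda>u w. mm Fv ?t qq u w + mm Fv qq ?Y u w) prg) v w =
      mm Fv prg (mm Fv (mm Fv ?t qq) prg) v w + mm Fv prg (mm Fv (mm Fv qq ?Y) prg) v w"
    by (simp add: mm_def distrib_left distrib_right sum.distrib)
  moreover have "mm Fv prg (mm Fv (mm Fv ?t qq) prg) v w = mm Fv prg ?t v w"
  proof (rule mm_cong[OF refl])
    fix u assume "u \<in> Fv"
    have "mm Fv (mm Fv ?t qq) prg u w = mm Fv ?t (mm Fv qq prg) u w" by (rule mm_assoc)
    also have "\<dots> = ?t u w" by (rule mm_id_right[OF fin_Fv vw(2)]) (rule pq(2)[OF _ vw(2)])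
    finally show "mm Fv (mm Fv ?t qq) prg u w = ?t u w" .
  qed
  moreover have "mm Fv prg (mm Fv (mm Fv qq ?Y) prg) v w = mm Fv ?Y prg v w"
  proof -
    have "mm Fv prg (mm Fv (mm Fv qq ?Y) prg) v w = mm Fv prg (mm Fv qq (mm Fv ?Y prg)) v w"
      by (intro mm_cong refl mm_assoc)
    also have "\<dots> = mm Fv (mm Fv prg qq) (mm Fv ?Y prg) v w" by (rule mm_assoc[symmetric])
    also have "\<dots> = mm Fv ?Y prg v w" by (rule mm_id_left[OF fin_Fv vw(1)]) (rule pq(1)[OF vw(1)])
    finally show ?thesis .
  qed
  ultimately have "mm Fv prg ?t v w + mm Fv ?Y prg v w = 0" by simp
  thus "(\<Sum>u\<in>Fv. YY X v u * prg u w) + (\<Sum>u\<in>Fv. YY X w u * prg v u) = 0"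
    by (simp add: mm_def mult.commute add.commute)
qed

lemma coord_value_Resid: "coord_value T \<alpha> (Resid k i a) = rT (\<alpha> i) a"
  by (simp add: rT_def)

lemma invariant_loop: "invariant_function \<gg> T E (th.loop (Suc l))"
  unfolding invariant_function_def
proof (intro conjI allI impI)
  show "scoeff (th.loop (Suc l)) m \<noteq> 0 \<Longrightarrow> set_mset m \<subseteq> deg1_vars T E" for m
    unfolding deg1_vars_eq by (rule th.supp_loop)
next
  fix X \<alpha> n
  interpret sy: symmetry prg Fv Rv cc "YY X" by (rule symmetry_YY)
  let ?val = "coord_value T \<alpha>"
  \<comment> \<open>The abstract variation of coordinates is the adjoint action on each \<alpha>
    i.\<close>
  have val: "coord_value T (\<lambda>i. \<alpha> i + t *\<^sub>R br X (\<alpha> i)) v = ?val v + t * sy.\<delta> ?val v" if v: "v \<in> th.D" for v t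
  proof -
    have "v \<in> deg1_vars T E" using v by (simp only: deg1_vars_eq)
    then obtain i a where v: "v = Resid 1 i a" "i < length (E 1)" "a < nT" by (auto simp: deg1_vars_def)
    have inj: "inj_on (Resid 1 i) {..<nT}" by (rule inj_onI) simp
    have "sy.\<delta> ?val v = (\<Sum>u\<in>th.D. YY X v u * ?val u)" by (simp add: sy.\<delta>_def)
    also have "\<dots> = (\<Sum>u\<in>Resid 1 i ` {..<nT}. YY X v u * ?val u)"
    proof (rule sum.mono_neutral_right)
      show "Resid 1 i ` {..<nT} \<subseteq> th.D" using v by (auto simp: deg1_vars_eq[symmetric] deg1_vars_def)
      show "\<forall>u\<in>th.D - Resid 1 i ` {..<nT}. YY X v u * ?val u = 0"
        using v by (auto simp: deg1_vars_eq[symmetric] deg1_vars_def)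
    qed (rule th.fin_D)
    also have "\<dots> = (\<Sum>b<nT. rT (br X (T ! b)) a * rT (\<alpha> i) b)"
      by (subst sum.reindex[OF inj]) (simp add: v rT_def)
    also have "\<dots> = rT (br X (\<alpha> i)) a"
    proof -
      have "br X (\<alpha> i) = br X (\<Sum>b<nT. rT (\<alpha> i) b *\<^sub>R T ! b)" by (simp only: rT_expand[symmetric])
      also have "\<dots> = (\<Sum>b<nT. rT (\<alpha> i) b *\<^sub>R br X (T ! b))" by (rule linear_eq_on_basis_sum[OF br_linear(1)])
      finally show ?thesis by (simp only: rT_sum_scale mult.commute)
    qed
    finally show ?thesis
      by (simp only: v coord_value_Resid linear_add[OF rT_linear] linear_scale[OF rT_linear] real_scaleR_def)
  qed
  have "Ev th.D (coord_value T (\<lambda>i. \<alpha> i + t *\<^sub>R br X (\<alpha> i))) f = Ev th.D (\<lambda>v. ?val v + t * sy.\<delta> ?val v) f" for t f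
  proof (intro fps_ext)
    fix n k
    have "(\<Prod>v\<in>#m. coord_value T (\<lambda>i. \<alpha> i + t *\<^sub>R br X (\<alpha> i)) v) = (\<Prod>v\<in>#m. ?val v + t * sy.\<delta> ?val v)"
      if "m \<in> msets th.D n" for m
      using that by (intro arg_cong[where f = prod_mset] image_mset_cong) (auto simp: msets_def val)
    thus "fps_nth (fps_nth (Ev th.D (coord_value T (\<lambda>i. \<alpha> i + t *\<^sub>R br X (\<alpha> i))) f) n) k =
        fps_nth (fps_nth (Ev th.D (\<lambda>v. ?val v + t * sy.\<delta> ?val v) f) n) k"
      by (simp add: Ev_nth)
  qed
  thus "((\<lambda>t. fps_nth (eval_ray T E (th.loop (Suc l)) (\<lambda>i. \<alpha> i + t *\<^sub>R br X (\<alpha> i))) n) has_real_derivative 0) (at 0)"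
    unfolding eval_ray_loop using sy.flat_Ev_ln_Z[of ?val] by (simp add: flat_def)
qed

end

subsection \<open>Supertraces\<close>

text \<open>\<open>G\<close> is the grading operator, and \<open>Op\<close> singles out the elements
  on which the trace is cyclic, namely operators that restrict to the finitely many Lie algebra
  components.\<close>

locale supertrace_ring =
  fixes tr :: "'o::{ring,monoid_mult} \<Rightarrow> real" and Op :: "'o \<Rightarrow> bool" and G :: 'o
  assumes tr_add: "tr (x + y) = tr x + tr y"
    and cyc: "Op x \<Longrightarrow> Op y \<Longrightarrow> tr (x * y) = tr (y * x)"
    and Op_1: "Op 1" and Op_G: "Op G" and Op_add: "Op x \<Longrightarrow> Op y \<Longrightarrow> Op (x + y)"
    and Op_uminus: "Op x \<Longrightarrow> Op (- x)" and Op_mult: "Op x \<Longrightarrow> Op y \<Longrightarrow> Op (x * y)"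
begin

lemma tr_0: "tr 0 = 0" using tr_add[of 0 0] by simp
lemma tr_uminus: "tr (- x) = - tr x" using tr_add[of x "- x"] by (simp add: tr_0)

lemma Op_diff: "Op x \<Longrightarrow> Op y \<Longrightarrow> Op (x - y)"
  using Op_add[OF _ Op_uminus, of x y] by simp
lemma Op_power: "Op x \<Longrightarrow> Op (x ^ n)"
  by (induction n) (simp_all add: Op_1 Op_mult)

definition str :: "'o \<Rightarrow> real" where "str x = tr (G * x)"

lemma str_add: "str (x + y) = str x + str y" by (simp add: str_def distrib_left tr_add)
lemma str_uminus: "str (- x) = - str x" by (simp add: str_def tr_uminus)
lemma str_0: "str 0 = 0" by (simp add: str_def tr_0)
lemma str_diff: "str (x - y) = str x - str y"
  using str_add[of x "- y"] by (simp add: str_uminus)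

definition ev :: "'o \<Rightarrow> bool" where "ev x \<longleftrightarrow> Op x \<and> G * x = x * G"
definition od :: "'o \<Rightarrow> bool" where "od x \<longleftrightarrow> Op x \<and> G * x = - (x * G)"

lemma ev_Op: "ev x \<Longrightarrow> Op x" and od_Op: "od x \<Longrightarrow> Op x" by (simp_all add: ev_def od_def)

lemma str_ev: "ev x \<Longrightarrow> Op y \<Longrightarrow> str (x * y) = str (y * x)"
  using cyc[of x "G * y"] by (simp add: ev_def str_def Op_mult Op_G mult.assoc[symmetric])

lemma str_od: "od x \<Longrightarrow> Op y \<Longrightarrow> str (x * y) = - str (y * x)"
  using cyc[of x "G * y"] by (simp add: od_def str_def Op_mult Op_G mult.assoc[symmetric] tr_uminus)

lemma ev_1: "ev 1" by (simp add: ev_def Op_1)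
lemma ev_diff: "ev x \<Longrightarrow> ev y \<Longrightarrow> ev (x - y)"
  by (simp add: ev_def Op_diff left_diff_distrib right_diff_distrib)
lemma od_mult: "od x \<Longrightarrow> od y \<Longrightarrow> ev (x * y)"
proof -
  assume x: "od x" and y: "od y"
  have "G * (x * y) = - (x * (G * y))" using x by (simp add: od_def mult.assoc[symmetric])
  also have "\<dots> = x * y * G" using y by (simp add: od_def mult.assoc)
  finally show ?thesis using x y by (simp add: ev_def od_def Op_mult)
qed

text \<open>
  Write \<open>\<delta>\<close> for the variation of \<open>(K, L)\<close> and \<open>X = K L\<close>.  Since \<open>\<delta>L = [d, C\<^sub>0]\<close> and
  \<open>[d, C\<^sub>j\<^sub>+\<^sub>1] = - [L, C\<^sub>j]\<close>, integrating by parts with \<open>d X\<^sup>n\<^sup>+\<^sup>1 K + X\<^sup>n\<^sup>+\<^sup>1 K d = L X\<^sup>n K + X\<^sup>n K L\<close> reduces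
  \<open>Str (X\<^sup>n K \<delta>L)\<close> to supertraces of the \<open>C\<^sub>j\<close>.  For \<open>Str (X\<^sup>n \<delta>K L)\<close> one uses
  \<open>\<delta>K = [d, K \<delta>K] - K \<delta>P - \<delta>P K\<close>.
\<close>

context
  fixes d K L \<kappa> L' :: 'o and CC :: "nat \<Rightarrow> 'o"
  assumes od_d: "od d" and od_K: "od K" and od_L: "od L" and Op_\<kappa>: "Op \<kappa>" and Op_L': "Op L'"
    and Op_CC: "Op (CC j)"
    and dd: "d * d = 0" and KK: "K * K = 0" and KdK: "K * (d * K) = K" and dKd: "d * (K * d) = d"
    and LL: "L * L = 0" and dL: "d * L = - (L * d)"
    and KLP: "K * (L * (1 - d * K - K * d)) = 0" and PLK: "(1 - d * K - K * d) * (L * K) = 0"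
    and K\<kappa>: "\<kappa> * K = - (K * \<kappa>)" and d\<kappa>d: "d * (\<kappa> * d) = 0"
    and \<kappa>: "\<kappa> = K * (d * \<kappa>) + \<kappa> * (d * K)"
    and L': "L' = d * CC 0 - CC 0 * d"
    and dCC: "d * CC (Suc j) - CC (Suc j) * d = - (L * CC j - CC j * L)"
    and str_CC: "str (CC j) = 0" and str_PCC: "str ((1 - d * K - K * d) * CC j) = 0"
begin

definition "PP = 1 - d * K - K * d"
definition "XX = K * L"
definition "YY n = XX ^ n * K"

lemma Op_all: "Op d" "Op K" "Op L" "Op PP" "Op XX" "Op (YY n)" "Op (XX ^ n)"
  using od_d od_K od_L by (auto simp: od_def PP_def XX_def YY_def intro!: Op_diff Op_1 Op_mult Op_power)

lemma ev_PP: "ev PP" unfolding PP_def by (intro ev_diff ev_1 od_mult od_d od_K)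
lemma ev_XX: "ev XX" unfolding XX_def by (intro od_mult od_L od_K)

lemma assoc_rule: "x * y = z \<Longrightarrow> x * (y * w) = z * w" for x y z w :: 'o
  by (simp add: mult.assoc[symmetric])
lemma assoc_rule3: "x * (y * u) = z \<Longrightarrow> x * (y * (u * w)) = z * w" for x y u z w :: 'o
  by (simp add: mult.assoc[symmetric])

lemmas rules = dd KK KdK dKd LL dL assoc_rule[OF dd] assoc_rule[OF KK] assoc_rule3[OF KdK]
  assoc_rule3[OF dKd] assoc_rule[OF LL] assoc_rule[OF dL]

lemma K_PP: "K * PP = 0" and PP_K: "PP * K = 0"
  by (simp_all add: PP_def left_diff_distrib right_diff_distrib mult.assoc rules)

lemma X_PP: "XX * PP = 0" using KLP by (simp add: XX_def PP_def mult.assoc)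
lemma PP_LK: "PP * (L * K) = 0" using PLK by (simp add: PP_def)

lemma YY_0: "YY 0 = K" by (simp add: YY_def)
lemma YY_Suc: "YY (Suc n) = K * (L * YY n)" by (simp add: YY_def XX_def mult.assoc)

lemma YY_PP: "YY n * PP = 0" by (simp add: YY_def mult.assoc K_PP)
lemma PP_L_YY: "PP * (L * YY n) = 0"
  using assoc_rule3[OF PP_LK] by (cases n) (simp_all add: YY_0 YY_Suc PP_LK)
lemma XX_PP: "XX ^ Suc n * PP = 0"
  by (simp only: power_Suc2 mult.assoc X_PP mult_zero_right)
lemma PP_XX: "PP * XX ^ Suc n = 0"
  using assoc_rule[OF PP_K] by (simp add: XX_def mult.assoc)

lemma dK: "d * K = 1 - PP - K * d" by (simp add: PP_def)

lemma d_YY_0: "d * YY 0 + YY 0 * d = 1 - PP" by (simp add: YY_0 PP_def)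

lemma d_YY_Suc: "d * YY (Suc n) + YY (Suc n) * d = L * YY n + YY n * L"
proof (induction n)
  case 0
  have "d * (K * (L * K)) = (1 - PP - K * d) * (L * K)" by (simp only: mult.assoc[symmetric] dK)
  also have "\<dots> = L * K + K * (L * (d * K))"
    unfolding left_diff_distrib by (simp add: PP_LK mult.assoc assoc_rule[OF dL])
  also have "K * (L * (d * K)) = K * L - XX * PP - K * (L * (K * d))"
    unfolding dK XX_def by (simp add: right_diff_distrib mult.assoc)
  finally show ?case by (simp add: X_PP YY_0 YY_Suc mult.assoc)
next
  case (Suc n)
  have "d * (K * (L * YY (Suc n))) = (d * K) * (L * YY (Suc n))" by (simp add: mult.assoc)
  also have "\<dots> = L * YY (Suc n) + K * (L * (d * YY (Suc n)))"
    unfolding dK left_diff_distrib by (simp add: PP_L_YY mult.assoc assoc_rule[OF dL])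
  also have "d * YY (Suc n) = L * YY n + YY n * L - YY (Suc n) * d" using Suc by (simp add: eq_diff_eq)
  also have "K * (L * (L * YY n + YY n * L - YY (Suc n) * d)) = YY (Suc n) * L - YY (Suc (Suc n)) * d"
    by (simp add: right_diff_distrib distrib_left YY_Suc mult.assoc assoc_rule[OF LL])
  finally show ?case by (simp add: YY_Suc[of "Suc n"])
qed

text \<open>Under the supertrace \<open>d\<close> is integrated by parts onto the power of
  \<open>K L\<close>. By \<open>d_YY_Suc\<close> this trades \<open>(n + 1, j)\<close> for
  \<open>(n, j + 1)\<close>, so \<open>j\<close> must be arbitrary in the induction; at
  \<open>n = 0\<close> only supertraces known to vanish remain.\<close>

lemma str_YY_commutator: "str (YY n * (d * CC j - CC j * d)) = 0"
proof (induction n arbitrary: j)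
  note Ops = Op_all Op_CC Op_mult
  case 0
  have "str (YY 0 * CC j * d) = - str (d * (YY 0 * CC j))" using str_od[OF od_d, of "YY 0 * CC j"] Ops by simp
  hence "str (YY 0 * (d * CC j - CC j * d)) = str ((d * YY 0 + YY 0 * d) * CC j)"
    by (simp add: right_diff_distrib distrib_right str_diff str_add mult.assoc)
  thus ?case unfolding d_YY_0 left_diff_distrib by (simp add: str_diff str_CC str_PCC PP_def)
next
  note Ops = Op_all Op_CC Op_mult
  case (Suc n)
  have "str (YY (Suc n) * CC j * d) = - str (d * (YY (Suc n) * CC j))" using str_od[OF od_d, of "YY (Suc n) * CC j"] Ops by simp
  hence "str (YY (Suc n) * (d * CC j - CC j * d)) = str ((d * YY (Suc n) + YY (Suc n) * d) * CC j)"
    by (simp add: right_diff_distrib distrib_right str_diff str_add mult.assoc)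
  also have "\<dots> = str (L * (YY n * CC j)) + str (YY n * (L * CC j))"
    unfolding d_YY_Suc by (simp add: distrib_right str_add mult.assoc)
  also have "str (L * (YY n * CC j)) = - str (YY n * (CC j * L))"
    using str_od[OF od_L, of "YY n * CC j"] Ops by (simp add: mult.assoc)
  also have "- str (YY n * (CC j * L)) + str (YY n * (L * CC j)) = - str (YY n * - (L * CC j - CC j * L))"
    by (simp add: right_diff_distrib str_diff)
  also have "\<dots> = 0" unfolding dCC[symmetric] by (simp add: Suc)
  finally show ?case .
qed

text \<open>The variation of the projector \<open>P = 1 - d K - K d\<close> when \<open>K\<close>
  varies by \<kappa>.\<close>

definition "DP = - (d * \<kappa>) - \<kappa> * d"

lemma Op_DP: "Op DP" unfolding DP_def by (intro Op_diff Op_uminus Op_mult Op_all Op_\<kappa>)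

lemma \<kappa>_decomp: "\<kappa> = d * (K * \<kappa>) - K * \<kappa> * d - K * DP - DP * K"
proof -
  have "d * (K * \<kappa>) - K * \<kappa> * d - K * DP - DP * K = K * (d * \<kappa>) + \<kappa> * (d * K)"
    by (simp add: DP_def right_diff_distrib left_diff_distrib K\<kappa> mult.assoc)
  thus ?thesis using \<kappa> by simp
qed

text \<open>The linearisation of \<open>P P = P\<close>: a variation of projectors has only blocks
  between the image and the kernel.\<close>

lemma DP_decomp: "DP = PP * DP + DP * PP"
proof -
  note r = rules d\<kappa>d assoc_rule3[OF d\<kappa>d] K\<kappa> assoc_rule[OF K\<kappa>]
  have "PP * DP + DP * PP = DP"
    by (simp add: DP_def PP_def right_diff_distrib left_diff_distrib mult.assoc r)
  thus ?thesis by simp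
qed

text \<open>By \<open>DP_decomp\<close> one factor \<open>P\<close> can always be moved next to
  \<open>Z\<close>, which it annihilates on both sides.\<close>

lemma str_DP: "PP * Z = 0 \<Longrightarrow> Z * PP = 0 \<Longrightarrow> Op Z \<Longrightarrow> str (Z * DP) = 0"
proof -
  assume Z: "PP * Z = 0" "Z * PP = 0" "Op Z"
  have "str (Z * DP) = str (Z * PP * DP) + str (Z * DP * PP)"
    by (subst DP_decomp) (simp add: distrib_left str_add mult.assoc)
  also have "str (Z * DP * PP) = str (PP * Z * DP)"
    using str_ev[OF ev_PP, of "Z * DP"] Z(3) Op_DP by (simp add: Op_mult mult.assoc)
  finally show ?thesis by (simp add: Z str_0)
qed

text \<open>Behind a factor \<open>L\<close>, \<open>d\<close> may be moved across the power of
  \<open>K L\<close> in front of \<open>K\<close>: the correction computed by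
  \<open>d_YY_Suc\<close> contains \<open>L\<close> twice or cancels.\<close>

lemma L_commutator: "L * (d * YY n) - L * (XX ^ n * (d * K)) = 0"
proof -
  have "L * (XX ^ n * (d * K)) = L * XX ^ n - L * (XX ^ n * PP) - L * (YY n * d)"
    unfolding dK by (simp add: right_diff_distrib YY_def mult.assoc)
  hence *: "L * (d * YY n) - L * (XX ^ n * (d * K)) =
      L * (d * YY n + YY n * d) - L * XX ^ n + L * (XX ^ n * PP)" by (simp add: distrib_left)
  show ?thesis
  proof (cases n)
    case 0
    thus ?thesis unfolding * by (simp add: d_YY_0 right_diff_distrib distrib_left[symmetric])
  next
    case (Suc m)
    have "L * (YY m * L) = L * XX ^ Suc m" by (simp only: YY_def XX_def power_Suc2 mult.assoc)
    thus ?thesis unfolding * unfolding Suc d_YY_Suc XX_PP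
      by (simp add: distrib_left assoc_rule[OF LL])
  qed
qed

text \<open>Of the four terms of \<open>\<kappa>_decomp\<close>, the commutator with
  \<open>d\<close> cancels by \<open>L_commutator\<close>, and the two with \<open>DP\<close> vanish
  by \<open>str_DP\<close> since \<open>P\<close> kills their other factors.\<close>

lemma str_\<kappa>_L: "str (XX ^ n * (\<kappa> * L)) = 0"
proof -
  note Ops = Op_all Op_\<kappa> Op_DP Op_mult
  let ?\<Lambda> = "K * \<kappa>"
  have "str (XX ^ n * (\<kappa> * L)) = str (XX ^ n * (d * (?\<Lambda> * L))) - str (XX ^ n * (?\<Lambda> * (d * L)))
      - str (YY n * DP * L) - str (XX ^ n * DP * XX)"
    by (subst \<kappa>_decomp) (simp add: right_diff_distrib left_diff_distrib str_diff YY_def XX_def mult.assoc)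
  moreover have "str (XX ^ n * (d * (?\<Lambda> * L))) = - str (L * (XX ^ n * (d * ?\<Lambda>)))"
    using str_od[OF od_L, of "XX ^ n * (d * ?\<Lambda>)"] Ops by (simp add: mult.assoc)
  moreover have "str (XX ^ n * (?\<Lambda> * (d * L))) = - str (L * (d * (XX ^ n * ?\<Lambda>)))"
    using str_od[OF od_L, of "d * (XX ^ n * ?\<Lambda>)"] str_od[OF od_d, of "XX ^ n * (?\<Lambda> * L)"] Ops
    by (simp add: mult.assoc dL str_uminus)
  moreover have "str (L * (d * (XX ^ n * ?\<Lambda>))) - str (L * (XX ^ n * (d * ?\<Lambda>))) = 0"
  proof -
    have "L * (d * (XX ^ n * ?\<Lambda>)) - L * (XX ^ n * (d * ?\<Lambda>)) = (L * (d * YY n) - L * (XX ^ n * (d * K))) * \<kappa>"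
      by (simp add: left_diff_distrib YY_def mult.assoc)
    thus ?thesis by (simp only: str_diff[symmetric] L_commutator mult_zero_left str_0)
  qed
  moreover have "str (YY n * DP * L) = 0"
  proof -
    have "str (L * YY n * DP) = 0"
      by (rule str_DP) (simp_all add: mult.assoc PP_L_YY YY_PP Op_all Op_mult)
    thus ?thesis using str_od[OF od_L, of "YY n * DP"] Ops by (simp add: mult.assoc)
  qed
  moreover have "str (XX ^ n * DP * XX) = 0"
  proof -
    have "str (XX ^ Suc n * DP) = 0" by (rule str_DP[OF PP_XX XX_PP Op_all(7)])
    thus ?thesis using str_ev[OF ev_XX, of "XX ^ n * DP"] Ops by (simp add: mult.assoc)
  qed
  ultimately show ?thesis by simp
qed

lemma str_variation: "str ((K * L) ^ n * (\<kappa> * L + K * L')) = 0"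
proof -
  have "str (XX ^ n * (K * L')) = 0"
    using str_YY_commutator[of n 0] by (simp add: L' YY_def mult.assoc)
  thus ?thesis using str_\<kappa>_L[of n] by (simp add: XX_def distrib_left str_add)
qed

end

text \<open>\<open>D n\<close> is the derivative of \<open>x ^ n\<close> when \<open>x\<close>
  varies by \<open>y\<close>. Each of its terms has \<open>y\<close> between powers of the even
  \<open>x\<close>, and cyclicity collects these on one side.\<close>

lemma str_derivation:
  assumes ev: "ev x" and y: "Op y" and 0: "\<And>n. str (x ^ n * y) = 0"
    and D: "D 0 = 0" "\<And>n. D (Suc n) = y * x ^ n + x * D n" "\<And>n. Op (D n)"
  shows "str (x ^ m * D n) = 0"
proof (induction n arbitrary: m)
  case 0
  thus ?case by (simp add: D str_0)
next
  case (Suc n)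
  have "str (x ^ m * (y * x ^ n)) = str (x ^ (n + m) * y)"
  proof (induction n arbitrary: m)
    case (Suc n)
    have "str (x ^ m * (y * x ^ Suc n)) = str (x * (x ^ m * (y * x ^ n)))"
      using str_ev[OF ev, of "x ^ m * (y * x ^ n)"] ev y
      by (simp add: Op_mult Op_power ev_Op mult.assoc power_Suc2 del: power_Suc)
    thus ?case using Suc[of "Suc m"] by (simp add: mult.assoc)
  qed simp
  thus ?case using Suc[of "Suc m"] 0
    by (simp add: D distrib_left str_add mult.assoc power_Suc2 del: power_Suc)
qed

end

subsection \<open>Operators on Lie algebra valued elements\<close>

typedef (overloaded) 'c lop = "{F :: (nat \<Rightarrow> 'c::real_vector) \<Rightarrow> nat \<Rightarrow> 'c.
    (\<forall>f g. F (\<lambda>a. f a + g a) = (\<lambda>a. F f a + F g a)) \<and> (\<forall>r f. F (\<lambda>a. r *\<^sub>R f a) = (\<lambda>a. r *\<^sub>R F f a))}"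
  morphisms app Abs_lop
  by (rule exI[of _ "\<lambda>f. f"]) simp

setup_lifting type_definition_lop

lemma lop_eqI: "(\<And>f a. app X f a = app Y f a) \<Longrightarrow> X = Y"
  by (simp add: app_inject[symmetric] fun_eq_iff)

lemma app_add: "app X (\<lambda>a. f a + g a) a = app X f a + app X g a"
  and app_scale: "app X (\<lambda>a. r *\<^sub>R f a) a = r *\<^sub>R app X f a"
  using app[of X] by (simp_all add: fun_eq_iff)

lemma app_zero: "app X (\<lambda>a. 0) a = 0" using app_scale[of X 0 "\<lambda>_. 0" a] by simp

lemma app_sum: "finite I \<Longrightarrow> app X (\<lambda>a. \<Sum>i\<in>I. r i *\<^sub>R f i a) a = (\<Sum>i\<in>I. r i *\<^sub>R app X (f i) a)"
  by (induction I rule: finite_induct) (simp_all add: app_add app_scale app_zero)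

text \<open>The class \<open>ring_1\<close> would require 0 and 1 to differ, which fails over the
  zero space.\<close>

instantiation lop :: (real_vector) "{ring, monoid_mult}"
begin

lift_definition zero_lop :: "'a lop" is "\<lambda>f a. 0" by simp
lift_definition one_lop :: "'a lop" is "\<lambda>f. f" by simp
lift_definition plus_lop :: "'a lop \<Rightarrow> 'a lop \<Rightarrow> 'a lop" is "\<lambda>F G f a. F f a + G f a"
  by (simp add: fun_eq_iff scaleR_add_right)
lift_definition uminus_lop :: "'a lop \<Rightarrow> 'a lop" is "\<lambda>F f a. - F f a" by simp
lift_definition minus_lop :: "'a lop \<Rightarrow> 'a lop \<Rightarrow> 'a lop" is "\<lambda>F G f a. F f a - G f a"
  by (simp add: fun_eq_iff scaleR_diff_right)
lift_definition times_lop :: "'a lop \<Rightarrow> 'a lop \<Rightarrow> 'a lop" is "\<lambda>F G f. F (G f)" by simp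

instance
proof
  fix x y z :: "'a lop"
  show "x * y * z = x * (y * z)" by transfer simp
  show "1 * x = x" "x * 1 = x" by (transfer; simp)+
  show "x + y + z = x + (y + z)" "x + y = y + x" "0 + x = x" "- x + x = 0" "x - y = x + - y"
    by (transfer; simp add: fun_eq_iff add_ac)+
  show "(x + y) * z = x * z + y * z" by transfer simp
  show "x * (y + z) = x * y + x * z" by transfer simp
qed

end

lemma app_simps [simp]: "app 0 f a = 0" "app 1 f = f" "app (X + Y) f a = app X f a + app Y f a"
  "app (- X) f a = - app X f a" "app (X - Y) f a = app X f a - app Y f a" "app (X * Y) f = app X (app Y f)"
  by (simp_all add: zero_lop.rep_eq one_lop.rep_eq plus_lop.rep_eq uminus_lop.rep_eq minus_lop.rep_eq times_lop.rep_eq)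

lemma app_power: "app (X ^ n) f = (app X ^^ n) f"
  by (induction n) simp_all

lift_definition lift :: "('c::real_vector \<Rightarrow> 'c) \<Rightarrow> 'c lop" is "\<lambda>F f a. if linear F then F (f a) else 0"
  by (simp add: fun_eq_iff linear_add linear_scale)

lemma app_lift: "linear F \<Longrightarrow> app (lift F) f a = F (f a)" by (simp add: lift.rep_eq)

text \<open>Elements of the tensor product use the indices below the dimension of the Lie algebra;
  this says that the operator descends to those components.\<close>

definition below :: "nat \<Rightarrow> 'c::real_vector lop \<Rightarrow> bool" where
  "below n X \<longleftrightarrow> (\<forall>f g a. (\<forall>b<n. f b = g b) \<longrightarrow> a < n \<longrightarrow> app X f a = app X g a)"

lemma belowD: "below n X \<Longrightarrow> (\<And>b. b < n \<Longrightarrow> f b = g b) \<Longrightarrow> a < n \<Longrightarrow> app X f a = app X g a"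
  unfolding below_def by blast

lemma below_intros: "below n 1" "below n X \<Longrightarrow> below n Y \<Longrightarrow> below n (X + Y)"
  "below n X \<Longrightarrow> below n (- X)" "below n X \<Longrightarrow> below n Y \<Longrightarrow> below n (X * Y)"
  "linear F \<Longrightarrow> below n (lift F)" "below n 0"
proof -
  assume X: "below n X"
  show "below n (- X)" unfolding below_def app_simps using belowD[OF X] by metis
  assume Y: "below n Y"
  show "below n (X + Y)" unfolding below_def app_simps
  proof (intro allI impI)
    fix f g :: "nat \<Rightarrow> 'b" and a
    assume "\<forall>b<n. f b = g b" "a < n"
    thus "app X f a + app Y f a = app X g a + app Y g a"
      using belowD[OF X, of f g a] belowD[OF Y, of f g a] by simp
  qed
  show "below n (X * Y)"
    unfolding below_def app_simps by (intro allI impI) (rule belowD[OF X belowD[OF Y]], auto)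
next
  show "linear F \<Longrightarrow> below n (lift F)" by (simp add: below_def app_lift)
qed (simp_all add: below_def)

locale superalg = dgf C + metric_lie \<gg> T
  for C :: "'c::real_vector dg_data" and \<gg> :: "'g::real_vector lie_data" and T
begin

definition ee :: "nat \<Rightarrow> 'c list" where "ee k = some_basis (gr k)"
definition BB :: "'c set" where "BB = (\<Union>k\<le>3. set (ee k))"

lemma ee_basis: "is_basis (ee k) (gr k)"
  unfolding ee_def by (rule some_basis[OF gr_subspace fin_dim])

lemma ee_gr: "c \<in> set (ee k) \<Longrightarrow> c \<in> gr k"
  using ee_basis[of k] unfolding is_basis_def by (metis span_base)

lemma ee_disjoint: "k \<le> 3 \<Longrightarrow> l \<le> 3 \<Longrightarrow> k \<noteq> l \<Longrightarrow> set (ee k) \<inter> set (ee l) = {}"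
proof (rule ccontr)
  assume kl: "k \<le> 3" "l \<le> 3" "k \<noteq> l" and "set (ee k) \<inter> set (ee l) \<noteq> {}"
  then obtain c where c: "c \<in> set (ee k)" "c \<in> set (ee l)" by blast
  have "(\<lambda>j. if j = k then c else 0) = (\<lambda>j. if j = l then c else 0)"
    by (rule gr_unique) (use kl c ee_gr subspace_0[OF gr_subspace] in auto)
  hence "c = 0" using kl by (metis (full_types))
  thus False using c(1) ee_basis[of k] dependent_zero by (auto simp: is_basis_def)
qed

lemma fin_BB: "finite BB" by (simp add: BB_def)

lemma sum_BB: "(\<Sum>c\<in>BB. f c) = (\<Sum>k\<le>3. \<Sum>c\<in>set (ee k). f c)"
  unfolding BB_def by (rule sum.UNION_disjoint) (use ee_disjoint in auto)

lemma BB_independent: "independent BB"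
proof
  assume "dependent BB"
  then obtain u v where u: "(\<Sum>c\<in>BB. u c *\<^sub>R c) = 0" and v: "v \<in> BB" "u v \<noteq> 0"
    using dependent_finite[OF fin_BB] by blast
  then obtain k where k: "k \<le> 3" "v \<in> set (ee k)" by (auto simp: BB_def)
  define g where "g k = (if k \<le> 3 then \<Sum>c\<in>set (ee k). u c *\<^sub>R c else 0)" for k
  have "g = (\<lambda>_. 0)"
  proof (rule gr_unique)
    show "\<forall>k\<le>3. g k \<in> gr k"
      by (auto simp: g_def intro: ee_gr intro!: subspace_sum[OF gr_subspace] subspace_scale[OF gr_subspace])
    show "sum g {..3} = (\<Sum>k\<le>3. 0)" using u unfolding sum_BB by (simp add: g_def)
  qed (simp_all add: g_def subspace_0[OF gr_subspace])
  hence "g k = 0" by simp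
  hence "(\<Sum>c\<in>set (ee k). u c *\<^sub>R c) = 0" using k(1) by (simp add: g_def)
  hence "u v = 0" using ee_basis[of k] k(2) dependent_finite[of "set (ee k)"] unfolding is_basis_def by auto
  thus False using v by simp
qed

lemma BB_span: "span BB = UNIV"
proof -
  have "x \<in> span BB" for x
  proof -
    obtain f where f: "\<And>k. f k \<in> gr k" "x = (\<Sum>k\<le>3. f k)" by (rule gr_expand[of x]) blast
    have "f k \<in> span BB" if "k \<le> 3" for k
    proof -
      have "f k \<in> span (set (ee k))" using f(1) ee_basis[of k] by (simp add: is_basis_def)
      thus ?thesis using span_mono[of "set (ee k)" BB] that by (auto simp: BB_def)
    qed
    thus ?thesis unfolding f(2) by (intro span_sum) auto
  qed
  thus ?thesis by blast
qed

abbreviation rB :: "'c \<Rightarrow> 'c \<Rightarrow> real" where "rB \<equiv> representation BB"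

lemma rB_linear: "linear (\<lambda>x. rB x c)"
  by (rule linearI) (simp_all add: representation_add representation_scale BB_independent BB_span)

lemma rB_expand: "x = (\<Sum>c\<in>BB. rB x c *\<^sub>R c)"
  using basis_expand[of BB x] fin_BB BB_independent BB_span by simp

lemma rB_basis: "c \<in> BB \<Longrightarrow> rB c c' = (if c' = c then 1 else 0)"
  using representation_basis[OF BB_independent, of c] by auto

definition I :: "(nat \<times> nat \<times> nat) set" where "I = idx ee nT"

lemma fin_I: "finite I" by (simp add: I_def finite_idx)

fun bas :: "nat \<times> nat \<times> nat \<Rightarrow> nat \<Rightarrow> 'c" where
  "bas (k, j, a) b = (if b = a then ee k ! j else 0)"
fun crd :: "nat \<times> nat \<times> nat \<Rightarrow> (nat \<Rightarrow> 'c) \<Rightarrow> real" where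
  "crd (k, j, a) f = representation BB (f a) (ee k ! j)"

lemma I_iff: "(k, j, a) \<in> I \<longleftrightarrow> k < 4 \<and> j < length (ee k) \<and> a < nT"
  by (simp add: I_def mem_idx)

lemma sum_nth_ee: "(\<Sum>j<length (ee k). f (ee k ! j)) = (\<Sum>c\<in>set (ee k). f c)"
  using ee_basis[of k] sum.reindex_bij_betw[OF bij_betw_nth[of "ee k"], of "{..<length (ee k)}" "set (ee k)" f]
  by (simp add: is_basis_def)

lemma sum_BB_nth: "(\<Sum>c\<in>BB. f c) = (\<Sum>k<4. \<Sum>j<length (ee k). f (ee k ! j))"
proof -
  have "{..3} = {..<4::nat}" by auto
  thus ?thesis by (simp add: sum_BB sum_nth_ee)
qed

lemma expand_bas: "a < nT \<Longrightarrow> f a = (\<Sum>i\<in>I. crd i f *\<^sub>R bas i a)"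
proof -
  assume a: "a < nT"
  have "(\<Sum>i\<in>I. crd i f *\<^sub>R bas i a) = (\<Sum>(k, j, b)\<in>I. crd (k, j, b) f *\<^sub>R bas (k, j, b) a)"
    by (rule sum.cong) auto
  also have "\<dots> = (\<Sum>k<4. \<Sum>j<length (ee k). \<Sum>b<nT. if b = a then rB (f a) (ee k ! j) *\<^sub>R ee k ! j else 0)"
    unfolding I_def sum_idx by (intro sum.cong refl) auto
  also have "\<dots> = (\<Sum>c\<in>BB. rB (f a) c *\<^sub>R c)" using a by (simp add: sum_BB_nth)
  finally show ?thesis using rB_expand[of "f a"] by simp
qed

lemma crd_sum: "finite J \<Longrightarrow> crd i (\<lambda>a. \<Sum>j\<in>J. r j *\<^sub>R g j a) = (\<Sum>j\<in>J. r j * crd i (g j))"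
  by (cases i) (simp add: linear_sum_real[OF rB_linear])

lemma crd_cong: "i \<in> I \<Longrightarrow> (\<And>a. a < nT \<Longrightarrow> f a = g a) \<Longrightarrow> crd i f = crd i g"
  by (cases i) (simp add: I_iff)

lemma app_expand: "below nT X \<Longrightarrow> a < nT \<Longrightarrow> app X f a = (\<Sum>i\<in>I. crd i f *\<^sub>R app X (bas i) a)"
proof -
  assume X: "below nT X" and a: "a < nT"
  have "app X f a = app X (\<lambda>a. \<Sum>i\<in>I. crd i f *\<^sub>R bas i a) a"
    by (rule belowD[OF X _ a]) (rule expand_bas)
  thus ?thesis by (simp add: app_sum fin_I)
qed

lemma crd_app: "below nT X \<Longrightarrow> i \<in> I \<Longrightarrow> crd i (app X f) = (\<Sum>j\<in>I. crd j f * crd i (app X (bas j)))"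
  by (subst crd_cong[OF _ app_expand]) (simp_all add: crd_sum fin_I)

definition tr :: "'c lop \<Rightarrow> real" where "tr X = (\<Sum>i\<in>I. crd i (app X (bas i)))"

text \<open>The grading operator, defined through the basis so that it is linear on all of C;
  \<open>\<gamma>_gr\<close> gives its intrinsic description.\<close>

definition \<gamma> :: "'c \<Rightarrow> 'c" where
  "\<gamma> x = (\<Sum>k\<le>3. \<Sum>c\<in>set (ee k). ((-1) ^ k * rB x c) *\<^sub>R c)"

lemma \<gamma>_linear: "linear \<gamma>"
  by (rule linearI) (simp_all add: \<gamma>_def linear_add[OF rB_linear] linear_scale[OF rB_linear]
      scaleR_add_left distrib_left sum.distrib scaleR_sum_right mult.left_commute)

lemma \<gamma>_ee: "k \<le> 3 \<Longrightarrow> c \<in> set (ee k) \<Longrightarrow> \<gamma> c = (-1) ^ k *\<^sub>R c"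
proof -
  assume k: "k \<le> 3" "c \<in> set (ee k)"
  hence B: "c \<in> BB" by (auto simp: BB_def)
  have "\<gamma> c = (\<Sum>l\<le>3. \<Sum>b\<in>set (ee l). if b = c then (-1) ^ k *\<^sub>R c else 0)"
    unfolding \<gamma>_def using k ee_disjoint[of k] by (intro sum.cong refl) (auto simp: rB_basis[OF B])
  also have "\<dots> = (\<Sum>b\<in>BB. if b = c then (-1) ^ k *\<^sub>R c else 0)" by (simp only: sum_BB)
  also have "\<dots> = (-1) ^ k *\<^sub>R c" using B fin_BB by simp
  finally show ?thesis .
qed

lemma \<gamma>_gr: "x \<in> gr k \<Longrightarrow> \<gamma> x = (-1) ^ k *\<^sub>R x"
proof (cases "k \<le> 3")
  case True
  assume "x \<in> gr k"
  hence "x \<in> span (set (ee k))" using ee_basis[of k] by (simp add: is_basis_def)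
  thus ?thesis
  proof (induction rule: span_induct)
    case base
    show ?case unfolding subspace_def
      by (simp add: linear_0[OF \<gamma>_linear] linear_add[OF \<gamma>_linear] linear_scale[OF \<gamma>_linear] scaleR_add_right)
  next
    case (step x)
    thus ?case by (rule \<gamma>_ee[OF True])
  qed
next
  case False
  assume "x \<in> gr k"
  hence "x = 0" using False gr_large[of k] by auto
  thus ?thesis by (simp add: linear_0[OF \<gamma>_linear])
qed

lemma rB_\<gamma>: "k \<le> 3 \<Longrightarrow> c \<in> set (ee k) \<Longrightarrow> rB (\<gamma> x) c = (-1) ^ k * rB x c"
proof -
  assume k: "k \<le> 3" "c \<in> set (ee k)"
  have "rB (\<gamma> x) c = (\<Sum>l\<le>3. \<Sum>b\<in>set (ee l). ((-1) ^ l * rB x b) * rB b c)"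
    unfolding \<gamma>_def by (simp only: linear_sum[OF rB_linear] linear_scale[OF rB_linear] real_scaleR_def)
  also have "\<dots> = (\<Sum>l\<le>3. \<Sum>b\<in>set (ee l). if b = c then (-1) ^ k * rB x c else 0)"
  proof (intro sum.cong refl)
    fix l b assume l: "l \<in> {..3::nat}" "b \<in> set (ee l)"
    hence B: "b \<in> BB" by (auto simp: BB_def)
    have "b = c \<Longrightarrow> l = k" using l k ee_disjoint[of k l] by auto
    thus "((-1) ^ l * rB x b) * rB b c = (if b = c then (-1) ^ k * rB x c else 0)"
      by (auto simp: rB_basis[OF B])
  qed
  also have "\<dots> = (\<Sum>b\<in>BB. if b = c then (-1) ^ k * rB x c else 0)" by (simp only: sum_BB)
  also have "\<dots> = (-1) ^ k * rB x c" using k fin_BB by (auto simp: BB_def)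
  finally show ?thesis .
qed

sublocale st: supertrace_ring tr "below nT" "lift \<gamma>"
proof
  show "tr (x + y) = tr x + tr y" for x y
  proof -
    have "crd i (app (x + y) f) = crd i (app x f) + crd i (app y f)" for i f
      by (cases i) (simp add: linear_add[OF rB_linear])
    thus ?thesis by (simp add: tr_def sum.distrib)
  qed
  show "tr (x * y) = tr (y * x)" if "below nT x" "below nT y" for x y
  proof -
    have "tr (x * y) = (\<Sum>i\<in>I. \<Sum>j\<in>I. crd j (app y (bas i)) * crd i (app x (bas j)))"
      unfolding tr_def using that(1) by (intro sum.cong refl) (simp add: crd_app[of x])
    also have "\<dots> = (\<Sum>j\<in>I. \<Sum>i\<in>I. crd j (app y (bas i)) * crd i (app x (bas j)))" by (rule sum.swap)
    also have "\<dots> = tr (y * x)"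
      unfolding tr_def using that(2) by (intro sum.cong refl) (simp add: crd_app[of y] mult.commute)
    finally show ?thesis .
  qed
qed (auto intro!: below_intros \<gamma>_linear)

lemma str_eq: "st.str X = (\<Sum>(k, j, a)\<in>I. (-1) ^ k * crd (k, j, a) (app X (bas (k, j, a))))"
proof -
  have "crd i (app (lift \<gamma> * X) f) = (-1) ^ fst i * crd i (app X f)" if "i \<in> I" for i f
    using that by (cases i) (auto simp: app_lift[OF \<gamma>_linear] I_iff intro!: rB_\<gamma>)
  thus ?thesis unfolding st.str_def tr_def by (intro sum.cong refl) auto
qed

lemma supertrace_eq: "supertrace C T (app X) = st.str X"
proof -
  have "{..3} = {..<4::nat}" by auto
  moreover have "bas (k, j, a) = (\<lambda>b. if b = a then ee k ! j else 0)" for k j a by auto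
  ultimately have "st.str X = (\<Sum>k\<le>3. \<Sum>j<length (ee k). \<Sum>a<nT.
      (-1) ^ k * rB (app X (\<lambda>b. if b = a then ee k ! j else 0) a) (ee k ! j))"
    by (simp only: str_eq I_def sum_idx crd.simps)
  also have "\<dots> = (\<Sum>k\<le>3. \<Sum>c\<in>set (ee k). \<Sum>a<nT.
      (-1) ^ k * rB (app X (\<lambda>b. if b = a then c else 0) a) c)"
    by (simp only: sum_nth_ee[of "\<lambda>c. \<Sum>a<nT. (-1) ^ _ * rB (app X (\<lambda>b. if b = a then c else 0) a) c"])
  also have "\<dots> = supertrace C T (app X)"
    unfolding supertrace_def Let_def ee_def[symmetric] BB_def[symmetric]
    by (intro sum.cong refl) (simp only: sum_distrib_left, rule sum.swap)
  finally show ?thesis by simp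
qed

end

lemma lift_mult: "linear F \<Longrightarrow> linear G \<Longrightarrow> lift F * lift G = lift (\<lambda>x. F (G x))"
  by (rule lop_eqI) (simp add: app_lift linear_compose[unfolded o_def] fun_eq_iff)

lemma lift_id: "lift (\<lambda>x. x) = 1"
  by (rule lop_eqI) (simp add: app_lift linear_ident)

lemma sum_scaleR_swap:
  fixes h :: "'i \<Rightarrow> 'j \<Rightarrow> 'x::real_vector"
  shows "(\<Sum>e\<in>A. r e *\<^sub>R (\<Sum>b\<in>B. \<Sum>c\<in>D. t e b c *\<^sub>R h b c)) = (\<Sum>b\<in>B. \<Sum>c\<in>D. (\<Sum>e\<in>A. r e * t e b c) *\<^sub>R h b c)"
proof -
  have "(\<Sum>e\<in>A. r e *\<^sub>R (\<Sum>b\<in>B. \<Sum>c\<in>D. t e b c *\<^sub>R h b c)) = (\<Sum>e\<in>A. \<Sum>b\<in>B. \<Sum>c\<in>D. (r e * t e b c) *\<^sub>R h b c)"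
    by (simp add: scaleR_sum_right)
  also have "\<dots> = (\<Sum>b\<in>B. \<Sum>e\<in>A. \<Sum>c\<in>D. (r e * t e b c) *\<^sub>R h b c)" by (rule sum.swap)
  also have "\<dots> = (\<Sum>b\<in>B. \<Sum>c\<in>D. \<Sum>e\<in>A. (r e * t e b c) *\<^sub>R h b c)"
    by (intro sum.cong refl sum.swap)
  finally show ?thesis by (simp add: scaleR_sum_left)
qed

context superalg
begin

text \<open>The operator l(A, .) for A with components \<open>A b\<close> along
  \<open>T ! b\<close>; applied to the components of another element it also gives the bracket l(A,
  B).\<close>

definition brop :: "(nat \<Rightarrow> 'c) \<Rightarrow> 'c lop" where
  "brop A = Abs_lop (\<lambda>f a. if a < nT then \<Sum>b<nT. \<Sum>c<nT. sc a b c *\<^sub>R mu (A b) (f c) else 0)"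

lemma app_brop: "app (brop A) f a = (if a < nT then \<Sum>b<nT. \<Sum>c<nT. sc a b c *\<^sub>R mu (A b) (f c) else 0)"
proof -
  have "app (brop A) = (\<lambda>f a. if a < nT then \<Sum>b<nT. \<Sum>c<nT. sc a b c *\<^sub>R mu (A b) (f c) else 0)"
    unfolding brop_def
    by (rule Abs_lop_inverse) (auto simp: fun_eq_iff linear_add[OF mu_linear(1)] linear_scale[OF mu_linear(1)]
        scaleR_add_right sum.distrib scaleR_sum_right mult.commute)
  thus ?thesis by simp
qed

lemma below_brop: "below nT (brop A)"
  unfolding below_def app_brop by (auto intro!: sum.cong)

lemma brop_add: "brop (\<lambda>b. A b + B b) = brop A + brop B"
  by (rule lop_eqI) (simp add: app_brop linear_add[OF mu_linear(2)] scaleR_add_right sum.distrib)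

lemma brop_scale: "app (brop (\<lambda>b. r *\<^sub>R A b)) f a = r *\<^sub>R app (brop A) f a"
  by (simp add: app_brop linear_scale[OF mu_linear(2)] scaleR_sum_right mult.commute)

lemma brop_uminus: "brop (\<lambda>b. - A b) = - brop A"
  by (rule lop_eqI) (simp add: app_brop linear_neg[OF mu_linear(2)] sum_negf)

lemma brop_0: "brop (\<lambda>b. 0) = 0"
  by (rule lop_eqI) (simp add: app_brop linear_0[OF mu_linear(2)])

lemma app_brop_brop: "a < nT \<Longrightarrow> app (brop A) (app (brop B) f) a =
   (\<Sum>b<nT. \<Sum>b'<nT. \<Sum>c<nT. (\<Sum>e<nT. sc a b e * sc e b' c) *\<^sub>R mu (mu (A b) (B b')) (f c))"
proof -
  assume a: "a < nT"
  have "app (brop A) (app (brop B) f) a =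
      (\<Sum>b<nT. \<Sum>e<nT. sc a b e *\<^sub>R (\<Sum>b'<nT. \<Sum>c<nT. sc e b' c *\<^sub>R mu (mu (A b) (B b')) (f c)))"
    using a by (simp add: app_brop linear_sum[OF mu_linear(1)] linear_scale[OF mu_linear(1)] mu_assoc)
  thus ?thesis by (simp only: sum_scaleR_swap)
qed

lemma app_brop_app_brop: "a < nT \<Longrightarrow> app (brop (app (brop A) B)) f a =
   (\<Sum>b<nT. \<Sum>b'<nT. \<Sum>c<nT. (\<Sum>e<nT. sc a e c * sc e b b') *\<^sub>R mu (mu (A b) (B b')) (f c))"
proof -
  assume a: "a < nT"
  have "app (brop (app (brop A) B)) f a =
      (\<Sum>e<nT. \<Sum>c<nT. sc a e c *\<^sub>R (\<Sum>b<nT. \<Sum>b'<nT. sc e b b' *\<^sub>R mu (mu (A b) (B b')) (f c)))"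
    using a by (simp add: app_brop[of _ f] app_brop[of A B] linear_sum[OF mu_linear(2)] linear_scale[OF mu_linear(2)])
  also have "\<dots> = (\<Sum>c<nT. \<Sum>e<nT. sc a e c *\<^sub>R (\<Sum>b<nT. \<Sum>b'<nT. sc e b b' *\<^sub>R mu (mu (A b) (B b')) (f c)))"
    by (rule sum.swap)
  also have "\<dots> = (\<Sum>c<nT. \<Sum>b<nT. \<Sum>b'<nT. (\<Sum>e<nT. sc a e c * sc e b b') *\<^sub>R mu (mu (A b) (B b')) (f c))"
    by (simp only: sum_scaleR_swap)
  also have "\<dots> = (\<Sum>b<nT. \<Sum>c<nT. \<Sum>b'<nT. (\<Sum>e<nT. sc a e c * sc e b b') *\<^sub>R mu (mu (A b) (B b')) (f c))"
    by (rule sum.swap)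
  also have "\<dots> = (\<Sum>b<nT. \<Sum>b'<nT. \<Sum>c<nT. (\<Sum>e<nT. sc a e c * sc e b b') *\<^sub>R mu (mu (A b) (B b')) (f c))"
    by (intro sum.cong refl sum.swap)
  finally show ?thesis .
qed

text \<open>The product is associative, so after exchanging \<open>A\<close> and \<open>B\<close>
  with the sign \<open>s\<close> only structure constants are left, and these satisfy the Jacobi
  identity.\<close>

lemma brop_commutator:
  assumes "\<And>b b'. b < nT \<Longrightarrow> b' < nT \<Longrightarrow> mu (A b) (B b') = s *\<^sub>R mu (B b') (A b)"
  shows "app (brop A) (app (brop B) f) a - s *\<^sub>R app (brop B) (app (brop A) f) a = app (brop (app (brop A) B)) f a"
proof (cases "a < nT")
  case True
  have "s *\<^sub>R app (brop B) (app (brop A) f) a =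
      (\<Sum>b'<nT. \<Sum>b<nT. \<Sum>c<nT. (\<Sum>e<nT. sc a b' e * sc e b c) *\<^sub>R mu (mu (A b) (B b')) (f c))"
    unfolding app_brop_brop[OF True] scaleR_sum_right
    by (intro sum.cong refl) (simp add: assms linear_scale[OF mu_linear(2)])
  also have "\<dots> = (\<Sum>b<nT. \<Sum>b'<nT. \<Sum>c<nT. (\<Sum>e<nT. sc a b' e * sc e b c) *\<^sub>R mu (mu (A b) (B b')) (f c))"
    by (rule sum.swap)
  finally have R: "s *\<^sub>R app (brop B) (app (brop A) f) a = \<dots>" .
  have "app (brop A) (app (brop B) f) a - s *\<^sub>R app (brop B) (app (brop A) f) a =
      (\<Sum>b<nT. \<Sum>b'<nT. \<Sum>c<nT. ((\<Sum>e<nT. sc a b e * sc e b' c) - (\<Sum>e<nT. sc a b' e * sc e b c)) *\<^sub>R mu (mu (A b) (B b')) (f c))"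
    unfolding R unfolding app_brop_brop[OF True] by (simp only: sum_subtractf scaleR_diff_left)
  also have "\<dots> = (\<Sum>b<nT. \<Sum>b'<nT. \<Sum>c<nT. (\<Sum>e<nT. sc a e c * sc e b b') *\<^sub>R mu (mu (A b) (B b')) (f c))"
    by (intro sum.cong refl) (simp add: sc_jacobi)
  finally show ?thesis by (simp only: app_brop_app_brop[OF True])
qed (simp add: app_brop)

lemma app_brop_gr: "(\<And>b. b < nT \<Longrightarrow> A b \<in> gr p) \<Longrightarrow> (\<And>b. b < nT \<Longrightarrow> f b \<in> gr q) \<Longrightarrow> app (brop A) f a \<in> gr (p + q)"
  unfolding app_brop by (auto intro!: subspace_sum[OF gr_subspace] subspace_scale[OF gr_subspace] mu_gr subspace_0[OF gr_subspace])

lemma d_brop: "(\<And>b. b < nT \<Longrightarrow> A b \<in> gr p) \<Longrightarrow> d (app (brop A) f a) =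
    app (brop (\<lambda>b. d (A b))) f a + (-1) ^ p *\<^sub>R app (brop A) (\<lambda>b. d (f b)) a"
proof -
  assume A: "\<And>b. b < nT \<Longrightarrow> A b \<in> gr p"
  have "d (mu (A b) x) = mu (d (A b)) x + (-1) ^ p *\<^sub>R mu (A b) (d x)" if "b < nT" for b x
    by (rule leibniz[OF A[OF that]])
  thus ?thesis
    by (simp add: app_brop linear_sum[OF d_linear] linear_scale[OF d_linear] linear_0[OF d_linear]
        scaleR_add_right sum.distrib scaleR_sum_right mult.commute cong: sum.cong_simp)
qed

lemma \<gamma>_mu: "a \<in> gr p \<Longrightarrow> \<gamma> (mu a x) = (-1) ^ p *\<^sub>R mu a (\<gamma> x)"
proof (rule linear_ext_gr[of "\<lambda>x. \<gamma> (mu a x)" "\<lambda>x. (-1) ^ p *\<^sub>R mu a (\<gamma> x)"])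
  assume a: "a \<in> gr p"
  show "linear (\<lambda>x. \<gamma> (mu a x))" using linear_compose[OF mu_linear(1) \<gamma>_linear] by (simp add: o_def)
  show "linear (\<lambda>x. (-1) ^ p *\<^sub>R mu a (\<gamma> x))"
    using linear_compose[OF \<gamma>_linear mu_linear(1)[of a]] by (simp add: o_def linear_compose_scale_right)
  show "\<gamma> (mu a x) = (-1) ^ p *\<^sub>R mu a (\<gamma> x)" if "x \<in> gr k" for k x
    using \<gamma>_gr[OF mu_gr[OF a that]] \<gamma>_gr[OF that] by (simp add: linear_scale[OF mu_linear(1)] power_add)
qed

lemma \<gamma>_brop: "(\<And>b. b < nT \<Longrightarrow> A b \<in> gr p) \<Longrightarrow> \<gamma> (app (brop A) f a) = (-1) ^ p *\<^sub>R app (brop A) (\<lambda>b. \<gamma> (f b)) a"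
proof -
  assume A: "\<And>b. b < nT \<Longrightarrow> A b \<in> gr p"
  have "\<gamma> (mu (A b) x) = (-1) ^ p *\<^sub>R mu (A b) (\<gamma> x)" if "b < nT" for b x
    by (rule \<gamma>_mu[OF A[OF that]])
  thus ?thesis
    by (simp add: app_brop linear_sum[OF \<gamma>_linear] linear_scale[OF \<gamma>_linear] linear_0[OF \<gamma>_linear]
        scaleR_sum_right mult.commute cong: sum.cong_simp)
qed

lemma od_brop: "(\<And>b. b < nT \<Longrightarrow> A b \<in> gr 1) \<Longrightarrow> st.od (brop A)"
  unfolding st.od_def by (auto intro!: lop_eqI simp: below_brop app_lift[OF \<gamma>_linear, abs_def] \<gamma>_brop[of A 1])

lemma od_lift: "linear F \<Longrightarrow> (\<And>k x. x \<in> gr k \<Longrightarrow> \<gamma> (F x) = - ((-1) ^ k *\<^sub>R F x)) \<Longrightarrow> st.od (lift F)"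
proof -
  assume F: "linear F" "\<And>k x. x \<in> gr k \<Longrightarrow> \<gamma> (F x) = - ((-1) ^ k *\<^sub>R F x)"
  have "\<gamma> (F x) = - F (\<gamma> x)" for x
  proof (rule linear_ext_gr[of "\<lambda>x. \<gamma> (F x)" "\<lambda>x. - F (\<gamma> x)"])
    show "linear (\<lambda>x. \<gamma> (F x))" using linear_compose[OF F(1) \<gamma>_linear] by (simp add: o_def)
    show "linear (\<lambda>x. - F (\<gamma> x))" using linear_compose[OF \<gamma>_linear F(1)] by (simp add: o_def linear_compose_neg)
  qed (simp add: F \<gamma>_gr linear_scale[OF F(1)])
  thus ?thesis unfolding st.od_def
    by (auto intro!: lop_eqI below_intros F simp: app_lift F(1) \<gamma>_linear app_lift[OF F(1), abs_def] app_lift[OF \<gamma>_linear, abs_def])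
qed

lemma od_lift_d: "st.od (lift d)"
  by (rule od_lift[OF d_linear]) (simp add: \<gamma>_gr[OF d_gr])

lemma od_lift_lowers: "linear F \<Longrightarrow> lowers_degree C F \<Longrightarrow> st.od (lift F)"
proof (rule od_lift)
  assume F: "linear F" "lowers_degree C F"
  fix k x assume x: "x \<in> gr k"
  show "\<gamma> (F x) = - ((-1) ^ k *\<^sub>R F x)"
  proof (cases k)
    case 0
    hence "F x = 0" using F(2) x unfolding lowers_degree_def by (meson image_subset_iff singletonD)
    thus ?thesis by (simp add: linear_0[OF \<gamma>_linear])
  next
    case (Suc l)
    hence "F x \<in> gr l" using F(2) x unfolding lowers_degree_def by (meson image_subset_iff)
    thus ?thesis using Suc by (simp add: \<gamma>_gr)
  qed
qed

text \<open>Only \<open>brop\<close> acts on the Lie algebra factor, so the trace contains the trace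
  of an adjoint action, which vanishes by \<open>sc_trace\<close>.\<close>

lemma tr_lift_brop: "linear F \<Longrightarrow> tr (lift F * brop A) = 0"
proof -
  assume F: "linear F"
  have "crd (k, j, a) (app (lift F * brop A) (bas (k, j, a))) = (\<Sum>b<nT. sc a b a * rB (F (mu (A b) (ee k ! j))) (ee k ! j))"
    if a: "a < nT" for k j a
  proof -
    have "app (brop A) (bas (k, j, a)) a = (\<Sum>b<nT. \<Sum>c<nT. if c = a then sc a b a *\<^sub>R mu (A b) (ee k ! j) else 0)"
      by (simp only: app_brop a if_True, intro sum.cong refl) (auto simp: linear_0[OF mu_linear(1)])
    hence "app (brop A) (bas (k, j, a)) a = (\<Sum>b<nT. sc a b a *\<^sub>R mu (A b) (ee k ! j))" using a by simp
    thus ?thesis by (simp add: app_lift[OF F] linear_sum[OF F] linear_scale[OF F]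
        linear_sum[OF rB_linear] linear_scale[OF rB_linear])
  qed
  hence "tr (lift F * brop A) = (\<Sum>(k, j, a)\<in>I. \<Sum>b<nT. sc a b a * rB (F (mu (A b) (ee k ! j))) (ee k ! j))"
    unfolding tr_def by (intro sum.cong refl) (auto simp: I_iff)
  also have "\<dots> = (\<Sum>k<4. \<Sum>j<length (ee k). \<Sum>b<nT. \<Sum>a<nT. sc a b a * rB (F (mu (A b) (ee k ! j))) (ee k ! j))"
    unfolding I_def sum_idx by (intro sum.cong refl sum.swap)
  also have "\<dots> = 0"
    by (simp add: sum_distrib_right[symmetric] sc_trace cong: sum.cong_simp)
  finally show ?thesis .
qed

definition conn :: "(nat \<Rightarrow> 'h list) \<Rightarrow> ('h \<Rightarrow> 'c) \<Rightarrow> (nat \<Rightarrow> 'g) \<Rightarrow> nat \<Rightarrow> 'c" where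
  "conn E \<iota> \<alpha> b = (\<Sum>i<length (E 1). rT (\<alpha> i) b *\<^sub>R \<iota> (E 1 ! i))"

lemma K_l_eq: "linear K \<Longrightarrow> K_l C \<gg> T E \<iota> K \<alpha> f = app (lift K * brop (conn E \<iota> \<alpha>)) f"
  for E :: "nat \<Rightarrow> 'h::real_vector list"
proof
  fix a assume K: "linear K"
  have "(\<Sum>b<nT. rT (br (\<alpha> i) (T ! b)) a *\<^sub>R mu (\<iota> (E 1 ! i)) (f b)) =
      (\<Sum>c<nT. \<Sum>b<nT. (rT (\<alpha> i) c * sc a c b) *\<^sub>R mu (\<iota> (E 1 ! i)) (f b))" for i
    by (subst sum.swap) (intro sum.cong refl, simp add: rT_br_T scaleR_sum_left)
  hence "(\<Sum>i<length (E 1). \<Sum>b<nT. rT (br (\<alpha> i) (T ! b)) a *\<^sub>R mu (\<iota> (E 1 ! i)) (f b)) =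
      (\<Sum>i<length (E 1). \<Sum>c<nT. \<Sum>b<nT. (rT (\<alpha> i) c * sc a c b) *\<^sub>R mu (\<iota> (E 1 ! i)) (f b))" by simp
  also have "\<dots> = (\<Sum>c<nT. \<Sum>i<length (E 1). \<Sum>b<nT. (rT (\<alpha> i) c * sc a c b) *\<^sub>R mu (\<iota> (E 1 ! i)) (f b))"
    by (rule sum.swap)
  also have "\<dots> = (\<Sum>c<nT. \<Sum>b<nT. \<Sum>i<length (E 1). (rT (\<alpha> i) c * sc a c b) *\<^sub>R mu (\<iota> (E 1 ! i)) (f b))"
    by (intro sum.cong refl sum.swap)
  also have "\<dots> = (\<Sum>c<nT. \<Sum>b<nT. sc a c b *\<^sub>R mu (conn E \<iota> \<alpha> c) (f b))"
    by (simp add: conn_def linear_sum[OF mu_linear(2)] linear_scale[OF mu_linear(2)] scaleR_sum_right mult.commute)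
  finally show "K_l C \<gg> T E \<iota> K \<alpha> f a = app (lift K * brop (conn E \<iota> \<alpha>)) f a"
    by (simp add: K_l_def rT_def[symmetric] app_lift[OF K] app_brop linear_0[OF K])
qed

lemma half_str_log_eq: "linear K \<Longrightarrow> half_str_log C \<gg> T E \<iota> K \<alpha> = fps_const (1/2) *
    Abs_fps (\<lambda>n. if n = 0 then 0 else (-1) ^ (n + 1) / real n * st.str ((lift K * brop (conn E \<iota> \<alpha>)) ^ n))"
  for E :: "nat \<Rightarrow> 'h::real_vector list"
proof -
  assume K: "linear K"
  have 1: "K_l C \<gg> T E \<iota> K \<alpha> = app (lift K * brop (conn E \<iota> \<alpha>))" by (rule ext) (rule K_l_eq[OF K])
  have 2: "app X ^^ n = app (X ^ n)" for X :: "'c lop" and n by (rule ext) (rule app_power[symmetric])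
  show ?thesis unfolding half_str_log_def str_log_def 1 2 supertrace_eq ..
qed

end

subsection \<open>The one-loop part as a supertrace\<close>

sublocale formal_theory \<subseteq> superalg C \<gg> T by unfold_locales

context formal_theory
begin

context
  fixes \<alpha> :: "nat \<Rightarrow> 'g"
begin

abbreviation "AA \<equiv> conn E \<iota> \<alpha>"
abbreviation "LA \<equiv> brop AA"
abbreviation "XA \<equiv> th.X (coord_value T \<alpha>)"

lemma AA_gr: "AA b \<in> gr 1"
  unfolding conn_def by (intro subspace_sum[OF gr_subspace] subspace_scale[OF gr_subspace] E_gr) auto

definition bF :: "var \<Rightarrow> nat \<Rightarrow> 'c" where "bF v b = (if b = vidx v then fc v else 0)"

definition NN :: "var \<Rightarrow> (nat \<Rightarrow> 'c) \<Rightarrow> real" where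
  "NN u f = (-1) ^ (1 + form_degree u) * \<eta> (vidx u) * pp (fc u) (app LA f (vidx u))"

text \<open>The coordinates of K l(\<iota>(\<alpha>), f) with respect to the vectors
  \<open>bF\<close>: the pairings \<open>NN\<close> with the fluctuations, converted by the
  propagator.\<close>

definition NQ :: "var \<Rightarrow> (nat \<Rightarrow> 'c) \<Rightarrow> real" where "NQ w f = (\<Sum>u\<in>Fv. prg w u * NN u f)"

lemma vidx_Fv: "u \<in> Fv \<Longrightarrow> vidx u < nT" by (cases u) (auto simp: Fv_iff)

lemma range_K_expand: "\<exists>x. K z = (\<Sum>k<4. \<Sum>j<length (eF k). x k j *\<^sub>R eF k ! j)"
proof -
  obtain f where f: "\<And>k. f k \<in> gr k" "z = (\<Sum>k\<le>3. f k)" by (rule gr_expand[of z]) blast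
  \<comment> \<open>\<open>K\<close> kills degree 0 and lowers the others by one, so the component
    in degree k of im K comes from degree k + 1; the empty degree 4 makes both index ranges
    equal.\<close>
  have "f 4 = 0" using f(1)[of 4] gr_large[of 4] by auto
  moreover have "K z = K (f 0) + K (f 1) + K (f 2) + K (f 3)"
    unfolding f(2) linear_sum[OF K_linear] by (simp add: eval_nat_numeral)
  moreover have "(\<Sum>k<4. K (f (Suc k))) = K (f 1) + K (f 2) + K (f 3) + K (f 4)"
    by (simp add: eval_nat_numeral)
  ultimately have "K z = (\<Sum>k<4. K (f (Suc k)))"
    using K_gr0[OF f(1)] by (simp add: linear_0[OF K_linear])
  also have "\<dots> = (\<Sum>k<4. \<Sum>j<length (eF k). representation (set (eF k)) (K (f (Suc k))) (eF k ! j) *\<^sub>R eF k ! j)"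
    using f(1) by (intro sum.cong refl eF_expand imageI)
  finally show ?thesis by (rule exI[of _ "\<lambda>k j. representation (set (eF k)) (K (f (Suc k))) (eF k ! j)"])
qed

text \<open>The difference between \<open>z\<close> and \<open>d (K z)\<close> lies in the kernel of
  \<open>K\<close>, which is orthogonal to im K.\<close>

lemma pi_K_d_K: "pp (K b) (d (K z)) = pp (K b) z"
proof -
  have "d (K z) = z - (P z + K (d z))" using decomp[of z] by (simp add: algebra_simps)
  thus ?thesis by (simp add: linear_diff[OF pi_linear(1)] pi_K_eq_0 linear_add[OF K_linear])
qed

text \<open>Paired with fluctuations through \<open>d\<close>, the unknown coordinates satisfy a
  linear system with the kinetic matrix, whose right hand side is \<open>NN\<close>; the propagator
  solves it.\<close>

lemma app_K_L: "app (lift K * LA) f a = (\<Sum>v\<in>Fv. NQ v f *\<^sub>R bF v a)"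
proof (cases "a < nT")
  case False
  have "bF v a = 0" if "v \<in> Fv" for v using vidx_Fv[OF that] False by (auto simp: bF_def)
  thus ?thesis using False by (simp add: app_lift[OF K_linear] app_brop linear_0[OF K_linear])
next
  case True
  have "\<forall>a. \<exists>x. K (app LA f a) = (\<Sum>k<4. \<Sum>j<length (eF k). x k j *\<^sub>R eF k ! j)" using range_K_expand by blast
  from choice[OF this] obtain x where x: "\<And>a. K (app LA f a) = (\<Sum>k<4. \<Sum>j<length (eF k). x a k j *\<^sub>R eF k ! j)" by blast
  define xx where "xx v = (case v of Fluct k j a \<Rightarrow> x a k j | Resid k j a \<Rightarrow> 0)" for v
  have g: "K (app LA f a) = (\<Sum>v\<in>Fv. xx v *\<^sub>R bF v a)" if a: "a < nT" for a
  proof -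
    have "(\<Sum>v\<in>Fv. xx v *\<^sub>R bF v a) = (\<Sum>k<4. \<Sum>j<length (eF k). \<Sum>b<nT. if b = a then x a k j *\<^sub>R eF k ! j else 0)"
      unfolding sum_Fv sum_idx by (intro sum.cong refl) (auto simp: xx_def bF_def fc_Fluct Fv_iff)
    thus ?thesis using a by (simp add: x)
  qed
  have qx: "(\<Sum>v\<in>Fv. qq u v * xx v) = NN u f" if u: "u \<in> Fv" for u
  proof -
    have "qq u v * xx v = (-1) ^ (1 + form_degree u) * \<eta> (vidx u) * (xx v * pp (fc u) (d (bF v (vidx u))))" if v: "v \<in> Fv" for v
    proof (cases "vidx u = vidx v \<and> pp (fc u) (d (fc v)) \<noteq> 0")
      case True
      hence "form_degree u + form_degree v = 2" using pi_gr[OF fc_gr d_gr[OF fc_gr], of u v] by simp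
      \<comment> \<open>The two degrees have the same parity, so the Koszul sign depends on
        \<open>u\<close> alone and comes out of the sum.\<close>
      hence "(-1::real) ^ ((1 + form_degree u) * (form_degree v + 1)) = (-1) ^ (1 + form_degree u)"
        using deg2_par[of u v] by (cases "even (form_degree u)") (simp_all add: minus_one_cases)
      moreover have "lf (fg u) (fg v) = \<eta> (vidx u)" using True vidx_Fv[OF u] by (simp add: fg_vidx lf_T)
      ultimately show ?thesis using True by (simp add: qq bF_def mult_ac)
    next
      case False
      thus ?thesis using vidx_Fv[OF u] vidx_Fv[OF v]
        by (auto simp: qq fg_vidx lf_T bF_def linear_0[OF d_linear] linear_0[OF pi_linear(1)])
    qed
    hence "(\<Sum>v\<in>Fv. qq u v * xx v) = (-1) ^ (1 + form_degree u) * \<eta> (vidx u) * (\<Sum>v\<in>Fv. xx v * pp (fc u) (d (bF v (vidx u))))"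
      unfolding sum_distrib_left by (rule sum.cong[OF refl])
    also have "(\<Sum>v\<in>Fv. xx v * pp (fc u) (d (bF v (vidx u)))) = pp (fc u) (d (K (app LA f (vidx u))))"
      unfolding g[OF vidx_Fv[OF u]]
      by (simp only: linear_eq_on_basis_sum[OF d_linear] linear_sum_real[OF pi_linear(1)])
    also obtain b where b: "fc u = K b" using fc_Fv[OF u] by blast
    have "pp (fc u) (d (K (app LA f (vidx u)))) = pp (fc u) (app LA f (vidx u))" by (simp only: b pi_K_d_K)
    finally show ?thesis by (simp only: NN_def)
  qed
  have "xx w = NQ w f" if w: "w \<in> Fv" for w
  proof -
    have "NQ w f = (\<Sum>u\<in>Fv. \<Sum>v\<in>Fv. prg w u * qq u v * xx v)"
      unfolding NQ_def by (intro sum.cong refl) (simp add: qx[symmetric] sum_distrib_left mult.assoc)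
    also have "\<dots> = (\<Sum>v\<in>Fv. (\<Sum>u\<in>Fv. prg w u * qq u v) * xx v)"
      by (subst sum.swap) (simp add: sum_distrib_right)
    also have "\<dots> = (\<Sum>v\<in>Fv. if v = w then xx w else 0)"
      by (intro sum.cong refl) (simp add: prop_left[OF w])
    finally show ?thesis using w fin_Fv by simp
  qed
  thus ?thesis using g[OF True] by (simp add: app_lift[OF K_linear])
qed

lemma sum_D: "(\<Sum>x\<in>th.D. g x) = (\<Sum>i<length (E 1). \<Sum>b<nT. g (Resid 1 i b))"
proof -
  have "th.D = (\<lambda>(i, b). Resid 1 i b) ` ({..<length (E 1)} \<times> {..<nT})"
    by (auto simp: deg1_vars_eq[symmetric] deg1_vars_def)
  moreover have "inj_on (\<lambda>(i, b). Resid 1 i b) ({..<length (E 1)} \<times> {..<nT})" by (rule inj_onI) auto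
  ultimately show ?thesis
    by (simp add: sum.reindex sum.cartesian_product case_prod_unfold)
qed

text \<open>The Koszul signs of the vertex with a degree one middle leg reduce to the same sign as
  in the kinetic term, which makes the two matrices match.\<close>

lemma NN_bF: "u \<in> Fv \<Longrightarrow> w \<in> Fv \<Longrightarrow> NN u (bF w) = th.A (coord_value T \<alpha>) u w"
proof -
  assume u: "u \<in> Fv" and w: "w \<in> Fv"
  let ?p = "\<lambda>i. pp (fc u) (mu (\<iota> (E 1 ! i)) (fc w))"
  let ?s = "(-1::real) ^ (1 + form_degree u) * \<eta> (vidx u)"
  have "th.A (coord_value T \<alpha>) u w = (\<Sum>i<length (E 1). \<Sum>b<nT. ?s * (sc (vidx u) b (vidx w) * (rT (\<alpha> i) b * ?p i)))"
    unfolding th.A_def sum_D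
  proof (intro sum.cong refl)
    fix i b assume i: "i \<in> {..<length (E 1)}" "b \<in> {..<nT}"
    hence R: "Resid 1 i b \<in> Rv" by (simp add: Rv_iff)
    have l: "lf (fg u) (br (fg (Resid 1 i b)) (fg w)) = \<eta> (vidx u) * sc (vidx u) b (vidx w)"
      using vidx_Fv[OF u] by (simp add: fg_vidx[of u] fg_vidx[of w] lf_rT sc_def)
    show "coord_value T \<alpha> (Resid 1 i b) * cc u (Resid 1 i b) w = ?s * (sc (vidx u) b (vidx w) * (rT (\<alpha> i) b * ?p i))"
    proof (cases "?p i = 0")
      case True
      thus ?thesis by (simp only: cc fc_Resid[OF R] mult_zero_right)
    next
      case False
      hence "form_degree u + (1 + form_degree w) = 3"
        using i by (intro pi_gr[OF fc_gr mu_gr[OF E_gr fc_gr]]) auto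
      hence "even (form_degree u) = even (form_degree w)" using deg2_par[of u w] by simp
      hence S: "(-1::real) ^ ((1 + form_degree u) * (form_degree (Resid 1 i b) + form_degree w)
          + (1 + form_degree (Resid 1 i b)) * form_degree w) = (-1) ^ (1 + form_degree u)"
        by (cases "even (form_degree u)") (simp_all add: minus_one_cases)
      show ?thesis unfolding coord_value_Resid cc l fc_Resid[OF R] S by (simp only: mult_ac)
    qed
  qed
  also have "\<dots> = ?s * (\<Sum>b<nT. sc (vidx u) b (vidx w) * (\<Sum>i<length (E 1). rT (\<alpha> i) b * ?p i))"
    by (subst sum.swap) (simp only: sum_distrib_left)
  also have "\<dots> = ?s * (\<Sum>b<nT. sc (vidx u) b (vidx w) * pp (fc u) (mu (AA b) (fc w)))"
    by (simp add: conn_def linear_sum[OF mu_linear(2)] linear_scale[OF mu_linear(2)] linear_sum_real[OF pi_linear(1)])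
  also have "(\<Sum>b<nT. sc (vidx u) b (vidx w) * pp (fc u) (mu (AA b) (fc w))) = pp (fc u) (app LA (bF w) (vidx u))"
  proof -
    have "app LA (bF w) (vidx u) = (\<Sum>b<nT. \<Sum>c<nT. if c = vidx w then sc (vidx u) b (vidx w) *\<^sub>R mu (AA b) (fc w) else 0)"
      by (simp only: app_brop vidx_Fv[OF u] if_True, intro sum.cong refl) (auto simp: bF_def linear_0[OF mu_linear(1)])
    thus ?thesis using vidx_Fv[OF w] by (simp add: linear_sum_real[OF pi_linear(1)])
  qed
  finally show ?thesis by (simp only: NN_def)
qed

lemma NQ_bF: "v \<in> Fv \<Longrightarrow> NQ w (bF v) = XA w v"
  unfolding NQ_def th.X_def by (intro sum.cong refl) (simp add: NN_bF)

lemma NQ_sum: "finite J \<Longrightarrow> (\<And>a. a < nT \<Longrightarrow> f a = (\<Sum>j\<in>J. r j *\<^sub>R g j a)) \<Longrightarrow> NQ w f = (\<Sum>j\<in>J. r j * NQ w (g j))"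
proof -
  assume J: "finite J" and f: "\<And>a. a < nT \<Longrightarrow> f a = (\<Sum>j\<in>J. r j *\<^sub>R g j a)"
  have "NN u f = (\<Sum>j\<in>J. r j * NN u (g j))" if u: "u \<in> Fv" for u
  proof -
    have "app LA f (vidx u) = app LA (\<lambda>a. \<Sum>j\<in>J. r j *\<^sub>R g j a) (vidx u)"
      by (rule belowD[OF below_brop f vidx_Fv[OF u]])
    thus ?thesis
      by (simp add: NN_def app_sum[OF J] linear_sum_real[OF pi_linear(1)] sum_distrib_left mult_ac)
  qed
  hence "NQ w f = (\<Sum>u\<in>Fv. \<Sum>j\<in>J. r j * (prg w u * NN u (g j)))"
    unfolding NQ_def by (intro sum.cong refl) (simp add: sum_distrib_left mult_ac)
  also have "\<dots> = (\<Sum>j\<in>J. r j * NQ w (g j))"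
    unfolding NQ_def sum_distrib_left by (rule sum.swap)
  finally show ?thesis .
qed

text \<open>The operator takes values in the span of the \<open>bF\<close>, so all but one of its
  applications become multiplication by the matrix \<open>XA\<close>.\<close>

lemma app_K_L_power:
  "app ((lift K * LA) ^ Suc n) f a = (\<Sum>v\<in>Fv. (\<Sum>w\<in>Fv. mpow Fv XA n v w * NQ w f) *\<^sub>R bF v a)"
proof (induction n arbitrary: f)
  case 0
  have "(\<Sum>w\<in>Fv. mpow Fv XA 0 v w * NQ w f) = NQ v f" if "v \<in> Fv" for v
    using that fin_Fv by (simp add: mpow_0 if_distrib[of "\<lambda>x. x * _"] cong: if_cong)
  thus ?case using app_K_L[of f a] by simp
next
  case (Suc n)
  have "app ((lift K * LA) ^ Suc (Suc n)) f a = app ((lift K * LA) ^ Suc n) (app (lift K * LA) f) a"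
    by (subst power_Suc2) simp
  also have "\<dots> = (\<Sum>v\<in>Fv. (\<Sum>w\<in>Fv. mpow Fv XA n v w * NQ w (app (lift K * LA) f)) *\<^sub>R bF v a)" by (rule Suc)
  also have "\<dots> = (\<Sum>v\<in>Fv. (\<Sum>u\<in>Fv. mpow Fv XA (Suc n) v u * NQ u f) *\<^sub>R bF v a)"
  proof -
    have q: "NQ w (app (lift K * LA) f) = (\<Sum>u\<in>Fv. NQ u f * XA w u)" for w
      using NQ_sum[OF fin_Fv app_K_L] by (simp add: NQ_bF cong: sum.cong_simp)
    have "(\<Sum>w\<in>Fv. mpow Fv XA n v w * (\<Sum>u\<in>Fv. NQ u f * XA w u)) = (\<Sum>u\<in>Fv. mpow Fv XA (Suc n) v u * NQ u f)" for v
      unfolding mpow_Suc sum_distrib_left sum_distrib_right by (subst sum.swap) (simp add: mult_ac)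
    thus ?thesis by (simp only: q)
  qed
  finally show ?case .
qed

text \<open>The operator preserves the degree; this lets the sign of a basis vector of C be replaced
  by that of a fluctuation in the supertrace.\<close>

lemma NQ_bas: "i \<in> I \<Longrightarrow> NQ w (bas i) \<noteq> 0 \<Longrightarrow> fst i = form_degree w"
proof -
  assume i: "i \<in> I" "NQ w (bas i) \<noteq> 0"
  then obtain u where u: "prg w u \<noteq> 0" "NN u (bas i) \<noteq> 0"
    unfolding NQ_def by (metis (no_types, lifting) mult_eq_0_iff sum.not_neutral_contains_not_neutral)
  obtain k j a where k: "i = (k, j, a)" by (cases i)
  have "bas i b \<in> gr k" for b
    using i(1) ee_gr[of "ee k ! j" k] subspace_0[OF gr_subspace] by (simp add: k I_iff)
  hence "app LA (bas i) (vidx u) \<in> gr (1 + k)" by (intro app_brop_gr AA_gr)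
  moreover have "pp (fc u) (app LA (bas i) (vidx u)) \<noteq> 0" using u(2) by (auto simp: NN_def)
  ultimately have "form_degree u + (1 + k) = 3" by (rule pi_gr[OF fc_gr])
  thus ?thesis using prop_deg[OF u(1)] by (simp add: k)
qed

lemma str_K_L_power: "st.str ((lift K * LA) ^ Suc n) = th.strF (coord_value T \<alpha>) (Suc n)"
proof -
  have e: "(-1) ^ fst i * crd i (app ((lift K * LA) ^ Suc n) (bas i)) =
      (\<Sum>w\<in>Fv. \<Sum>v\<in>Fv. (-1) ^ form_degree w * mpow Fv XA n v w * (crd i (bF v) * NQ w (bas i)))" if i: "i \<in> I" for i
  proof -
    have "app ((lift K * LA) ^ Suc n) (bas i) = (\<lambda>a. \<Sum>v\<in>Fv. (\<Sum>w\<in>Fv. mpow Fv XA n v w * NQ w (bas i)) *\<^sub>R bF v a)"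
      by (rule ext) (rule app_K_L_power)
    hence "(-1) ^ fst i * crd i (app ((lift K * LA) ^ Suc n) (bas i)) =
        (\<Sum>v\<in>Fv. \<Sum>w\<in>Fv. (-1) ^ fst i * mpow Fv XA n v w * (crd i (bF v) * NQ w (bas i)))"
      by (simp only: crd_sum[OF fin_Fv] sum_distrib_left sum_distrib_right mult_ac)
    also have "\<dots> = (\<Sum>v\<in>Fv. \<Sum>w\<in>Fv. (-1) ^ form_degree w * mpow Fv XA n v w * (crd i (bF v) * NQ w (bas i)))"
      using NQ_bas[OF i] by (intro sum.cong refl) fastforce
    finally show ?thesis by (subst sum.swap)
  qed
  have n: "(\<Sum>i\<in>I. crd i (bF v) * NQ w (bas i)) = XA w v" if "v \<in> Fv" for v w
    using NQ_sum[OF fin_I, of "bF v" "\<lambda>i. crd i (bF v)" bas w] expand_bas NQ_bF[OF that] by simp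
  have "st.str ((lift K * LA) ^ Suc n) = (\<Sum>i\<in>I. (-1) ^ fst i * crd i (app ((lift K * LA) ^ Suc n) (bas i)))"
    unfolding str_eq by (rule sum.cong) auto
  also have "\<dots> = (\<Sum>i\<in>I. \<Sum>w\<in>Fv. \<Sum>v\<in>Fv. (-1) ^ form_degree w * mpow Fv XA n v w * (crd i (bF v) * NQ w (bas i)))"
    by (intro sum.cong refl e)
  also have "\<dots> = (\<Sum>w\<in>Fv. \<Sum>i\<in>I. \<Sum>v\<in>Fv. (-1) ^ form_degree w * mpow Fv XA n v w * (crd i (bF v) * NQ w (bas i)))"
    by (rule sum.swap)
  also have "\<dots> = (\<Sum>w\<in>Fv. \<Sum>v\<in>Fv. \<Sum>i\<in>I. (-1) ^ form_degree w * mpow Fv XA n v w * (crd i (bF v) * NQ w (bas i)))"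
    by (intro sum.cong refl sum.swap)
  also have "\<dots> = (\<Sum>w\<in>Fv. \<Sum>v\<in>Fv. (-1) ^ form_degree w * mpow Fv XA n v w * XA w v)"
    by (intro sum.cong refl) (simp only: sum_distrib_left[symmetric] n)
  also have "\<dots> = (\<Sum>w\<in>Fv. (-1) ^ form_degree w * mpow Fv XA (Suc n) w w)"
    by (intro sum.cong refl) (simp add: mpow_Suc_left fin_Fv sum_distrib_left mult_ac del: power_Suc)
  finally show ?thesis by (simp only: th.strF_def)
qed

end

theorem one_loop_formula:
  "eval_ray T E (loop_part 1 (effective_action C \<gg> T E \<iota> K)) \<alpha> = half_str_log C \<gg> T E \<iota> K \<alpha>"
proof -
  have "(\<lambda>n. if n = 0 then 0 else (-1) ^ (n + 1) / real n * th.strF (coord_value T \<alpha>) n) =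
      (\<lambda>n. if n = 0 then 0 else (-1) ^ (n + 1) / real n * st.str ((lift K * brop (conn E \<iota> \<alpha>)) ^ n))"
  proof
    fix n
    show "(if n = 0 then 0 else (-1) ^ (n + 1) / real n * th.strF (coord_value T \<alpha>) n) =
        (if n = 0 then 0 else (-1) ^ (n + 1) / real n * st.str ((lift K * brop (conn E \<iota> \<alpha>)) ^ n))"
      by (cases n) (simp, simp only: str_K_L_power)
  qed
  thus ?thesis by (simp only: eval_ray_one_loop half_str_log_eq[OF K_linear])
qed

end

subsection \<open>The variation of the one-loop part\<close>

lemma sum4_swap:
  "(\<Sum>b\<in>A. \<Sum>c\<in>B. \<Sum>i\<in>J. \<Sum>j\<in>L. t b c i j) = (\<Sum>i\<in>J. \<Sum>j\<in>L. \<Sum>b\<in>A. \<Sum>c\<in>B. t b c i j)"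
  for t :: "_ \<Rightarrow> _ \<Rightarrow> _ \<Rightarrow> _ \<Rightarrow> 'x::comm_monoid_add"
proof -
  have "(\<Sum>b\<in>A. \<Sum>c\<in>B. \<Sum>i\<in>J. \<Sum>j\<in>L. t b c i j) = (\<Sum>b\<in>A. \<Sum>i\<in>J. \<Sum>c\<in>B. \<Sum>j\<in>L. t b c i j)"
    by (rule sum.cong[OF refl], rule sum.swap)
  also have "\<dots> = (\<Sum>i\<in>J. \<Sum>b\<in>A. \<Sum>c\<in>B. \<Sum>j\<in>L. t b c i j)" by (rule sum.swap)
  also have "\<dots> = (\<Sum>i\<in>J. \<Sum>b\<in>A. \<Sum>j\<in>L. \<Sum>c\<in>B. t b c i j)"
    by (rule sum.cong[OF refl], rule sum.cong[OF refl], rule sum.swap)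
  also have "\<dots> = (\<Sum>i\<in>J. \<Sum>j\<in>L. \<Sum>b\<in>A. \<Sum>c\<in>B. t b c i j)"
    by (rule sum.cong[OF refl], rule sum.swap)
  finally show ?thesis .
qed

context superalg
begin

lemma app_brop_conn: "a < nT \<Longrightarrow> app (brop (conn E \<iota>1 \<alpha>)) (conn E \<iota>2 \<alpha>) a =
    (\<Sum>i<length (E 1). \<Sum>j<length (E 1). rT (br (\<alpha> i) (\<alpha> j)) a *\<^sub>R mu (\<iota>1 (E 1 ! i)) (\<iota>2 (E 1 ! j)))"
proof -
  assume a: "a < nT"
  let ?t = "\<lambda>b c i j. (rT (\<alpha> i) b * rT (\<alpha> j) c * sc a b c) *\<^sub>R mu (\<iota>1 (E 1 ! i)) (\<iota>2 (E 1 ! j))"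
  have "sc a b c *\<^sub>R mu (conn E \<iota>1 \<alpha> b) (conn E \<iota>2 \<alpha> c) = (\<Sum>i<length (E 1). \<Sum>j<length (E 1). ?t b c i j)" for b c
    by (simp add: conn_def linear_sum[OF mu_linear(1)] linear_scale[OF mu_linear(1)] linear_sum[OF mu_linear(2)]
        linear_scale[OF mu_linear(2)] scaleR_sum_right mult_ac) (subst sum.swap, simp add: mult_ac)
  hence "app (brop (conn E \<iota>1 \<alpha>)) (conn E \<iota>2 \<alpha>) a = (\<Sum>b<nT. \<Sum>c<nT. \<Sum>i<length (E 1). \<Sum>j<length (E 1). ?t b c i j)"
    using a by (simp only: app_brop if_True)
  also have "\<dots> = (\<Sum>i<length (E 1). \<Sum>j<length (E 1). \<Sum>b<nT. \<Sum>c<nT. ?t b c i j)" by (rule sum4_swap)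
  finally show ?thesis by (simp only: rT_br scaleR_sum_left)
qed

text \<open>In degree one the product is anticommutative, and so are the structure
  constants.\<close>

lemma app_brop_sym: "(\<And>b. b < nT \<Longrightarrow> A b \<in> gr 1) \<Longrightarrow> (\<And>b. b < nT \<Longrightarrow> B b \<in> gr 1) \<Longrightarrow> app (brop B) A a = app (brop A) B a"
proof (cases "a < nT")
  case True
  assume A: "\<And>b. b < nT \<Longrightarrow> A b \<in> gr 1" and B: "\<And>b. b < nT \<Longrightarrow> B b \<in> gr 1"
  have m: "sc a b c *\<^sub>R mu (B b) (A c) = sc a c b *\<^sub>R mu (A c) (B b)" if "b < nT" "c < nT" for b c
    using mu_comm[OF B A, of b c] that sc_anti[of a b c] by simp
  have "app (brop B) A a = (\<Sum>b<nT. \<Sum>c<nT. sc a c b *\<^sub>R mu (A c) (B b))"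
    using True by (simp only: app_brop if_True) (intro sum.cong refl, simp add: m)
  also have "\<dots> = app (brop A) B a" using True by (simp only: app_brop if_True) (rule sum.swap)
  finally show ?thesis .
qed (simp add: app_brop)

lemma lift_d_brop0:
  assumes "\<And>b. b < nT \<Longrightarrow> c b \<in> gr 0"
  shows "lift d * brop c - brop c * lift d = brop (\<lambda>b. d (c b))"
  by (rule lop_eqI) (simp add: app_lift[OF d_linear] app_lift[OF d_linear, abs_def] d_brop[of c 0] assms)

lemma str_lift_brop: "linear F \<Longrightarrow> st.str (lift F * brop c) = 0"
proof -
  assume F: "linear F"
  have "linear (\<lambda>x. \<gamma> (F x))" using linear_compose[OF F \<gamma>_linear] by (simp add: o_def)
  thus ?thesis
    using tr_lift_brop by (simp add: st.str_def mult.assoc[symmetric] lift_mult[OF \<gamma>_linear F])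
qed

lemma str_brop: "st.str (brop c) = 0"
  using str_lift_brop[OF linear_ident] by (simp add: lift_id)

section \<open>Derivatives of supertraces of powers\<close>

primrec DD :: "'c lop \<Rightarrow> 'c lop \<Rightarrow> nat \<Rightarrow> 'c lop" where
  "DD X X' 0 = 0"
| "DD X X' (Suc n) = X' * X ^ n + X * DD X X' n"

lemma below_DD: "below nT X \<Longrightarrow> below nT X' \<Longrightarrow> below nT (DD X X' n)"
  by (induction n) (simp_all add: below_intros st.Op_power)

lemma str_power_derivative:
  assumes X: "\<And>s. s \<in> S \<Longrightarrow> below nT (X s)" and X': "below nT X'" and t: "t \<in> S"
    and D: "\<And>i j. i \<in> I \<Longrightarrow> j \<in> I \<Longrightarrow>
      ((\<lambda>s. crd i (app (X s) (bas j))) has_real_derivative crd i (app X' (bas j))) (at t within S)"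
  shows "((\<lambda>s. st.str (X s ^ n)) has_real_derivative st.str (DD (X t) X' n)) (at t within S)"
proof -
  have m: "((\<lambda>s. crd i (app (X s ^ n) (bas j))) has_real_derivative crd i (app (DD (X t) X' n) (bas j))) (at t within S)"
    if i: "i \<in> I" and j: "j \<in> I" for i j
    using i
  proof (induction n arbitrary: i)
    case 0
    have "crd i (\<lambda>a. 0) = 0" by (cases i) (simp add: linear_0[OF rB_linear])
    moreover have "app 0 (bas j) = (\<lambda>a. 0)" by (rule ext) simp
    ultimately show ?case by simp
  next
    case (Suc n)
    have e: "crd i (app (X s ^ Suc n) (bas j)) = (\<Sum>k\<in>I. crd k (app (X s ^ n) (bas j)) * crd i (app (X s) (bas k)))"
      if "s \<in> S" for s
      using crd_app[OF X[OF that] Suc.prems, of "app (X s ^ n) (bas j)"] by simp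
    have "crd i (app (DD (X t) X' (Suc n)) (bas j)) = crd i (app X' (app (X t ^ n) (bas j))) + crd i (app (X t) (app (DD (X t) X' n) (bas j)))"
      by (cases i) (simp add: linear_add[OF rB_linear])
    also have "\<dots> = (\<Sum>k\<in>I. crd k (app (X t ^ n) (bas j)) * crd i (app X' (bas k))
        + crd k (app (DD (X t) X' n) (bas j)) * crd i (app (X t) (bas k)))"
      by (simp only: crd_app[OF X' Suc.prems, of "app (X t ^ n) (bas j)"]
          crd_app[OF X[OF t] Suc.prems, of "app (DD (X t) X' n) (bas j)"] sum.distrib)
    finally have f: "crd i (app (DD (X t) X' (Suc n)) (bas j)) = \<dots>" .
    have "((\<lambda>s. \<Sum>k\<in>I. crd k (app (X s ^ n) (bas j)) * crd i (app (X s) (bas k))) has_real_derivative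
        crd i (app (DD (X t) X' (Suc n)) (bas j))) (at t within S)"
      unfolding f by (intro DERIV_sum DERIV_mult' Suc.IH D Suc.prems)
    thus ?case
      by (rule has_field_derivative_transform_within[where d = 1]) (simp_all only: t e zero_less_one)
  qed
  have s: "st.str Z = (\<Sum>i\<in>I. (-1) ^ fst i * crd i (app Z (bas i)))" for Z
    unfolding str_eq by (rule sum.cong) auto
  show ?thesis unfolding s by (intro DERIV_sum DERIV_cmult m)
qed

lemma str_power_stationary:
  assumes X: "\<And>s. s \<in> S \<Longrightarrow> below nT (X s)" and X': "below nT X'" and t: "t \<in> S"
    and D: "\<And>i j. i \<in> I \<Longrightarrow> j \<in> I \<Longrightarrow>
      ((\<lambda>s. crd i (app (X s) (bas j))) has_real_derivative crd i (app X' (bas j))) (at t within S)"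
    and ev: "st.ev (X t)" and z: "\<And>n. st.str (X t ^ n * X') = 0"
  shows "((\<lambda>s. st.str (X s ^ n)) has_real_derivative 0) (at t within S)"
proof -
  \<comment> \<open>The case of exponent 0 of \<open>str_derivation\<close>, whose induction needs
    arbitrary exponents.\<close>
  have "st.str (X t ^ 0 * DD (X t) X' n) = 0"
    by (rule st.str_derivation[OF ev X' z]) (simp_all add: below_DD X[OF t] X')
  thus ?thesis using str_power_derivative[OF X X' t D, of n] by simp
qed

end

context formal_theory
begin

lemma conn_\<iota>: "conn E \<iota> \<alpha> b = \<iota> (\<Sum>i<length (E 1). rT (\<alpha> i) b *\<^sub>R E 1 ! i)"
  by (simp add: conn_def linear_sum[OF \<iota>_linear] linear_scale[OF \<iota>_linear])

lemma P_gr: "b \<in> gr k \<Longrightarrow> P b \<in> gr k"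
proof -
  assume b: "b \<in> gr k"
  have "d (K b) \<in> gr k"
  proof (cases k)
    case 0
    thus ?thesis using b K_gr0[of b] subspace_0[OF gr_subspace] by (simp add: linear_0[OF d_linear])
  next
    case (Suc l)
    thus ?thesis using b K_gr d_gr by blast
  qed
  thus ?thesis unfolding P_def using b K_gr[OF d_gr[OF b]]
    by (intro subspace_diff[OF gr_subspace])
qed

lemma bracket_class:
  "(\<Sum>i<length (E 1). \<Sum>j<length (E 1). r i j *\<^sub>R mu (\<iota> (E 1 ! i)) (\<iota> (E 1 ! j))) =
   \<iota> (\<Sum>i<length (E 1). \<Sum>j<length (E 1). r i j *\<^sub>R cls (mu (\<iota> (E 1 ! i)) (\<iota> (E 1 ! j))))"
proof -
  have "\<iota> (cls (mu (\<iota> x) (\<iota> y))) = mu (\<iota> x) (\<iota> y)" for x y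
    using \<iota>_mult[of "\<iota> x" "\<iota> y"] by (simp add: cls_\<iota>)
  thus ?thesis by (simp add: linear_sum[OF \<iota>_linear] linear_scale[OF \<iota>_linear])
qed

section \<open>Consequences of the Maurer-Cartan equation\<close>

context
  fixes \<alpha> :: "nat \<Rightarrow> 'g"
  assumes MC: "\<alpha> \<in> maurer_cartan C \<gg> E \<iota>"
begin

text \<open>The Maurer-Cartan equation says that the curvature is orthogonal to the representatives
  of degree one. As the curvature itself lies in im \<iota>, pairing it with any element sees only
  the projection to im \<iota>, so nondegeneracy makes it zero.\<close>

lemma curvature_zero:
  assumes a: "a < nT"
  shows "(\<Sum>i<length (E 1). \<Sum>j<length (E 1). rT (br (\<alpha> i) (\<alpha> j)) a *\<^sub>R mu (\<iota> (E 1 ! i)) (\<iota> (E 1 ! j))) = 0"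
proof -
  let ?n = "length (E 1)"
  let ?F = "\<Sum>i<?n. \<Sum>j<?n. rT (br (\<alpha> i) (\<alpha> j)) a *\<^sub>R mu (\<iota> (E 1 ! i)) (\<iota> (E 1 ! j))"
  obtain \<zeta> where \<zeta>: "?F = \<iota> \<zeta>" using bracket_class[of "\<lambda>i j. rT (br (\<alpha> i) (\<alpha> j)) a"] by blast
  have "mu (\<iota> (E 1 ! i)) (\<iota> (E 1 ! j)) \<in> gr 2" if "i < ?n" "j < ?n" for i j
    using mu_gr[OF E_gr[of 1 i] E_gr[of 1 j]] that by (simp add: numeral_2_eq_2)
  hence F_gr: "?F \<in> gr 2" by (intro subspace_sum[OF gr_subspace] subspace_scale[OF gr_subspace]) auto
  have E: "pp (\<iota> (E 1 ! k)) ?F = 0" if k: "k < ?n" for k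
  proof -
    have "pp (\<iota> (E 1 ! k)) ?F = (\<Sum>i<?n. \<Sum>j<?n. rT (br (\<alpha> i) (\<alpha> j)) a * pp (\<iota> (E 1 ! k)) (mu (\<iota> (E 1 ! i)) (\<iota> (E 1 ! j))))"
      by (simp add: linear_sum[OF pi_linear(1)] linear_scale[OF pi_linear(1)])
    also have "\<dots> = rT (\<Sum>i<?n. \<Sum>j<?n. pp (\<iota> (E 1 ! k)) (mu (\<iota> (E 1 ! i)) (\<iota> (E 1 ! j))) *\<^sub>R br (\<alpha> i) (\<alpha> j)) a"
      by (simp add: linear_sum[OF rT_linear] linear_scale[OF rT_linear] mult.commute)
    also have "\<dots> = 0" using MC k by (simp add: maurer_cartan_def linear_0[OF rT_linear])
    finally show ?thesis .
  qed
  have "?F = 0"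
  proof (rule pi_nondeg_right)
    fix b
    show "pp b ?F = 0"
    proof (rule pi_zero[of "\<lambda>b. pp b ?F"])
      fix k b assume b: "b \<in> gr k"
      show "pp b ?F = 0"
      proof (cases "k = 1")
        case False
        thus ?thesis using pi_gr[OF b F_gr] by fastforce
      next
        case True
        obtain x where x: "P b = \<iota> x" using P_range by blast
        have "x = cls (P b)" by (simp add: x cls_\<iota>)
        hence "x \<in> coh_grade C cls 1" using P_gr[OF b] True by (auto simp: coh_grade_def)
        hence "x \<in> span (set (E 1))" using E_basis[of 1] by (simp add: is_basis_def)
        hence "pp (\<iota> x) ?F = 0"
        proof (induction rule: span_induct)
          case base
          show ?case unfolding subspace_def
            by (simp add: linear_0[OF \<iota>_linear] linear_add[OF \<iota>_linear] linear_scale[OF \<iota>_linear]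
                linear_0[OF pi_linear(2)] linear_add[OF pi_linear(2)] linear_scale[OF pi_linear(2)])
        next
          case (step y)
          then obtain k where "k < length (E 1)" "y = E 1 ! k" by (auto simp: in_set_conv_nth)
          thus ?case using E[of k] by (simp only:)
        qed
        moreover have "pp b ?F = pp (P b) ?F" unfolding \<zeta> pi_P by simp
        ultimately show ?thesis by (simp only: x)
      qed
    qed (rule pi_linear)
  qed
  thus ?thesis .
qed

lemma app_AA_AA: "app (brop (conn E \<iota> \<alpha>)) (conn E \<iota> \<alpha>) = (\<lambda>a. 0)"
proof
  fix a
  show "app (brop (conn E \<iota> \<alpha>)) (conn E \<iota> \<alpha>) a = 0"
    by (cases "a < nT") (simp only: app_brop_conn curvature_zero, simp add: app_brop)
qed

text \<open>Twice the square of an odd operator l(A, .) is its graded commutator with itself, that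
  is, the adjoint action of the curvature.\<close>

lemma LA_LA: "brop (conn E \<iota> \<alpha>) * brop (conn E \<iota> \<alpha>) = 0"
proof (rule lop_eqI)
  fix f a
  have m: "mu (conn E \<iota> \<alpha> b) (conn E \<iota> \<alpha> b') = (-1) *\<^sub>R mu (conn E \<iota> \<alpha> b') (conn E \<iota> \<alpha> b)" for b b'
    using mu_comm[OF AA_gr[of \<alpha> b] AA_gr[of \<alpha> b']] by simp
  have "app (brop (conn E \<iota> \<alpha>)) (app (brop (conn E \<iota> \<alpha>)) f) a
      - (-1) *\<^sub>R app (brop (conn E \<iota> \<alpha>)) (app (brop (conn E \<iota> \<alpha>)) f) a = 0"
    by (rule trans[OF brop_commutator[OF m]]) (simp only: app_AA_AA brop_0 app_simps)
  thus "app (brop (conn E \<iota> \<alpha>) * brop (conn E \<iota> \<alpha>)) f a = app 0 f a"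
    by (simp add: scaleR_2[symmetric])
qed

text \<open>The homogeneous components in \<alpha> of the gauge parameter: each is the primitive in
  im K of the error left by the preceding ones.\<close>

primrec cj :: "(nat \<Rightarrow> 'c) \<Rightarrow> nat \<Rightarrow> nat \<Rightarrow> 'c" where
  "cj B 0 = (\<lambda>b. K (B b))"
| "cj B (Suc j) = (\<lambda>b. - K (app (brop (conn E \<iota> \<alpha>)) (cj B j) b))"

lemma P_AA_K: "P (app (brop (conn E \<iota> \<alpha>)) (\<lambda>b. K (f b)) a) = 0"
  by (simp add: app_brop conn_\<iota> linear_sum[OF P_linear] linear_scale[OF P_linear] linear_0[OF P_linear] P_\<iota>_K)

lemma d_AA: "d (app (brop (conn E \<iota> \<alpha>)) f a) = - app (brop (conn E \<iota> \<alpha>)) (\<lambda>b. d (f b)) a"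
proof -
  have "d (conn E \<iota> \<alpha> b) = 0" for b by (simp add: conn_\<iota>)
  thus ?thesis by (simp add: d_brop[of "conn E \<iota> \<alpha>" 1, OF AA_gr] brop_0)
qed

lemma str_variation_formal:
  assumes \<kappa>: "linear \<kappa>" "lowers_degree C \<kappa>" "\<And>a. \<kappa> (K a) = - K (\<kappa> a)" "\<And>a. d (\<kappa> (d a)) = 0"
      "\<And>a. \<kappa> a = K (d (\<kappa> a)) + \<kappa> (d (K a))"
    and B: "\<And>b. b < nT \<Longrightarrow> B b \<in> gr 1" "\<And>b. d (B b) = 0" "\<And>b. P (B b) = 0"
      "\<And>a. app (brop (conn E \<iota> \<alpha>)) B a = 0"
  shows "st.str ((lift K * brop (conn E \<iota> \<alpha>)) ^ n * (lift \<kappa> * brop (conn E \<iota> \<alpha>) + lift K * brop B)) = 0"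
proof -
  let ?A = "conn E \<iota> \<alpha>"
  note al = app_lift[OF d_linear] app_lift[OF K_linear] app_lift[OF P_linear] app_lift[OF \<kappa>(1)]
    app_lift[OF d_linear, abs_def] app_lift[OF K_linear, abs_def] app_lift[OF P_linear, abs_def] app_lift[OF \<kappa>(1), abs_def]
  have PP: "1 - lift d * lift K - lift K * lift d = lift P"
    by (rule lop_eqI) (simp add: al P_def)
  have cj_K: "\<exists>f. cj B j = (\<lambda>b. K (f b))" for j
  proof (cases j)
    case (Suc m)
    have "cj B j = (\<lambda>b. K (- app (brop ?A) (cj B m) b))" by (simp add: Suc linear_neg[OF K_linear])
    thus ?thesis by (rule exI[of _ "\<lambda>b. - app (brop ?A) (cj B m) b"])
  qed auto
  have cj_gr: "b < nT \<Longrightarrow> cj B j b \<in> gr 0" for j b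
  proof (induction j arbitrary: b)
    case 0
    thus ?case using K_gr[of "B b" 0] B(1) by simp
  next
    case (Suc j)
    have "app (brop ?A) (cj B j) b \<in> gr (1 + 0)" by (rule app_brop_gr[OF AA_gr Suc.IH])
    thus ?case using K_gr[of _ 0] subspace_neg[OF gr_subspace] by simp
  qed
  have d_cj0: "d (cj B 0 b) = B b" for b
    using decomp[of "B b"] by (simp add: B linear_0[OF K_linear])
  \<comment> \<open>The bracket of A with the preceding term is closed, by the hypothesis on
    \<open>B\<close> at first and by \<open>LA_LA\<close> afterwards, and has no component in im
    \<iota> since the preceding term lies in im K; \<open>K\<close> thus gives a primitive.\<close>
  have d_cj: "d (cj B (Suc j) b) = - app (brop ?A) (cj B j) b" for j b
  proof (induction j arbitrary: b)
    case 0
    let ?y = "app (brop ?A) (cj B 0) b"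
    have "P ?y = 0" by (simp add: P_AA_K)
    moreover have "d ?y = 0" unfolding d_AA d_cj0 by (simp add: B(4))
    ultimately have "d (K ?y) = ?y" using decomp[of ?y] by (simp add: linear_0[OF K_linear])
    thus ?case by (simp add: linear_neg[OF d_linear])
  next
    case (Suc j)
    let ?y = "app (brop ?A) (cj B (Suc j)) b"
    obtain f where f: "cj B (Suc j) = (\<lambda>b. K (f b))" using cj_K by blast
    have "P ?y = 0" unfolding f by (rule P_AA_K)
    moreover have "d ?y = 0"
    proof -
      have "d ?y = app (brop ?A) (app (brop ?A) (cj B j)) b"
        unfolding d_AA Suc using app_scale[of "brop ?A" "-1" "app (brop ?A) (cj B j)" b] by simp
      also have "\<dots> = app (brop ?A * brop ?A) (cj B j) b" by simp
      finally show ?thesis by (simp only: LA_LA app_simps)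
    qed
    ultimately have "d (K ?y) = ?y" using decomp[of ?y] by (simp add: linear_0[OF K_linear])
    thus ?case by (simp add: linear_neg[OF d_linear])
  qed
  show ?thesis
  proof (rule st.str_variation[where CC = "\<lambda>j. brop (cj B j)" and d = "lift d"])
    show "st.od (lift d)" by (rule od_lift_d)
    show "st.od (lift K)" by (rule od_lift_lowers[OF K_linear lowers])
    show "st.od (brop ?A)" by (rule od_brop) (rule AA_gr)
    show "below nT (lift \<kappa>)" "below nT (brop B)" "\<And>j. below nT (brop (cj B j))"
      by (simp_all add: below_intros below_brop \<kappa>(1))
    show "lift d * lift d = 0" "lift K * lift K = 0" "lift K * (lift d * lift K) = lift K" "lift d * (lift K * lift d) = lift d"
      by (rule lop_eqI, simp add: al K_d_K d_K_d)+
    show "brop ?A * brop ?A = 0" by (rule LA_LA)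
    show "lift d * brop ?A = - (brop ?A * lift d)" by (rule lop_eqI) (simp add: al d_AA)
    show "lift K * (brop ?A * (1 - lift d * lift K - lift K * lift d)) = 0"
      unfolding PP by (rule lop_eqI) (simp add: al app_brop conn_\<iota> linear_sum[OF K_linear] linear_scale[OF K_linear]
          linear_0[OF K_linear] K_\<iota>_P)
    show "(1 - lift d * lift K - lift K * lift d) * (brop ?A * lift K) = 0"
      unfolding PP by (rule lop_eqI) (simp add: al P_AA_K)
    show "lift \<kappa> * lift K = - (lift K * lift \<kappa>)" by (rule lop_eqI) (simp add: al \<kappa>(3))
    show "lift d * (lift \<kappa> * lift d) = 0" by (rule lop_eqI) (simp add: al \<kappa>(4))
    show "lift \<kappa> = lift K * (lift d * lift \<kappa>) + lift \<kappa> * (lift d * lift K)"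
      by (rule lop_eqI) (simp add: al \<kappa>(5)[symmetric])
    show "brop B = lift d * brop (cj B 0) - brop (cj B 0) * lift d"
    proof -
      have "lift d * brop (cj B 0) - brop (cj B 0) * lift d = brop (\<lambda>b. d (cj B 0 b))"
        by (rule lift_d_brop0) (rule cj_gr)
      thus ?thesis by (simp only: d_cj0)
    qed
    show "lift d * brop (cj B (Suc j)) - brop (cj B (Suc j)) * lift d = - (brop ?A * brop (cj B j) - brop (cj B j) * brop ?A)" for j
    proof -
      have "brop ?A * brop (cj B j) - brop (cj B j) * brop ?A = brop (app (brop ?A) (cj B j))"
      proof (rule lop_eqI)
        fix f a
        have "mu (?A b) (cj B j b') = 1 *\<^sub>R mu (cj B j b') (?A b)" if "b' < nT" for b b'
          using mu_comm[OF AA_gr cj_gr[OF that]] by simp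
        from brop_commutator[of ?A "cj B j" 1 f a, OF this]
        show "app (brop ?A * brop (cj B j) - brop (cj B j) * brop ?A) f a = app (brop (app (brop ?A) (cj B j))) f a"
          by simp
      qed
      moreover have "lift d * brop (cj B (Suc j)) - brop (cj B (Suc j)) * lift d = brop (\<lambda>b. d (cj B (Suc j) b))"
        by (rule lift_d_brop0) (rule cj_gr)
      ultimately show ?thesis by (simp only: d_cj brop_uminus)
    qed
    show "st.str (brop (cj B j)) = 0" for j by (rule str_brop)
    show "st.str ((1 - lift d * lift K - lift K * lift d) * brop (cj B j)) = 0" for j
      unfolding PP by (rule str_lift_brop[OF P_linear])
  qed
qed

text \<open>The hypothesis is the derivative of the curvature, a sum of two brackets; these agree by
  symmetry in degree one.\<close>

lemma app_AA_variation:
  assumes "\<And>x. x < length (E 1) \<Longrightarrow> \<iota>' (E 1 ! x) \<in> gr 1"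
    and v: "\<And>a. a < nT \<Longrightarrow> (\<Sum>i<length (E 1). \<Sum>j<length (E 1). rT (br (\<alpha> i) (\<alpha> j)) a *\<^sub>R
      (mu (\<iota>' (E 1 ! i)) (\<iota> (E 1 ! j)) + mu (\<iota> (E 1 ! i)) (\<iota>' (E 1 ! j)))) = 0"
  shows "app (brop (conn E \<iota> \<alpha>)) (conn E \<iota>' \<alpha>) a = 0"
proof (cases "a < nT")
  case True
  have B: "conn E \<iota>' \<alpha> b \<in> gr 1" for b
    unfolding conn_def using assms(1) by (intro subspace_sum[OF gr_subspace] subspace_scale[OF gr_subspace]) auto
  have "app (brop (conn E \<iota>' \<alpha>)) (conn E \<iota> \<alpha>) a + app (brop (conn E \<iota> \<alpha>)) (conn E \<iota>' \<alpha>) a = 0"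
    unfolding app_brop_conn[OF True] using v[OF True] by (simp add: scaleR_add_right sum.distrib)
  hence "app (brop (conn E \<iota> \<alpha>)) (conn E \<iota>' \<alpha>) a + app (brop (conn E \<iota> \<alpha>)) (conn E \<iota>' \<alpha>) a = 0"
    by (simp only: app_brop_sym[of "conn E \<iota> \<alpha>" "conn E \<iota>' \<alpha>", OF AA_gr B])
  thus ?thesis by (simp add: scaleR_2[symmetric])
qed (simp add: app_brop)

end

lemma cls_zero: "d y = 0 \<Longrightarrow> cls y = 0 \<Longrightarrow> \<exists>u. y = d u"
  using coh unfolding cohomology_def by blast

lemma cls_linear: "d a = 0 \<Longrightarrow> d b = 0 \<Longrightarrow> cls (a + b) = cls a + cls b"
  and cls_scale: "d a = 0 \<Longrightarrow> cls (r *\<^sub>R a) = r *\<^sub>R cls a"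
  using coh unfolding cohomology_def by blast+

theorem infinitesimal_stationary:
  assumes def: "infinitesimal_deformation C cls \<iota> K \<delta>\<iota> \<delta>K" and MC: "\<alpha> \<in> maurer_cartan C \<gg> E \<iota>"
  shows "((\<lambda>t. fps_nth (half_str_log C \<gg> T E (\<lambda>x. \<iota> x + t *\<^sub>R \<delta>\<iota> x) (\<lambda>a. K a + t *\<^sub>R \<delta>K a) \<alpha>) n)
      has_real_derivative 0) (at 0)"
proof -
  have \<delta>\<iota>: "linear \<delta>\<iota>" "\<And>x. d (\<delta>\<iota> x) = 0" "\<And>x. cls (\<delta>\<iota> x) = 0" "\<And>k x. x \<in> coh_grade C cls k \<Longrightarrow> \<delta>\<iota> x \<in> gr k"
    and \<delta>K: "linear \<delta>K" "lowers_degree C \<delta>K"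
    and h: "\<And>a. d (\<delta>K a) + \<delta>K (d a) = - \<delta>\<iota> (coh_transpose C \<iota> \<iota> a) - \<iota> (coh_transpose C \<iota> \<delta>\<iota> a)"
    and K\<iota>': "\<And>x. \<delta>K (\<iota> x) + K (\<delta>\<iota> x) = 0" and KK': "\<And>a. \<delta>K (K a) + K (\<delta>K a) = 0"
    and m: "\<And>a b. d a = 0 \<Longrightarrow> d b = 0 \<Longrightarrow> \<delta>\<iota> (cls (mu a b)) = mu (\<delta>\<iota> (cls a)) (\<iota> (cls b)) + mu (\<iota> (cls a)) (\<delta>\<iota> (cls b))"
    using def unfolding infinitesimal_deformation_def image_subset_iff by blast+
  have \<iota>P: "\<iota> (coh_transpose C \<iota> \<iota> a) = P a" for a
  proof -
    have "d (K a) + K (d a) = a - \<iota> (coh_transpose C \<iota> \<iota> a)" using ind unfolding induction_data_def by blast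
    thus ?thesis by (simp add: P_def algebra_simps)
  qed
  \<comment> \<open>Applying \<open>d\<close> to the linearised homotopy relation leaves only this
    term, because its right hand side consists of cocycles.\<close>
  have dKd: "d (\<delta>K (d a)) = 0" for a
    using arg_cong[OF h[of "d a"], of d] arg_cong[OF h[of a], of d]
    by (simp add: linear_add[OF d_linear] linear_diff[OF d_linear] linear_neg[OF d_linear] \<delta>\<iota>(2))
  \<comment> \<open>The linearisation of \<open>K d K = K\<close>.\<close>
  have \<delta>K_decomp: "\<delta>K a = K (d (\<delta>K a)) + \<delta>K (d (K a))" for a
  proof -
    have "K (d (\<delta>K a)) + K (\<delta>K (d a)) = - K (\<delta>\<iota> (coh_transpose C \<iota> \<iota> a))"
      using arg_cong[OF h[of a], of K] by (simp add: linear_add[OF K_linear] linear_diff[OF K_linear] linear_neg[OF K_linear])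
    also have "\<dots> = \<delta>K (P a)" using K\<iota>'[of "coh_transpose C \<iota> \<iota> a"] by (simp add: \<iota>P eq_neg_iff_add_eq_0 neg_eq_iff_add_eq_0 add.commute)
    also have "\<dots> = \<delta>K a - \<delta>K (d (K a)) - \<delta>K (K (d a))" by (simp add: P_def linear_diff[OF \<delta>K(1)])
    also have "\<delta>K (K (d a)) = - K (\<delta>K (d a))" using KK'[of "d a"] by (simp add: eq_neg_iff_add_eq_0)
    finally have "K (d (\<delta>K a)) = \<delta>K a - \<delta>K (d (K a))" by simp
    thus ?thesis by simp
  qed
  have \<delta>\<iota>_E: "\<delta>\<iota> (E 1 ! i) \<in> gr 1" if "i < length (E 1)" for i
    by (rule \<delta>\<iota>(4)) (use E_basis[of 1] that in \<open>metis is_basis_def nth_mem one_less_numeral_iff semiring_norm(76) span_base\<close>)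
  let ?B = "conn E \<delta>\<iota> \<alpha>" and ?A = "conn E \<iota> \<alpha>"
  have "app (brop ?A) ?B a = 0" for a
  proof (rule app_AA_variation[OF MC])
    show "\<delta>\<iota> (E 1 ! x) \<in> gr 1" if "x < length (E 1)" for x by (rule \<delta>\<iota>_E[OF that])
  next
    fix a assume a: "a < nT"
    let ?z = "\<Sum>i<length (E 1). \<Sum>j<length (E 1). rT (br (\<alpha> i) (\<alpha> j)) a *\<^sub>R cls (mu (\<iota> (E 1 ! i)) (\<iota> (E 1 ! j)))"
    \<comment> \<open>The curvature is the representative of the class \<open>?z\<close>, so the
      class vanishes, and with it the variation of the curvature, which is \<delta>\<iota> of the
      same class.\<close>
    have "\<iota> ?z = 0" using curvature_zero[OF MC a] bracket_class by simp
    hence "cls (\<iota> ?z) = cls (\<iota> 0)" by (simp add: linear_0[OF \<iota>_linear])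
    hence z: "?z = 0" by (simp only: cls_\<iota>)
    have "\<delta>\<iota> (cls (mu (\<iota> x) (\<iota> y))) = mu (\<delta>\<iota> x) (\<iota> y) + mu (\<iota> x) (\<delta>\<iota> y)" for x y
      using m[of "\<iota> x" "\<iota> y"] by (simp add: cls_\<iota>)
    hence "(\<Sum>i<length (E 1). \<Sum>j<length (E 1). rT (br (\<alpha> i) (\<alpha> j)) a *\<^sub>R
        (mu (\<delta>\<iota> (E 1 ! i)) (\<iota> (E 1 ! j)) + mu (\<iota> (E 1 ! i)) (\<delta>\<iota> (E 1 ! j)))) = \<delta>\<iota> ?z"
      by (simp add: linear_sum[OF \<delta>\<iota>(1)] linear_scale[OF \<delta>\<iota>(1)])
    thus "(\<Sum>i<length (E 1). \<Sum>j<length (E 1). rT (br (\<alpha> i) (\<alpha> j)) a *\<^sub>R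
        (mu (\<delta>\<iota> (E 1 ! i)) (\<iota> (E 1 ! j)) + mu (\<iota> (E 1 ! i)) (\<delta>\<iota> (E 1 ! j)))) = 0"
      unfolding z by (simp add: linear_0[OF \<delta>\<iota>(1)])
  qed
  moreover have "P (\<delta>\<iota> x) = 0" for x using cls_zero[OF \<delta>\<iota>(2) \<delta>\<iota>(3), of x] by auto
  hence "P (?B b) = 0" for b by (simp add: conn_def linear_sum[OF P_linear] linear_scale[OF P_linear])
  moreover have "d (?B b) = 0" for b by (simp add: conn_def linear_sum[OF d_linear] linear_scale[OF d_linear] \<delta>\<iota>(2))
  moreover have "?B b \<in> gr 1" for b
    unfolding conn_def using \<delta>\<iota>_E by (intro subspace_sum[OF gr_subspace] subspace_scale[OF gr_subspace]) auto
  moreover have "\<delta>K (K a) = - K (\<delta>K a)" for a using KK'[of a] by (simp add: eq_neg_iff_add_eq_0)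
  ultimately have var: "st.str ((lift K * brop ?A) ^ n * (lift \<delta>K * brop ?A + lift K * brop ?B)) = 0" for n
    using \<delta>K dKd \<delta>K_decomp by (intro str_variation_formal[OF MC]) blast+
  let ?K = "\<lambda>t a. K a + t *\<^sub>R \<delta>K a" and ?\<iota> = "\<lambda>t x. \<iota> x + t *\<^sub>R \<delta>\<iota> x"
  have Kt: "linear (?K t)" for t
    by (intro linear_compose_add K_linear linear_compose_scale_right \<delta>K(1))
  define X where "X t = lift (?K t) * brop (conn E (?\<iota> t) \<alpha>)" for t
  have X0: "X 0 = lift K * brop ?A" by (simp add: X_def)
  have D: "((\<lambda>t. crd i (app (X t) f)) has_real_derivative crd i (app (lift \<delta>K * brop ?A + lift K * brop ?B) f)) (at 0)" for i f
  proof -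
    have "conn E (?\<iota> t) \<alpha> = (\<lambda>b. ?A b + t *\<^sub>R ?B b)" for t
      by (rule ext) (simp add: conn_def scaleR_add_right sum.distrib scaleR_sum_right mult.commute)
    \<comment> \<open>Both factors are affine in \<open>t\<close>, so the operator is a quadratic
      polynomial whose linear coefficient is the required derivative.\<close>
    hence "app (X t) f a = K (app (brop ?A) f a) + t *\<^sub>R (\<delta>K (app (brop ?A) f a) + K (app (brop ?B) f a))
        + (t * t) *\<^sub>R \<delta>K (app (brop ?B) f a)" for t a
      by (simp add: X_def app_lift[OF Kt] brop_add brop_scale linear_add[OF K_linear] linear_add[OF \<delta>K(1)]
          linear_scale[OF K_linear] linear_scale[OF \<delta>K(1)] scaleR_add_right)
    hence "crd i (app (X t) f) = crd i (app (lift K * brop ?A) f) + t * crd i (app (lift \<delta>K * brop ?A + lift K * brop ?B) f)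
        + t * t * crd i (app (lift \<delta>K * brop ?B) f)" for t
      by (cases i) (simp add: app_lift[OF K_linear] app_lift[OF \<delta>K(1)] linear_add[OF rB_linear] linear_scale[OF rB_linear])
    thus ?thesis by (auto intro!: derivative_eq_intros)
  qed
  have "((\<lambda>t. st.str (X t ^ n)) has_real_derivative 0) (at 0)" for n
  proof (rule str_power_stationary[of UNIV])
    show "below nT (X s)" for s unfolding X_def by (intro below_intros below_brop Kt)
    show "below nT (lift \<delta>K * brop ?A + lift K * brop ?B)" by (intro below_intros below_brop \<delta>K K_linear)
    show "st.ev (X 0)" unfolding X0
      by (intro st.od_mult od_lift_lowers[OF K_linear lowers] od_brop AA_gr)
    show "st.str (X 0 ^ n * (lift \<delta>K * brop ?A + lift K * brop ?B)) = 0" for n unfolding X0 by (rule var)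
  qed (simp_all only: D UNIV_I)
  from DERIV_cmult[OF this[of n], of "if n = 0 then 0 else 1/2 * ((-1) ^ (n + 1) / real n)"]
  have "((\<lambda>t. (if n = 0 then 0 else 1/2 * ((-1) ^ (n + 1) / real n)) * st.str (X t ^ n)) has_real_derivative 0) (at 0)" by simp
  moreover have "fps_nth (half_str_log C \<gg> T E (?\<iota> t) (?K t) \<alpha>) n =
      (if n = 0 then 0 else 1/2 * ((-1) ^ (n + 1) / real n)) * st.str (X t ^ n)" for t
    by (simp add: half_str_log_eq[OF Kt] X_def)
  ultimately show ?thesis by simp
qed

end

subsection \<open>Finite deformations\<close>

lemma at_within_unit_interval: "t \<in> {0..1} \<Longrightarrow> at t within {0..1::real} \<noteq> bot"
proof -
  assume t: "t \<in> {0..1}"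
  consider "t = 0" | "t = 1" | "0 < t" "t < 1" using t by fastforce
  thus ?thesis
    by cases (simp_all add: at_within_Icc_at_right at_within_Icc_at_left at_within_Icc_at)
qed

context superalg
begin

text \<open>Derivatives of paths in the space \<open>C\<close>, which carries no topology, are taken coordinatewise.\<close>

definition vder :: "real \<Rightarrow> (real \<Rightarrow> 'c) \<Rightarrow> 'c \<Rightarrow> bool" where
  "vder t y y' \<longleftrightarrow> (\<forall>\<phi> :: 'c \<Rightarrow> real. linear \<phi> \<longrightarrow>
     ((\<lambda>s. \<phi> (y s)) has_real_derivative \<phi> y') (at t within {0..1}))"

lemma vderD: "vder t y y' \<Longrightarrow> linear \<phi> \<Longrightarrow> ((\<lambda>s. \<phi> (y s)) has_real_derivative \<phi> y') (at t within {0..1})"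
  by (simp add: vder_def)

lemma vder_cong: "vder t y y' \<Longrightarrow> t \<in> {0..1} \<Longrightarrow> (\<And>s. s \<in> {0..1} \<Longrightarrow> y s = z s) \<Longrightarrow> vder t z y'"
  unfolding vder_def
proof (intro allI impI)
  fix \<phi> :: "'c \<Rightarrow> real"
  assume "\<forall>\<phi>::'c \<Rightarrow> real. linear \<phi> \<longrightarrow> ((\<lambda>s. \<phi> (y s)) has_real_derivative \<phi> y') (at t within {0..1})"
    and t: "t \<in> {0..1}" and e: "\<And>s. s \<in> {0..1} \<Longrightarrow> y s = z s" and "linear \<phi>"
  hence "((\<lambda>s. \<phi> (y s)) has_real_derivative \<phi> y') (at t within {0..1})" by blast
  thus "((\<lambda>s. \<phi> (z s)) has_real_derivative \<phi> y') (at t within {0..1})"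
    by (rule has_field_derivative_transform_within[where d = 1]) (simp_all only: t e zero_less_one)
qed

lemma vder_const: "vder t (\<lambda>s. c) 0"
  by (simp add: vder_def linear_0)

lemma vder_linear: "linear F \<Longrightarrow> vder t y y' \<Longrightarrow> vder t (\<lambda>s. F (y s)) (F y')"
  unfolding vder_def
proof (intro allI impI)
  fix \<phi> :: "'c \<Rightarrow> real"
  assume F: "linear F" and y: "\<forall>\<phi>::'c \<Rightarrow> real. linear \<phi> \<longrightarrow> ((\<lambda>s. \<phi> (y s)) has_real_derivative \<phi> y') (at t within {0..1})"
    and \<phi>: "linear \<phi>"
  have "linear (\<lambda>x. \<phi> (F x))" using linear_compose[OF F \<phi>] by (simp add: o_def)
  with y show "((\<lambda>s. \<phi> (F (y s))) has_real_derivative \<phi> (F y')) (at t within {0..1})" by blast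
qed

lemma vder_scale: "vder t y y' \<Longrightarrow> vder t (\<lambda>s. r *\<^sub>R y s) (r *\<^sub>R y')"
  by (rule vder_linear) (simp_all add: linear_scale_self linearI scaleR_add_right)

lemma vder_sum: "(\<And>i. i \<in> J \<Longrightarrow> vder t (y i) (y' i)) \<Longrightarrow> vder t (\<lambda>s. \<Sum>i\<in>J. y i s) (\<Sum>i\<in>J. y' i)"
  unfolding vder_def by (auto simp: linear_sum intro!: DERIV_sum)

text \<open>Linear constraints constant along the path are inherited by its derivative, also at the
  end points, where one-sided derivatives are still unique.\<close>

lemma vder_functional:
  fixes c :: real
  assumes y: "vder t y y'" and t: "t \<in> {0..1}" and \<phi>: "linear \<phi>" and c: "\<And>s. s \<in> {0..1} \<Longrightarrow> \<phi> (y s) = c"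
  shows "\<phi> y' = 0"
proof -
  have "((\<lambda>s. c) has_real_derivative \<phi> y') (at t within {0..1})"
    by (rule has_field_derivative_transform_within[OF vderD[OF y \<phi>], where d = 1]) (simp_all only: t c zero_less_one)
  hence "((\<lambda>s::real. 0::real) \<longlongrightarrow> \<phi> y') (at t within {0..1})" by (simp add: has_field_derivative_iff)
  thus ?thesis using tendsto_unique[OF at_within_unit_interval[OF t] tendsto_const] by metis
qed

lemma vder_unique:
  assumes y: "vder t y y'" and z: "vder t z z'" and t: "t \<in> {0..1}" and e: "\<And>s. s \<in> {0..1} \<Longrightarrow> y s = z s"
  shows "y' = z'"
proof -
  have "vder t (\<lambda>s. y s - z s) (y' - z')"
    using y z unfolding vder_def by (auto simp: linear_diff intro!: DERIV_diff)
  hence "rB (y' - z') c = 0" for c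
    by (rule vder_functional[OF _ t, of _ _ _ 0]) (simp_all add: rB_linear e linear_0[OF rB_linear])
  hence "y' - z' = 0" using rB_expand[of "y' - z'"] by simp
  thus ?thesis by simp
qed

lemma vder_app:
  assumes K: "\<And>s. s \<in> {0..1} \<Longrightarrow> linear (K s)" and K': "linear K'" and d: "\<And>x. vder t (\<lambda>s. K s x) (K' x)"
    and y: "vder t y y'" and t: "t \<in> {0..1}"
  shows "vder t (\<lambda>s. K s (y s)) (K' (y t) + K t y')"
  unfolding vder_def
proof (intro allI impI)
  fix \<phi> :: "'c \<Rightarrow> real" assume \<phi>: "linear \<phi>"
  have e: "\<phi> (F x) = (\<Sum>c\<in>BB. rB x c * \<phi> (F c))" if "linear F" for F x
  proof -
    have "F x = (\<Sum>c\<in>BB. rB x c *\<^sub>R F c)"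
      using rB_expand[of x] linear_eq_on_basis_sum[OF that, of "\<lambda>c. rB x c" "\<lambda>c. c" BB] by simp
    thus ?thesis by (simp add: linear_sum_real[OF \<phi>])
  qed
  have "\<phi> (K' (y t) + K t y') = (\<Sum>c\<in>BB. rB (y t) c * \<phi> (K' c) + rB y' c * \<phi> (K t c))"
    by (simp only: linear_add[OF \<phi>] e[OF K', of "y t"] e[OF K[OF t], of y'] sum.distrib)
  hence "((\<lambda>s. \<Sum>c\<in>BB. rB (y s) c * \<phi> (K s c)) has_real_derivative \<phi> (K' (y t) + K t y')) (at t within {0..1})"
    by (auto intro!: DERIV_sum DERIV_mult' vderD[OF y rB_linear] vderD[OF d \<phi>])
  thus "((\<lambda>s. \<phi> (K s (y s))) has_real_derivative \<phi> (K' (y t) + K t y')) (at t within {0..1})"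
  proof (rule has_field_derivative_transform_within[where d = 1])
    fix s :: real assume "s \<in> {0..1}"
    thus "(\<Sum>c\<in>BB. rB (y s) c * \<phi> (K s c)) = \<phi> (K s (y s))" by (rule e[OF K, symmetric])
  qed (simp_all only: t zero_less_one)
qed

lemma smooth_path_vder: "smooth_path \<gamma>' \<Longrightarrow> t \<in> {0..1} \<Longrightarrow> \<exists>y'. vder t (\<lambda>s. \<gamma>' s x) y'"
proof -
  assume s: "smooth_path \<gamma>'" and t: "t \<in> {0..1}"
  have "\<exists>r. ((\<lambda>s. rB (\<gamma>' s x) c) has_real_derivative r) (at t within {0..1})" for c
  proof -
    have "smooth01 (\<lambda>s. rB (\<gamma>' s x) c)" using s rB_linear unfolding smooth_path_def by blast
    thus ?thesis using t unfolding smooth01_def by metis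
  qed
  then obtain r where r: "\<And>c. ((\<lambda>s. rB (\<gamma>' s x) c) has_real_derivative r c) (at t within {0..1})" by metis
  have "vder t (\<lambda>s. \<gamma>' s x) (\<Sum>c\<in>BB. r c *\<^sub>R c)"
    unfolding vder_def
  proof (intro allI impI)
    fix \<phi> :: "'c \<Rightarrow> real" assume \<phi>: "linear \<phi>"
    have "\<phi> y = (\<Sum>c\<in>BB. rB y c * \<phi> c)" for y
      using rB_expand[of y] linear_sum_real[OF \<phi>, of "\<lambda>c. rB y c" "\<lambda>c. c" BB] by simp
    hence "(\<lambda>s. \<phi> (\<gamma>' s x)) = (\<lambda>s. \<Sum>c\<in>BB. rB (\<gamma>' s x) c * \<phi> c)" by blast
    moreover have "((\<lambda>s. \<Sum>c\<in>BB. rB (\<gamma>' s x) c * \<phi> c) has_real_derivative (\<Sum>c\<in>BB. r c * \<phi> c)) (at t within {0..1})"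
      by (intro DERIV_sum DERIV_cmult_right r)
    ultimately show "((\<lambda>s. \<phi> (\<gamma>' s x)) has_real_derivative \<phi> (\<Sum>c\<in>BB. r c *\<^sub>R c)) (at t within {0..1})"
      by (simp add: linear_sum_real[OF \<phi>])
  qed
  thus ?thesis by blast
qed

lemma rB_gr: "x \<in> gr k \<Longrightarrow> l \<le> 3 \<Longrightarrow> l \<noteq> k \<Longrightarrow> c \<in> set (ee l) \<Longrightarrow> rB x c = 0"
proof -
  assume x: "x \<in> gr k" and l: "l \<le> 3" "l \<noteq> k" "c \<in> set (ee l)"
  have "x \<in> span (set (ee k))" using x ee_basis[of k] by (simp add: is_basis_def)
  thus ?thesis
  proof (induction rule: span_induct)
    case base
    show ?case unfolding subspace_def
      by (simp add: linear_0[OF rB_linear] linear_add[OF rB_linear] linear_scale[OF rB_linear])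
  next
    case (step y)
    have k: "k \<le> 3"
    proof (rule ccontr)
      assume "\<not> k \<le> 3"
      hence "y = 0" using ee_gr[OF step] gr_large[of k] by auto
      hence "0 \<in> set (ee k)" using step by simp
      thus False using ee_basis[of k] dependent_zero[of "set (ee k)"] unfolding is_basis_def by blast
    qed
    have "y \<in> BB" using step k by (auto simp: BB_def)
    moreover have "c \<noteq> y" using step l ee_disjoint[OF l(1) k l(2)] by blast
    ultimately show ?case by (simp add: rB_basis)
  qed
qed

text \<open>A graded piece is cut out by the vanishing of the coordinates in the other degrees, and
  these are linear functionals.\<close>

lemma vder_gr:
  assumes y: "vder t y y'" and t: "t \<in> {0..1}" and g: "\<And>s. s \<in> {0..1} \<Longrightarrow> y s \<in> gr k"
  shows "y' \<in> gr k"
proof -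
  have z: "rB y' c = 0" if "l \<le> 3" "l \<noteq> k" "c \<in> set (ee l)" for l c
    by (rule vder_functional[OF y t rB_linear]) (rule rB_gr[OF g that])
  have y': "y' = (\<Sum>l\<le>3. \<Sum>c\<in>set (ee l). rB y' c *\<^sub>R c)" using rB_expand[of y'] by (simp add: sum_BB)
  have "(\<Sum>c\<in>set (ee l). rB y' c *\<^sub>R c) \<in> gr k" if "l \<in> {..3}" for l
  proof (cases "l = k")
    case True
    thus ?thesis using ee_gr by (intro subspace_sum[OF gr_subspace] subspace_scale[OF gr_subspace]) auto
  next
    case False
    thus ?thesis using z[of l] that subspace_0[OF gr_subspace] by simp
  qed
  hence "(\<Sum>l\<le>3. \<Sum>c\<in>set (ee l). rB y' c *\<^sub>R c) \<in> gr k" by (rule subspace_sum[OF gr_subspace])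
  thus ?thesis using y' by simp
qed

lemma vder_conn: "(\<And>x. vder t (\<lambda>s. \<iota>' s x) (\<iota>1 x)) \<Longrightarrow> vder t (\<lambda>s. conn E (\<iota>' s) \<alpha> b) (conn E \<iota>1 \<alpha> b)"
  unfolding conn_def by (intro vder_sum vder_scale)

lemma vder_brop: "(\<And>b. vder t (\<lambda>s. A s b) (A' b)) \<Longrightarrow> vder t (\<lambda>s. app (brop (A s)) f a) (app (brop A') f a)"
  unfolding app_brop
  by (cases "a < nT") (auto intro!: vder_sum vder_scale vder_linear[OF mu_linear(2)] vder_const)

end

context formal_theory
begin

section \<open>Independence of pairing, product and Maurer-Cartan set from the
  representatives\<close>

lemma representatives_differ: "d (\<iota>2 x) = 0 \<Longrightarrow> cls (\<iota>2 x) = x \<Longrightarrow> \<exists>u. \<iota>2 x = \<iota> x + d u"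
proof -
  assume x: "d (\<iota>2 x) = 0" "cls (\<iota>2 x) = x"
  have "cls (\<iota>2 x + (-1) *\<^sub>R \<iota> x) = 0"
    using x cls_linear[of "\<iota>2 x" "(-1) *\<^sub>R \<iota> x"] cls_scale[of "\<iota> x" "-1"]
    by (simp add: linear_neg[OF d_linear] cls_\<iota>)
  moreover have "d (\<iota>2 x + (-1) *\<^sub>R \<iota> x) = 0" by (simp add: x linear_diff[OF d_linear])
  ultimately obtain u where "\<iota>2 x + (-1) *\<^sub>R \<iota> x = d u" using cls_zero by blast
  hence "\<iota>2 x = \<iota> x + d u" by (simp add: algebra_simps)
  thus ?thesis by blast
qed

lemma pi_\<iota>_d: "pp (\<iota> x) (d b) = 0" and pi_d_\<iota>: "pp (d b) (\<iota> x) = 0"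
  using pi_P[of "\<iota> x" "d b"] pi_P[of "d b" "\<iota> x"]
  by (simp_all add: linear_0[OF pi_linear(1)] linear_0[OF pi_linear(2)])

text \<open>Representatives of one class differ by an exact element, and exact elements are
  orthogonal to representatives and to each other.\<close>

lemma pairing_representatives:
  assumes "induction C cls \<iota>2 K2"
  shows "pp (\<iota>2 x) (\<iota>2 y) = pp (\<iota> x) (\<iota> y)"
proof -
  interpret i: induction C cls \<iota>2 K2 by (rule assms)
  obtain u v where u: "\<iota>2 x = \<iota> x + d u" and v: "\<iota>2 y = \<iota> y + d v"
    using representatives_differ[of \<iota>2] i.d_\<iota> i.cls_\<iota> by metis
  have "pp (d u) (d v) = 0"
    by (rule pi_zero[of "\<lambda>u. pp (d u) (d v)" u])
       (use linear_compose[OF d_linear pi_linear(2)[of "d v"]] in \<open>simp add: o_def\<close>, rule pi_closed_exact[OF d_d d_gr])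
  thus ?thesis unfolding u v
    by (simp add: linear_add[OF pi_linear(1)] linear_add[OF pi_linear(2)] pi_\<iota>_d pi_d_\<iota>)
qed

lemma product_representatives:
  assumes "induction C cls \<iota>2 K2"
  shows "mu (\<iota>2 x) (\<iota>2 y) = \<iota>2 (cls (mu (\<iota> x) (\<iota> y)))"
proof -
  interpret i: induction C cls \<iota>2 K2 by (rule assms)
  have "\<iota> (cls (mu (\<iota>2 x) (\<iota>2 y))) = mu (\<iota> x) (\<iota> y)"
    using \<iota>_mult[of "\<iota>2 x" "\<iota>2 y"] by (simp add: i.cls_\<iota>)
  hence "cls (mu (\<iota>2 x) (\<iota>2 y)) = cls (mu (\<iota> x) (\<iota> y))" using cls_\<iota> by metis
  moreover have "\<iota>2 (cls (mu (\<iota>2 x) (\<iota>2 y))) = mu (\<iota>2 x) (\<iota>2 y)"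
    using i.\<iota>_mult[of "\<iota>2 x" "\<iota>2 y"] by (simp add: i.cls_\<iota>)
  ultimately show ?thesis by simp
qed

lemma formal_theory_transfer:
  assumes "induction C cls \<iota>2 K2"
  shows "formal_theory C cls \<iota>2 K2 \<gg> T E"
proof -
  interpret i: induction C cls \<iota>2 K2 by (rule assms)
  have "cohomology_basis C cls \<iota>2 E"
    using cbas unfolding cohomology_basis_def pairing_representatives[OF assms] .
  thus ?thesis by unfold_locales
qed

lemma maurer_cartan_transfer:
  assumes "induction C cls \<iota>2 K2"
  shows "maurer_cartan C \<gg> E \<iota>2 = maurer_cartan C \<gg> E \<iota>"
proof -
  have "mu (\<iota> x) (\<iota> y) = \<iota> (cls (mu (\<iota> x) (\<iota> y)))" for x y
    using \<iota>_mult[of "\<iota> x" "\<iota> y"] by (simp add: cls_\<iota>)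
  hence "pp (\<iota>2 z) (mu (\<iota>2 x) (\<iota>2 y)) = pp (\<iota> z) (mu (\<iota> x) (\<iota> y))" for x y z
    using product_representatives[OF assms] pairing_representatives[OF assms] by metis
  thus ?thesis by (simp add: maurer_cartan_def)
qed

text \<open>The ambient data are those of the path at the parameter \<open>t\<close>; the
  derivatives of the path satisfy the linearised conditions, so the infinitesimal argument applies
  at every point.\<close>

lemma path_stationary:
  assumes t: "t \<in> {0..1}" and ft: "\<And>s. s \<in> {0..1} \<Longrightarrow> formal_theory C cls (\<iota>' s) (K' s) \<gg> T E"
    and smooth: "smooth_path \<iota>'" "smooth_path K'" and at: "\<iota>' t = \<iota>" "K' t = K"
    and MC: "\<And>s. s \<in> {0..1} \<Longrightarrow> \<alpha> \<in> maurer_cartan C \<gg> E (\<iota>' s)"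
  shows "((\<lambda>s. st.str ((lift (K' s) * brop (conn E (\<iota>' s) \<alpha>)) ^ n)) has_real_derivative 0) (at t within {0..1})"
proof -
  \<comment> \<open>The conditions for all \<open>s\<close> are collected in one formula, because
    differentiating them at \<open>t\<close> requires them along the whole path.\<close>
  have S: "linear (K' s) \<and> (\<forall>x. K' s (K' s x) = 0) \<and> (\<forall>x. K' s (d (K' s x)) = K' s x) \<and> (\<forall>x. d (K' s (d x)) = d x) \<and>
      (\<forall>k x. x \<in> gr (Suc k) \<longrightarrow> K' s x \<in> gr k) \<and> (\<forall>x. x \<in> gr 0 \<longrightarrow> K' s x = 0) \<and>
      (\<forall>x. d (\<iota>' s x) = 0) \<and> (\<forall>x. cls (\<iota>' s x) = x) \<and> (\<forall>i<length (E 1). \<iota>' s (E 1 ! i) \<in> gr 1) \<and>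
      (\<forall>a<nT. (\<Sum>i<length (E 1). \<Sum>j<length (E 1). rT (br (\<alpha> i) (\<alpha> j)) a *\<^sub>R mu (\<iota>' s (E 1 ! i)) (\<iota>' s (E 1 ! j))) = 0)"
    if s: "s \<in> {0..1}" for s
  proof -
    interpret i: formal_theory C cls "\<iota>' s" "K' s" \<gg> T E by (rule ft[OF s])
    show ?thesis
      using i.K_linear i.K_K i.K_d_K i.d_K_d i.K_gr i.K_gr0 i.d_\<iota> i.cls_\<iota> i.E_gr[of 1] i.curvature_zero[OF MC[OF s]]
      by (intro conjI allI impI) (assumption | simp)+
  qed
  have "\<forall>x. \<exists>y. vder t (\<lambda>s. K' s x) y" using smooth_path_vder[OF smooth(2) t] by blast
  from choice[OF this] obtain K0 where K0: "\<And>x. vder t (\<lambda>s. K' s x) (K0 x)" by blast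
  have "\<forall>x. \<exists>y. vder t (\<lambda>s. \<iota>' s x) y" using smooth_path_vder[OF smooth(1) t] by blast
  from choice[OF this] obtain \<iota>1 where \<iota>1: "\<And>x. vder t (\<lambda>s. \<iota>' s x) (\<iota>1 x)" by blast
  \<comment> \<open>\<open>K0\<close> is chosen separately for each argument; the linear extension
    from the basis has the same derivative property and is linear by construction.\<close>
  define K1 where "K1 x = (\<Sum>c\<in>BB. rB x c *\<^sub>R K0 c)" for x
  have K1_linear: "linear K1"
    by (rule linearI) (simp_all add: K1_def linear_add[OF rB_linear] linear_scale[OF rB_linear]
        scaleR_add_left sum.distrib scaleR_sum_right)
  have K1: "vder t (\<lambda>s. K' s x) (K1 x)" for x
  proof (rule vder_cong[OF _ t])
    show "vder t (\<lambda>s. \<Sum>c\<in>BB. rB x c *\<^sub>R K' s c) (K1 x)" unfolding K1_def by (intro vder_sum vder_scale K0)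
    fix s :: real assume s: "s \<in> {0..1}"
    have l: "linear (K' s)" using S[OF s] by blast
    show "(\<Sum>c\<in>BB. rB x c *\<^sub>R K' s c) = K' s x"
      using rB_expand[of x] linear_eq_on_basis_sum[OF l, of "\<lambda>c. rB x c" "\<lambda>c. c" BB] by simp
  qed
  have lin: "s \<in> {0..1} \<Longrightarrow> linear (K' s)" for s using S by blast
  have prod: "vder t (\<lambda>s. K' s (y s)) (K1 (y t) + K y')" if "vder t y y'" for y y'
    using vder_app[OF _ K1_linear K1 that t] lin by (simp only: at)
  have "K1 (K a) + K (K1 a) = 0" for a
    by (rule vder_unique[OF prod[OF K1[of a], unfolded at] vder_const[of t 0] t]) (use S in blast)
  hence \<kappa>3: "K1 (K a) = - K (K1 a)" for a by (simp add: eq_neg_iff_add_eq_0)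
  have \<kappa>4: "d (K1 (d a)) = 0" for a
    by (rule vder_unique[OF vder_linear[OF d_linear K1[of "d a"]] vder_const[of t "d a"] t]) (use S in blast)
  have "K1 (d (K a)) + K (d (K1 a)) = K1 a" for a
    by (rule vder_unique[OF prod[OF vder_linear[OF d_linear K1[of a]], unfolded at] K1[of a] t]) (use S in blast)
  hence \<kappa>5: "K1 a = K (d (K1 a)) + K1 (d (K a))" for a by (simp add: add.commute)
  have \<kappa>2: "lowers_degree C K1"
    unfolding lowers_degree_def image_subset_iff
  proof (intro conjI ballI allI)
    fix x assume x: "x \<in> gr 0"
    have "K1 x = 0" by (rule vder_unique[OF K1 vder_const[of t 0] t]) (use S x in blast)
    thus "K1 x \<in> {0}" by simp
  next
    fix k x assume x: "x \<in> gr (Suc k)"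
    show "K1 x \<in> gr k" by (rule vder_gr[OF K1 t]) (use S x in blast)
  qed
  let ?A = "conn E \<iota> \<alpha>" and ?B = "conn E \<iota>1 \<alpha>"
  have \<iota>1_gr: "\<iota>1 (E 1 ! i) \<in> gr 1" if "i < length (E 1)" for i
    by (rule vder_gr[OF \<iota>1 t]) (use S that in blast)
  have \<iota>1_d: "d (\<iota>1 x) = 0" for x
    by (rule vder_unique[OF vder_linear[OF d_linear \<iota>1[of x]] vder_const[of t 0] t]) (use S in blast)
  \<comment> \<open>Along the path \<open>\<iota>' s x\<close> changes only by exact elements, so
    its image under the projector at \<open>t\<close> is constant.\<close>
  have \<iota>1_P: "P (\<iota>1 x) = 0" for x
  proof (rule vder_unique[OF vder_linear[OF P_linear \<iota>1[of x]] vder_const[of t "\<iota> x"] t])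
    fix s :: real assume "s \<in> {0..1}"
    then obtain u where "\<iota>' s x = \<iota> x + d u" using S representatives_differ[of "\<iota>' s"] by blast
    thus "P (\<iota>' s x) = \<iota> x" by (simp add: linear_add[OF P_linear])
  qed
  have MCt: "\<alpha> \<in> maurer_cartan C \<gg> E \<iota>" using MC[OF t] by (simp only: at)
  have AB: "app (brop ?A) ?B a = 0" for a
  proof (rule app_AA_variation[OF MCt])
    show "\<iota>1 (E 1 ! x) \<in> gr 1" if "x < length (E 1)" for x by (rule \<iota>1_gr[OF that])
  next
    fix a assume a: "a < nT"
    have "vder t (\<lambda>s. mu (\<iota>' s x) (\<iota>' s y)) (mu (\<iota>1 x) (\<iota> y) + mu (\<iota> x) (\<iota>1 y))" for x y
      using vder_app[of "\<lambda>s. mu (\<iota>' s x)" "mu (\<iota>1 x)" t "\<lambda>s. \<iota>' s y" "\<iota>1 y"] mu_linear(1) \<iota>1 t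
        vder_linear[OF mu_linear(2) \<iota>1] by (simp add: at)
    hence v: "vder t (\<lambda>s. \<Sum>i<length (E 1). \<Sum>j<length (E 1). rT (br (\<alpha> i) (\<alpha> j)) a *\<^sub>R mu (\<iota>' s (E 1 ! i)) (\<iota>' s (E 1 ! j)))
        (\<Sum>i<length (E 1). \<Sum>j<length (E 1). rT (br (\<alpha> i) (\<alpha> j)) a *\<^sub>R
        (mu (\<iota>1 (E 1 ! i)) (\<iota> (E 1 ! j)) + mu (\<iota> (E 1 ! i)) (\<iota>1 (E 1 ! j))))"
      by (intro vder_sum vder_scale)
    show "(\<Sum>i<length (E 1). \<Sum>j<length (E 1). rT (br (\<alpha> i) (\<alpha> j)) a *\<^sub>R
        (mu (\<iota>1 (E 1 ! i)) (\<iota> (E 1 ! j)) + mu (\<iota> (E 1 ! i)) (\<iota>1 (E 1 ! j)))) = 0"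
      by (rule vder_unique[OF v vder_const[of t 0] t]) (use S a in blast)
  qed
  have B: "?B b \<in> gr 1" "d (?B b) = 0" "P (?B b) = 0" for b
  proof -
    show "?B b \<in> gr 1"
      unfolding conn_def using \<iota>1_gr by (intro subspace_sum[OF gr_subspace] subspace_scale[OF gr_subspace]) auto
  qed (simp_all add: conn_def linear_sum[OF d_linear] linear_scale[OF d_linear] linear_sum[OF P_linear] linear_scale[OF P_linear] \<iota>1_d \<iota>1_P)
  have var: "st.str ((lift K * brop ?A) ^ n * (lift K1 * brop ?A + lift K * brop ?B)) = 0" for n
    by (rule str_variation_formal[OF MCt K1_linear \<kappa>2 \<kappa>3 \<kappa>4 \<kappa>5 B(1) B(2) B(3) AB])
  define X where "X s = lift (K' s) * brop (conn E (\<iota>' s) \<alpha>)" for s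
  have Xt: "X t = lift K * brop ?A" by (simp add: X_def at)
  have D: "((\<lambda>s. crd i (app (X s) f)) has_real_derivative crd i (app (lift K1 * brop ?A + lift K * brop ?B) f)) (at t within {0..1})" for i f
  proof -
    obtain k j a where i: "i = (k, j, a)" by (cases i)
    have "vder t (\<lambda>s. K' s (app (brop (conn E (\<iota>' s) \<alpha>)) f a))
        (K1 (app (brop (conn E (\<iota>' t) \<alpha>)) f a) + K (app (brop ?B) f a))"
      by (rule prod, rule vder_brop, rule vder_conn, rule \<iota>1)
    hence "vder t (\<lambda>s. K' s (app (brop (conn E (\<iota>' s) \<alpha>)) f a)) (K1 (app (brop ?A) f a) + K (app (brop ?B) f a))"
      by (simp only: at)
    from vderD[OF this rB_linear, of "ee k ! j"]
    have "((\<lambda>s. rB (K' s (app (brop (conn E (\<iota>' s) \<alpha>)) f a)) (ee k ! j)) has_real_derivative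
        crd i (app (lift K1 * brop ?A + lift K * brop ?B) f)) (at t within {0..1})"
      by (simp add: i app_lift[OF K_linear] app_lift[OF K1_linear])
    thus ?thesis
      by (rule has_field_derivative_transform_within[where d = 1])
         (use t in \<open>simp_all add: i X_def app_lift[OF lin]\<close>)
  qed
  have "((\<lambda>s. st.str (X s ^ n)) has_real_derivative 0) (at t within {0..1})"
  proof (rule str_power_stationary[OF _ _ t])
    show "below nT (X s)" if "s \<in> {0..1}" for s unfolding X_def by (intro below_intros below_brop lin that)
    show "below nT (lift K1 * brop ?A + lift K * brop ?B)" by (intro below_intros below_brop K1_linear K_linear)
    show "st.ev (X t)" unfolding Xt
      by (intro st.od_mult od_lift_lowers[OF K_linear lowers] od_brop AA_gr)
    show "st.str (X t ^ n * (lift K1 * brop ?A + lift K * brop ?B)) = 0" for n unfolding Xt by (rule var)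
  qed (rule D)
  thus ?thesis by (simp only: X_def)
qed

theorem deformation_invariance:
  assumes def: "deformation C cls \<iota>' K'" and at: "\<iota>' 0 = \<iota>" "K' 0 = K" and t: "t \<in> {0..1}"
    and MC: "\<alpha> \<in> maurer_cartan C \<gg> E \<iota>"
  shows "eval_ray T E (loop_part 1 (effective_action C \<gg> T E (\<iota>' t) (K' t))) \<alpha> =
    eval_ray T E (loop_part 1 (effective_action C \<gg> T E \<iota> K)) \<alpha>"
proof -
  have ind: "induction C cls (\<iota>' s) (K' s)" if "s \<in> {0..1}" for s
    by unfold_locales (use def coh that in \<open>simp_all add: deformation_def\<close>)
  have ft: "formal_theory C cls (\<iota>' s) (K' s) \<gg> T E" if "s \<in> {0..1}" for s
    by (rule formal_theory_transfer[OF ind[OF that]])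
  have MCs: "\<alpha> \<in> maurer_cartan C \<gg> E (\<iota>' s)" if "s \<in> {0..1}" for s
    using MC maurer_cartan_transfer[OF ind[OF that]] by simp
  have smooth: "smooth_path \<iota>'" "smooth_path K'" using def by (simp_all add: deformation_def)
  \<comment> \<open>The supertraces as functions of the parameter. At each \<open>s\<close> the
    whole theory is reinterpreted with the data at \<open>s\<close>, which \<open>E\<close> still
    fits, to obtain derivative zero.\<close>
  define g where "g n s = st.str ((lift (K' s) * brop (conn E (\<iota>' s) \<alpha>)) ^ n)" for n s
  have D: "(g n has_real_derivative 0) (at s within {0..1})" if s: "s \<in> {0..1}" for n s
  proof -
    interpret i: formal_theory C cls "\<iota>' s" "K' s" \<gg> T E by (rule ft[OF s])
    show ?thesis unfolding g_def[abs_def] by (rule i.path_stationary[OF s ft smooth refl refl MCs])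
  qed
  have const: "g n t = g n 0" for n
  proof (rule DERIV_isconst2[of 0 1 "g n" t])
    show "continuous_on {0..1} (g n)" by (rule DERIV_continuous_on[OF D])
    show "(g n has_real_derivative 0) (at x)" if "0 < x" "x < 1" for x
      using D[of x n] that at_within_Icc_at[of 0 x 1] by simp
  qed (use t in auto)
  have "eval_ray T E (loop_part 1 (effective_action C \<gg> T E (\<iota>' s) (K' s))) \<alpha> =
      fps_const (1/2) * Abs_fps (\<lambda>n. if n = 0 then 0 else (-1) ^ (n + 1) / real n * g n s)" if s: "s \<in> {0..1}" for s
  proof -
    interpret i: formal_theory C cls "\<iota>' s" "K' s" \<gg> T E by (rule ft[OF s])
    show ?thesis unfolding i.one_loop_formula g_def by (rule half_str_log_eq[OF i.K_linear])
  qed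
  from this[OF t] this[of 0] show ?thesis by (simp only: const at atLeastAtMost_iff zero_le_one order_refl simp_thms)
qed

end

theorem proposition7:
  fixes C :: "'c::real_vector dg_data"
    and \<gg> :: "'g::real_vector lie_data"
    and cls :: "'c \<Rightarrow> 'h::real_vector"
    and \<iota> :: "'h \<Rightarrow> 'c" and K :: "'c \<Rightarrow> 'c"
    and T :: "'g list" and E :: "nat \<Rightarrow> 'h list"
  assumes "dg_frobenius C" and "cohomology C cls"
    and "dim (coh_grade C cls 0) = 1" and "dim (coh_grade C cls 3) = 1"
    and "metric_lie_algebra \<gg>" and "orthonormal_basis \<gg> T"
    and "induction_data C cls \<iota> K" and "cohomology_basis C cls \<iota> E"
    and "formal_dg C cls" and "algebra_hom C cls \<iota>"
  shows
    "((\<exists>F. effective_action C \<gg> T E \<iota> K =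
              hbar_series (\<lambda>l. if l = 0 then W_prod C \<gg> T E \<iota> else F l) \<and>
           (\<forall>l\<ge>1. invariant_function \<gg> T E (F l))))
     \<and>
     (\<forall>\<alpha>. eval_ray T E (loop_part 1 (effective_action C \<gg> T E \<iota> K)) \<alpha> =
          half_str_log C \<gg> T E \<iota> K \<alpha>)
     \<and>
     (\<forall>\<iota>' K'. deformation C cls \<iota>' K' \<and> \<iota>' 0 = \<iota> \<and> K' 0 = K \<longrightarrow>
        (\<forall>t\<in>{0..1}. \<forall>\<alpha>\<in>maurer_cartan C \<gg> E \<iota>.
           eval_ray T E (loop_part 1 (effective_action C \<gg> T E (\<iota>' t) (K' t))) \<alpha> =
           eval_ray T E (loop_part 1 (effective_action C \<gg> T E \<iota> K)) \<alpha>))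
     \<and>
     (\<forall>\<delta>\<iota> \<delta>K. infinitesimal_deformation C cls \<iota> K \<delta>\<iota> \<delta>K \<longrightarrow>
        (\<forall>\<alpha>\<in>maurer_cartan C \<gg> E \<iota>. \<forall>n.
           ((\<lambda>t. fps_nth (half_str_log C \<gg> T E (\<lambda>x. \<iota> x + t *\<^sub>R \<delta>\<iota> x)
                                              (\<lambda>a. K a + t *\<^sub>R \<delta>K a) \<alpha>) n)
              has_real_derivative 0) (at 0)))"
proof -
  interpret formal_theory C cls \<iota> K \<gg> T E
    by unfold_locales (use assms in simp_all)
  have 1: "\<exists>F. effective_action C \<gg> T E \<iota> K =
              hbar_series (\<lambda>l. if l = 0 then W_prod C \<gg> T E \<iota> else F l) \<and>
           (\<forall>l\<ge>1. invariant_function \<gg> T E (F l))"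
  proof (intro exI conjI allI impI)
    show "effective_action C \<gg> T E \<iota> K = hbar_series (\<lambda>l. if l = 0 then W_prod C \<gg> T E \<iota> else th.loop l)"
      by (rule effective_action_expansion)
    show "invariant_function \<gg> T E (th.loop l)" if "l \<ge> 1" for l
      using that invariant_loop[of "l - 1"] by simp
  qed
  show ?thesis
    using 1 one_loop_formula deformation_invariance infinitesimal_stationary by (intro conjI allI impI ballI) auto
qed

end
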